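(* Let $\mathbb{K}$ be an algebraically closed field, let $\mathcal{C}=\mathscr{K}(\mathrm{Vect}_2^{\mathrm{fd}})$ be the core of the fully-dualizable objects of the bicategory $\mathrm{Vect}_2$ of $\mathbb{K}$-linear abelian categories, linear functors and natural transformations, and consider the trivial $SO(2)$-action on $\mathcal{C}$. Then the bicategory of homotopy fixed points $\mathcal{C}^{SO(2)}$ is equivalent to the bicategory $\mathrm{CY}$ of Calabi-Yau categories, Calabi-Yau functors and natural transformations.
   Context: $\mathrm{Vect}_2$ and its core. A $\mathbb{K}$-linear abelian category is finite if it has finite-dimensional Hom-spaces, every object has finite length, it has enough projectives, and it has finitely many isomorphism classes of simple objects. The fully-dualizable objects of $\mathrm{Vect}_2$ are precisely the finite, semi-simple linear categories; $\mathrm{Vect}_2^{\mathrm{fd}}$ is the full sub-bicategory on these. The core $\mathscr{K}(\mathcal{B})$ of a bicategory $\mathcal{B}$ has all objects of $\mathcal{B}$, the 1-equivalences as 1-morphisms and the 2-isomorphisms as 2-morphisms. Calabi-Yau categories. A Calabi-Yau category $(\mathcal{D},\mathrm{tr}^{\mathcal{D}})$ is a $\mathbb{K}$-linear, finite, semi-simple category $\mathcal{D}$ together with $\mathbb{K}$-linear maps $\mathrm{tr}^{\mathcal{D}}_c : \mathrm{End}_{\mathcal{D}}(c)\to\mathbb{K}$ for each object $c$, such that: (1) $\mathrm{tr}^{\mathcal{D}}_c(g\circ f)=\mathrm{tr}^{\mathcal{D}}_d(f\circ g)$ for all $f\in\mathrm{Hom}(c,d)$, $g\in\mathrm{Hom}(d,c)$;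 (2) $\mathrm{tr}^{\mathcal{D}}_{c\oplus d}(f\oplus g)=\mathrm{tr}^{\mathcal{D}}_c(f)+\mathrm{tr}^{\mathcal{D}}_d(g)$ for all $f\in\mathrm{End}(c)$, $g\in\mathrm{End}(d)$; (3) for all objects $c,d$ the pairing $\mathrm{Hom}(c,d)\otimes_{\mathbb{K}}\mathrm{Hom}(d,c)\to\mathbb{K}$, $f\otimes g\mapsto\mathrm{tr}^{\mathcal{D}}_c(g\circ f)$, is non-degenerate. A linear functor $F : \mathcal{D}\to\mathcal{E}$ between Calabi-Yau categories is a Calabi-Yau functor if $\mathrm{tr}^{\mathcal{D}}_c(f)=\mathrm{tr}^{\mathcal{E}}_{F(c)}(F(f))$ for every object $c$ and every $f\in\mathrm{End}_{\mathcal{D}}(c)$. A Calabi-Yau natural transformation between Calabi-Yau functors is just an ordinary natural transformation. The bicategory $\mathrm{CY}$ of Calabi-Yau categories has Calabi-Yau categories as objects, Calabi-Yau functors as 1-morphisms and natural transformations as 2-morphisms. Homotopy fixed points. For a topological group $G$, $\Pi_2(G)$ is the monoidal bicategory whose objects are the points of $G$, whose 1-morphisms are paths, and whose 2-morphisms are homotopy classes of homotopies between paths (2-tracks); the monoidal product is (pointwise) multiplication in $G$. A $G$-action on a bicategory $\mathcal{C}$ is a trifunctor $\rho : B\Pi_2(G)\to\mathrm{Bicat}$ with $\rho( * )=\mathcal{C}$, where $B\Pi_2(G)$ is the tricategory with one object $*$ and endomorphism bicategory $\Pi_2(G)$; equivalently, a weak monoidal 2-functor from $\Pi_2(G)$ to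 the monoidal bicategory $\mathrm{Aut}(\mathcal{C})$ of auto-equivalences. The trivial action sends everything to identities. $\mathcal{C}^G:=\mathrm{Nat}(\Delta,\rho)$ (tritransformations, modifications, perturbations), where $\Delta$ is the constant functor at the terminal bicategory. For the trivial action of $G=SO(2)$ this unpacks as follows (suppressing coherence isomorphisms; $e$ is the unit of $G$, $*$ is horizontal composition). An object is $(c,\Theta,\Pi,M)$, consisting of: an object $c$ of $\mathcal{C}$; for each $g\in G$ a 1-equivalence $\Theta_g : c\to c$; for each path $\gamma : g\to h$ an invertible 2-morphism $\Theta_\gamma : \Theta_g\to\Theta_h$, compatible with composition and identities of paths and natural with respect to 2-tracks; invertible 2-morphisms $\Pi_{gh} : \Theta_h\circ\Theta_g\to\Theta_{gh}$ compatible with the $\Theta_\gamma$; and an invertible 2-morphism $M : \Theta_e\to\mathrm{id}_c$. These satisfy $\Pi_{gh,k}\circ(\mathrm{id}_{\Theta_k}*\Pi_{gh})=\Pi_{g,hk}\circ(\Pi_{hk}*\mathrm{id}_{\Theta_g})$, $\Pi_{eg}=\mathrm{id}_{\Theta_g}*M$ and $\Pi_{ge}=M*\mathrm{id}_{\Theta_g}$. A 1-morphism $(c,\Theta,\Pi,M)\to(c',\Theta',\Pi',M')$ is a pair $(f,m)$ consisting of a 1-morphism $f : c\to c'$ and invertible 2-morphisms $m_g : f\circ\Theta_g\to\Theta'_g\circ f$ such that $(\Theta'_\gamma*\mathrm{id}_f)\circ m_g=m_h\circ(\mathrm{id}_f*\Theta_\gamma)$ for each path $\gamma:g\to h$, $m_{gh}\circ(\mathrm{id}_f*\Pi_{gh})=(\Pi'_{gh}*\mathrm{id}_f)\circ(\mathrm{id}_{\Theta'_h}*m_g)\circ(m_h*\mathrm{id}_{\Theta_g})$,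 and $(M'*\mathrm{id}_f)\circ m_e=\mathrm{id}_f*M$. A 2-morphism $(f,m)\to(\xi,n)$ is a 2-morphism $\alpha : f\to\xi$ in $\mathcal{C}$ such that $(\mathrm{id}_{\Theta'_g}*\alpha)\circ m_g=n_g\circ(\alpha*\mathrm{id}_{\Theta_g})$ for all $g$.
   Formalization: CY is replaced by its core (Calabi-Yau functors that are equivalences, natural isomorphisms): the fixed points have only invertible 2-morphisms, whereas CY contains non-invertible ones such as the zero transformation of an identity functor. *)

theory Defs
  imports "HOL-Analysis.Analysis" "HOL-Algebra.Group"
begin

section \<open>Bicategories\<close>

text \<open>
  A bicategory is presented by carriers: cells know their boundaries (the hom-sets for different
  boundaries are disjoint), so compositions need not be indexed by objects.
  Compositions are written in the order of functions: \<open>g \<diamondop> f\<close> is "first \<open>f\<close>, then \<open>g\<close>",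
  \<open>\<odot>\<close> is vertical and \<open>\<star>\<close> horizontal composition of 2-cells.
  The associator \<open>assoc h g f\<close> goes from \<open>(h \<diamondop> g) \<diamondop> f\<close> to \<open>h \<diamondop> (g \<diamondop> f)\<close>; the inverses of the
  coherence cells are part of the data only to have names for them.
\<close>

record ('a, 'f, 't) bicat =
  Ob :: "'a set"
  Hom1 :: "'a \<Rightarrow> 'a \<Rightarrow> 'f set"
  Hom2 :: "'f \<Rightarrow> 'f \<Rightarrow> 't set"
  id1 :: "'a \<Rightarrow> 'f"
  id2 :: "'f \<Rightarrow> 't"
  comp1 :: "'f \<Rightarrow> 'f \<Rightarrow> 'f" (infixr "\<diamondop>\<index>" 75)
  vcomp :: "'t \<Rightarrow> 't \<Rightarrow> 't" (infixr "\<odot>\<index>" 60)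
  hcomp :: "'t \<Rightarrow> 't \<Rightarrow> 't" (infixr "\<star>\<index>" 70)
  assoc :: "'f \<Rightarrow> 'f \<Rightarrow> 'f \<Rightarrow> 't"
  assoc_inv :: "'f \<Rightarrow> 'f \<Rightarrow> 'f \<Rightarrow> 't"
  lunit :: "'f \<Rightarrow> 't"
  lunit_inv :: "'f \<Rightarrow> 't"
  runit :: "'f \<Rightarrow> 't"
  runit_inv :: "'f \<Rightarrow> 't"

definition inverse2 ::
  "('a, 'f, 't, 'z) bicat_scheme \<Rightarrow> 'f \<Rightarrow> 'f \<Rightarrow> 't \<Rightarrow> 't \<Rightarrow> bool" where
  "inverse2 B f g \<alpha> \<beta> \<longleftrightarrow> \<alpha> \<in> Hom2 B f g \<and> \<beta> \<in> Hom2 B g f \<and>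
     \<beta> \<odot>\<^bsub>B\<^esub> \<alpha> = id2 B f \<and> \<alpha> \<odot>\<^bsub>B\<^esub> \<beta> = id2 B g"

definition Iso2 :: "('a, 'f, 't, 'z) bicat_scheme \<Rightarrow> 'f \<Rightarrow> 'f \<Rightarrow> 't set" where
  "Iso2 B f g = {\<alpha>. \<exists>\<beta>. inverse2 B f g \<alpha> \<beta>}"

definition Equiv1 :: "('a, 'f, 't, 'z) bicat_scheme \<Rightarrow> 'a \<Rightarrow> 'a \<Rightarrow> 'f set" where
  "Equiv1 B a b = {f \<in> Hom1 B a b. \<exists>g \<in> Hom1 B b a.
     Iso2 B (id1 B a) (g \<diamondop>\<^bsub>B\<^esub> f) \<noteq> {} \<and> Iso2 B (f \<diamondop>\<^bsub>B\<^esub> g) (id1 B b) \<noteq> {}}"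

locale bicategory =
  fixes B :: "('a, 'f, 't, 'z) bicat_scheme" (structure)
  assumes Hom1_disjoint:
      "\<lbrakk>a \<in> Ob B; b \<in> Ob B; a' \<in> Ob B; b' \<in> Ob B; f \<in> Hom1 B a b; f \<in> Hom1 B a' b'\<rbrakk>
        \<Longrightarrow> a = a' \<and> b = b'"
    and Hom2_disjoint:
      "\<lbrakk>a \<in> Ob B; b \<in> Ob B; f \<in> Hom1 B a b; g \<in> Hom1 B a b;
        a' \<in> Ob B; b' \<in> Ob B; f' \<in> Hom1 B a' b'; g' \<in> Hom1 B a' b';
        \<alpha> \<in> Hom2 B f g; \<alpha> \<in> Hom2 B f' g'\<rbrakk> \<Longrightarrow> f = f' \<and> g = g'"
    and id1_closed: "a \<in> Ob B \<Longrightarrow> id1 B a \<in> Hom1 B a a"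
    and comp1_closed:
      "\<lbrakk>a \<in> Ob B; b \<in> Ob B; c \<in> Ob B; f \<in> Hom1 B a b; g \<in> Hom1 B b c\<rbrakk>
        \<Longrightarrow> g \<diamondop> f \<in> Hom1 B a c"
    and id2_closed:
      "\<lbrakk>a \<in> Ob B; b \<in> Ob B; f \<in> Hom1 B a b\<rbrakk> \<Longrightarrow> id2 B f \<in> Hom2 B f f"
    and vcomp_closed:
      "\<lbrakk>a \<in> Ob B; b \<in> Ob B; f \<in> Hom1 B a b; g \<in> Hom1 B a b; h \<in> Hom1 B a b;
        \<alpha> \<in> Hom2 B f g; \<beta> \<in> Hom2 B g h\<rbrakk> \<Longrightarrow> \<beta> \<odot> \<alpha> \<in> Hom2 B f h"
    and vcomp_assoc:
      "\<lbrakk>a \<in> Ob B; b \<in> Ob B; f \<in> Hom1 B a b; g \<in> Hom1 B a b; h \<in> Hom1 B a b; k \<in> Hom1 B a b;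
        \<alpha> \<in> Hom2 B f g; \<beta> \<in> Hom2 B g h; \<gamma> \<in> Hom2 B h k\<rbrakk>
        \<Longrightarrow> (\<gamma> \<odot> \<beta>) \<odot> \<alpha> = \<gamma> \<odot> (\<beta> \<odot> \<alpha>)"
    and vcomp_id:
      "\<lbrakk>a \<in> Ob B; b \<in> Ob B; f \<in> Hom1 B a b; g \<in> Hom1 B a b; \<alpha> \<in> Hom2 B f g\<rbrakk>
        \<Longrightarrow> \<alpha> \<odot> id2 B f = \<alpha> \<and> id2 B g \<odot> \<alpha> = \<alpha>"
    and hcomp_closed:
      "\<lbrakk>a \<in> Ob B; b \<in> Ob B; c \<in> Ob B;
        f \<in> Hom1 B a b; f' \<in> Hom1 B a b; g \<in> Hom1 B b c; g' \<in> Hom1 B b c;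
        \<alpha> \<in> Hom2 B f f'; \<beta> \<in> Hom2 B g g'\<rbrakk>
        \<Longrightarrow> \<beta> \<star> \<alpha> \<in> Hom2 B (g \<diamondop> f) (g' \<diamondop> f')"
    and hcomp_id:
      "\<lbrakk>a \<in> Ob B; b \<in> Ob B; c \<in> Ob B; f \<in> Hom1 B a b; g \<in> Hom1 B b c\<rbrakk>
        \<Longrightarrow> id2 B g \<star> id2 B f = id2 B (g \<diamondop> f)"
    and interchange:
      "\<lbrakk>a \<in> Ob B; b \<in> Ob B; c \<in> Ob B;
        f \<in> Hom1 B a b; f' \<in> Hom1 B a b; f'' \<in> Hom1 B a b;
        g \<in> Hom1 B b c; g' \<in> Hom1 B b c; g'' \<in> Hom1 B b c;
        \<alpha> \<in> Hom2 B f f'; \<alpha>' \<in> Hom2 B f' f''; \<beta> \<in> Hom2 B g g'; \<beta>' \<in> Hom2 B g' g''\<rbrakk>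
        \<Longrightarrow> (\<beta>' \<star> \<alpha>') \<odot> (\<beta> \<star> \<alpha>) = (\<beta>' \<odot> \<beta>) \<star> (\<alpha>' \<odot> \<alpha>)"
    and assoc_iso:
      "\<lbrakk>a \<in> Ob B; b \<in> Ob B; c \<in> Ob B; d \<in> Ob B;
        f \<in> Hom1 B a b; g \<in> Hom1 B b c; h \<in> Hom1 B c d\<rbrakk>
        \<Longrightarrow> inverse2 B ((h \<diamondop> g) \<diamondop> f) (h \<diamondop> (g \<diamondop> f)) (assoc B h g f) (assoc_inv B h g f)"
    and assoc_natural:
      "\<lbrakk>a \<in> Ob B; b \<in> Ob B; c \<in> Ob B; d \<in> Ob B;
        f \<in> Hom1 B a b; f' \<in> Hom1 B a b; g \<in> Hom1 B b c; g' \<in> Hom1 B b c;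
        h \<in> Hom1 B c d; h' \<in> Hom1 B c d;
        \<alpha> \<in> Hom2 B f f'; \<beta> \<in> Hom2 B g g'; \<gamma> \<in> Hom2 B h h'\<rbrakk>
        \<Longrightarrow> assoc B h' g' f' \<odot> ((\<gamma> \<star> \<beta>) \<star> \<alpha>) = (\<gamma> \<star> (\<beta> \<star> \<alpha>)) \<odot> assoc B h g f"
    and lunit_iso:
      "\<lbrakk>a \<in> Ob B; b \<in> Ob B; f \<in> Hom1 B a b\<rbrakk>
        \<Longrightarrow> inverse2 B (id1 B b \<diamondop> f) f (lunit B f) (lunit_inv B f)"
    and lunit_natural:
      "\<lbrakk>a \<in> Ob B; b \<in> Ob B; f \<in> Hom1 B a b; f' \<in> Hom1 B a b; \<alpha> \<in> Hom2 B f f'\<rbrakk>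
        \<Longrightarrow> lunit B f' \<odot> (id2 B (id1 B b) \<star> \<alpha>) = \<alpha> \<odot> lunit B f"
    and runit_iso:
      "\<lbrakk>a \<in> Ob B; b \<in> Ob B; f \<in> Hom1 B a b\<rbrakk>
        \<Longrightarrow> inverse2 B (f \<diamondop> id1 B a) f (runit B f) (runit_inv B f)"
    and runit_natural:
      "\<lbrakk>a \<in> Ob B; b \<in> Ob B; f \<in> Hom1 B a b; f' \<in> Hom1 B a b; \<alpha> \<in> Hom2 B f f'\<rbrakk>
        \<Longrightarrow> runit B f' \<odot> (\<alpha> \<star> id2 B (id1 B a)) = \<alpha> \<odot> runit B f"
    and pentagon:
      "\<lbrakk>a \<in> Ob B; b \<in> Ob B; c \<in> Ob B; d \<in> Ob B; e \<in> Ob B;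
        f \<in> Hom1 B a b; g \<in> Hom1 B b c; h \<in> Hom1 B c d; k \<in> Hom1 B d e\<rbrakk>
        \<Longrightarrow> assoc B k h (g \<diamondop> f) \<odot> assoc B (k \<diamondop> h) g f =
            (id2 B k \<star> assoc B h g f) \<odot> assoc B k (h \<diamondop> g) f \<odot> (assoc B k h g \<star> id2 B f)"
    and triangle:
      "\<lbrakk>a \<in> Ob B; b \<in> Ob B; c \<in> Ob B; f \<in> Hom1 B a b; g \<in> Hom1 B b c\<rbrakk>
        \<Longrightarrow> (id2 B g \<star> lunit B f) \<odot> assoc B g (id1 B b) f = runit B g \<star> id2 B f"

definition core :: "('a, 'f, 't) bicat \<Rightarrow> ('a, 'f, 't) bicat" where
  "core B = B\<lparr>Hom1 := Equiv1 B, Hom2 := Iso2 B\<rparr>"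

definition full_sub :: "('a, 'f, 't) bicat \<Rightarrow> 'a set \<Rightarrow> ('a, 'f, 't) bicat" where
  "full_sub B S = B\<lparr>Ob := Ob B \<inter> S\<rparr>"

text \<open>Pseudofunctors (homomorphisms of bicategories) and biequivalences.\<close>

record ('a, 'f, 't, 'b, 'g, 'u) pseudo =
  F0 :: "'a \<Rightarrow> 'b"
  F1 :: "'f \<Rightarrow> 'g"
  F2 :: "'t \<Rightarrow> 'u"
  Fcomp :: "'f \<Rightarrow> 'f \<Rightarrow> 'u"
  Funit :: "'a \<Rightarrow> 'u"

locale pseudofunctor =
  B: bicategory B + C: bicategory C
  for B :: "('a, 'f, 't) bicat" and C :: "('b, 'g, 'u) bicat" +
  fixes F :: "('a, 'f, 't, 'b, 'g, 'u) pseudo"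
  assumes F0_closed: "a \<in> Ob B \<Longrightarrow> F0 F a \<in> Ob C"
    and F1_closed:
      "\<lbrakk>a \<in> Ob B; b \<in> Ob B; f \<in> Hom1 B a b\<rbrakk> \<Longrightarrow> F1 F f \<in> Hom1 C (F0 F a) (F0 F b)"
    and F2_closed:
      "\<lbrakk>a \<in> Ob B; b \<in> Ob B; f \<in> Hom1 B a b; g \<in> Hom1 B a b; \<alpha> \<in> Hom2 B f g\<rbrakk>
        \<Longrightarrow> F2 F \<alpha> \<in> Hom2 C (F1 F f) (F1 F g)"
    and F2_id:
      "\<lbrakk>a \<in> Ob B; b \<in> Ob B; f \<in> Hom1 B a b\<rbrakk> \<Longrightarrow> F2 F (id2 B f) = id2 C (F1 F f)"
    and F2_vcomp:
      "\<lbrakk>a \<in> Ob B; b \<in> Ob B; f \<in> Hom1 B a b; g \<in> Hom1 B a b; h \<in> Hom1 B a b;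
        \<alpha> \<in> Hom2 B f g; \<beta> \<in> Hom2 B g h\<rbrakk> \<Longrightarrow> F2 F (\<beta> \<odot>\<^bsub>B\<^esub> \<alpha>) = F2 F \<beta> \<odot>\<^bsub>C\<^esub> F2 F \<alpha>"
    and Fcomp_iso:
      "\<lbrakk>a \<in> Ob B; b \<in> Ob B; c \<in> Ob B; f \<in> Hom1 B a b; g \<in> Hom1 B b c\<rbrakk>
        \<Longrightarrow> Fcomp F g f \<in> Iso2 C (F1 F g \<diamondop>\<^bsub>C\<^esub> F1 F f) (F1 F (g \<diamondop>\<^bsub>B\<^esub> f))"
    and Fcomp_natural:
      "\<lbrakk>a \<in> Ob B; b \<in> Ob B; c \<in> Ob B;
        f \<in> Hom1 B a b; f' \<in> Hom1 B a b; g \<in> Hom1 B b c; g' \<in> Hom1 B b c;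
        \<alpha> \<in> Hom2 B f f'; \<beta> \<in> Hom2 B g g'\<rbrakk>
        \<Longrightarrow> Fcomp F g' f' \<odot>\<^bsub>C\<^esub> (F2 F \<beta> \<star>\<^bsub>C\<^esub> F2 F \<alpha>) = F2 F (\<beta> \<star>\<^bsub>B\<^esub> \<alpha>) \<odot>\<^bsub>C\<^esub> Fcomp F g f"
    and Funit_iso:
      "a \<in> Ob B \<Longrightarrow> Funit F a \<in> Iso2 C (id1 C (F0 F a)) (F1 F (id1 B a))"
    and Fcomp_assoc:
      "\<lbrakk>a \<in> Ob B; b \<in> Ob B; c \<in> Ob B; d \<in> Ob B;
        f \<in> Hom1 B a b; g \<in> Hom1 B b c; h \<in> Hom1 B c d\<rbrakk>
        \<Longrightarrow> F2 F (assoc B h g f) \<odot>\<^bsub>C\<^esub> Fcomp F (h \<diamondop>\<^bsub>B\<^esub> g) f \<odot>\<^bsub>C\<^esub> (Fcomp F h g \<star>\<^bsub>C\<^esub> id2 C (F1 F f)) =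
            Fcomp F h (g \<diamondop>\<^bsub>B\<^esub> f) \<odot>\<^bsub>C\<^esub> (id2 C (F1 F h) \<star>\<^bsub>C\<^esub> Fcomp F g f) \<odot>\<^bsub>C\<^esub>
            assoc C (F1 F h) (F1 F g) (F1 F f)"
    and Fcomp_lunit:
      "\<lbrakk>a \<in> Ob B; b \<in> Ob B; f \<in> Hom1 B a b\<rbrakk>
        \<Longrightarrow> F2 F (lunit B f) \<odot>\<^bsub>C\<^esub> Fcomp F (id1 B b) f \<odot>\<^bsub>C\<^esub> (Funit F b \<star>\<^bsub>C\<^esub> id2 C (F1 F f)) =
            lunit C (F1 F f)"
    and Fcomp_runit:
      "\<lbrakk>a \<in> Ob B; b \<in> Ob B; f \<in> Hom1 B a b\<rbrakk>
        \<Longrightarrow> F2 F (runit B f) \<odot>\<^bsub>C\<^esub> Fcomp F f (id1 B a) \<odot>\<^bsub>C\<^esub> (id2 C (F1 F f) \<star>\<^bsub>C\<^esub> Funit F a) =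
            runit C (F1 F f)"

text \<open>
  A biequivalence is a pseudofunctor that is surjective on objects up to equivalence and locally an
  equivalence of categories: essentially surjective on 1-cells and bijective on 2-cells.
\<close>

locale biequivalence = pseudofunctor B C F
  for B :: "('a, 'f, 't) bicat" and C :: "('b, 'g, 'u) bicat"
    and F :: "('a, 'f, 't, 'b, 'g, 'u) pseudo" +
  assumes surj_objects: "y \<in> Ob C \<Longrightarrow> \<exists>x \<in> Ob B. Equiv1 C (F0 F x) y \<noteq> {}"
    and surj_1cells:
      "\<lbrakk>a \<in> Ob B; b \<in> Ob B; k \<in> Hom1 C (F0 F a) (F0 F b)\<rbrakk>
        \<Longrightarrow> \<exists>f \<in> Hom1 B a b. Iso2 C (F1 F f) k \<noteq> {}"
    and bij_2cells:
      "\<lbrakk>a \<in> Ob B; b \<in> Ob B; f \<in> Hom1 B a b; g \<in> Hom1 B a b\<rbrakk>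
        \<Longrightarrow> bij_betw (F2 F) (Hom2 B f g) (Hom2 C (F1 F f) (F1 F g))"

definition biequivalent :: "('a, 'f, 't) bicat \<Rightarrow> ('b, 'g, 'u) bicat \<Rightarrow> bool" where
  "biequivalent B C \<longleftrightarrow> (\<exists>F. biequivalence B C F)"

section \<open>Homotopy fixed points of a trivial action\<close>

text \<open>
  \<open>G\<close> is a group whose topology is the subspace topology inherited from its element type.
  The bicategory of homotopy fixed points of the trivial \<open>G\<close>-action on a bicategory \<open>B\<close> is given by
  its unpacked description, with the coherence cells of \<open>B\<close> inserted.
\<close>

definition paths_in :: "'g :: topological_space monoid \<Rightarrow> (real \<Rightarrow> 'g) set" where
  "paths_in G = {\<gamma>. path \<gamma> \<and> path_image \<gamma> \<subseteq> carrier G}"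

record ('g, 'a, 'f, 't) hfp0 =
  hbase :: 'a
  h\<Theta> :: "'g \<Rightarrow> 'f"
  h\<Theta>p :: "(real \<Rightarrow> 'g) \<Rightarrow> 't"
  h\<Pi> :: "'g \<Rightarrow> 'g \<Rightarrow> 't"
  hM :: 't

locale hfp_object =
  fixes G :: "'g :: topological_space monoid" (structure)
    and B :: "('a, 'f, 't) bicat"
    and X :: "('g, 'a, 'f, 't) hfp0"
  assumes base: "hbase X \<in> Ob B"
    and \<Theta>_extensional: "h\<Theta> X \<in> extensional (carrier G)"
    and \<Theta>p_extensional: "h\<Theta>p X \<in> extensional (paths_in G)"
    and \<Pi>_extensional:
      "h\<Pi> X \<in> extensional (carrier G)" "g \<in> carrier G \<Longrightarrow> h\<Pi> X g \<in> extensional (carrier G)"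
    and \<Theta>_equiv: "g \<in> carrier G \<Longrightarrow> h\<Theta> X g \<in> Equiv1 B (hbase X) (hbase X)"
    and \<Theta>p_iso:
      "\<gamma> \<in> paths_in G \<Longrightarrow>
        h\<Theta>p X \<gamma> \<in> Iso2 B (h\<Theta> X (pathstart \<gamma>)) (h\<Theta> X (pathfinish \<gamma>))"
    and \<Theta>p_const: "g \<in> carrier G \<Longrightarrow> h\<Theta>p X (\<lambda>_. g) = id2 B (h\<Theta> X g)"
    and \<Theta>p_join:
      "\<lbrakk>\<gamma> \<in> paths_in G; \<delta> \<in> paths_in G; pathfinish \<gamma> = pathstart \<delta>\<rbrakk>
        \<Longrightarrow> h\<Theta>p X (\<gamma> +++ \<delta>) = h\<Theta>p X \<delta> \<odot>\<^bsub>B\<^esub> h\<Theta>p X \<gamma>"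
    and \<Theta>p_track: \<comment> \<open>naturality for 2-tracks, which act trivially as \<open>B\<close> has no 3-cells\<close>
      "homotopic_paths (carrier G) \<gamma> \<delta> \<Longrightarrow> h\<Theta>p X \<gamma> = h\<Theta>p X \<delta>"
    and \<Pi>_iso:
      "\<lbrakk>g \<in> carrier G; h \<in> carrier G\<rbrakk>
        \<Longrightarrow> h\<Pi> X g h \<in> Iso2 B (h\<Theta> X h \<diamondop>\<^bsub>B\<^esub> h\<Theta> X g) (h\<Theta> X (g \<otimes> h))"
    and \<Pi>_natural:
      "\<lbrakk>\<gamma> \<in> paths_in G; \<delta> \<in> paths_in G\<rbrakk>
        \<Longrightarrow> h\<Pi> X (pathfinish \<gamma>) (pathfinish \<delta>) \<odot>\<^bsub>B\<^esub> (h\<Theta>p X \<delta> \<star>\<^bsub>B\<^esub> h\<Theta>p X \<gamma>) =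
            h\<Theta>p X (\<lambda>t. \<gamma> t \<otimes> \<delta> t) \<odot>\<^bsub>B\<^esub> h\<Pi> X (pathstart \<gamma>) (pathstart \<delta>)"
    and M_iso: "hM X \<in> Iso2 B (h\<Theta> X \<one>) (id1 B (hbase X))"
    and \<Pi>_assoc:
      "\<lbrakk>g \<in> carrier G; h \<in> carrier G; k \<in> carrier G\<rbrakk>
        \<Longrightarrow> h\<Pi> X (g \<otimes> h) k \<odot>\<^bsub>B\<^esub> (id2 B (h\<Theta> X k) \<star>\<^bsub>B\<^esub> h\<Pi> X g h) \<odot>\<^bsub>B\<^esub>
              assoc B (h\<Theta> X k) (h\<Theta> X h) (h\<Theta> X g) =
            h\<Pi> X g (h \<otimes> k) \<odot>\<^bsub>B\<^esub> (h\<Pi> X h k \<star>\<^bsub>B\<^esub> id2 B (h\<Theta> X g))"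
    and \<Pi>_unit_left:
      "g \<in> carrier G \<Longrightarrow>
        h\<Pi> X \<one> g = runit B (h\<Theta> X g) \<odot>\<^bsub>B\<^esub> (id2 B (h\<Theta> X g) \<star>\<^bsub>B\<^esub> hM X)"
    and \<Pi>_unit_right:
      "g \<in> carrier G \<Longrightarrow>
        h\<Pi> X g \<one> = lunit B (h\<Theta> X g) \<odot>\<^bsub>B\<^esub> (hM X \<star>\<^bsub>B\<^esub> id2 B (h\<Theta> X g))"

record ('g, 'a, 'f, 't) hfp1 =
  hsrc :: "('g, 'a, 'f, 't) hfp0"
  htrg :: "('g, 'a, 'f, 't) hfp0"
  hcell :: 'f
  hm :: "'g \<Rightarrow> 't"

locale hfp_morphism =
  fixes G :: "'g :: topological_space monoid" (structure)
    and B :: "('a, 'f, 't) bicat"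
    and X Y :: "('g, 'a, 'f, 't) hfp0"
    and f :: 'f
    and m :: "'g \<Rightarrow> 't"
  assumes cell: "f \<in> Hom1 B (hbase X) (hbase Y)"
    and m_extensional: "m \<in> extensional (carrier G)"
    and m_iso: "g \<in> carrier G \<Longrightarrow> m g \<in> Iso2 B (f \<diamondop>\<^bsub>B\<^esub> h\<Theta> X g) (h\<Theta> Y g \<diamondop>\<^bsub>B\<^esub> f)"
    and m_natural:
      "\<gamma> \<in> paths_in G \<Longrightarrow>
        (h\<Theta>p Y \<gamma> \<star>\<^bsub>B\<^esub> id2 B f) \<odot>\<^bsub>B\<^esub> m (pathstart \<gamma>) =
        m (pathfinish \<gamma>) \<odot>\<^bsub>B\<^esub> (id2 B f \<star>\<^bsub>B\<^esub> h\<Theta>p X \<gamma>)"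
    and m_\<Pi>:
      "\<lbrakk>g \<in> carrier G; h \<in> carrier G\<rbrakk> \<Longrightarrow>
        m (g \<otimes> h) \<odot>\<^bsub>B\<^esub> (id2 B f \<star>\<^bsub>B\<^esub> h\<Pi> X g h) \<odot>\<^bsub>B\<^esub> assoc B f (h\<Theta> X h) (h\<Theta> X g) =
        (h\<Pi> Y g h \<star>\<^bsub>B\<^esub> id2 B f) \<odot>\<^bsub>B\<^esub> assoc_inv B (h\<Theta> Y h) (h\<Theta> Y g) f \<odot>\<^bsub>B\<^esub>
          (id2 B (h\<Theta> Y h) \<star>\<^bsub>B\<^esub> m g) \<odot>\<^bsub>B\<^esub> assoc B (h\<Theta> Y h) f (h\<Theta> X g) \<odot>\<^bsub>B\<^esub>
          (m h \<star>\<^bsub>B\<^esub> id2 B (h\<Theta> X g))"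
    and m_M:
      "lunit B f \<odot>\<^bsub>B\<^esub> (hM Y \<star>\<^bsub>B\<^esub> id2 B f) \<odot>\<^bsub>B\<^esub> m \<one> =
       runit B f \<odot>\<^bsub>B\<^esub> (id2 B f \<star>\<^bsub>B\<^esub> hM X)"

text \<open>A 2-cell of the fixed point bicategory is a triple of source, target and underlying 2-cell.\<close>

type_synonym ('g, 'a, 'f, 't) hfp2 =
  "('g, 'a, 'f, 't) hfp1 \<times> ('g, 'a, 'f, 't) hfp1 \<times> 't"

definition hfp_Hom1 ::
  "'g :: topological_space monoid \<Rightarrow> ('a, 'f, 't) bicat \<Rightarrow>
    ('g, 'a, 'f, 't) hfp0 \<Rightarrow> ('g, 'a, 'f, 't) hfp0 \<Rightarrow> ('g, 'a, 'f, 't) hfp1 set" where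
  "hfp_Hom1 G B X Y =
     {P. hsrc P = X \<and> htrg P = Y \<and> hfp_morphism G B X Y (hcell P) (hm P)}"

definition hfp_Hom2 ::
  "'g :: topological_space monoid \<Rightarrow> ('a, 'f, 't) bicat \<Rightarrow>
    ('g, 'a, 'f, 't) hfp1 \<Rightarrow> ('g, 'a, 'f, 't) hfp1 \<Rightarrow> ('g, 'a, 'f, 't) hfp2 set" where
  "hfp_Hom2 G B P Q =
     {(P, Q, \<alpha>) | \<alpha>. \<alpha> \<in> Hom2 B (hcell P) (hcell Q) \<and>
        (\<forall>g \<in> carrier G.
          (id2 B (h\<Theta> (htrg P) g) \<star>\<^bsub>B\<^esub> \<alpha>) \<odot>\<^bsub>B\<^esub> hm P g =
          hm Q g \<odot>\<^bsub>B\<^esub> (\<alpha> \<star>\<^bsub>B\<^esub> id2 B (h\<Theta> (hsrc P) g)))}"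

definition hfp_id1 ::
  "'g :: topological_space monoid \<Rightarrow> ('a, 'f, 't) bicat \<Rightarrow>
    ('g, 'a, 'f, 't) hfp0 \<Rightarrow> ('g, 'a, 'f, 't) hfp1" where
  "hfp_id1 G B X =
     \<lparr>hsrc = X, htrg = X, hcell = id1 B (hbase X),
      hm = (\<lambda>g \<in> carrier G. runit_inv B (h\<Theta> X g) \<odot>\<^bsub>B\<^esub> lunit B (h\<Theta> X g))\<rparr>"

definition hfp_comp1 ::
  "'g :: topological_space monoid \<Rightarrow> ('a, 'f, 't) bicat \<Rightarrow>
    ('g, 'a, 'f, 't) hfp1 \<Rightarrow> ('g, 'a, 'f, 't) hfp1 \<Rightarrow> ('g, 'a, 'f, 't) hfp1" where
  "hfp_comp1 G B Q P =
     \<lparr>hsrc = hsrc P, htrg = htrg Q, hcell = hcell Q \<diamondop>\<^bsub>B\<^esub> hcell P,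
      hm = (\<lambda>g \<in> carrier G.
        assoc B (h\<Theta> (htrg Q) g) (hcell Q) (hcell P) \<odot>\<^bsub>B\<^esub>
        (hm Q g \<star>\<^bsub>B\<^esub> id2 B (hcell P)) \<odot>\<^bsub>B\<^esub>
        assoc_inv B (hcell Q) (h\<Theta> (htrg P) g) (hcell P) \<odot>\<^bsub>B\<^esub>
        (id2 B (hcell Q) \<star>\<^bsub>B\<^esub> hm P g) \<odot>\<^bsub>B\<^esub>
        assoc B (hcell Q) (hcell P) (h\<Theta> (hsrc P) g))\<rparr>"

definition homotopy_fixed_points ::
  "'g :: topological_space monoid \<Rightarrow> ('a, 'f, 't) bicat \<Rightarrow>
    (('g, 'a, 'f, 't) hfp0, ('g, 'a, 'f, 't) hfp1, ('g, 'a, 'f, 't) hfp2) bicat" where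
  "homotopy_fixed_points G B =
    (let id1' = hfp_id1 G B; comp' = hfp_comp1 G B in
     \<lparr>Ob = {X. hfp_object G B X},
      Hom1 = hfp_Hom1 G B,
      Hom2 = hfp_Hom2 G B,
      id1 = id1',
      id2 = (\<lambda>P. (P, P, id2 B (hcell P))),
      comp1 = comp',
      vcomp = (\<lambda>(Q, R, \<beta>) (P, Q', \<alpha>). (P, R, \<beta> \<odot>\<^bsub>B\<^esub> \<alpha>)),
      hcomp = (\<lambda>(Q, Q', \<beta>) (P, P', \<alpha>). (comp' Q P, comp' Q' P', \<beta> \<star>\<^bsub>B\<^esub> \<alpha>)),
      assoc = (\<lambda>R Q P. (comp' (comp' R Q) P, comp' R (comp' Q P),
                         assoc B (hcell R) (hcell Q) (hcell P))),
      assoc_inv = (\<lambda>R Q P. (comp' R (comp' Q P), comp' (comp' R Q) P,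
                         assoc_inv B (hcell R) (hcell Q) (hcell P))),
      lunit = (\<lambda>P. (comp' (id1' (htrg P)) P, P, lunit B (hcell P))),
      lunit_inv = (\<lambda>P. (P, comp' (id1' (htrg P)) P, lunit_inv B (hcell P))),
      runit = (\<lambda>P. (comp' P (id1' (hsrc P)), P, runit B (hcell P))),
      runit_inv = (\<lambda>P. (P, comp' P (id1' (hsrc P)), runit_inv B (hcell P)))\<rparr>)"

definition SO :: "(real ^ 'n ^ 'n) monoid" where
  "SO = \<lparr>carrier = {A. orthogonal_matrix A \<and> det A = 1}, mult = (**), one = mat 1\<rparr>"

section \<open>Linear and abelian categories\<close>

text \<open>
  Categories have their objects in a type \<open>'o\<close> and their morphisms in a type \<open>'m\<close>; these types play
  the role of the universe and are arbitrary in the theorem.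
  Hom-sets are disjoint, and \<open>g \<cdot> f\<close> is "first \<open>f\<close>, then \<open>g\<close>".
\<close>

record ('o, 'm, 'k) lincat =
  Obj :: "'o set"
  Hom :: "'o \<Rightarrow> 'o \<Rightarrow> 'm set"
  Idt :: "'o \<Rightarrow> 'm"
  Cmp :: "'m \<Rightarrow> 'm \<Rightarrow> 'm" (infixr "\<cdot>\<index>" 70)
  Zer :: "'o \<Rightarrow> 'o \<Rightarrow> 'm"
  Add :: "'m \<Rightarrow> 'm \<Rightarrow> 'm" (infixl "\<oplus>\<index>" 65)
  Scl :: "'k \<Rightarrow> 'm \<Rightarrow> 'm" (infixr "*\<^sub>L\<index>" 75)

locale linear_category =
  fixes D :: "('o, 'm, 'k :: field) lincat" (structure)
  assumes Hom_disjoint: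
      "\<lbrakk>a \<in> Obj D; b \<in> Obj D; a' \<in> Obj D; b' \<in> Obj D; f \<in> Hom D a b; f \<in> Hom D a' b'\<rbrakk>
        \<Longrightarrow> a = a' \<and> b = b'"
    and Idt_closed: "a \<in> Obj D \<Longrightarrow> Idt D a \<in> Hom D a a"
    and Cmp_closed:
      "\<lbrakk>a \<in> Obj D; b \<in> Obj D; c \<in> Obj D; f \<in> Hom D a b; g \<in> Hom D b c\<rbrakk>
        \<Longrightarrow> g \<cdot> f \<in> Hom D a c"
    and Cmp_Idt:
      "\<lbrakk>a \<in> Obj D; b \<in> Obj D; f \<in> Hom D a b\<rbrakk> \<Longrightarrow> f \<cdot> Idt D a = f \<and> Idt D b \<cdot> f = f"
    and Cmp_assoc:
      "\<lbrakk>a \<in> Obj D; b \<in> Obj D; c \<in> Obj D; d \<in> Obj D;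
        f \<in> Hom D a b; g \<in> Hom D b c; h \<in> Hom D c d\<rbrakk> \<Longrightarrow> (h \<cdot> g) \<cdot> f = h \<cdot> (g \<cdot> f)"
    and Zer_closed: "\<lbrakk>a \<in> Obj D; b \<in> Obj D\<rbrakk> \<Longrightarrow> Zer D a b \<in> Hom D a b"
    and Add_closed:
      "\<lbrakk>a \<in> Obj D; b \<in> Obj D; f \<in> Hom D a b; g \<in> Hom D a b\<rbrakk> \<Longrightarrow> f \<oplus> g \<in> Hom D a b"
    and Scl_closed: "\<lbrakk>a \<in> Obj D; b \<in> Obj D; f \<in> Hom D a b\<rbrakk> \<Longrightarrow> r *\<^sub>L f \<in> Hom D a b"
    and Add_assoc:
      "\<lbrakk>a \<in> Obj D; b \<in> Obj D; f \<in> Hom D a b; g \<in> Hom D a b; h \<in> Hom D a b\<rbrakk>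
        \<Longrightarrow> (f \<oplus> g) \<oplus> h = f \<oplus> (g \<oplus> h)"
    and Add_commute:
      "\<lbrakk>a \<in> Obj D; b \<in> Obj D; f \<in> Hom D a b; g \<in> Hom D a b\<rbrakk> \<Longrightarrow> f \<oplus> g = g \<oplus> f"
    and Add_Zer: "\<lbrakk>a \<in> Obj D; b \<in> Obj D; f \<in> Hom D a b\<rbrakk> \<Longrightarrow> f \<oplus> Zer D a b = f"
    and Add_inverse:
      "\<lbrakk>a \<in> Obj D; b \<in> Obj D; f \<in> Hom D a b\<rbrakk> \<Longrightarrow> \<exists>g \<in> Hom D a b. f \<oplus> g = Zer D a b"
    and Scl_one: "\<lbrakk>a \<in> Obj D; b \<in> Obj D; f \<in> Hom D a b\<rbrakk> \<Longrightarrow> 1 *\<^sub>L f = f"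
    and Scl_Scl:
      "\<lbrakk>a \<in> Obj D; b \<in> Obj D; f \<in> Hom D a b\<rbrakk> \<Longrightarrow> r *\<^sub>L (s *\<^sub>L f) = (r * s) *\<^sub>L f"
    and Scl_Add_left:
      "\<lbrakk>a \<in> Obj D; b \<in> Obj D; f \<in> Hom D a b\<rbrakk> \<Longrightarrow> (r + s) *\<^sub>L f = r *\<^sub>L f \<oplus> s *\<^sub>L f"
    and Scl_Add_right:
      "\<lbrakk>a \<in> Obj D; b \<in> Obj D; f \<in> Hom D a b; g \<in> Hom D a b\<rbrakk>
        \<Longrightarrow> r *\<^sub>L (f \<oplus> g) = r *\<^sub>L f \<oplus> r *\<^sub>L g"
    and Cmp_Add_left:
      "\<lbrakk>a \<in> Obj D; b \<in> Obj D; c \<in> Obj D; f \<in> Hom D a b; g \<in> Hom D b c; g' \<in> Hom D b c\<rbrakk>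
        \<Longrightarrow> (g \<oplus> g') \<cdot> f = g \<cdot> f \<oplus> g' \<cdot> f"
    and Cmp_Add_right:
      "\<lbrakk>a \<in> Obj D; b \<in> Obj D; c \<in> Obj D; f \<in> Hom D a b; f' \<in> Hom D a b; g \<in> Hom D b c\<rbrakk>
        \<Longrightarrow> g \<cdot> (f \<oplus> f') = g \<cdot> f \<oplus> g \<cdot> f'"
    and Cmp_Scl:
      "\<lbrakk>a \<in> Obj D; b \<in> Obj D; c \<in> Obj D; f \<in> Hom D a b; g \<in> Hom D b c\<rbrakk>
        \<Longrightarrow> (r *\<^sub>L g) \<cdot> f = r *\<^sub>L (g \<cdot> f) \<and> g \<cdot> (r *\<^sub>L f) = r *\<^sub>L (g \<cdot> f)"

definition Arr :: "('o, 'm, 'k) lincat \<Rightarrow> 'm set" where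
  "Arr D = (\<Union>a \<in> Obj D. \<Union>b \<in> Obj D. Hom D a b)"

definition zero_object :: "('o, 'm, 'k) lincat \<Rightarrow> 'o \<Rightarrow> bool" where
  "zero_object D z \<longleftrightarrow> z \<in> Obj D \<and>
     (\<forall>a \<in> Obj D. (\<exists>!f. f \<in> Hom D a z) \<and> (\<exists>!f. f \<in> Hom D z a))"

definition is_iso :: "('o, 'm, 'k) lincat \<Rightarrow> 'o \<Rightarrow> 'o \<Rightarrow> 'm \<Rightarrow> bool" where
  "is_iso D a b f \<longleftrightarrow> f \<in> Hom D a b \<and>
     (\<exists>g \<in> Hom D b a. g \<cdot>\<^bsub>D\<^esub> f = Idt D a \<and> f \<cdot>\<^bsub>D\<^esub> g = Idt D b)"

definition monic :: "('o, 'm, 'k) lincat \<Rightarrow> 'o \<Rightarrow> 'o \<Rightarrow> 'm \<Rightarrow> bool" where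
  "monic D a b f \<longleftrightarrow> f \<in> Hom D a b \<and>
     (\<forall>x \<in> Obj D. \<forall>u \<in> Hom D x a. \<forall>v \<in> Hom D x a. f \<cdot>\<^bsub>D\<^esub> u = f \<cdot>\<^bsub>D\<^esub> v \<longrightarrow> u = v)"

definition epic :: "('o, 'm, 'k) lincat \<Rightarrow> 'o \<Rightarrow> 'o \<Rightarrow> 'm \<Rightarrow> bool" where
  "epic D a b f \<longleftrightarrow> f \<in> Hom D a b \<and>
     (\<forall>x \<in> Obj D. \<forall>u \<in> Hom D b x. \<forall>v \<in> Hom D b x. u \<cdot>\<^bsub>D\<^esub> f = v \<cdot>\<^bsub>D\<^esub> f \<longrightarrow> u = v)"

text \<open>\<open>i : c \<rightarrow> a\<close> is a kernel, and \<open>p : b \<rightarrow> c\<close> a cokernel, of \<open>f : a \<rightarrow> b\<close>.\<close>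

definition is_kernel :: "('o, 'm, 'k) lincat \<Rightarrow> 'o \<Rightarrow> 'o \<Rightarrow> 'm \<Rightarrow> 'o \<Rightarrow> 'm \<Rightarrow> bool" where
  "is_kernel D a b f c i \<longleftrightarrow> c \<in> Obj D \<and> i \<in> Hom D c a \<and> f \<cdot>\<^bsub>D\<^esub> i = Zer D c b \<and>
     (\<forall>x \<in> Obj D. \<forall>u \<in> Hom D x a. f \<cdot>\<^bsub>D\<^esub> u = Zer D x b \<longrightarrow>
        (\<exists>!v. v \<in> Hom D x c \<and> i \<cdot>\<^bsub>D\<^esub> v = u))"

definition is_cokernel :: "('o, 'm, 'k) lincat \<Rightarrow> 'o \<Rightarrow> 'o \<Rightarrow> 'm \<Rightarrow> 'o \<Rightarrow> 'm \<Rightarrow> bool" where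
  "is_cokernel D a b f c p \<longleftrightarrow> c \<in> Obj D \<and> p \<in> Hom D b c \<and> p \<cdot>\<^bsub>D\<^esub> f = Zer D a c \<and>
     (\<forall>x \<in> Obj D. \<forall>u \<in> Hom D b x. u \<cdot>\<^bsub>D\<^esub> f = Zer D a x \<longrightarrow>
        (\<exists>!v. v \<in> Hom D c x \<and> v \<cdot>\<^bsub>D\<^esub> p = u))"

definition is_biproduct ::
  "('o, 'm, 'k) lincat \<Rightarrow> 'o \<Rightarrow> 'o \<Rightarrow> 'o \<Rightarrow> 'm \<Rightarrow> 'm \<Rightarrow> 'm \<Rightarrow> 'm \<Rightarrow> bool" where
  "is_biproduct D a b s i j p q \<longleftrightarrow> s \<in> Obj D \<and>
     i \<in> Hom D a s \<and> j \<in> Hom D b s \<and> p \<in> Hom D s a \<and> q \<in> Hom D s b \<and>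
     p \<cdot>\<^bsub>D\<^esub> i = Idt D a \<and> q \<cdot>\<^bsub>D\<^esub> j = Idt D b \<and>
     p \<cdot>\<^bsub>D\<^esub> j = Zer D b a \<and> q \<cdot>\<^bsub>D\<^esub> i = Zer D a b \<and>
     (i \<cdot>\<^bsub>D\<^esub> p) \<oplus>\<^bsub>D\<^esub> (j \<cdot>\<^bsub>D\<^esub> q) = Idt D s"

locale abelian_category = linear_category D
  for D :: "('o, 'm, 'k :: field) lincat" (structure) +
  assumes has_zero_object: "\<exists>z. zero_object D z"
    and has_biproducts:
      "\<lbrakk>a \<in> Obj D; b \<in> Obj D\<rbrakk> \<Longrightarrow> \<exists>s i j p q. is_biproduct D a b s i j p q"
    and has_kernels:
      "\<lbrakk>a \<in> Obj D; b \<in> Obj D; f \<in> Hom D a b\<rbrakk> \<Longrightarrow> \<exists>c i. is_kernel D a b f c i"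
    and has_cokernels:
      "\<lbrakk>a \<in> Obj D; b \<in> Obj D; f \<in> Hom D a b\<rbrakk> \<Longrightarrow> \<exists>c p. is_cokernel D a b f c p"
    and mono_is_kernel:
      "\<lbrakk>a \<in> Obj D; b \<in> Obj D; monic D a b f\<rbrakk>
        \<Longrightarrow> \<exists>c \<in> Obj D. \<exists>g \<in> Hom D b c. is_kernel D b c g a f"
    and epi_is_cokernel:
      "\<lbrakk>a \<in> Obj D; b \<in> Obj D; epic D a b f\<rbrakk>
        \<Longrightarrow> \<exists>c \<in> Obj D. \<exists>g \<in> Hom D c a. is_cokernel D c a g b f"

definition simple_object :: "('o, 'm, 'k) lincat \<Rightarrow> 'o \<Rightarrow> bool" where
  "simple_object D s \<longleftrightarrow> s \<in> Obj D \<and> \<not> zero_object D s \<and>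
     (\<forall>x \<in> Obj D. \<forall>i. monic D x s i \<longrightarrow> zero_object D x \<or> is_iso D x s i)"

definition projective_object :: "('o, 'm, 'k) lincat \<Rightarrow> 'o \<Rightarrow> bool" where
  "projective_object D p \<longleftrightarrow> p \<in> Obj D \<and>
     (\<forall>a \<in> Obj D. \<forall>b \<in> Obj D. \<forall>e. epic D a b e \<longrightarrow>
        (\<forall>f \<in> Hom D p b. \<exists>g \<in> Hom D p a. e \<cdot>\<^bsub>D\<^esub> g = f))"

text \<open>Finite length: there is a composition series, i.e. a chain of monomorphisms from a zero object
  to \<open>x\<close> with simple successive quotients.\<close>

definition finite_length :: "('o, 'm, 'k) lincat \<Rightarrow> 'o \<Rightarrow> bool" where
  "finite_length D x \<longleftrightarrow> (\<exists>(n :: nat) X i.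
     zero_object D (X 0) \<and> X n = x \<and>
     (\<forall>k < n. X (Suc k) \<in> Obj D \<and> monic D (X k) (X (Suc k)) (i k) \<and>
        (\<exists>q p. is_cokernel D (X k) (X (Suc k)) (i k) q p \<and> simple_object D q)))"

inductive_set lin_span ::
  "('o, 'm, 'k) lincat \<Rightarrow> 'o \<Rightarrow> 'o \<Rightarrow> 'm set \<Rightarrow> 'm set"
  for D :: "('o, 'm, 'k) lincat" and a b :: 'o and S :: "'m set" where
    "Zer D a b \<in> lin_span D a b S"
  | "\<lbrakk>f \<in> S; g \<in> lin_span D a b S\<rbrakk> \<Longrightarrow> (r *\<^sub>L\<^bsub>D\<^esub> f) \<oplus>\<^bsub>D\<^esub> g \<in> lin_span D a b S"

locale finite_category = abelian_category D
  for D :: "('o, 'm, 'k :: field) lincat" (structure) +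
  assumes finite_dim_Hom:
      "\<lbrakk>a \<in> Obj D; b \<in> Obj D\<rbrakk>
        \<Longrightarrow> \<exists>S. finite S \<and> S \<subseteq> Hom D a b \<and> Hom D a b = lin_span D a b S"
    and all_finite_length: "a \<in> Obj D \<Longrightarrow> finite_length D a"
    and enough_projectives:
      "a \<in> Obj D \<Longrightarrow> \<exists>p e. projective_object D p \<and> epic D p a e"
    and finitely_many_simples:
      "\<exists>S. finite S \<and> (\<forall>s \<in> S. simple_object D s) \<and>
        (\<forall>x. simple_object D x \<longrightarrow> (\<exists>s \<in> S. \<exists>f. is_iso D x s f))"

primrec hom_sum ::
  "('o, 'm, 'k) lincat \<Rightarrow> 'o \<Rightarrow> 'o \<Rightarrow> (nat \<Rightarrow> 'm) \<Rightarrow> nat \<Rightarrow> 'm" where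
  "hom_sum D a b u 0 = Zer D a b"
| "hom_sum D a b u (Suc n) = hom_sum D a b u n \<oplus>\<^bsub>D\<^esub> u n"

definition finite_direct_sum ::
  "('o, 'm, 'k) lincat \<Rightarrow> nat \<Rightarrow> (nat \<Rightarrow> 'o) \<Rightarrow> 'o \<Rightarrow> bool" where
  "finite_direct_sum D n s x \<longleftrightarrow> x \<in> Obj D \<and> (\<exists>i p.
     (\<forall>k < n. s k \<in> Obj D \<and> i k \<in> Hom D (s k) x \<and> p k \<in> Hom D x (s k)) \<and>
     (\<forall>j < n. \<forall>k < n. p j \<cdot>\<^bsub>D\<^esub> i k = (if j = k then Idt D (s k) else Zer D (s k) (s j))) \<and>
     hom_sum D x x (\<lambda>k. i k \<cdot>\<^bsub>D\<^esub> p k) n = Idt D x)"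

definition semisimple :: "('o, 'm, 'k) lincat \<Rightarrow> bool" where
  "semisimple D \<longleftrightarrow> (\<forall>x \<in> Obj D. \<exists>n s.
     (\<forall>k < n. simple_object D (s k)) \<and> finite_direct_sum D n s x)"

section \<open>The bicategory of linear abelian categories\<close>

text \<open>
  Composition of functors is strictly associative and unital, so all coherence cells are identities.
  Functors and transformations are extensional, so that equality of cells is equality on the
  relevant objects and morphisms.
\<close>

record ('o, 'm, 'k) linfun =
  Dom :: "('o, 'm, 'k) lincat"
  Cod :: "('o, 'm, 'k) lincat"
  omap :: "'o \<Rightarrow> 'o"
  mmap :: "'m \<Rightarrow> 'm"

record ('o, 'm, 'k) nattr =
  Src :: "('o, 'm, 'k) linfun"
  Trg :: "('o, 'm, 'k) linfun"
  cmpt :: "'o \<Rightarrow> 'm"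

definition linear_functors ::
  "('o, 'm, 'k) lincat \<Rightarrow> ('o, 'm, 'k) lincat \<Rightarrow> ('o, 'm, 'k) linfun set" where
  "linear_functors D E = {F. Dom F = D \<and> Cod F = E \<and>
     omap F \<in> Obj D \<rightarrow>\<^sub>E Obj E \<and> mmap F \<in> extensional (Arr D) \<and>
     (\<forall>a \<in> Obj D. mmap F (Idt D a) = Idt E (omap F a)) \<and>
     (\<forall>a \<in> Obj D. \<forall>b \<in> Obj D. \<forall>f \<in> Hom D a b.
        mmap F f \<in> Hom E (omap F a) (omap F b)) \<and>
     (\<forall>a \<in> Obj D. \<forall>b \<in> Obj D. \<forall>c \<in> Obj D. \<forall>f \<in> Hom D a b. \<forall>g \<in> Hom D b c.
        mmap F (g \<cdot>\<^bsub>D\<^esub> f) = mmap F g \<cdot>\<^bsub>E\<^esub> mmap F f) \<and>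
     (\<forall>a \<in> Obj D. \<forall>b \<in> Obj D. \<forall>f \<in> Hom D a b. \<forall>g \<in> Hom D a b.
        mmap F (f \<oplus>\<^bsub>D\<^esub> g) = mmap F f \<oplus>\<^bsub>E\<^esub> mmap F g) \<and>
     (\<forall>a \<in> Obj D. \<forall>b \<in> Obj D. \<forall>f \<in> Hom D a b. \<forall>r.
        mmap F (r *\<^sub>L\<^bsub>D\<^esub> f) = r *\<^sub>L\<^bsub>E\<^esub> mmap F f)}"

definition nat_transformations ::
  "('o, 'm, 'k) linfun \<Rightarrow> ('o, 'm, 'k) linfun \<Rightarrow> ('o, 'm, 'k) nattr set" where
  "nat_transformations F G = {\<alpha>. Src \<alpha> = F \<and> Trg \<alpha> = G \<and>
     cmpt \<alpha> \<in> (\<Pi>\<^sub>E a \<in> Obj (Dom F). Hom (Cod F) (omap F a) (omap G a)) \<and>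
     (\<forall>a \<in> Obj (Dom F). \<forall>b \<in> Obj (Dom F). \<forall>f \<in> Hom (Dom F) a b.
        cmpt \<alpha> b \<cdot>\<^bsub>Cod F\<^esub> mmap F f = mmap G f \<cdot>\<^bsub>Cod F\<^esub> cmpt \<alpha> a)}"

definition fun_id :: "('o, 'm, 'k) lincat \<Rightarrow> ('o, 'm, 'k) linfun" where
  "fun_id D = \<lparr>Dom = D, Cod = D, omap = (\<lambda>a \<in> Obj D. a), mmap = (\<lambda>f \<in> Arr D. f)\<rparr>"

definition fun_comp ::
  "('o, 'm, 'k) linfun \<Rightarrow> ('o, 'm, 'k) linfun \<Rightarrow> ('o, 'm, 'k) linfun" where
  "fun_comp G F = \<lparr>Dom = Dom F, Cod = Cod G,
     omap = (\<lambda>a \<in> Obj (Dom F). omap G (omap F a)),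
     mmap = (\<lambda>f \<in> Arr (Dom F). mmap G (mmap F f))\<rparr>"

definition nat_id :: "('o, 'm, 'k) linfun \<Rightarrow> ('o, 'm, 'k) nattr" where
  "nat_id F = \<lparr>Src = F, Trg = F, cmpt = (\<lambda>a \<in> Obj (Dom F). Idt (Cod F) (omap F a))\<rparr>"

definition nat_vcomp ::
  "('o, 'm, 'k) nattr \<Rightarrow> ('o, 'm, 'k) nattr \<Rightarrow> ('o, 'm, 'k) nattr" where
  "nat_vcomp \<beta> \<alpha> = \<lparr>Src = Src \<alpha>, Trg = Trg \<beta>,
     cmpt = (\<lambda>a \<in> Obj (Dom (Src \<alpha>)). cmpt \<beta> a \<cdot>\<^bsub>Cod (Src \<alpha>)\<^esub> cmpt \<alpha> a)\<rparr>"

definition nat_hcomp ::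
  "('o, 'm, 'k) nattr \<Rightarrow> ('o, 'm, 'k) nattr \<Rightarrow> ('o, 'm, 'k) nattr" where
  "nat_hcomp \<beta> \<alpha> = \<lparr>Src = fun_comp (Src \<beta>) (Src \<alpha>), Trg = fun_comp (Trg \<beta>) (Trg \<alpha>),
     cmpt = (\<lambda>a \<in> Obj (Dom (Src \<alpha>)).
       cmpt \<beta> (omap (Trg \<alpha>) a) \<cdot>\<^bsub>Cod (Src \<beta>)\<^esub> mmap (Src \<beta>) (cmpt \<alpha> a))\<rparr>"

definition Vect2 ::
  "(('o, 'm, 'k :: field) lincat, ('o, 'm, 'k) linfun, ('o, 'm, 'k) nattr) bicat" where
  "Vect2 = \<lparr>Ob = {D. abelian_category D},
     Hom1 = linear_functors,
     Hom2 = nat_transformations,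
     id1 = fun_id,
     id2 = nat_id,
     comp1 = fun_comp,
     vcomp = nat_vcomp,
     hcomp = nat_hcomp,
     assoc = (\<lambda>H G F. nat_id (fun_comp H (fun_comp G F))),
     assoc_inv = (\<lambda>H G F. nat_id (fun_comp H (fun_comp G F))),
     lunit = nat_id, lunit_inv = nat_id,
     runit = nat_id, runit_inv = nat_id\<rparr>"

text \<open>The fully dualizable objects are precisely the finite semisimple categories.\<close>

definition Vect2_fd ::
  "(('o, 'm, 'k :: field) lincat, ('o, 'm, 'k) linfun, ('o, 'm, 'k) nattr) bicat" where
  "Vect2_fd = full_sub Vect2 {D. finite_category D \<and> semisimple D}"

section \<open>Calabi-Yau categories\<close>

locale CY_category = finite_category D
  for D :: "('o, 'm, 'k :: field) lincat" (structure) +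
  fixes tr :: "'o \<Rightarrow> 'm \<Rightarrow> 'k"
  assumes all_semisimple: "semisimple D"
    and tr_extensional:
      "tr \<in> extensional (Obj D)" "c \<in> Obj D \<Longrightarrow> tr c \<in> extensional (Hom D c c)"
    and tr_Add:
      "\<lbrakk>c \<in> Obj D; f \<in> Hom D c c; g \<in> Hom D c c\<rbrakk> \<Longrightarrow> tr c (f \<oplus> g) = tr c f + tr c g"
    and tr_Scl: "\<lbrakk>c \<in> Obj D; f \<in> Hom D c c\<rbrakk> \<Longrightarrow> tr c (r *\<^sub>L f) = r * tr c f"
    and tr_cyclic:
      "\<lbrakk>c \<in> Obj D; d \<in> Obj D; f \<in> Hom D c d; g \<in> Hom D d c\<rbrakk> \<Longrightarrow> tr c (g \<cdot> f) = tr d (f \<cdot> g)"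
    and tr_direct_sum:
      "\<lbrakk>c \<in> Obj D; d \<in> Obj D; is_biproduct D c d s i j p q; f \<in> Hom D c c; g \<in> Hom D d d\<rbrakk>
        \<Longrightarrow> tr s ((i \<cdot> f \<cdot> p) \<oplus> (j \<cdot> g \<cdot> q)) = tr c f + tr d g"
    and tr_nondegenerate_left:
      "\<lbrakk>c \<in> Obj D; d \<in> Obj D; f \<in> Hom D c d; \<And>g. g \<in> Hom D d c \<Longrightarrow> tr c (g \<cdot> f) = 0\<rbrakk>
        \<Longrightarrow> f = Zer D c d"
    and tr_nondegenerate_right:
      "\<lbrakk>c \<in> Obj D; d \<in> Obj D; g \<in> Hom D d c; \<And>f. f \<in> Hom D c d \<Longrightarrow> tr c (g \<cdot> f) = 0\<rbrakk>
        \<Longrightarrow> g = Zer D d c"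

definition CY_functors ::
  "('o, 'm, 'k) lincat \<times> ('o \<Rightarrow> 'm \<Rightarrow> 'k) \<Rightarrow> ('o, 'm, 'k) lincat \<times> ('o \<Rightarrow> 'm \<Rightarrow> 'k) \<Rightarrow>
    (('o, 'm, 'k) linfun) set" where
  "CY_functors X Y = {F \<in> linear_functors (fst X) (fst Y).
     \<forall>c \<in> Obj (fst X). \<forall>f \<in> Hom (fst X) c c. snd X c f = snd Y (omap F c) (mmap F f)}"

text \<open>
  A functor does not know the traces on its domain and codomain, hence the cells of the bicategory of
  Calabi-Yau categories are tagged with their boundaries. The 2-cells are all natural
  transformations.
\<close>

type_synonym ('o, 'm, 'k) cy0 = "('o, 'm, 'k) lincat \<times> ('o \<Rightarrow> 'm \<Rightarrow> 'k)"

type_synonym ('o, 'm, 'k) cy1 =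
  "('o, 'm, 'k) cy0 \<times> ('o, 'm, 'k) cy0 \<times> ('o, 'm, 'k) linfun"

type_synonym ('o, 'm, 'k) cy2 =
  "('o, 'm, 'k) cy1 \<times> ('o, 'm, 'k) cy1 \<times> ('o, 'm, 'k) nattr"

definition CY_comp :: "('o, 'm, 'k) cy1 \<Rightarrow> ('o, 'm, 'k) cy1 \<Rightarrow> ('o, 'm, 'k) cy1" where
  "CY_comp = (\<lambda>(Y', Z, G) (X, Y, F). (X, Z, fun_comp G F))"

definition CY_nat_id :: "('o, 'm, 'k) cy1 \<Rightarrow> ('o, 'm, 'k) cy2" where
  "CY_nat_id = (\<lambda>(X, Y, F). ((X, Y, F), (X, Y, F), nat_id F))"

definition CY ::
  "(('o, 'm, 'k :: field) cy0, ('o, 'm, 'k) cy1, ('o, 'm, 'k) cy2) bicat" where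
  "CY = \<lparr>Ob = {(D, t). CY_category D t},
     Hom1 = (\<lambda>X Y. {(X, Y, F) | F. F \<in> CY_functors X Y}),
     Hom2 = (\<lambda>(X, Y, F) (X', Y', G).
       {((X, Y, F), (X', Y', G), \<alpha>) | \<alpha>. \<alpha> \<in> nat_transformations F G}),
     id1 = (\<lambda>X. (X, X, fun_id (fst X))),
     id2 = CY_nat_id,
     comp1 = CY_comp,
     vcomp = (\<lambda>(Q, R, \<beta>) (P, Q', \<alpha>). (P, R, nat_vcomp \<beta> \<alpha>)),
     hcomp = (\<lambda>(Q, Q', \<beta>) (P, P', \<alpha>). (CY_comp Q P, CY_comp Q' P', nat_hcomp \<beta> \<alpha>)),
     assoc = (\<lambda>R Q P. CY_nat_id (CY_comp R (CY_comp Q P))),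
     assoc_inv = (\<lambda>R Q P. CY_nat_id (CY_comp R (CY_comp Q P))),
     lunit = CY_nat_id, lunit_inv = CY_nat_id,
     runit = CY_nat_id, runit_inv = CY_nat_id\<rparr>"

text \<open>
  Fixed points of an action on a core have only equivalences as 1-cells and invertible 2-cells.
  A Calabi-Yau functor need not be an equivalence, nor a natural transformation invertible, so the
  fixed points are to be compared with \<^term>\<open>core CY\<close>.
\<close>

end

(* A homotopy fixed point trivializes along paths from the unit of SO(2): following Theta along a path
   from 1 to g and then undoing M identifies Theta_g with the identity. The pointwise product of paths
   forces compatibility with Pi, so the only invariant left is the holonomy along the generator of
   pi_1(SO(2)) = Z, a natural automorphism of the identity functor; 1-morphisms are the equivalences
   commuting with the holonomies, and 2-morphisms are all natural isomorphisms. Every automorphism nu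
   is a holonomy: Theta_g = id, Theta_gamma = nu^n with n the increment of the integer part of the
   angle, and Pi corrects for the carries when angles are added.

   On a finite semisimple category over an algebraically closed field, Schur's lemma yields a canonical
   trace, and every Calabi-Yau structure is f |-> can(nu f) for a unique natural automorphism nu of the
   identity. Equivalences preserve the canonical trace, so they are Calabi-Yau functors exactly if they
   commute with these automorphisms. *)

theory Submission
  imports Defs
begin

section \<open>Cores and locally full bicategories\<close>

text \<open>The comparison passes through the common base \<open>core Vect2_fd\<close>: on both
  sides a 1-cell is an equivalence of the base with extra data or properties, and a 2-cell is any
  2-cell of the base between the underlying equivalences. So composition needs no comparison beyond
  identity 2-cells.

  The cells \<open>m g\<close> of a 1-morphism are no choice. A path from the unit to
  \<open>g\<close> prescribes the value of \<open>m g\<close>, and two such paths differ, up to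
  homotopy, by full turns. The prescription is independent of the path exactly if the functor
  commutes with the holonomies. The same trivializations make the condition on 2-morphisms
  automatic.

  On the Calabi-Yau side the key is rigidity. Endomorphisms of a simple object are scalars, so a
  linear cyclic trace is determined by its values on identities of simple objects, and nondegeneracy
  makes these values nonzero. The canonical trace is the one with all values 1. An equivalence sends
  simple objects to simple ones, so it cannot change these values.\<close>

lemma inverse2_sym: "inverse2 B f g \<alpha> \<beta> \<Longrightarrow> inverse2 B g f \<beta> \<alpha>"
  by (auto simp: inverse2_def)

lemma Iso2_sym: "Iso2 B f g \<noteq> {} \<Longrightarrow> Iso2 B g f \<noteq> {}"
  by (auto simp: Iso2_def intro: inverse2_sym)

lemma isomorphicI: "inverse2 B f g \<alpha> \<beta> \<Longrightarrow> Iso2 B f g \<noteq> {}"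
  by (auto simp: Iso2_def)

lemma Iso2_Hom2: "\<alpha> \<in> Iso2 B f g \<Longrightarrow> \<alpha> \<in> Hom2 B f g"
  by (auto simp: Iso2_def inverse2_def)

lemma Equiv1_Hom1: "f \<in> Equiv1 B a b \<Longrightarrow> f \<in> Hom1 B a b"
  by (auto simp: Equiv1_def)

lemma Equiv1I:
  "\<lbrakk>f \<in> Hom1 B a b; g \<in> Hom1 B b a; Iso2 B (id1 B a) (g \<diamondop>\<^bsub>B\<^esub> f) \<noteq> {};
    Iso2 B (f \<diamondop>\<^bsub>B\<^esub> g) (id1 B b) \<noteq> {}\<rbrakk> \<Longrightarrow> f \<in> Equiv1 B a b"
  unfolding Equiv1_def by blast

text \<open>In \<open>Equiv1\<close> the two isomorphisms point in opposite directions, as unit and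
  counit do. Inverting both exhibits the quasi-inverse as an equivalence, which is what membership
  in the core requires of it.\<close>

lemma Equiv1_inverse:
  assumes "f \<in> Equiv1 B a b"
  obtains g where "g \<in> Equiv1 B b a" "Iso2 B (id1 B a) (g \<diamondop>\<^bsub>B\<^esub> f) \<noteq> {}"
    "Iso2 B (f \<diamondop>\<^bsub>B\<^esub> g) (id1 B b) \<noteq> {}"
proof -
  from assms obtain g where g: "f \<in> Hom1 B a b" "g \<in> Hom1 B b a"
    "Iso2 B (id1 B a) (g \<diamondop>\<^bsub>B\<^esub> f) \<noteq> {}" "Iso2 B (f \<diamondop>\<^bsub>B\<^esub> g) (id1 B b) \<noteq> {}"
    unfolding Equiv1_def by blast
  show ?thesis
    by (rule that[OF Equiv1I[OF g(2,1) Iso2_sym[OF g(4)] Iso2_sym[OF g(3)]] g(3,4)])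
qed

section \<open>Invertible 2-cells and composition of equivalences\<close>

context bicategory
begin

lemma inverse2_id2:
  "\<lbrakk>a \<in> Ob B; b \<in> Ob B; f \<in> Hom1 B a b\<rbrakk> \<Longrightarrow> inverse2 B f f (id2 B f) (id2 B f)"
  by (simp add: inverse2_def id2_closed vcomp_id[of a b f f])

lemma id2_vcomp_id2:
  "\<lbrakk>a \<in> Ob B; b \<in> Ob B; f \<in> Hom1 B a b\<rbrakk> \<Longrightarrow> id2 B f \<odot> id2 B f = id2 B f"
  using vcomp_id id2_closed by metis

lemma id2_Iso2: "\<lbrakk>a \<in> Ob B; b \<in> Ob B; f \<in> Hom1 B a b\<rbrakk> \<Longrightarrow> id2 B f \<in> Iso2 B f f"
  using inverse2_id2 by (auto simp: Iso2_def)

lemma inverse2_vcomp: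
  assumes ob: "a \<in> Ob B" "b \<in> Ob B" and f: "f \<in> Hom1 B a b" "g \<in> Hom1 B a b" "h \<in> Hom1 B a b"
    and \<alpha>: "inverse2 B f g \<alpha> \<alpha>'" and \<beta>: "inverse2 B g h \<beta> \<beta>'"
  shows "inverse2 B f h (\<beta> \<odot> \<alpha>) (\<alpha>' \<odot> \<beta>')"
proof -
  have c: "\<alpha> \<in> Hom2 B f g" "\<alpha>' \<in> Hom2 B g f" "\<beta> \<in> Hom2 B g h" "\<beta>' \<in> Hom2 B h g"
    using \<alpha> \<beta> by (auto simp: inverse2_def)
  have ba: "\<beta> \<odot> \<alpha> \<in> Hom2 B f h" and ab: "\<alpha>' \<odot> \<beta>' \<in> Hom2 B h f"
    using vcomp_closed ob f c by blast+
  have "(\<alpha>' \<odot> \<beta>') \<odot> (\<beta> \<odot> \<alpha>) = \<alpha>' \<odot> ((\<beta>' \<odot> \<beta>) \<odot> \<alpha>)"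
    using vcomp_assoc[OF ob f(1,3,2,1) ba c(4,2)] vcomp_assoc[OF ob f(1,2,3,2) c(1,3,4)] by simp
  also have "\<dots> = id2 B f"
    using \<alpha> \<beta> vcomp_id[OF ob f(1,2) c(1)] by (simp add: inverse2_def)
  finally have 1: "(\<alpha>' \<odot> \<beta>') \<odot> (\<beta> \<odot> \<alpha>) = id2 B f" .
  have "(\<beta> \<odot> \<alpha>) \<odot> (\<alpha>' \<odot> \<beta>') = \<beta> \<odot> ((\<alpha> \<odot> \<alpha>') \<odot> \<beta>')"
    using vcomp_assoc[OF ob f(3,1,2,3) ab c(1,3)] vcomp_assoc[OF ob f(3,2,1,2) c(4,2,1)] by simp
  also have "\<dots> = id2 B h"
    using \<alpha> \<beta> vcomp_id[OF ob f(3,2) c(4)] by (simp add: inverse2_def)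
  finally show ?thesis
    using 1 ba ab by (simp add: inverse2_def)
qed

lemma inverse2_hcomp:
  assumes ob: "a \<in> Ob B" "b \<in> Ob B" "c \<in> Ob B"
    and f: "f \<in> Hom1 B a b" "f' \<in> Hom1 B a b" and g: "g \<in> Hom1 B b c" "g' \<in> Hom1 B b c"
    and \<alpha>: "inverse2 B f f' \<alpha> \<alpha>'" and \<beta>: "inverse2 B g g' \<beta> \<beta>'"
  shows "inverse2 B (g \<diamondop> f) (g' \<diamondop> f') (\<beta> \<star> \<alpha>) (\<beta>' \<star> \<alpha>')"
proof -
  have c: "\<alpha> \<in> Hom2 B f f'" "\<alpha>' \<in> Hom2 B f' f" "\<beta> \<in> Hom2 B g g'" "\<beta>' \<in> Hom2 B g' g"
    using \<alpha> \<beta> by (auto simp: inverse2_def)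
  show ?thesis
    using interchange[OF ob f(1,2,1) g(1,2,1) c(1,2) c(3,4)]
      interchange[OF ob f(2,1,2) g(2,1,2) c(2,1) c(4,3)]
      hcomp_closed[OF ob f(1,2) g(1,2) c(1,3)] hcomp_closed[OF ob f(2,1) g(2,1) c(2,4)]
      hcomp_id[OF ob f(1) g(1)] hcomp_id[OF ob f(2) g(2)] \<alpha> \<beta>
    by (simp add: inverse2_def)
qed

lemma Iso2_vcomp:
  "\<lbrakk>a \<in> Ob B; b \<in> Ob B; f \<in> Hom1 B a b; g \<in> Hom1 B a b; h \<in> Hom1 B a b;
    \<alpha> \<in> Iso2 B f g; \<beta> \<in> Iso2 B g h\<rbrakk> \<Longrightarrow> \<beta> \<odot> \<alpha> \<in> Iso2 B f h"
  unfolding Iso2_def using inverse2_vcomp by blast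

lemma Iso2_hcomp:
  "\<lbrakk>a \<in> Ob B; b \<in> Ob B; c \<in> Ob B;
    f \<in> Hom1 B a b; f' \<in> Hom1 B a b; g \<in> Hom1 B b c; g' \<in> Hom1 B b c;
    \<alpha> \<in> Iso2 B f f'; \<beta> \<in> Iso2 B g g'\<rbrakk> \<Longrightarrow> \<beta> \<star> \<alpha> \<in> Iso2 B (g \<diamondop> f) (g' \<diamondop> f')"
  unfolding Iso2_def using inverse2_hcomp by blast

lemma isomorphic_trans:
  "\<lbrakk>a \<in> Ob B; b \<in> Ob B; f \<in> Hom1 B a b; g \<in> Hom1 B a b; h \<in> Hom1 B a b;
    Iso2 B f g \<noteq> {}; Iso2 B g h \<noteq> {}\<rbrakk> \<Longrightarrow> Iso2 B f h \<noteq> {}"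
  using Iso2_vcomp by blast

lemma isomorphic_assoc:
  "\<lbrakk>a \<in> Ob B; b \<in> Ob B; c \<in> Ob B; d \<in> Ob B; f \<in> Hom1 B a b; g \<in> Hom1 B b c; h \<in> Hom1 B c d\<rbrakk>
    \<Longrightarrow> Iso2 B ((h \<diamondop> g) \<diamondop> f) (h \<diamondop> g \<diamondop> f) \<noteq> {}"
  by (rule isomorphicI[OF assoc_iso])

lemma isomorphic_whisker:
  "\<lbrakk>a \<in> Ob B; b \<in> Ob B; c \<in> Ob B; d \<in> Ob B; f \<in> Hom1 B a b; g \<in> Hom1 B b c; g' \<in> Hom1 B b c;
    h \<in> Hom1 B c d; Iso2 B g g' \<noteq> {}\<rbrakk> \<Longrightarrow> Iso2 B (h \<diamondop> g \<diamondop> f) (h \<diamondop> g' \<diamondop> f) \<noteq> {}"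
proof -
  assume ob: "a \<in> Ob B" "b \<in> Ob B" "c \<in> Ob B" "d \<in> Ob B"
    and f: "f \<in> Hom1 B a b" "g \<in> Hom1 B b c" "g' \<in> Hom1 B b c" "h \<in> Hom1 B c d"
    and "Iso2 B g g' \<noteq> {}"
  then obtain \<alpha> where "\<alpha> \<in> Iso2 B g g'" by blast
  from Iso2_hcomp[OF ob(1-3) f(1,1) f(2,3) id2_Iso2[OF ob(1,2) f(1)] this]
  have "\<alpha> \<star> id2 B f \<in> Iso2 B (g \<diamondop> f) (g' \<diamondop> f)" .
  from Iso2_hcomp[OF ob(1,3,4) comp1_closed[OF ob(1-3) f(1,2)] comp1_closed[OF ob(1-3) f(1,3)]
      f(4,4) this id2_Iso2[OF ob(3,4) f(4)]]
  show ?thesis by blast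
qed

lemma isomorphic_contract:
  assumes ob: "a \<in> Ob B" "b \<in> Ob B" "c \<in> Ob B"
    and f: "f \<in> Hom1 B a b" "f' \<in> Hom1 B b a" and g: "g \<in> Hom1 B b c" "g' \<in> Hom1 B c b"
    and "Iso2 B (id1 B a) (f' \<diamondop> f) \<noteq> {}" and i: "Iso2 B (id1 B b) (g' \<diamondop> g) \<noteq> {}"
  shows "Iso2 B (id1 B a) ((f' \<diamondop> g') \<diamondop> g \<diamondop> f) \<noteq> {}"
proof -
  note cl = comp1_closed[OF ob f(1) g(1)] comp1_closed[OF ob(3,2,1) g(2) f(2)]
    comp1_closed[OF ob(2,3,2) g] comp1_closed[OF ob(1,2,1) f] id1_closed[OF ob(1)]
    id1_closed[OF ob(2)]
  note cl2 = comp1_closed[OF ob(1,3,1) cl(1,2)] comp1_closed[OF ob(1,2,2) f(1) cl(3)]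
    comp1_closed[OF ob(1,3,2) cl(1) g(2)] comp1_closed[OF ob(1,2,2) f(1) cl(6)]
  note cl3 = comp1_closed[OF ob(1,2,1) cl2(2) f(2)] comp1_closed[OF ob(1,2,1) cl2(3) f(2)]
    comp1_closed[OF ob(1,2,1) cl2(4) f(2)]
  have 1: "Iso2 B (f' \<diamondop> f) (f' \<diamondop> id1 B b \<diamondop> f) \<noteq> {}"
  proof -
    have "Iso2 B (id1 B b \<diamondop> f) f \<noteq> {}"
      by (rule isomorphicI[OF lunit_iso[OF ob(1,2) f(1)]])
    from Iso2_sym[OF this] obtain \<alpha> where "\<alpha> \<in> Iso2 B f (id1 B b \<diamondop> f)" by blast
    from Iso2_hcomp[OF ob(1,2,1) f(1) cl2(4) f(2,2) this id2_Iso2[OF ob(2,1) f(2)]]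
    show ?thesis by blast
  qed
  have 2: "Iso2 B (f' \<diamondop> id1 B b \<diamondop> f) (f' \<diamondop> (g' \<diamondop> g) \<diamondop> f) \<noteq> {}"
    by (rule isomorphic_whisker[OF ob(1,2,2,1) f(1) cl(6) cl(3) f(2) i])
  have 3: "Iso2 B (f' \<diamondop> (g' \<diamondop> g) \<diamondop> f) (f' \<diamondop> g' \<diamondop> g \<diamondop> f) \<noteq> {}"
  proof -
    obtain \<alpha> where "\<alpha> \<in> Iso2 B ((g' \<diamondop> g) \<diamondop> f) (g' \<diamondop> g \<diamondop> f)"
      using isomorphic_assoc[OF ob(1,2,3,2) f(1) g] by blast
    from Iso2_hcomp[OF ob(1,2,1) cl2(2,3) f(2,2) this id2_Iso2[OF ob(2,1) f(2)]]
    show ?thesis by blast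
  qed
  have 4: "Iso2 B (f' \<diamondop> g' \<diamondop> g \<diamondop> f) ((f' \<diamondop> g') \<diamondop> g \<diamondop> f) \<noteq> {}"
    by (rule Iso2_sym[OF isomorphic_assoc[OF ob(1,3,2,1) cl(1) g(2) f(2)]])
  show ?thesis
    by (rule isomorphic_trans[OF ob(1,1) _ _ _ assms(8) isomorphic_trans[OF ob(1,1) _ _ _ 1
        isomorphic_trans[OF ob(1,1) _ _ _ 2 isomorphic_trans[OF ob(1,1) _ _ _ 3 4]]]])
      (use cl cl2 cl3 comp1_closed[OF ob(1,3,1) cl(1,2)] in \<open>auto\<close>)
qed

lemma Equiv1_comp1:
  assumes ob: "a \<in> Ob B" "b \<in> Ob B" "c \<in> Ob B" and f: "f \<in> Equiv1 B a b" and g: "g \<in> Equiv1 B b c"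
  shows "g \<diamondop> f \<in> Equiv1 B a c"
proof -
  from f obtain f' where f': "f' \<in> Equiv1 B b a" "Iso2 B (id1 B a) (f' \<diamondop> f) \<noteq> {}"
    "Iso2 B (f \<diamondop> f') (id1 B b) \<noteq> {}" by (rule Equiv1_inverse)
  from g obtain g' where g': "g' \<in> Equiv1 B c b" "Iso2 B (id1 B b) (g' \<diamondop> g) \<noteq> {}"
    "Iso2 B (g \<diamondop> g') (id1 B c) \<noteq> {}" by (rule Equiv1_inverse)
  note h = f[THEN Equiv1_Hom1] g[THEN Equiv1_Hom1] f'(1)[THEN Equiv1_Hom1] g'(1)[THEN Equiv1_Hom1]
  have "Iso2 B (id1 B a) ((f' \<diamondop> g') \<diamondop> g \<diamondop> f) \<noteq> {}"
    by (rule isomorphic_contract[OF ob h(1,3,2,4) f'(2) g'(2)])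
  \<comment> \<open>The counit half is the same contraction with the quasi-inverses in the leading
    role, after inverting the two counits.\<close>
  moreover have "Iso2 B (id1 B c) ((g \<diamondop> f) \<diamondop> f' \<diamondop> g') \<noteq> {}"
    by (rule isomorphic_contract[OF ob(3,2,1) h(4,2,3,1) Iso2_sym[OF g'(3)] Iso2_sym[OF f'(3)]])
  ultimately show ?thesis
    by (rule Equiv1I[OF comp1_closed[OF ob h(1,2)] comp1_closed[OF ob(3,2,1) h(4,3)] _ Iso2_sym])
qed

lemma id1_Equiv1: assumes "a \<in> Ob B" shows "id1 B a \<in> Equiv1 B a a"
proof -
  have "Iso2 B (id1 B a \<diamondop> id1 B a) (id1 B a) \<noteq> {}"
    by (rule isomorphicI[OF lunit_iso[OF assms assms id1_closed[OF assms]]])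
  then show ?thesis
    using Equiv1I[OF id1_closed[OF assms] id1_closed[OF assms]] Iso2_sym[of B] by simp
qed

end

section \<open>Cores and full sub-bicategories\<close>

lemma core_simps [simp]:
  "Ob (core B) = Ob B" "Hom1 (core B) = Equiv1 B" "Hom2 (core B) = Iso2 B"
  "id1 (core B) = id1 B" "id2 (core B) = id2 B" "comp1 (core B) = comp1 B"
  "vcomp (core B) = vcomp B" "hcomp (core B) = hcomp B"
  "assoc (core B) = assoc B" "assoc_inv (core B) = assoc_inv B"
  "lunit (core B) = lunit B" "lunit_inv (core B) = lunit_inv B"
  "runit (core B) = runit B" "runit_inv (core B) = runit_inv B"
  by (simp_all add: core_def)

lemma inverse2_core [simp]: "inverse2 (core B) = inverse2 B"
  by (auto simp: fun_eq_iff inverse2_def Iso2_def)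

lemma Iso2_core [simp]: "Iso2 (core B) = Iso2 B"
  by (simp add: fun_eq_iff Iso2_def)

text \<open>The quasi-inverse of an equivalence is an equivalence and the unit and counit are
  invertible, so all witnesses survive in the core: forming it is idempotent on 1-cells.\<close>

lemma Equiv1_core [simp]: "Equiv1 (core B) = Equiv1 B"
proof (intro ext equalityI subsetI)
  fix a b f assume f: "f \<in> Equiv1 B a b"
  from f show "f \<in> Equiv1 (core B) a b"
    by (rule Equiv1_inverse) (use f in \<open>auto simp: Equiv1_def[of "core B"]\<close>)
qed (simp add: Equiv1_def[of "core B"])

text \<open>Equations are inherited. The closure conditions hold since equivalences compose,
  invertible 2-cells compose in both directions, and coherence cells come with their
  inverses.\<close>

lemma bicategory_core:
  assumes "bicategory B" shows "bicategory (core B)"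
proof -
  interpret bicategory B by fact
  note E = Equiv1_Hom1 and H = Iso2_Hom2
  have [intro]: "inverse2 B f g \<alpha> \<beta> \<Longrightarrow> \<alpha> \<in> Iso2 B f g" for f g \<alpha> \<beta>
    by (auto simp: Iso2_def)
  show ?thesis
    apply (unfold_locales; simp)
    subgoal by (meson E Hom1_disjoint)
    subgoal by (meson E H Hom2_disjoint)
    subgoal by (rule id1_Equiv1)
    subgoal by (rule Equiv1_comp1)
    subgoal by (meson E id2_Iso2)
    subgoal by (meson E Iso2_vcomp)
    subgoal by (meson E H vcomp_assoc)
    subgoal by (meson E H vcomp_id)
    subgoal by (meson E Iso2_hcomp)
    subgoal by (meson E hcomp_id)
    subgoal by (rule interchange; (rule E H)?)
    subgoal by (meson E assoc_iso)
    subgoal by (rule assoc_natural; (rule E H)?)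
    subgoal by (meson E lunit_iso)
    subgoal by (meson E H lunit_natural)
    subgoal by (meson E runit_iso)
    subgoal by (meson E H runit_natural)
    subgoal by (meson E pentagon)
    subgoal by (meson E triangle)
    done
qed

lemma full_sub_simps [simp]:
  "Ob (full_sub B S) = Ob B \<inter> S" "Hom1 (full_sub B S) = Hom1 B" "Hom2 (full_sub B S) = Hom2 B"
  "id1 (full_sub B S) = id1 B" "id2 (full_sub B S) = id2 B" "comp1 (full_sub B S) = comp1 B"
  "vcomp (full_sub B S) = vcomp B" "hcomp (full_sub B S) = hcomp B"
  "assoc (full_sub B S) = assoc B" "assoc_inv (full_sub B S) = assoc_inv B"
  "lunit (full_sub B S) = lunit B" "lunit_inv (full_sub B S) = lunit_inv B"
  "runit (full_sub B S) = runit B" "runit_inv (full_sub B S) = runit_inv B"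
  by (simp_all add: full_sub_def)

lemma Iso2_full_sub [simp]: "Iso2 (full_sub B S) = Iso2 B" "Equiv1 (full_sub B S) = Equiv1 B"
  "inverse2 (full_sub B S) = inverse2 B"
  by (simp_all add: fun_eq_iff Iso2_def Equiv1_def inverse2_def)

lemma bicategory_full_sub:
  assumes "bicategory B" shows "bicategory (full_sub B S)"
proof -
  interpret bicategory B by fact
  show ?thesis
    apply (unfold_locales; simp; (elim conjE)?)
    subgoal by (meson Hom1_disjoint)
    subgoal by (meson Hom2_disjoint)
    subgoal by (rule id1_closed)
    subgoal by (meson comp1_closed)
    subgoal by (meson id2_closed)
    subgoal by (meson vcomp_closed)
    subgoal by (meson vcomp_assoc)
    subgoal by (meson vcomp_id)
    subgoal by (meson hcomp_closed)
    subgoal by (meson hcomp_id)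
    subgoal by (rule interchange)
    subgoal by (meson assoc_iso)
    subgoal by (rule assoc_natural)
    subgoal by (meson lunit_iso)
    subgoal by (meson lunit_natural)
    subgoal by (meson runit_iso)
    subgoal by (meson runit_natural)
    subgoal by (meson pentagon)
    subgoal by (meson triangle)
    done
qed

text \<open>
  Both the fixed points and the Calabi-Yau categories are of this form over \<open>core Vect2_fd\<close>: 0- and
  1-cells carry additional data or properties, 2-cells are only tagged with their boundaries.
\<close>

locale lifted_bicategory = B: bicategory B
  for B :: "('a, 'f, 't) bicat" +
  fixes C :: "('b, 'g, 'g \<times> 'g \<times> 't) bicat" and u0 :: "'b \<Rightarrow> 'a" and u1 :: "'g \<Rightarrow> 'f"
  assumes u0_closed: "X \<in> Ob C \<Longrightarrow> u0 X \<in> Ob B"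
    and u1_closed: "\<lbrakk>X \<in> Ob C; Y \<in> Ob C; P \<in> Hom1 C X Y\<rbrakk> \<Longrightarrow> u1 P \<in> Hom1 B (u0 X) (u0 Y)"
    and C_Hom1_disjoint:
      "\<lbrakk>X \<in> Ob C; Y \<in> Ob C; X' \<in> Ob C; Y' \<in> Ob C; P \<in> Hom1 C X Y; P \<in> Hom1 C X' Y'\<rbrakk>
        \<Longrightarrow> X = X' \<and> Y = Y'"
    and C_id1: "X \<in> Ob C \<Longrightarrow> id1 C X \<in> Hom1 C X X" "X \<in> Ob C \<Longrightarrow> u1 (id1 C X) = id1 B (u0 X)"
    and C_comp1:
      "\<lbrakk>X \<in> Ob C; Y \<in> Ob C; Z \<in> Ob C; P \<in> Hom1 C X Y; Q \<in> Hom1 C Y Z\<rbrakk>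
        \<Longrightarrow> Q \<diamondop>\<^bsub>C\<^esub> P \<in> Hom1 C X Z"
      "\<lbrakk>X \<in> Ob C; Y \<in> Ob C; Z \<in> Ob C; P \<in> Hom1 C X Y; Q \<in> Hom1 C Y Z\<rbrakk>
        \<Longrightarrow> u1 (Q \<diamondop>\<^bsub>C\<^esub> P) = u1 Q \<diamondop>\<^bsub>B\<^esub> u1 P"
    and C_Hom2: "\<lbrakk>X \<in> Ob C; Y \<in> Ob C; P \<in> Hom1 C X Y; Q \<in> Hom1 C X Y\<rbrakk>
        \<Longrightarrow> Hom2 C P Q = {(P, Q, \<alpha>) | \<alpha>. \<alpha> \<in> Hom2 B (u1 P) (u1 Q)}"
    and C_id2: "\<lbrakk>X \<in> Ob C; Y \<in> Ob C; P \<in> Hom1 C X Y\<rbrakk> \<Longrightarrow> id2 C P = (P, P, id2 B (u1 P))"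
    and C_vcomp: "(Q, R, \<beta>) \<odot>\<^bsub>C\<^esub> (P, Q', \<alpha>) = (P, R, \<beta> \<odot>\<^bsub>B\<^esub> \<alpha>)"
    and C_hcomp: "(Q, Q', \<beta>) \<star>\<^bsub>C\<^esub> (P, P', \<alpha>) = (Q \<diamondop>\<^bsub>C\<^esub> P, Q' \<diamondop>\<^bsub>C\<^esub> P', \<beta> \<star>\<^bsub>B\<^esub> \<alpha>)"
    and C_assoc:
      "\<lbrakk>W \<in> Ob C; X \<in> Ob C; Y \<in> Ob C; Z \<in> Ob C; P \<in> Hom1 C W X; Q \<in> Hom1 C X Y; R \<in> Hom1 C Y Z\<rbrakk>
        \<Longrightarrow> assoc C R Q P =
          ((R \<diamondop>\<^bsub>C\<^esub> Q) \<diamondop>\<^bsub>C\<^esub> P, R \<diamondop>\<^bsub>C\<^esub> Q \<diamondop>\<^bsub>C\<^esub> P, assoc B (u1 R) (u1 Q) (u1 P))"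
      "\<lbrakk>W \<in> Ob C; X \<in> Ob C; Y \<in> Ob C; Z \<in> Ob C; P \<in> Hom1 C W X; Q \<in> Hom1 C X Y; R \<in> Hom1 C Y Z\<rbrakk>
        \<Longrightarrow> assoc_inv C R Q P =
          (R \<diamondop>\<^bsub>C\<^esub> Q \<diamondop>\<^bsub>C\<^esub> P, (R \<diamondop>\<^bsub>C\<^esub> Q) \<diamondop>\<^bsub>C\<^esub> P, assoc_inv B (u1 R) (u1 Q) (u1 P))"
    and C_lunit:
      "\<lbrakk>X \<in> Ob C; Y \<in> Ob C; P \<in> Hom1 C X Y\<rbrakk> \<Longrightarrow> lunit C P = (id1 C Y \<diamondop>\<^bsub>C\<^esub> P, P, lunit B (u1 P))"
      "\<lbrakk>X \<in> Ob C; Y \<in> Ob C; P \<in> Hom1 C X Y\<rbrakk>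
        \<Longrightarrow> lunit_inv C P = (P, id1 C Y \<diamondop>\<^bsub>C\<^esub> P, lunit_inv B (u1 P))"
    and C_runit:
      "\<lbrakk>X \<in> Ob C; Y \<in> Ob C; P \<in> Hom1 C X Y\<rbrakk> \<Longrightarrow> runit C P = (P \<diamondop>\<^bsub>C\<^esub> id1 C X, P, runit B (u1 P))"
      "\<lbrakk>X \<in> Ob C; Y \<in> Ob C; P \<in> Hom1 C X Y\<rbrakk>
        \<Longrightarrow> runit_inv C P = (P, P \<diamondop>\<^bsub>C\<^esub> id1 C X, runit_inv B (u1 P))"
begin

lemma inverse2_lifted:
  assumes "X \<in> Ob C" "Y \<in> Ob C" "P \<in> Hom1 C X Y" "Q \<in> Hom1 C X Y"
  shows "inverse2 C P Q (P, Q, \<alpha>) (Q, P, \<beta>) \<longleftrightarrow> inverse2 B (u1 P) (u1 Q) \<alpha> \<beta>"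
  using assms by (auto simp: inverse2_def C_Hom2 C_vcomp C_id2)

text \<open>By \<open>C_Hom2\<close> the 2-cells are those of the base with tags, so each axiom
  about 2-cells becomes the axiom of the base once the tags are unpacked.\<close>

sublocale bicategory C
proof
  fix X Y P Q X' Y' P' Q' \<alpha>
  assume "X \<in> Ob C" "Y \<in> Ob C" "P \<in> Hom1 C X Y" "Q \<in> Hom1 C X Y"
    "X' \<in> Ob C" "Y' \<in> Ob C" "P' \<in> Hom1 C X' Y'" "Q' \<in> Hom1 C X' Y'"
    "\<alpha> \<in> Hom2 C P Q" "\<alpha> \<in> Hom2 C P' Q'"
  then show "P = P' \<and> Q = Q'" by (auto simp: C_Hom2)
next
  fix X Y Z W P Q R
  assume a: "X \<in> Ob C" "Y \<in> Ob C" "Z \<in> Ob C" "W \<in> Ob C"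
    "P \<in> Hom1 C X Y" "Q \<in> Hom1 C Y Z" "R \<in> Hom1 C Z W"
  show "inverse2 C ((R \<diamondop>\<^bsub>C\<^esub> Q) \<diamondop>\<^bsub>C\<^esub> P) (R \<diamondop>\<^bsub>C\<^esub> Q \<diamondop>\<^bsub>C\<^esub> P) (assoc C R Q P) (assoc_inv C R Q P)"
    unfolding C_assoc[OF a]
    by (subst inverse2_lifted[OF a(1,4)])
      (use a in \<open>simp_all add: C_comp1[of X Y Z] C_comp1[of Y Z W] C_comp1[of X Y W]
        C_comp1[of X Z W] B.assoc_iso[OF a(1-4)[THEN u0_closed]] u1_closed\<close>)
next
  fix X Y P assume a: "X \<in> Ob C" "Y \<in> Ob C" "P \<in> Hom1 C X Y"
  show "inverse2 C (id1 C Y \<diamondop>\<^bsub>C\<^esub> P) P (lunit C P) (lunit_inv C P)"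
    unfolding C_lunit[OF a]
    by (subst inverse2_lifted[OF a(1,2)])
      (use a in \<open>simp_all add: C_comp1[of X Y Y] C_id1 B.lunit_iso[OF a(1,2)[THEN u0_closed]] u1_closed\<close>)
  show "inverse2 C (P \<diamondop>\<^bsub>C\<^esub> id1 C X) P (runit C P) (runit_inv C P)"
    unfolding C_runit[OF a]
    by (subst inverse2_lifted[OF a(1,2)])
      (use a in \<open>simp_all add: C_comp1[of X X Y] C_id1 B.runit_iso[OF a(1,2)[THEN u0_closed]] u1_closed\<close>)
next
  fix X Y P assume a: "X \<in> Ob C" "Y \<in> Ob C" "P \<in> Hom1 C X Y"
  then show "id2 C P \<in> Hom2 C P P"
    by (simp add: C_id2 C_Hom2 B.id2_closed[OF a(1,2)[THEN u0_closed]] u1_closed)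
next
  fix X Y P Q R \<alpha> \<beta>
  assume a: "X \<in> Ob C" "Y \<in> Ob C" "P \<in> Hom1 C X Y" "Q \<in> Hom1 C X Y" "R \<in> Hom1 C X Y"
    "\<alpha> \<in> Hom2 C P Q" "\<beta> \<in> Hom2 C Q R"
  then show "\<beta> \<odot>\<^bsub>C\<^esub> \<alpha> \<in> Hom2 C P R"
    using B.vcomp_closed[OF a(1,2)[THEN u0_closed] a(3-5)[THEN u1_closed[OF a(1,2)]]]
    by (auto simp: C_Hom2 C_vcomp)
next
  fix X Y P Q R S \<alpha> \<beta> \<gamma>
  assume a: "X \<in> Ob C" "Y \<in> Ob C" "P \<in> Hom1 C X Y" "Q \<in> Hom1 C X Y" "R \<in> Hom1 C X Y"
    "S \<in> Hom1 C X Y" "\<alpha> \<in> Hom2 C P Q" "\<beta> \<in> Hom2 C Q R" "\<gamma> \<in> Hom2 C R S"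
  then show "(\<gamma> \<odot>\<^bsub>C\<^esub> \<beta>) \<odot>\<^bsub>C\<^esub> \<alpha> = \<gamma> \<odot>\<^bsub>C\<^esub> \<beta> \<odot>\<^bsub>C\<^esub> \<alpha>"
    using B.vcomp_assoc[OF a(1,2)[THEN u0_closed] a(3-6)[THEN u1_closed[OF a(1,2)]]]
    by (auto simp: C_Hom2 C_vcomp)
next
  fix X Y P Q \<alpha>
  assume a: "X \<in> Ob C" "Y \<in> Ob C" "P \<in> Hom1 C X Y" "Q \<in> Hom1 C X Y" "\<alpha> \<in> Hom2 C P Q"
  note u = B.vcomp_id[OF a(1,2)[THEN u0_closed] a(3-4)[THEN u1_closed[OF a(1,2)]]]
    B.lunit_natural[OF a(1,2)[THEN u0_closed] a(3-4)[THEN u1_closed[OF a(1,2)]]]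
    B.runit_natural[OF a(1,2)[THEN u0_closed] a(3-4)[THEN u1_closed[OF a(1,2)]]]
  show "\<alpha> \<odot>\<^bsub>C\<^esub> id2 C P = \<alpha> \<and> id2 C Q \<odot>\<^bsub>C\<^esub> \<alpha> = \<alpha>"
    "lunit C Q \<odot>\<^bsub>C\<^esub> (id2 C (id1 C Y) \<star>\<^bsub>C\<^esub> \<alpha>) = \<alpha> \<odot>\<^bsub>C\<^esub> lunit C P"
    "runit C Q \<odot>\<^bsub>C\<^esub> (\<alpha> \<star>\<^bsub>C\<^esub> id2 C (id1 C X)) = \<alpha> \<odot>\<^bsub>C\<^esub> runit C P"
    using a u by (auto simp: C_Hom2 C_vcomp C_hcomp C_id2[OF a(1,2)] C_id2[OF a(1,1)]
        C_id2[OF a(2,2)] C_id1 C_lunit[OF a(1,2)] C_runit[OF a(1,2)])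
next
  fix X Y Z P P' Q Q' \<alpha> \<beta>
  assume a: "X \<in> Ob C" "Y \<in> Ob C" "Z \<in> Ob C" "P \<in> Hom1 C X Y" "P' \<in> Hom1 C X Y"
    "Q \<in> Hom1 C Y Z" "Q' \<in> Hom1 C Y Z" "\<alpha> \<in> Hom2 C P P'" "\<beta> \<in> Hom2 C Q Q'"
  show "\<beta> \<star>\<^bsub>C\<^esub> \<alpha> \<in> Hom2 C (Q \<diamondop>\<^bsub>C\<^esub> P) (Q' \<diamondop>\<^bsub>C\<^esub> P')"
    using a B.hcomp_closed[OF a(1-3)[THEN u0_closed] a(4,5)[THEN u1_closed[OF a(1,2)]]
        a(6,7)[THEN u1_closed[OF a(2,3)]]]
    by (auto simp: C_Hom2 C_Hom2[OF a(1,3)] C_hcomp C_comp1[OF a(1-3)])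
next
  fix X Y Z P Q
  assume a: "X \<in> Ob C" "Y \<in> Ob C" "Z \<in> Ob C" "P \<in> Hom1 C X Y" "Q \<in> Hom1 C Y Z"
  note u = a(1-3)[THEN u0_closed] a(4)[THEN u1_closed[OF a(1,2)]] a(5)[THEN u1_closed[OF a(2,3)]]
  show "id2 C Q \<star>\<^bsub>C\<^esub> id2 C P = id2 C (Q \<diamondop>\<^bsub>C\<^esub> P)"
    using a B.hcomp_id[OF u]
    by (simp add: C_id2[OF a(1,2)] C_id2[OF a(2,3)] C_id2[OF a(1,3)] C_hcomp C_comp1[OF a(1-3)])
  show "(id2 C Q \<star>\<^bsub>C\<^esub> lunit C P) \<odot>\<^bsub>C\<^esub> assoc C Q (id1 C Y) P = runit C Q \<star>\<^bsub>C\<^esub> id2 C P"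
    using a B.triangle[OF u]
    by (simp add: C_id2[OF a(1,2)] C_id2[OF a(2,3)] C_id1 C_lunit[OF a(1,2)] C_runit[OF a(2,3)]
        C_assoc[OF a(1,2,2,3)] C_hcomp C_vcomp)
next
  fix X Y Z P P' P'' Q Q' Q'' \<alpha> \<alpha>' \<beta> \<beta>'
  assume a: "X \<in> Ob C" "Y \<in> Ob C" "Z \<in> Ob C"
    "P \<in> Hom1 C X Y" "P' \<in> Hom1 C X Y" "P'' \<in> Hom1 C X Y"
    "Q \<in> Hom1 C Y Z" "Q' \<in> Hom1 C Y Z" "Q'' \<in> Hom1 C Y Z"
    "\<alpha> \<in> Hom2 C P P'" "\<alpha>' \<in> Hom2 C P' P''" "\<beta> \<in> Hom2 C Q Q'" "\<beta>' \<in> Hom2 C Q' Q''"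
  then show "(\<beta>' \<star>\<^bsub>C\<^esub> \<alpha>') \<odot>\<^bsub>C\<^esub> (\<beta> \<star>\<^bsub>C\<^esub> \<alpha>) = (\<beta>' \<odot>\<^bsub>C\<^esub> \<beta>) \<star>\<^bsub>C\<^esub> (\<alpha>' \<odot>\<^bsub>C\<^esub> \<alpha>)"
    using B.interchange[OF a(1-3)[THEN u0_closed] a(4-6)[THEN u1_closed[OF a(1,2)]]
        a(7-9)[THEN u1_closed[OF a(2,3)]]]
    by (auto simp: C_Hom2 C_hcomp C_vcomp)
next
  fix X Y Z W P P' Q Q' R R' \<alpha> \<beta> \<gamma>
  assume a: "X \<in> Ob C" "Y \<in> Ob C" "Z \<in> Ob C" "W \<in> Ob C"
    "P \<in> Hom1 C X Y" "P' \<in> Hom1 C X Y" "Q \<in> Hom1 C Y Z" "Q' \<in> Hom1 C Y Z"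
    "R \<in> Hom1 C Z W" "R' \<in> Hom1 C Z W"
    "\<alpha> \<in> Hom2 C P P'" "\<beta> \<in> Hom2 C Q Q'" "\<gamma> \<in> Hom2 C R R'"
  then show "assoc C R' Q' P' \<odot>\<^bsub>C\<^esub> ((\<gamma> \<star>\<^bsub>C\<^esub> \<beta>) \<star>\<^bsub>C\<^esub> \<alpha>) = (\<gamma> \<star>\<^bsub>C\<^esub> \<beta> \<star>\<^bsub>C\<^esub> \<alpha>) \<odot>\<^bsub>C\<^esub> assoc C R Q P"
    using B.assoc_natural[OF a(1-4)[THEN u0_closed] a(5,6)[THEN u1_closed[OF a(1,2)]]
        a(7,8)[THEN u1_closed[OF a(2,3)]] a(9,10)[THEN u1_closed[OF a(3,4)]]]
    by (auto simp: C_Hom2 C_hcomp C_vcomp C_assoc[OF a(1-4)])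
next
  fix V X Y Z W P Q R S
  assume a: "V \<in> Ob C" "X \<in> Ob C" "Y \<in> Ob C" "Z \<in> Ob C" "W \<in> Ob C"
    "P \<in> Hom1 C V X" "Q \<in> Hom1 C X Y" "R \<in> Hom1 C Y Z" "S \<in> Hom1 C Z W"
  then show "assoc C S R (Q \<diamondop>\<^bsub>C\<^esub> P) \<odot>\<^bsub>C\<^esub> assoc C (S \<diamondop>\<^bsub>C\<^esub> R) Q P =
    (id2 C S \<star>\<^bsub>C\<^esub> assoc C R Q P) \<odot>\<^bsub>C\<^esub> assoc C S (R \<diamondop>\<^bsub>C\<^esub> Q) P \<odot>\<^bsub>C\<^esub> (assoc C S R Q \<star>\<^bsub>C\<^esub> id2 C P)"
    using B.pentagon[OF a(1-5)[THEN u0_closed] a(6)[THEN u1_closed[OF a(1,2)]]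
        a(7)[THEN u1_closed[OF a(2,3)]] a(8)[THEN u1_closed[OF a(3,4)]] a(9)[THEN u1_closed[OF a(4,5)]]]
    by (simp add: C_hcomp C_vcomp C_id2[OF a(1,2)] C_id2[OF a(4,5)]
        C_assoc[OF a(1-4)] C_assoc[OF a(2-5)] C_assoc[OF a(1,3,4,5)] C_assoc[OF a(1,2,3,5)]
        C_assoc[OF a(1,2,4,5)] C_comp1[OF a(1-3)] C_comp1[OF a(2-4)] C_comp1[OF a(3-5)])
qed (meson C_Hom1_disjoint C_id1 C_comp1)+

text \<open>Local fullness also lifts the inverse. This supplies the compositors, the unitors and
  the isomorphisms between 1-cells that share their underlying 1-cell.\<close>

lemma lifted_Iso2:
  "\<lbrakk>X \<in> Ob C; Y \<in> Ob C; P \<in> Hom1 C X Y; Q \<in> Hom1 C X Y; \<alpha> \<in> Iso2 B (u1 P) (u1 Q)\<rbrakk>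
    \<Longrightarrow> (P, Q, \<alpha>) \<in> Iso2 C P Q"
  using inverse2_lifted by (fastforce simp: Iso2_def)

end

text \<open>
  The map need not preserve composition on the nose: the compositors are identity 2-cells of \<open>B\<close>.
\<close>

lemma biequivalent_lifted:
  fixes B :: "('a, 'f, 't) bicat"
  assumes C: "lifted_bicategory B C u0 u1" and D: "lifted_bicategory B D v0 v1"
    and \<phi>: "\<And>X. X \<in> Ob C \<Longrightarrow> \<phi> X \<in> Ob D" "\<And>X. X \<in> Ob C \<Longrightarrow> v0 (\<phi> X) = u0 X"
      "\<And>y. y \<in> Ob D \<Longrightarrow> \<exists>X \<in> Ob C. \<phi> X = y"
    and \<psi>: "\<And>X Y P. \<lbrakk>X \<in> Ob C; Y \<in> Ob C; P \<in> Hom1 C X Y\<rbrakk> \<Longrightarrow> \<psi> P \<in> Hom1 D (\<phi> X) (\<phi> Y)"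
      "\<And>X Y P. \<lbrakk>X \<in> Ob C; Y \<in> Ob C; P \<in> Hom1 C X Y\<rbrakk> \<Longrightarrow> v1 (\<psi> P) = u1 P"
      "\<And>X Y k. \<lbrakk>X \<in> Ob C; Y \<in> Ob C; k \<in> Hom1 D (\<phi> X) (\<phi> Y)\<rbrakk> \<Longrightarrow> \<exists>P \<in> Hom1 C X Y. u1 P = v1 k"
  shows "biequivalent C D"
proof -
  interpret B: bicategory B by (rule lifted_bicategory.axioms(1)[OF C])
  interpret C: lifted_bicategory B C u0 u1 by fact
  interpret D: lifted_bicategory B D v0 v1 by fact
  define F where "F = \<lparr>F0 = \<phi>, F1 = \<psi>, F2 = (\<lambda>(P, Q, \<alpha>). (\<psi> P, \<psi> Q, \<alpha>)),
    Fcomp = (\<lambda>Q P. (\<psi> Q \<diamondop>\<^bsub>D\<^esub> \<psi> P, \<psi> (Q \<diamondop>\<^bsub>C\<^esub> P), id2 B (u1 Q \<diamondop>\<^bsub>B\<^esub> u1 P))),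
    Funit = (\<lambda>X. (id1 D (\<phi> X), \<psi> (id1 C X), id2 B (id1 B (u0 X))))\<rparr>"
  have F: "F0 F = \<phi>" "F1 F = \<psi>" "F2 F (P, Q, \<alpha>) = (\<psi> P, \<psi> Q, \<alpha>)"
    "Fcomp F Q P = (\<psi> Q \<diamondop>\<^bsub>D\<^esub> \<psi> P, \<psi> (Q \<diamondop>\<^bsub>C\<^esub> P), id2 B (u1 Q \<diamondop>\<^bsub>B\<^esub> u1 P))"
    "Funit F X = (id1 D (\<phi> X), \<psi> (id1 C X), id2 B (id1 B (u0 X)))" for P Q \<alpha> X
    by (simp_all add: F_def)
  have "biequivalence C D F"
  proof (unfold_locales, unfold F)
    show "X \<in> Ob C \<Longrightarrow> \<phi> X \<in> Ob D" for X by (rule \<phi>)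
    show "\<lbrakk>X \<in> Ob C; Y \<in> Ob C; P \<in> Hom1 C X Y\<rbrakk> \<Longrightarrow> \<psi> P \<in> Hom1 D (\<phi> X) (\<phi> Y)" for X Y P by (rule \<psi>)
  next
    fix X Y P Q assume a: "X \<in> Ob C" "Y \<in> Ob C" "P \<in> Hom1 C X Y" "Q \<in> Hom1 C X Y"
    show "F2 F \<alpha> \<in> Hom2 D (\<psi> P) (\<psi> Q)" if "\<alpha> \<in> Hom2 C P Q" for \<alpha>
      using that a by (auto simp: F \<psi>(1,2)[OF a(1,2)] C.C_Hom2 D.C_Hom2[OF a(1,2)[THEN \<phi>(1)]])
    show "bij_betw (F2 F) (Hom2 C P Q) (Hom2 D (\<psi> P) (\<psi> Q))"
      using a by (auto simp: bij_betw_def inj_on_def F image_def C.C_Hom2 \<psi>(1,2)[OF a(1,2)]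
          D.C_Hom2[OF a(1,2)[THEN \<phi>(1)]])
    show "F2 F (\<beta> \<odot>\<^bsub>C\<^esub> \<alpha>) = F2 F \<beta> \<odot>\<^bsub>D\<^esub> F2 F \<alpha>"
      if "R \<in> Hom1 C X Y" "\<alpha> \<in> Hom2 C P Q" "\<beta> \<in> Hom2 C Q R" for \<alpha> \<beta> R
      using that a by (auto simp: F C.C_Hom2 C.C_vcomp D.C_vcomp)
    show "F2 F (id2 C P) = id2 D (\<psi> P)"
      using a by (simp add: C.C_id2 F D.C_id2[OF a(1,2)[THEN \<phi>(1)]] \<psi>(1,2)[OF a(1,2)])
    note u = a(1,2)[THEN C.u0_closed] a(3)[THEN C.u1_closed[OF a(1,2)]]
    note D = a(1,2)[THEN \<phi>(1)] \<psi>(1)[OF a(1-3)]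
    show "F2 F (lunit C P) \<odot>\<^bsub>D\<^esub>
      (\<psi> (id1 C Y) \<diamondop>\<^bsub>D\<^esub> \<psi> P, \<psi> (id1 C Y \<diamondop>\<^bsub>C\<^esub> P), id2 B (u1 (id1 C Y) \<diamondop>\<^bsub>B\<^esub> u1 P)) \<odot>\<^bsub>D\<^esub>
      ((id1 D (\<phi> Y), \<psi> (id1 C Y), id2 B (id1 B (u0 Y))) \<star>\<^bsub>D\<^esub> id2 D (\<psi> P)) = lunit D (\<psi> P)"
      using B.id2_vcomp_id2[OF u(1,2) B.comp1_closed[OF u(1,2,2,3) B.id1_closed[OF u(2)]]]
        B.vcomp_id[OF u(1,2) B.comp1_closed[OF u(1,2,2,3) B.id1_closed[OF u(2)]] u(3)]
        B.lunit_iso[OF u]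
      by (simp add: C.C_lunit[OF a(1-3)] D.C_lunit[OF D] F D.C_vcomp D.C_hcomp D.C_id2[OF D] \<psi>(1,2)[OF a(1-3)]
          C.C_id1 a B.hcomp_id[OF u(1,2,2,3) B.id1_closed[OF u(2)]] inverse2_def)
    show "F2 F (runit C P) \<odot>\<^bsub>D\<^esub>
      (\<psi> P \<diamondop>\<^bsub>D\<^esub> \<psi> (id1 C X), \<psi> (P \<diamondop>\<^bsub>C\<^esub> id1 C X), id2 B (u1 P \<diamondop>\<^bsub>B\<^esub> u1 (id1 C X))) \<odot>\<^bsub>D\<^esub>
      (id2 D (\<psi> P) \<star>\<^bsub>D\<^esub> (id1 D (\<phi> X), \<psi> (id1 C X), id2 B (id1 B (u0 X)))) = runit D (\<psi> P)"
      using B.id2_vcomp_id2[OF u(1,2) B.comp1_closed[OF u(1,1,2) B.id1_closed[OF u(1)] u(3)]]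
        B.vcomp_id[OF u(1,2) B.comp1_closed[OF u(1,1,2) B.id1_closed[OF u(1)] u(3)] u(3)]
        B.runit_iso[OF u]
      by (simp add: C.C_runit[OF a(1-3)] D.C_runit[OF D] F D.C_vcomp D.C_hcomp D.C_id2[OF D] \<psi>(1,2)[OF a(1-3)]
          C.C_id1 a B.hcomp_id[OF u(1,1,2) B.id1_closed[OF u(1)] u(3)] inverse2_def)
  next
    fix X Y Z P Q assume a: "X \<in> Ob C" "Y \<in> Ob C" "Z \<in> Ob C" "P \<in> Hom1 C X Y" "Q \<in> Hom1 C Y Z"
    note u = a(1-3)[THEN C.u0_closed] a(4)[THEN C.u1_closed[OF a(1,2)]] a(5)[THEN C.u1_closed[OF a(2,3)]]
    note D = a(1-3)[THEN \<phi>(1)] \<psi>(1)[OF a(1,2,4)] \<psi>(1)[OF a(2,3,5)]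
    show "(\<psi> Q \<diamondop>\<^bsub>D\<^esub> \<psi> P, \<psi> (Q \<diamondop>\<^bsub>C\<^esub> P), id2 B (u1 Q \<diamondop>\<^bsub>B\<^esub> u1 P))
        \<in> Iso2 D (\<psi> Q \<diamondop>\<^bsub>D\<^esub> \<psi> P) (\<psi> (Q \<diamondop>\<^bsub>C\<^esub> P))"
      by (rule D.lifted_Iso2[OF D(1,3) D.C_comp1(1)[OF D] \<psi>(1)[OF a(1,3) C.C_comp1(1)[OF a]]])
        (simp add: D.C_comp1(2)[OF D] \<psi>(2)[OF a(1,3) C.C_comp1(1)[OF a]] C.C_comp1(2)[OF a]
          \<psi>(2)[OF a(1,2,4)] \<psi>(2)[OF a(2,3,5)] B.id2_Iso2[OF u(1,3) B.comp1_closed[OF u]])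
  next
    fix X Y Z P P' Q Q' \<alpha> \<beta>
    assume a: "X \<in> Ob C" "Y \<in> Ob C" "Z \<in> Ob C" "P \<in> Hom1 C X Y" "P' \<in> Hom1 C X Y"
      "Q \<in> Hom1 C Y Z" "Q' \<in> Hom1 C Y Z" "\<alpha> \<in> Hom2 C P P'" "\<beta> \<in> Hom2 C Q Q'"
    note u = a(1-3)[THEN C.u0_closed] a(4,5)[THEN C.u1_closed[OF a(1,2)]] a(6,7)[THEN C.u1_closed[OF a(2,3)]]
    show "(\<psi> Q' \<diamondop>\<^bsub>D\<^esub> \<psi> P', \<psi> (Q' \<diamondop>\<^bsub>C\<^esub> P'), id2 B (u1 Q' \<diamondop>\<^bsub>B\<^esub> u1 P')) \<odot>\<^bsub>D\<^esub> (F2 F \<beta> \<star>\<^bsub>D\<^esub> F2 F \<alpha>) =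
       F2 F (\<beta> \<star>\<^bsub>C\<^esub> \<alpha>) \<odot>\<^bsub>D\<^esub> (\<psi> Q \<diamondop>\<^bsub>D\<^esub> \<psi> P, \<psi> (Q \<diamondop>\<^bsub>C\<^esub> P), id2 B (u1 Q \<diamondop>\<^bsub>B\<^esub> u1 P))"
      using a B.vcomp_id[OF u(1,3) B.comp1_closed[OF u(1-4,6)] B.comp1_closed[OF u(1-3,5,7)]]
        B.hcomp_closed[OF u]
      by (auto simp: C.C_Hom2 F D.C_hcomp D.C_vcomp C.C_hcomp)
  next
    fix X assume a: "X \<in> Ob C"
    show "(id1 D (\<phi> X), \<psi> (id1 C X), id2 B (id1 B (u0 X))) \<in> Iso2 D (id1 D (\<phi> X)) (\<psi> (id1 C X))"
      by (rule D.lifted_Iso2[OF \<phi>(1)[OF a] \<phi>(1)[OF a] D.C_id1(1)[OF \<phi>(1)[OF a]]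
            \<psi>(1)[OF a a C.C_id1(1)[OF a]]])
        (simp add: D.C_id1(2)[OF \<phi>(1)[OF a]] \<psi>(2)[OF a a C.C_id1(1)[OF a]] C.C_id1(2)[OF a] \<phi> a
          B.id2_Iso2[OF C.u0_closed[OF a] C.u0_closed[OF a] B.id1_closed[OF C.u0_closed[OF a]]])
  next
    fix X Y Z W P Q R
    assume a: "X \<in> Ob C" "Y \<in> Ob C" "Z \<in> Ob C" "W \<in> Ob C"
      "P \<in> Hom1 C X Y" "Q \<in> Hom1 C Y Z" "R \<in> Hom1 C Z W"
    note u = a(1-4)[THEN C.u0_closed] a(5)[THEN C.u1_closed[OF a(1,2)]] a(6)[THEN C.u1_closed[OF a(2,3)]]
      a(7)[THEN C.u1_closed[OF a(3,4)]]
    note D = a(1-4)[THEN \<phi>(1)] \<psi>(1)[OF a(1,2,5)] \<psi>(1)[OF a(2,3,6)] \<psi>(1)[OF a(3,4,7)]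
    note k = B.comp1_closed[OF u(1-3,5,6)] B.comp1_closed[OF u(2-4,6,7)]
    note l = B.comp1_closed[OF u(1,3,4) k(1) u(7)] B.comp1_closed[OF u(1,2,4,5) k(2)]
    show "F2 F (assoc C R Q P) \<odot>\<^bsub>D\<^esub>
       (\<psi> (R \<diamondop>\<^bsub>C\<^esub> Q) \<diamondop>\<^bsub>D\<^esub> \<psi> P, \<psi> ((R \<diamondop>\<^bsub>C\<^esub> Q) \<diamondop>\<^bsub>C\<^esub> P), id2 B (u1 (R \<diamondop>\<^bsub>C\<^esub> Q) \<diamondop>\<^bsub>B\<^esub> u1 P)) \<odot>\<^bsub>D\<^esub>
       ((\<psi> R \<diamondop>\<^bsub>D\<^esub> \<psi> Q, \<psi> (R \<diamondop>\<^bsub>C\<^esub> Q), id2 B (u1 R \<diamondop>\<^bsub>B\<^esub> u1 Q)) \<star>\<^bsub>D\<^esub> id2 D (\<psi> P)) =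
       (\<psi> R \<diamondop>\<^bsub>D\<^esub> \<psi> (Q \<diamondop>\<^bsub>C\<^esub> P), \<psi> (R \<diamondop>\<^bsub>C\<^esub> Q \<diamondop>\<^bsub>C\<^esub> P), id2 B (u1 R \<diamondop>\<^bsub>B\<^esub> u1 (Q \<diamondop>\<^bsub>C\<^esub> P))) \<odot>\<^bsub>D\<^esub>
       (id2 D (\<psi> R) \<star>\<^bsub>D\<^esub> (\<psi> Q \<diamondop>\<^bsub>D\<^esub> \<psi> P, \<psi> (Q \<diamondop>\<^bsub>C\<^esub> P), id2 B (u1 Q \<diamondop>\<^bsub>B\<^esub> u1 P))) \<odot>\<^bsub>D\<^esub>
       assoc D (\<psi> R) (\<psi> Q) (\<psi> P)"
      using B.vcomp_id[OF u(1,4) l(2,1)] B.id2_vcomp_id2[OF u(1,4) l(1)]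
        B.id2_vcomp_id2[OF u(1,4) l(2)] B.assoc_iso[OF u]
        B.hcomp_id[OF u(1,2,4,5) k(2)] B.hcomp_id[OF u(1,3,4) k(1) u(7)]
      by (simp add: C.C_assoc[OF a] D.C_assoc[OF D] F D.C_vcomp D.C_hcomp
          D.C_id2[OF D(1,2,5)] D.C_id2[OF D(3,4,7)] \<psi>(2)[OF a(1,2,5)] \<psi>(2)[OF a(2,3,6)]
          \<psi>(2)[OF a(3,4,7)] C.C_comp1[OF a(1-3,5,6)] C.C_comp1[OF a(2-4,6,7)] inverse2_def)
  next
    fix y assume "y \<in> Ob D"
    then show "\<exists>X \<in> Ob C. Equiv1 D (\<phi> X) y \<noteq> {}"
      using \<phi>(3) D.id1_Equiv1 by blast
  next
    fix X Y k assume a: "X \<in> Ob C" "Y \<in> Ob C" "k \<in> Hom1 D (\<phi> X) (\<phi> Y)"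
    then obtain P where P: "P \<in> Hom1 C X Y" "u1 P = v1 k" using \<psi>(3) by blast
    \<comment> \<open>\<open>\<psi> P\<close> and \<open>k\<close> may differ in their extra data,
      but they have the same underlying 1-cell, so its identity, suitably tagged, is an isomorphism
      between them.\<close>
    have "(\<psi> P, k, id2 B (u1 P)) \<in> Iso2 D (\<psi> P) k"
      by (rule D.lifted_Iso2[OF \<phi>(1)[OF a(1)] \<phi>(1)[OF a(2)] \<psi>(1)[OF a(1,2) P(1)] a(3)])
        (use B.id2_Iso2[OF C.u0_closed[OF a(1)] C.u0_closed[OF a(2)] C.u1_closed[OF a(1,2) P(1)]]
          in \<open>simp add: \<psi>(2)[OF a(1,2) P(1)] P(2)\<close>)
    with P show "\<exists>f \<in> Hom1 C X Y. Iso2 D (\<psi> f) k \<noteq> {}" by blast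
  qed
  then show ?thesis unfolding biequivalent_def by blast
qed

section \<open>The bicategory of linear abelian categories\<close>

text \<open>
  Hom-sets are disjoint, so a morphism determines its domain and codomain. Stating typing
  conditions through them makes the laws of a category usable as conditional rewrite rules.
\<close>

definition dom_of :: "('o, 'm, 'k) lincat \<Rightarrow> 'm \<Rightarrow> 'o" where
  "dom_of D f = (THE a. a \<in> Obj D \<and> (\<exists>b \<in> Obj D. f \<in> Hom D a b))"

definition cod_of :: "('o, 'm, 'k) lincat \<Rightarrow> 'm \<Rightarrow> 'o" where
  "cod_of D f = (THE b. b \<in> Obj D \<and> (\<exists>a \<in> Obj D. f \<in> Hom D a b))"

context linear_category
begin

lemma Hom_dom_cod:
  assumes "a \<in> Obj D" "b \<in> Obj D" "f \<in> Hom D a b"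
  shows "dom_of D f = a" "cod_of D f = b"
  using assms Hom_disjoint unfolding dom_of_def cod_of_def by (blast intro!: the_equality)+

lemma ArrE:
  assumes "f \<in> Arr D"
  obtains "dom_of D f \<in> Obj D" "cod_of D f \<in> Obj D" "f \<in> Hom D (dom_of D f) (cod_of D f)"
proof -
  obtain a b where "a \<in> Obj D" "b \<in> Obj D" "f \<in> Hom D a b"
    using assms unfolding Arr_def by blast
  with Hom_dom_cod[OF this] that show thesis by simp
qed

lemma dom_of_Obj [simp]: "f \<in> Arr D \<Longrightarrow> dom_of D f \<in> Obj D"
  and cod_of_Obj [simp]: "f \<in> Arr D \<Longrightarrow> cod_of D f \<in> Obj D"
  by (erule ArrE, assumption)+

lemma Hom_iff:
  assumes "a \<in> Obj D" "b \<in> Obj D"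
  shows "f \<in> Hom D a b \<longleftrightarrow> f \<in> Arr D \<and> dom_of D f = a \<and> cod_of D f = b"
proof
  assume "f \<in> Hom D a b"
  with assms show "f \<in> Arr D \<and> dom_of D f = a \<and> cod_of D f = b"
    using Hom_dom_cod unfolding Arr_def by blast
qed (auto elim: ArrE)

lemma all_Hom_iff: "(\<forall>a \<in> Obj D. \<forall>b \<in> Obj D. \<forall>f \<in> Hom D a b. P a b f) \<longleftrightarrow>
    (\<forall>f \<in> Arr D. P (dom_of D f) (cod_of D f) f)"
  by (auto simp: Hom_iff elim: ArrE)

lemma all_Hom_parallel_iff:
  "(\<forall>a \<in> Obj D. \<forall>b \<in> Obj D. \<forall>f \<in> Hom D a b. \<forall>g \<in> Hom D a b. P f g) \<longleftrightarrow>
    (\<forall>f \<in> Arr D. \<forall>g \<in> Arr D. dom_of D g = dom_of D f \<longrightarrow> cod_of D g = cod_of D f \<longrightarrow> P f g)"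
  unfolding all_Hom_iff by (auto simp: Hom_iff)

lemma all_Hom_composable_iff:
  "(\<forall>a \<in> Obj D. \<forall>b \<in> Obj D. \<forall>c \<in> Obj D. \<forall>f \<in> Hom D a b. \<forall>g \<in> Hom D b c. P f g) \<longleftrightarrow>
    (\<forall>f \<in> Arr D. \<forall>g \<in> Arr D. dom_of D g = cod_of D f \<longrightarrow> P f g)" (is "?L \<longleftrightarrow> ?R")
proof
  assume ?L
  then show ?R by (metis ArrE)
qed (auto simp: Hom_iff)

lemma Idt_Arr [simp]:
  assumes "a \<in> Obj D" shows "Idt D a \<in> Arr D" "dom_of D (Idt D a) = a" "cod_of D (Idt D a) = a"
  using Idt_closed[OF assms] assms by (auto simp: Hom_iff)

lemma Zer_Arr [simp]:
  assumes "a \<in> Obj D" "b \<in> Obj D"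
  shows "Zer D a b \<in> Arr D" "dom_of D (Zer D a b) = a" "cod_of D (Zer D a b) = b"
  using Zer_closed[OF assms] assms by (auto simp: Hom_iff)

lemma Cmp_Arr [simp]:
  assumes "f \<in> Arr D" "g \<in> Arr D" "dom_of D g = cod_of D f"
  shows "g \<cdot> f \<in> Arr D" "dom_of D (g \<cdot> f) = dom_of D f" "cod_of D (g \<cdot> f) = cod_of D g"
  using Cmp_closed[of "dom_of D f" "cod_of D f" "cod_of D g" f g] assms by (auto simp: Hom_iff)

lemma Add_Arr [simp]:
  assumes "f \<in> Arr D" "g \<in> Arr D" "dom_of D g = dom_of D f" "cod_of D g = cod_of D f"
  shows "f \<oplus> g \<in> Arr D" "dom_of D (f \<oplus> g) = dom_of D f" "cod_of D (f \<oplus> g) = cod_of D f"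
  using Add_closed[of "dom_of D f" "cod_of D f" f g] assms by (auto simp: Hom_iff)

lemma Scl_Arr [simp]:
  assumes "f \<in> Arr D"
  shows "r *\<^sub>L f \<in> Arr D" "dom_of D (r *\<^sub>L f) = dom_of D f" "cod_of D (r *\<^sub>L f) = cod_of D f"
  using Scl_closed[of "dom_of D f" "cod_of D f" f r] assms by (auto simp: Hom_iff)

lemma Cmp_Idt_left [simp]: "\<lbrakk>f \<in> Arr D; cod_of D f = a\<rbrakk> \<Longrightarrow> Idt D a \<cdot> f = f"
  and Cmp_Idt_right [simp]: "\<lbrakk>f \<in> Arr D; dom_of D f = a\<rbrakk> \<Longrightarrow> f \<cdot> Idt D a = f"
  using Cmp_Idt[of "dom_of D f" "cod_of D f" f] by (auto simp: Hom_iff)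

lemma Cmp_assoc' [simp]:
  "\<lbrakk>f \<in> Arr D; g \<in> Arr D; h \<in> Arr D; dom_of D g = cod_of D f; dom_of D h = cod_of D g\<rbrakk>
    \<Longrightarrow> (h \<cdot> g) \<cdot> f = h \<cdot> g \<cdot> f"
  using Cmp_assoc[of "dom_of D f" "cod_of D f" "cod_of D g" "cod_of D h" f g h] by (auto simp: Hom_iff)

end

section \<open>Linear functors and natural transformations\<close>

lemma linear_functors_iff:
  assumes "linear_category D" "linear_category E"
  shows "F \<in> linear_functors D E \<longleftrightarrow> Dom F = D \<and> Cod F = E \<and>
     omap F \<in> Obj D \<rightarrow>\<^sub>E Obj E \<and> mmap F \<in> extensional (Arr D) \<and>
     (\<forall>a \<in> Obj D. mmap F (Idt D a) = Idt E (omap F a)) \<and>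
     (\<forall>f \<in> Arr D. mmap F f \<in> Arr E \<and> dom_of E (mmap F f) = omap F (dom_of D f) \<and>
        cod_of E (mmap F f) = omap F (cod_of D f)) \<and>
     (\<forall>f \<in> Arr D. \<forall>g \<in> Arr D. dom_of D g = cod_of D f \<longrightarrow>
        mmap F (g \<cdot>\<^bsub>D\<^esub> f) = mmap F g \<cdot>\<^bsub>E\<^esub> mmap F f) \<and>
     (\<forall>f \<in> Arr D. \<forall>g \<in> Arr D. dom_of D g = dom_of D f \<longrightarrow> cod_of D g = cod_of D f \<longrightarrow>
        mmap F (f \<oplus>\<^bsub>D\<^esub> g) = mmap F f \<oplus>\<^bsub>E\<^esub> mmap F g) \<and>
     (\<forall>f \<in> Arr D. \<forall>r. mmap F (r *\<^sub>L\<^bsub>D\<^esub> f) = r *\<^sub>L\<^bsub>E\<^esub> mmap F f)" (is "?L \<longleftrightarrow> ?R")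
proof -
  interpret D: linear_category D by fact
  interpret E: linear_category E by fact
  have om: "\<lbrakk>h \<in> Obj D \<rightarrow>\<^sub>E Obj E; a \<in> Obj D\<rbrakk> \<Longrightarrow> h a \<in> Obj E" for h a by auto
  show ?thesis
    unfolding linear_functors_def mem_Collect_eq D.all_Hom_composable_iff D.all_Hom_parallel_iff
      D.all_Hom_iff
    by (intro conj_cong refl ball_cong) (simp_all add: E.Hom_iff om)
qed

locale linear_functor = Dm: linear_category D + Cd: linear_category E
  for D E :: "('o, 'm, 'k :: field) lincat" and F :: "('o, 'm, 'k) linfun" +
  assumes linear: "F \<in> linear_functors D E"
begin

lemmas linear' = linear[unfolded linear_functors_iff[OF Dm.linear_category_axioms Cd.linear_category_axioms]]

lemma Dom [simp]: "Dom F = D" and Cod [simp]: "Cod F = E"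
  and omap_Obj [simp]: "a \<in> Obj D \<Longrightarrow> omap F a \<in> Obj E"
  and omap_extensional: "omap F \<in> extensional (Obj D)"
  and mmap_extensional: "mmap F \<in> extensional (Arr D)"
  and mmap_Idt [simp]: "a \<in> Obj D \<Longrightarrow> mmap F (Idt D a) = Idt E (omap F a)"
  and mmap_Arr [simp]: "f \<in> Arr D \<Longrightarrow> mmap F f \<in> Arr E"
    "f \<in> Arr D \<Longrightarrow> dom_of E (mmap F f) = omap F (dom_of D f)"
    "f \<in> Arr D \<Longrightarrow> cod_of E (mmap F f) = omap F (cod_of D f)"
  and mmap_Cmp [simp]: "\<lbrakk>f \<in> Arr D; g \<in> Arr D; dom_of D g = cod_of D f\<rbrakk>
        \<Longrightarrow> mmap F (g \<cdot>\<^bsub>D\<^esub> f) = mmap F g \<cdot>\<^bsub>E\<^esub> mmap F f"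
  and mmap_Add [simp]: "\<lbrakk>f \<in> Arr D; g \<in> Arr D; dom_of D g = dom_of D f; cod_of D g = cod_of D f\<rbrakk>
        \<Longrightarrow> mmap F (f \<oplus>\<^bsub>D\<^esub> g) = mmap F f \<oplus>\<^bsub>E\<^esub> mmap F g"
  and mmap_Scl [simp]: "f \<in> Arr D \<Longrightarrow> mmap F (r *\<^sub>L\<^bsub>D\<^esub> f) = r *\<^sub>L\<^bsub>E\<^esub> mmap F f"
  using linear' by (auto simp: PiE_def)

end

lemma linfun_eqI:
  assumes "F \<in> linear_functors D E" "G \<in> linear_functors D E"
    and "\<And>a. a \<in> Obj D \<Longrightarrow> omap F a = omap G a" "\<And>f. f \<in> Arr D \<Longrightarrow> mmap F f = mmap G f"
  shows "F = G"
proof -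
  have "omap F = omap G" "mmap F = mmap G"
    using assms by (auto simp: linear_functors_def PiE_def intro!: extensionalityI)
  with assms(1,2) show ?thesis by (auto simp: linear_functors_def)
qed

lemma nat_transformations_iff:
  assumes "linear_functor D E F" "linear_functor D E G"
  shows "\<alpha> \<in> nat_transformations F G \<longleftrightarrow> Src \<alpha> = F \<and> Trg \<alpha> = G \<and> cmpt \<alpha> \<in> extensional (Obj D) \<and>
    (\<forall>a \<in> Obj D. cmpt \<alpha> a \<in> Arr E \<and> dom_of E (cmpt \<alpha> a) = omap F a \<and> cod_of E (cmpt \<alpha> a) = omap G a) \<and>
    (\<forall>f \<in> Arr D. cmpt \<alpha> (cod_of D f) \<cdot>\<^bsub>E\<^esub> mmap F f = mmap G f \<cdot>\<^bsub>E\<^esub> cmpt \<alpha> (dom_of D f))"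
proof -
  interpret F: linear_functor D E F by fact
  interpret G: linear_functor D E G by fact
  show ?thesis
    by (auto simp: nat_transformations_def F.Dm.all_Hom_iff PiE_iff F.Cd.Hom_iff)
qed

locale linear_nat = Sc: linear_functor D E F + Tg: linear_functor D E G
  for D E :: "('o, 'm, 'k :: field) lincat" and F G :: "('o, 'm, 'k) linfun"
    and \<alpha> :: "('o, 'm, 'k) nattr" +
  assumes nat: "\<alpha> \<in> nat_transformations F G"
begin

lemmas nat' = nat[unfolded nat_transformations_iff[OF Sc.linear_functor_axioms Tg.linear_functor_axioms]]

lemma Src [simp]: "Src \<alpha> = F" and Trg [simp]: "Trg \<alpha> = G"
  and cmpt_extensional: "cmpt \<alpha> \<in> extensional (Obj D)"
  and cmpt_Arr [simp]: "a \<in> Obj D \<Longrightarrow> cmpt \<alpha> a \<in> Arr E"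
    "a \<in> Obj D \<Longrightarrow> dom_of E (cmpt \<alpha> a) = omap F a" "a \<in> Obj D \<Longrightarrow> cod_of E (cmpt \<alpha> a) = omap G a"
  and natural: "f \<in> Arr D \<Longrightarrow> cmpt \<alpha> (cod_of D f) \<cdot>\<^bsub>E\<^esub> mmap F f = mmap G f \<cdot>\<^bsub>E\<^esub> cmpt \<alpha> (dom_of D f)"
  using nat' by auto

lemma naturality: "\<lbrakk>f \<in> Arr D; dom_of D f = a; cod_of D f = b\<rbrakk>
    \<Longrightarrow> cmpt \<alpha> b \<cdot>\<^bsub>E\<^esub> mmap F f = mmap G f \<cdot>\<^bsub>E\<^esub> cmpt \<alpha> a"
  using natural by blast

end

lemma nattr_eqI:
  assumes "\<alpha> \<in> nat_transformations F G" "\<beta> \<in> nat_transformations F G"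
    and "\<And>a. a \<in> Obj (Dom F) \<Longrightarrow> cmpt \<alpha> a = cmpt \<beta> a"
  shows "\<alpha> = \<beta>"
proof -
  have "cmpt \<alpha> = cmpt \<beta>"
    using assms by (auto simp: nat_transformations_def PiE_def intro!: extensionalityI)
  with assms(1,2) show ?thesis by (auto simp: nat_transformations_def)
qed

lemma fun_id_linear: assumes "linear_category D" shows "linear_functor D D (fun_id D)"
proof -
  interpret linear_category D by fact
  show ?thesis
    by unfold_locales (auto simp: linear_functors_iff[OF assms assms] fun_id_def)
qed

lemma fun_comp_linear:
  assumes "linear_functor D E F" "linear_functor E H G"
  shows "linear_functor D H (fun_comp G F)"
proof -
  interpret F: linear_functor D E F by fact
  interpret G: linear_functor E H G by fact
  show ?thesis
    by unfold_locales
      (auto simp: linear_functors_iff[OF F.Dm.linear_category_axioms G.Cd.linear_category_axioms] fun_comp_def)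
qed

lemma fun_id_simps [simp]:
  "Dom (fun_id D) = D" "Cod (fun_id D) = D" "a \<in> Obj D \<Longrightarrow> omap (fun_id D) a = a"
  "f \<in> Arr D \<Longrightarrow> mmap (fun_id D) f = f"
  by (simp_all add: fun_id_def)

lemma fun_comp_simps [simp]:
  "Dom (fun_comp G F) = Dom F" "Cod (fun_comp G F) = Cod G"
  "a \<in> Obj (Dom F) \<Longrightarrow> omap (fun_comp G F) a = omap G (omap F a)"
  "f \<in> Arr (Dom F) \<Longrightarrow> mmap (fun_comp G F) f = mmap G (mmap F f)"
  by (simp_all add: fun_comp_def)

lemma nat_simps [simp]:
  "Src (nat_id F) = F" "Trg (nat_id F) = F"
  "a \<in> Obj (Dom F) \<Longrightarrow> cmpt (nat_id F) a = Idt (Cod F) (omap F a)"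
  "Src (nat_vcomp \<beta> \<alpha>) = Src \<alpha>" "Trg (nat_vcomp \<beta> \<alpha>) = Trg \<beta>"
  "a \<in> Obj (Dom (Src \<alpha>)) \<Longrightarrow> cmpt (nat_vcomp \<beta> \<alpha>) a = cmpt \<beta> a \<cdot>\<^bsub>Cod (Src \<alpha>)\<^esub> cmpt \<alpha> a"
  "Src (nat_hcomp \<beta> \<alpha>) = fun_comp (Src \<beta>) (Src \<alpha>)" "Trg (nat_hcomp \<beta> \<alpha>) = fun_comp (Trg \<beta>) (Trg \<alpha>)"
  "a \<in> Obj (Dom (Src \<alpha>)) \<Longrightarrow> cmpt (nat_hcomp \<beta> \<alpha>) a =
     cmpt \<beta> (omap (Trg \<alpha>) a) \<cdot>\<^bsub>Cod (Src \<beta>)\<^esub> mmap (Src \<beta>) (cmpt \<alpha> a)"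
  by (simp_all add: nat_id_def nat_vcomp_def nat_hcomp_def)

lemma nat_id_linear: assumes "linear_functor D E F" shows "linear_nat D E F F (nat_id F)"
proof -
  interpret F: linear_functor D E F by fact
  show ?thesis
    by unfold_locales (auto simp: nat_transformations_iff[OF assms assms] nat_id_def)
qed

lemma nat_vcomp_linear:
  assumes "linear_nat D E F G \<alpha>" "linear_nat D E G H \<beta>"
  shows "linear_nat D E F H (nat_vcomp \<beta> \<alpha>)"
proof -
  interpret a: linear_nat D E F G \<alpha> by fact
  interpret b: linear_nat D E G H \<beta> by fact
  have "(cmpt \<beta> (cod_of D f) \<cdot>\<^bsub>E\<^esub> cmpt \<alpha> (cod_of D f)) \<cdot>\<^bsub>E\<^esub> mmap F f =
      mmap H f \<cdot>\<^bsub>E\<^esub> cmpt \<beta> (dom_of D f) \<cdot>\<^bsub>E\<^esub> cmpt \<alpha> (dom_of D f)" if "f \<in> Arr D" for f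
  proof -
    have "(cmpt \<beta> (cod_of D f) \<cdot>\<^bsub>E\<^esub> cmpt \<alpha> (cod_of D f)) \<cdot>\<^bsub>E\<^esub> mmap F f
        = cmpt \<beta> (cod_of D f) \<cdot>\<^bsub>E\<^esub> mmap G f \<cdot>\<^bsub>E\<^esub> cmpt \<alpha> (dom_of D f)"
      using that by (simp add: a.natural)
    also have "\<dots> = (cmpt \<beta> (cod_of D f) \<cdot>\<^bsub>E\<^esub> mmap G f) \<cdot>\<^bsub>E\<^esub> cmpt \<alpha> (dom_of D f)"
      using that by simp
    also have "\<dots> = mmap H f \<cdot>\<^bsub>E\<^esub> cmpt \<beta> (dom_of D f) \<cdot>\<^bsub>E\<^esub> cmpt \<alpha> (dom_of D f)"
      unfolding b.natural[OF that] using that by simp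
    finally show ?thesis .
  qed
  then show ?thesis
    by unfold_locales (auto simp: nat_transformations_iff[OF a.Sc.linear_functor_axioms
          b.Tg.linear_functor_axioms] nat_vcomp_def)
qed

lemma nat_hcomp_linear:
  assumes "linear_nat D E F F' \<alpha>" "linear_nat E H G G' \<beta>"
  shows "linear_nat D H (fun_comp G F) (fun_comp G' F') (nat_hcomp \<beta> \<alpha>)"
proof -
  interpret a: linear_nat D E F F' \<alpha> by fact
  interpret b: linear_nat E H G G' \<beta> by fact
  interpret GF: linear_functor D H "fun_comp G F"
    by (rule fun_comp_linear[OF a.Sc.linear_functor_axioms b.Sc.linear_functor_axioms])
  interpret GF': linear_functor D H "fun_comp G' F'"
    by (rule fun_comp_linear[OF a.Tg.linear_functor_axioms b.Tg.linear_functor_axioms])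
  have "(cmpt \<beta> (omap F' (cod_of D f)) \<cdot>\<^bsub>H\<^esub> mmap G (cmpt \<alpha> (cod_of D f))) \<cdot>\<^bsub>H\<^esub> mmap G (mmap F f) =
      mmap G' (mmap F' f) \<cdot>\<^bsub>H\<^esub> cmpt \<beta> (omap F' (dom_of D f)) \<cdot>\<^bsub>H\<^esub> mmap G (cmpt \<alpha> (dom_of D f))"
    if f: "f \<in> Arr D" for f
  proof -
    have "(cmpt \<beta> (omap F' (cod_of D f)) \<cdot>\<^bsub>H\<^esub> mmap G (cmpt \<alpha> (cod_of D f))) \<cdot>\<^bsub>H\<^esub> mmap G (mmap F f) =
      cmpt \<beta> (omap F' (cod_of D f)) \<cdot>\<^bsub>H\<^esub> mmap G (cmpt \<alpha> (cod_of D f) \<cdot>\<^bsub>E\<^esub> mmap F f)"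
      using f by simp
    also have "\<dots> = (cmpt \<beta> (omap F' (cod_of D f)) \<cdot>\<^bsub>H\<^esub> mmap G (mmap F' f)) \<cdot>\<^bsub>H\<^esub> mmap G (cmpt \<alpha> (dom_of D f))"
      unfolding a.natural[OF f] using f by simp
    also have "\<dots> = (mmap G' (mmap F' f) \<cdot>\<^bsub>H\<^esub> cmpt \<beta> (omap F' (dom_of D f))) \<cdot>\<^bsub>H\<^esub> mmap G (cmpt \<alpha> (dom_of D f))"
      using f by (subst b.naturality[of "mmap F' f" "omap F' (dom_of D f)"]) simp_all
    finally show ?thesis using f by simp
  qed
  then show ?thesis
    by unfold_locales (auto simp: nat_transformations_iff[OF GF.linear_functor_axioms GF'.linear_functor_axioms]
       nat_hcomp_def)
qed

lemma linear_functorI: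
  "\<lbrakk>linear_category D; linear_category E; F \<in> linear_functors D E\<rbrakk> \<Longrightarrow> linear_functor D E F"
  by (simp add: linear_functor_def linear_functor_axioms_def)

lemma linear_natI:
  "\<lbrakk>linear_functor D E F; linear_functor D E G; \<alpha> \<in> nat_transformations F G\<rbrakk> \<Longrightarrow> linear_nat D E F G \<alpha>"
  by (simp add: linear_nat_def linear_nat_axioms_def)

lemma linear_nat_eqI:
  assumes "linear_nat D E F G \<alpha>" "linear_nat D E F G \<beta>" "\<And>a. a \<in> Obj D \<Longrightarrow> cmpt \<alpha> a = cmpt \<beta> a"
  shows "\<alpha> = \<beta>"
  using nattr_eqI linear_nat.nat assms linear_functor.Dom linear_nat.axioms(1) by metis

lemma linear_functor_eqI:
  assumes "linear_functor D E F" "linear_functor D E G"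
    "\<And>a. a \<in> Obj D \<Longrightarrow> omap F a = omap G a" "\<And>f. f \<in> Arr D \<Longrightarrow> mmap F f = mmap G f"
  shows "F = G"
  using linfun_eqI linear_functor.linear assms by metis

lemma fun_comp_assoc:
  assumes "linear_functor D E F" "linear_functor E H G" "linear_functor H J K"
  shows "fun_comp (fun_comp K G) F = fun_comp K (fun_comp G F)"
proof -
  interpret F: linear_functor D E F by fact
  interpret G: linear_functor E H G by fact
  show ?thesis
    by (rule linear_functor_eqI[of D J])
      (use assms in \<open>auto intro: fun_comp_linear\<close>)
qed

lemma fun_comp_id:
  assumes "linear_functor D E F"
  shows "fun_comp F (fun_id D) = F" "fun_comp (fun_id E) F = F"
proof -
  interpret F: linear_functor D E F by fact
  show "fun_comp F (fun_id D) = F"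
    by (rule linear_functor_eqI[of D E])
      (use assms in \<open>auto intro: fun_comp_linear fun_id_linear F.Dm.linear_category_axioms\<close>)
  show "fun_comp (fun_id E) F = F"
    by (rule linear_functor_eqI[of D E])
      (use assms in \<open>auto intro: fun_comp_linear fun_id_linear F.Cd.linear_category_axioms\<close>)
qed

lemma nat_vcomp_id:
  assumes "linear_nat D E F G \<alpha>"
  shows "nat_vcomp \<alpha> (nat_id F) = \<alpha>" "nat_vcomp (nat_id G) \<alpha> = \<alpha>"
proof -
  interpret a: linear_nat D E F G \<alpha> by fact
  show "nat_vcomp \<alpha> (nat_id F) = \<alpha>"
    by (rule linear_nat_eqI[of D E F G])
      (use assms in \<open>auto intro: nat_vcomp_linear nat_id_linear a.Sc.linear_functor_axioms\<close>)
  show "nat_vcomp (nat_id G) \<alpha> = \<alpha>"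
    by (rule linear_nat_eqI[of D E F G])
      (use assms in \<open>auto intro: nat_vcomp_linear nat_id_linear a.Tg.linear_functor_axioms\<close>)
qed

lemma nat_hcomp_id:
  assumes "linear_nat D E F G \<alpha>"
  shows "nat_hcomp \<alpha> (nat_id (fun_id D)) = \<alpha>" "nat_hcomp (nat_id (fun_id E)) \<alpha> = \<alpha>"
proof -
  interpret a: linear_nat D E F G \<alpha> by fact
  note i = fun_id_linear[OF a.Sc.Dm.linear_category_axioms] fun_id_linear[OF a.Sc.Cd.linear_category_axioms]
  show "nat_hcomp \<alpha> (nat_id (fun_id D)) = \<alpha>"
    using nat_hcomp_linear[OF nat_id_linear[OF i(1)] assms]
    by (intro linear_nat_eqI[of D E F G])
      (simp_all add: fun_comp_id[OF a.Sc.linear_functor_axioms] fun_comp_id[OF a.Tg.linear_functor_axioms] assms)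
  show "nat_hcomp (nat_id (fun_id E)) \<alpha> = \<alpha>"
    using nat_hcomp_linear[OF assms nat_id_linear[OF i(2)]]
    by (intro linear_nat_eqI[of D E F G])
      (simp_all add: fun_comp_id[OF a.Sc.linear_functor_axioms] fun_comp_id[OF a.Tg.linear_functor_axioms] assms)
qed

lemma nat_hcomp_id_id:
  assumes "linear_functor D E F" "linear_functor E H G"
  shows "nat_hcomp (nat_id G) (nat_id F) = nat_id (fun_comp G F)"
proof -
  interpret F: linear_functor D E F by fact
  interpret G: linear_functor E H G by fact
  show ?thesis
    by (rule linear_nat_eqI[of D H "fun_comp G F" "fun_comp G F"])
      (use assms in \<open>auto intro!: nat_hcomp_linear nat_id_linear fun_comp_linear\<close>)
qed

lemma nat_vcomp_assoc:
  assumes "linear_nat D E F G \<alpha>" "linear_nat D E G H \<beta>" "linear_nat D E H K \<gamma>"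
  shows "nat_vcomp (nat_vcomp \<gamma> \<beta>) \<alpha> = nat_vcomp \<gamma> (nat_vcomp \<beta> \<alpha>)"
proof -
  interpret a: linear_nat D E F G \<alpha> by fact
  interpret b: linear_nat D E G H \<beta> by fact
  interpret c: linear_nat D E H K \<gamma> by fact
  show ?thesis
    by (rule linear_nat_eqI[of D E F K])
      (use assms in \<open>auto intro: nat_vcomp_linear\<close>)
qed

lemma nat_hcomp_assoc:
  assumes "linear_nat D E F F' \<alpha>" "linear_nat E H G G' \<beta>" "linear_nat H J K K' \<gamma>"
  shows "nat_hcomp (nat_hcomp \<gamma> \<beta>) \<alpha> = nat_hcomp \<gamma> (nat_hcomp \<beta> \<alpha>)"
proof -
  interpret a: linear_nat D E F F' \<alpha> by fact
  interpret b: linear_nat E H G G' \<beta> by fact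
  interpret c: linear_nat H J K K' \<gamma> by fact
  note f = a.Sc.linear_functor_axioms b.Sc.linear_functor_axioms c.Sc.linear_functor_axioms
  note g = a.Tg.linear_functor_axioms b.Tg.linear_functor_axioms c.Tg.linear_functor_axioms
  have "linear_nat D J (fun_comp K (fun_comp G F)) (fun_comp K' (fun_comp G' F')) (nat_hcomp (nat_hcomp \<gamma> \<beta>) \<alpha>)"
    using nat_hcomp_linear[OF assms(1) nat_hcomp_linear[OF assms(2,3)]]
    by (simp add: fun_comp_assoc[OF f] fun_comp_assoc[OF g])
  then show ?thesis
    by (rule linear_nat_eqI) (use assms in \<open>auto intro: nat_hcomp_linear\<close>)
qed

text \<open>At each object the two composites differ only in the order of a component of
  \<open>\<beta>\<close> and the image of a component of \<open>\<alpha>'\<close>; naturality of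
  \<open>\<beta>\<close> at that component exchanges them.\<close>

lemma nat_interchange:
  assumes "linear_nat D E F F' \<alpha>" "linear_nat D E F' F'' \<alpha>'" "linear_nat E H G G' \<beta>" "linear_nat E H G' G'' \<beta>'"
  shows "nat_vcomp (nat_hcomp \<beta>' \<alpha>') (nat_hcomp \<beta> \<alpha>) = nat_hcomp (nat_vcomp \<beta>' \<beta>) (nat_vcomp \<alpha>' \<alpha>)"
proof -
  interpret a: linear_nat D E F F' \<alpha> by fact
  interpret a': linear_nat D E F' F'' \<alpha>' by fact
  interpret b: linear_nat E H G G' \<beta> by fact
  interpret b': linear_nat E H G' G'' \<beta>' by fact
  show ?thesis
  proof (rule linear_nat_eqI[of D H "fun_comp G F" "fun_comp G'' F''"])
    fix x assume x: "x \<in> Obj D"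
    have "mmap G' (cmpt \<alpha>' x) \<cdot>\<^bsub>H\<^esub> cmpt \<beta> (omap F' x) \<cdot>\<^bsub>H\<^esub> mmap G (cmpt \<alpha> x) =
        (cmpt \<beta> (omap F'' x) \<cdot>\<^bsub>H\<^esub> mmap G (cmpt \<alpha>' x)) \<cdot>\<^bsub>H\<^esub> mmap G (cmpt \<alpha> x)"
      using x by (subst b.naturality[of _ "omap F' x" "omap F'' x"]) auto
    then show "cmpt (nat_vcomp (nat_hcomp \<beta>' \<alpha>') (nat_hcomp \<beta> \<alpha>)) x =
        cmpt (nat_hcomp (nat_vcomp \<beta>' \<beta>) (nat_vcomp \<alpha>' \<alpha>)) x"
      using x by simp
  qed (use assms in \<open>auto intro: nat_hcomp_linear nat_vcomp_linear\<close>)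
qed

section \<open>The bicategory axioms for \<open>Vect2\<close>, up to its finite semisimple
  core\<close>

lemma Vect2_simps [simp]:
  "Ob Vect2 = {D. abelian_category D}" "Hom1 Vect2 = linear_functors"
  "Hom2 Vect2 = nat_transformations" "id1 Vect2 = fun_id" "id2 Vect2 = nat_id"
  "comp1 Vect2 = fun_comp" "vcomp Vect2 = nat_vcomp" "hcomp Vect2 = nat_hcomp"
  "assoc Vect2 = (\<lambda>H G F. nat_id (fun_comp H (fun_comp G F)))"
  "assoc_inv Vect2 = (\<lambda>H G F. nat_id (fun_comp H (fun_comp G F)))"
  "lunit Vect2 = nat_id" "lunit_inv Vect2 = nat_id" "runit Vect2 = nat_id" "runit_inv Vect2 = nat_id"
  by (simp_all add: Vect2_def)

lemma bicategory_Vect2: "bicategory Vect2"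
proof -
  note A = abelian_category.axioms(1)
  note f = linear_functorI[OF A A]
  have n: "linear_nat D E F G \<alpha>" if "abelian_category D" "abelian_category E"
    "F \<in> linear_functors D E" "G \<in> linear_functors D E" "\<alpha> \<in> nat_transformations F G" for D E F G \<alpha>
    using linear_natI[OF f f] that by blast
  note fl = linear_functor.linear and nl = linear_nat.nat
  show ?thesis
    apply (unfold_locales; simp)
    subgoal by (auto simp: linear_functors_def)
    subgoal by (auto simp: nat_transformations_def)
    subgoal by (rule fl[OF fun_id_linear[OF A]])
    subgoal by (rule fl[OF fun_comp_linear[OF f f]])
    subgoal by (rule nl[OF nat_id_linear[OF f]])
    subgoal by (rule nl[OF nat_vcomp_linear[OF n n]])
    subgoal by (rule nat_vcomp_assoc[OF n n n])
    subgoal for D E F G \<alpha> using nat_vcomp_id[OF n[of D E F G \<alpha>]] by simp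
    subgoal by (rule nl[OF nat_hcomp_linear[OF n n]])
    subgoal by (rule nat_hcomp_id_id[OF f f])
    subgoal by (rule nat_interchange[OF n n n n])
    subgoal premises p for a b c d F G H
      using fun_comp_assoc[OF f[OF p(1,2,5)] f[OF p(2,3,6)] f[OF p(3,4,7)]]
        nat_id_linear[OF fun_comp_linear[OF fun_comp_linear[OF f[OF p(1,2,5)] f[OF p(2,3,6)]] f[OF p(3,4,7)]]]
      by (simp add: inverse2_def nl nat_vcomp_id)
    subgoal premises p for a b c d F F' G G' H H' \<alpha> \<beta> \<gamma>
    proof -
      note l = n[OF p(1,2,5,6,11)] n[OF p(2,3,7,8,12)] n[OF p(3,4,9,10,13)]
      show ?thesis
        using nat_vcomp_id[OF nat_hcomp_linear[OF nat_hcomp_linear[OF l(1,2)] l(3)]] nat_hcomp_assoc[OF l]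
        by simp
    qed
    subgoal premises p for a b F
      using nat_id_linear[OF f[OF p]] by (simp add: inverse2_def nl nat_vcomp_id fun_comp_id[OF f[OF p]])
    subgoal premises p for a b F F' \<alpha>
      by (simp add: nat_hcomp_id[OF n[OF p]] nat_vcomp_id[OF n[OF p]])
    subgoal premises p for a b F
      using nat_id_linear[OF f[OF p]] by (simp add: inverse2_def nl nat_vcomp_id fun_comp_id[OF f[OF p]])
    subgoal premises p for a b F F' \<alpha>
      by (simp add: nat_hcomp_id[OF n[OF p]] nat_vcomp_id[OF n[OF p]])
    subgoal premises p for a b c d e F G H K
    proof -
      note l = f[OF p(1,2,6)] f[OF p(2,3,7)] f[OF p(3,4,8)] f[OF p(4,5,9)]
      note m = fun_comp_linear[OF l(1,2)] fun_comp_linear[OF l(2,3)] fun_comp_linear[OF l(3,4)]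
      note k = fun_comp_linear[OF m(1) l(3)] fun_comp_linear[OF m(2) l(4)]
      note i = nat_vcomp_id[OF nat_id_linear[OF fun_comp_linear[OF k(1) l(4)]]]
      show ?thesis
        by (simp add: fun_comp_assoc[OF l(1-3)] fun_comp_assoc[OF l(1,2) m(3)] fun_comp_assoc[OF m(1) l(3,4)]
            fun_comp_assoc[OF l(2,3,4)] fun_comp_assoc[OF l(1) m(2) l(4)] nat_hcomp_id_id[OF k(1) l(4)]
            nat_hcomp_id_id[OF l(1) k(2)] i)
    qed
    subgoal premises p for a b c F G
      using nat_vcomp_id[OF nat_id_linear[OF fun_comp_linear[OF f[OF p(1,2,4)] f[OF p(2,3,5)]]]]
      by (simp add: nat_hcomp_id_id[OF f[OF p(1,2,4)] f[OF p(2,3,5)]] fun_comp_id[OF f[OF p(1,2,4)]])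
    done
qed

lemma Vect2_fd_simps [simp]:
  "Ob Vect2_fd = {D. finite_category D \<and> semisimple D}"
  "Hom1 Vect2_fd = linear_functors" "Hom2 Vect2_fd = nat_transformations"
  "Iso2 Vect2_fd = Iso2 Vect2" "Equiv1 Vect2_fd = Equiv1 Vect2"
  "id1 Vect2_fd = fun_id" "id2 Vect2_fd = nat_id"
  "comp1 Vect2_fd = fun_comp" "vcomp Vect2_fd = nat_vcomp" "hcomp Vect2_fd = nat_hcomp"
  "assoc Vect2_fd = (\<lambda>H G F. nat_id (fun_comp H (fun_comp G F)))"
  "assoc_inv Vect2_fd = (\<lambda>H G F. nat_id (fun_comp H (fun_comp G F)))"
  "lunit Vect2_fd = nat_id" "lunit_inv Vect2_fd = nat_id"
  "runit Vect2_fd = nat_id" "runit_inv Vect2_fd = nat_id"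
  by (auto simp: Vect2_fd_def finite_category_def)

lemma bicategory_core_Vect2_fd: "bicategory (core Vect2_fd)"
  unfolding Vect2_fd_def by (intro bicategory_core bicategory_full_sub bicategory_Vect2)

section \<open>Isomorphisms, natural isomorphisms and equivalences of linear categories\<close>

definition isom :: "('o, 'm, 'k) lincat \<Rightarrow> 'm \<Rightarrow> bool" where
  "isom D f \<longleftrightarrow> f \<in> Arr D \<and> (\<exists>g \<in> Arr D. dom_of D g = cod_of D f \<and> cod_of D g = dom_of D f \<and>
     g \<cdot>\<^bsub>D\<^esub> f = Idt D (dom_of D f) \<and> f \<cdot>\<^bsub>D\<^esub> g = Idt D (cod_of D f))"

definition inv_of :: "('o, 'm, 'k) lincat \<Rightarrow> 'm \<Rightarrow> 'm" where
  "inv_of D f = (SOME g. g \<in> Arr D \<and> dom_of D g = cod_of D f \<and> cod_of D g = dom_of D f \<and>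
     g \<cdot>\<^bsub>D\<^esub> f = Idt D (dom_of D f) \<and> f \<cdot>\<^bsub>D\<^esub> g = Idt D (cod_of D f))"

context linear_category
begin

lemma isom_Arr [simp]: "isom D f \<Longrightarrow> f \<in> Arr D"
  by (simp add: isom_def)

lemma inv_of [simp]:
  assumes "isom D f"
  shows "inv_of D f \<in> Arr D" "dom_of D (inv_of D f) = cod_of D f" "cod_of D (inv_of D f) = dom_of D f"
    "inv_of D f \<cdot> f = Idt D (dom_of D f)" "f \<cdot> inv_of D f = Idt D (cod_of D f)"
proof -
  have "\<exists>g. g \<in> Arr D \<and> dom_of D g = cod_of D f \<and> cod_of D g = dom_of D f \<and>
     g \<cdot> f = Idt D (dom_of D f) \<and> f \<cdot> g = Idt D (cod_of D f)"
    using assms unfolding isom_def by (elim conjE bexE) (intro exI conjI)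
  from someI_ex[OF this, folded inv_of_def]
  show "inv_of D f \<in> Arr D" "dom_of D (inv_of D f) = cod_of D f" "cod_of D (inv_of D f) = dom_of D f"
    "inv_of D f \<cdot> f = Idt D (dom_of D f)" "f \<cdot> inv_of D f = Idt D (cod_of D f)"
    by blast+
qed

lemma inv_of_cancel [simp]:
  assumes "isom D f" "g \<in> Arr D"
  shows "cod_of D g = dom_of D f \<Longrightarrow> inv_of D f \<cdot> f \<cdot> g = g"
    "cod_of D g = cod_of D f \<Longrightarrow> f \<cdot> inv_of D f \<cdot> g = g"
proof -
  assume "cod_of D g = dom_of D f"
  then show "inv_of D f \<cdot> f \<cdot> g = g"
    using assms by (subst Cmp_assoc'[symmetric]) simp_all
next
  assume "cod_of D g = cod_of D f"
  then show "f \<cdot> inv_of D f \<cdot> g = g"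
    using assms by (subst Cmp_assoc'[symmetric]) simp_all
qed

lemma isomI: "\<lbrakk>f \<in> Arr D; g \<in> Arr D; dom_of D g = cod_of D f; cod_of D g = dom_of D f;
    g \<cdot> f = Idt D (dom_of D f); f \<cdot> g = Idt D (cod_of D f)\<rbrakk> \<Longrightarrow> isom D f"
  unfolding isom_def by blast

lemma isom_inv_of [simp]: "isom D f \<Longrightarrow> isom D (inv_of D f)"
  by (rule isomI[of _ f]) auto

lemma isom_Idt [simp]: "a \<in> Obj D \<Longrightarrow> isom D (Idt D a)"
  by (rule isomI[of _ "Idt D a"]) auto

lemma isom_Cmp [simp]: "\<lbrakk>isom D f; isom D g; dom_of D g = cod_of D f\<rbrakk> \<Longrightarrow> isom D (g \<cdot> f)"
  by (rule isomI[of _ "inv_of D f \<cdot> inv_of D g"]) auto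

lemma isom_cancel_right:
  assumes "isom D f" "g \<in> Arr D" "h \<in> Arr D" "dom_of D g = cod_of D f" "dom_of D h = cod_of D f"
    and "g \<cdot> f = h \<cdot> f"
  shows "g = h"
proof -
  have "(g \<cdot> f) \<cdot> inv_of D f = (h \<cdot> f) \<cdot> inv_of D f" using assms by simp
  then show ?thesis using assms(1-5) by simp
qed

lemma isom_cancel_left:
  assumes "isom D f" "g \<in> Arr D" "h \<in> Arr D" "cod_of D g = dom_of D f" "cod_of D h = dom_of D f"
    and "f \<cdot> g = f \<cdot> h"
  shows "g = h"
proof -
  have "inv_of D f \<cdot> f \<cdot> g = inv_of D f \<cdot> f \<cdot> h" using assms by simp
  then show ?thesis using assms(1-5) by simp
qed

lemma inv_of_eqI:
  assumes "isom D f" "g \<in> Arr D" "dom_of D g = cod_of D f" "f \<cdot> g = Idt D (cod_of D f)"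
    "cod_of D g = dom_of D f"
  shows "inv_of D f = g"
  by (rule isom_cancel_left[of f]) (use assms in auto)

end

lemma (in linear_functor) isom_mmap [simp]:
  assumes "isom D f" shows "isom E (mmap F f)" "mmap F (inv_of D f) = inv_of E (mmap F f)"
proof -
  have *: "mmap F (inv_of D f) \<cdot>\<^bsub>E\<^esub> mmap F f = Idt E (omap F (dom_of D f))"
    "mmap F f \<cdot>\<^bsub>E\<^esub> mmap F (inv_of D f) = Idt E (omap F (cod_of D f))"
    using assms by (simp_all flip: mmap_Cmp)
  show "isom E (mmap F f)"
    by (rule Cd.isomI[of _ "mmap F (inv_of D f)"]) (use assms * in auto)
  then show "mmap F (inv_of D f) = inv_of E (mmap F f)"
    by (rule Cd.inv_of_eqI[symmetric]) (use assms * in auto)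
qed

locale linear_nat_iso = linear_nat D E F G \<alpha>
  for D E :: "('o, 'm, 'k :: field) lincat" and F G :: "('o, 'm, 'k) linfun"
    and \<alpha> :: "('o, 'm, 'k) nattr" +
  assumes isom_cmpt [simp]: "a \<in> Obj D \<Longrightarrow> isom E (cmpt \<alpha> a)"

definition nat_inv :: "('o, 'm, 'k) nattr \<Rightarrow> ('o, 'm, 'k) nattr" where
  "nat_inv \<alpha> = \<lparr>Src = Trg \<alpha>, Trg = Src \<alpha>,
     cmpt = (\<lambda>a \<in> Obj (Dom (Src \<alpha>)). inv_of (Cod (Src \<alpha>)) (cmpt \<alpha> a))\<rparr>"

lemma linear_nat_isoI: "\<lbrakk>linear_nat D E F G \<alpha>; \<And>a. a \<in> Obj D \<Longrightarrow> isom E (cmpt \<alpha> a)\<rbrakk>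
    \<Longrightarrow> linear_nat_iso D E F G \<alpha>"
  by (simp add: linear_nat_iso_def linear_nat_iso_axioms_def)

lemma nat_inv_simps [simp]:
  "Src (nat_inv \<alpha>) = Trg \<alpha>" "Trg (nat_inv \<alpha>) = Src \<alpha>"
  "a \<in> Obj (Dom (Src \<alpha>)) \<Longrightarrow> cmpt (nat_inv \<alpha>) a = inv_of (Cod (Src \<alpha>)) (cmpt \<alpha> a)"
  by (simp_all add: nat_inv_def)

lemma nat_inv_linear:
  assumes "linear_nat_iso D E F G \<alpha>" shows "linear_nat_iso D E G F (nat_inv \<alpha>)"
proof -
  interpret linear_nat_iso D E F G \<alpha> by fact
  have "inv_of E (cmpt \<alpha> (cod_of D f)) \<cdot>\<^bsub>E\<^esub> mmap G f = mmap F f \<cdot>\<^bsub>E\<^esub> inv_of E (cmpt \<alpha> (dom_of D f))"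
    if f: "f \<in> Arr D" for f
  proof (rule Sc.Cd.isom_cancel_left[of "cmpt \<alpha> (cod_of D f)"])
    have "cmpt \<alpha> (cod_of D f) \<cdot>\<^bsub>E\<^esub> mmap F f \<cdot>\<^bsub>E\<^esub> inv_of E (cmpt \<alpha> (dom_of D f)) =
      (cmpt \<alpha> (cod_of D f) \<cdot>\<^bsub>E\<^esub> mmap F f) \<cdot>\<^bsub>E\<^esub> inv_of E (cmpt \<alpha> (dom_of D f))"
      using f by simp
    also have "\<dots> = mmap G f" unfolding natural[OF f] using f by simp
    finally show "cmpt \<alpha> (cod_of D f) \<cdot>\<^bsub>E\<^esub> inv_of E (cmpt \<alpha> (cod_of D f)) \<cdot>\<^bsub>E\<^esub> mmap G f =
      cmpt \<alpha> (cod_of D f) \<cdot>\<^bsub>E\<^esub> mmap F f \<cdot>\<^bsub>E\<^esub> inv_of E (cmpt \<alpha> (dom_of D f))"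
      using f by simp
  qed (use f in auto)
  then have "linear_nat D E G F (nat_inv \<alpha>)"
    by unfold_locales
      (auto simp: nat_transformations_iff[OF Tg.linear_functor_axioms Sc.linear_functor_axioms] nat_inv_def)
  then show ?thesis by (rule linear_nat_isoI) auto
qed

lemma nat_iso_id: assumes "linear_functor D E F" shows "linear_nat_iso D E F F (nat_id F)"
proof -
  interpret linear_functor D E F by fact
  show ?thesis by (rule linear_nat_isoI[OF nat_id_linear[OF assms]]) auto
qed

lemma nat_iso_vcomp:
  assumes "linear_nat_iso D E F G \<alpha>" "linear_nat_iso D E G H \<beta>"
  shows "linear_nat_iso D E F H (nat_vcomp \<beta> \<alpha>)"
proof -
  interpret a: linear_nat_iso D E F G \<alpha> by fact
  interpret b: linear_nat_iso D E G H \<beta> by fact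
  show ?thesis
    by (rule linear_nat_isoI[OF nat_vcomp_linear[OF a.linear_nat_axioms b.linear_nat_axioms]]) auto
qed

lemma nat_iso_hcomp:
  assumes "linear_nat_iso D E F F' \<alpha>" "linear_nat_iso E H G G' \<beta>"
  shows "linear_nat_iso D H (fun_comp G F) (fun_comp G' F') (nat_hcomp \<beta> \<alpha>)"
proof -
  interpret a: linear_nat_iso D E F F' \<alpha> by fact
  interpret b: linear_nat_iso E H G G' \<beta> by fact
  show ?thesis
    by (rule linear_nat_isoI[OF nat_hcomp_linear[OF a.linear_nat_axioms b.linear_nat_axioms]]) auto
qed

lemma nat_inv_vcomp:
  assumes "linear_nat_iso D E F G \<alpha>"
  shows "nat_vcomp (nat_inv \<alpha>) \<alpha> = nat_id F" "nat_vcomp \<alpha> (nat_inv \<alpha>) = nat_id G"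
proof -
  interpret linear_nat_iso D E F G \<alpha> by fact
  interpret i: linear_nat_iso D E G F "nat_inv \<alpha>" by (rule nat_inv_linear[OF assms])
  show "nat_vcomp (nat_inv \<alpha>) \<alpha> = nat_id F"
    by (rule linear_nat_eqI[of D E F F])
      (auto intro: nat_vcomp_linear nat_id_linear linear_nat_axioms i.linear_nat_axioms Sc.linear_functor_axioms)
  show "nat_vcomp \<alpha> (nat_inv \<alpha>) = nat_id G"
    by (rule linear_nat_eqI[of D E G G])
      (auto intro: nat_vcomp_linear nat_id_linear linear_nat_axioms i.linear_nat_axioms Tg.linear_functor_axioms)
qed

text \<open>Pointwise inverses of a natural transformation are natural, so they assemble to the
  inverse 2-cell \<open>nat_inv \<alpha>\<close>. From here on invertibility of 2-cells is a matter
  of components.\<close>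

lemma Iso2_Vect2_iff:
  assumes "linear_functor D E F" "linear_functor D E G"
  shows "\<alpha> \<in> Iso2 Vect2 F G \<longleftrightarrow> linear_nat_iso D E F G \<alpha>"
proof
  interpret F: linear_functor D E F by fact
  interpret G: linear_functor D E G by fact
  assume "\<alpha> \<in> Iso2 Vect2 F G"
  then obtain \<beta> where i: "inverse2 Vect2 F G \<alpha> \<beta>" by (auto simp: Iso2_def)
  interpret a: linear_nat D E F G \<alpha> by (rule linear_natI) (use i assms in \<open>auto simp: inverse2_def\<close>)
  interpret b: linear_nat D E G F \<beta> by (rule linear_natI) (use i assms in \<open>auto simp: inverse2_def\<close>)
  show "linear_nat_iso D E F G \<alpha>"
  proof (rule linear_nat_isoI[OF a.linear_nat_axioms])
    fix x assume x: "x \<in> Obj D"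
    have e: "nat_vcomp \<beta> \<alpha> = nat_id F" "nat_vcomp \<alpha> \<beta> = nat_id G" using i by (auto simp: inverse2_def)
    have "cmpt (nat_vcomp \<beta> \<alpha>) x = cmpt (nat_id F) x" "cmpt (nat_vcomp \<alpha> \<beta>) x = cmpt (nat_id G) x"
      unfolding e by simp_all
    then show "isom E (cmpt \<alpha> x)"
      by (intro F.Cd.isomI[of _ "cmpt \<beta> x"]) (use x in auto)
  qed
next
  assume "linear_nat_iso D E F G \<alpha>"
  then have "inverse2 Vect2 F G \<alpha> (nat_inv \<alpha>)"
    using nat_inv_vcomp linear_nat.nat linear_nat_iso.axioms(1) nat_inv_linear
    by (fastforce simp: inverse2_def)
  then show "\<alpha> \<in> Iso2 Vect2 F G" by (auto simp: Iso2_def)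
qed

text \<open>Names the quasi-inverse, unit and counit whose existence membership in
  \<open>Equiv1 Vect2\<close> asserts; \<open>Equiv1_Vect2E\<close> below produces an
  instance.\<close>

locale linear_equivalence = linear_functor D E F
  for D E :: "('o, 'm, 'k :: field) lincat" and F :: "('o, 'm, 'k) linfun" +
  fixes G :: "('o, 'm, 'k) linfun" and \<eta> \<epsilon> :: "('o, 'm, 'k) nattr"
  assumes unit: "linear_nat_iso D D (fun_id D) (fun_comp G F) \<eta>"
    and counit: "linear_nat_iso E E (fun_comp F G) (fun_id E) \<epsilon>"
    and inverse_linear: "linear_functor E D G"
begin

sublocale G: linear_functor E D G by (rule inverse_linear)
sublocale unit: linear_nat_iso D D "fun_id D" "fun_comp G F" \<eta> by (rule unit)
sublocale counit: linear_nat_iso E E "fun_comp F G" "fun_id E" \<epsilon> by (rule counit)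

text \<open>Naturality of the unit recovers an arrow from its image under the composite of
  \<open>F\<close> and \<open>G\<close>, up to invertible factors.\<close>

lemma faithful:
  assumes "f \<in> Arr D" "g \<in> Arr D" "dom_of D f = dom_of D g" "cod_of D f = cod_of D g" "mmap F f = mmap F g"
  shows "f = g"
proof (rule Dm.isom_cancel_left[of "cmpt \<eta> (cod_of D g)"])
  have "cmpt \<eta> (cod_of D g) \<cdot>\<^bsub>D\<^esub> f = mmap G (mmap F f) \<cdot>\<^bsub>D\<^esub> cmpt \<eta> (dom_of D g)"
    using unit.naturality[of f "dom_of D g" "cod_of D g"] assms(1-4) by simp
  also have "\<dots> = cmpt \<eta> (cod_of D g) \<cdot>\<^bsub>D\<^esub> g"
    using unit.naturality[of g "dom_of D g" "cod_of D g"] assms(2) unfolding assms(5) by simp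
  finally show "cmpt \<eta> (cod_of D g) \<cdot>\<^bsub>D\<^esub> f = cmpt \<eta> (cod_of D g) \<cdot>\<^bsub>D\<^esub> g" .
qed (use assms(1-4) in simp_all)

end

lemma linear_equivalence_sym:
  assumes "linear_equivalence D E F G \<eta> \<epsilon>" shows "linear_equivalence E D G F (nat_inv \<epsilon>) (nat_inv \<eta>)"
proof -
  interpret linear_equivalence D E F G \<eta> \<epsilon> by fact
  show ?thesis
    by (simp add: linear_equivalence_def linear_equivalence_axioms_def G.linear_functor_axioms linear_functor_axioms
        nat_inv_linear unit counit)
qed

text \<open>The preimage of \<open>g\<close> is \<open>G g\<close> conjugated with the unit. Its
  image under \<open>G\<close> after \<open>F\<close> is \<open>G g\<close>, and \<open>G\<close> is
  faithful since it is an equivalence too.\<close>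

lemma (in linear_equivalence) full:
  assumes "a \<in> Obj D" "b \<in> Obj D" "g \<in> Arr E" "dom_of E g = omap F a" "cod_of E g = omap F b"
  obtains f where "f \<in> Arr D" "dom_of D f = a" "cod_of D f = b" "mmap F f = g"
proof -
  interpret s: linear_equivalence E D G F "nat_inv \<epsilon>" "nat_inv \<eta>"
    by (rule linear_equivalence_sym[OF linear_equivalence_axioms])
  define f where "f = inv_of D (cmpt \<eta> b) \<cdot>\<^bsub>D\<^esub> mmap G g \<cdot>\<^bsub>D\<^esub> cmpt \<eta> a"
  have f: "f \<in> Arr D" "dom_of D f = a" "cod_of D f = b"
    using assms by (simp_all add: f_def)
  have "mmap G (mmap F f) \<cdot>\<^bsub>D\<^esub> cmpt \<eta> a = cmpt \<eta> b \<cdot>\<^bsub>D\<^esub> f"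
    using unit.naturality[of f a b] f by simp
  also have "\<dots> = mmap G g \<cdot>\<^bsub>D\<^esub> cmpt \<eta> a"
    using assms by (simp add: f_def)
  finally have "mmap G (mmap F f) = mmap G g"
    by (rule Dm.isom_cancel_right[rotated 5]) (use assms f in simp_all)
  then have "mmap F f = g" by (rule s.faithful[rotated 4]) (use f assms in simp_all)
  with f that show thesis by blast
qed

lemma Equiv1_Vect2E:
  assumes "linear_category D" "linear_category E" "F \<in> Equiv1 Vect2 D E"
  obtains G \<eta> \<epsilon> where "linear_equivalence D E F G \<eta> \<epsilon>" "G \<in> Equiv1 Vect2 E D"
proof -
  obtain G where G: "G \<in> Equiv1 Vect2 E D" "Iso2 Vect2 (fun_id D) (fun_comp G F) \<noteq> {}"
    "Iso2 Vect2 (fun_comp F G) (fun_id E) \<noteq> {}"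
    using assms(3) by (rule Equiv1_inverse) simp
  have l: "linear_functor D E F" "linear_functor E D G"
    using Equiv1_Hom1[OF assms(3)] Equiv1_Hom1[OF G(1)] assms by (auto intro: linear_functorI)
  from G obtain \<eta> \<epsilon> where "\<eta> \<in> Iso2 Vect2 (fun_id D) (fun_comp G F)" "\<epsilon> \<in> Iso2 Vect2 (fun_comp F G) (fun_id E)"
    by blast
  then have "linear_equivalence D E F G \<eta> \<epsilon>"
    unfolding linear_equivalence_def linear_equivalence_axioms_def
    using l fun_id_linear[OF assms(1)] fun_id_linear[OF assms(2)] fun_comp_linear[OF l] fun_comp_linear[OF l(2,1)]
    by (simp add: Iso2_Vect2_iff[of D D] Iso2_Vect2_iff[of E E])
  from this G(1) show thesis by (rule that)
qed

section \<open>Traces on semisimple categories\<close>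

context linear_category
begin

lemma Add_assoc':
  "\<lbrakk>f \<in> Arr D; g \<in> Arr D; h \<in> Arr D; dom_of D g = dom_of D f; cod_of D g = cod_of D f;
    dom_of D h = dom_of D f; cod_of D h = cod_of D f\<rbrakk> \<Longrightarrow> (f \<oplus> g) \<oplus> h = f \<oplus> (g \<oplus> h)"
  using Add_assoc[of "dom_of D f" "cod_of D f" f g h] by (simp add: Hom_iff)

lemma Add_commute':
  "\<lbrakk>f \<in> Arr D; g \<in> Arr D; dom_of D g = dom_of D f; cod_of D g = cod_of D f\<rbrakk> \<Longrightarrow> f \<oplus> g = g \<oplus> f"
  by (rule Add_commute[of "dom_of D f" "cod_of D f" f g]) (simp_all add: Hom_iff)

lemma Add_Zer_right [simp]: "\<lbrakk>f \<in> Arr D; dom_of D f = a; cod_of D f = b\<rbrakk> \<Longrightarrow> f \<oplus> Zer D a b = f"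
  by (rule Add_Zer) (auto simp: Hom_iff)

lemma Add_Zer_left [simp]: "\<lbrakk>f \<in> Arr D; dom_of D f = a; cod_of D f = b\<rbrakk> \<Longrightarrow> Zer D a b \<oplus> f = f"
  by (subst Add_commute') auto

lemma Cmp_Add_left' [simp]:
  "\<lbrakk>f \<in> Arr D; g \<in> Arr D; h \<in> Arr D; dom_of D g = cod_of D f; dom_of D h = cod_of D f; cod_of D h = cod_of D g\<rbrakk>
    \<Longrightarrow> (g \<oplus> h) \<cdot> f = g \<cdot> f \<oplus> h \<cdot> f"
  by (rule Cmp_Add_left[of "dom_of D f" "cod_of D f" "cod_of D g"]) (auto simp: Hom_iff)

lemma Cmp_Add_right' [simp]:
  "\<lbrakk>f \<in> Arr D; g \<in> Arr D; h \<in> Arr D; dom_of D g = dom_of D f; cod_of D g = cod_of D f; dom_of D h = cod_of D f\<rbrakk>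
    \<Longrightarrow> h \<cdot> (f \<oplus> g) = h \<cdot> f \<oplus> h \<cdot> g"
  by (rule Cmp_Add_right[of "dom_of D f" "cod_of D f" "cod_of D h"]) (auto simp: Hom_iff)

lemma Cmp_Scl' [simp]:
  assumes "f \<in> Arr D" "g \<in> Arr D" "dom_of D g = cod_of D f"
  shows "(r *\<^sub>L g) \<cdot> f = r *\<^sub>L (g \<cdot> f)" "g \<cdot> (r *\<^sub>L f) = r *\<^sub>L (g \<cdot> f)"
  using Cmp_Scl[of "dom_of D f" "cod_of D f" "cod_of D g" f g r] assms by (simp_all add: Hom_iff)

lemma Scl_one' [simp]: "f \<in> Arr D \<Longrightarrow> 1 *\<^sub>L f = f"
  by (rule Scl_one[of "dom_of D f" "cod_of D f"]) (auto simp: Hom_iff)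

lemma Scl_Scl' [simp]: "f \<in> Arr D \<Longrightarrow> r *\<^sub>L (s *\<^sub>L f) = (r * s) *\<^sub>L f"
  by (rule Scl_Scl[of "dom_of D f" "cod_of D f"]) (auto simp: Hom_iff)

lemma Scl_add: "f \<in> Arr D \<Longrightarrow> (r + s) *\<^sub>L f = r *\<^sub>L f \<oplus> s *\<^sub>L f"
  by (rule Scl_Add_left[of "dom_of D f" "cod_of D f"]) (auto simp: Hom_iff)

lemma Scl_Add [simp]:
  "\<lbrakk>f \<in> Arr D; g \<in> Arr D; dom_of D g = dom_of D f; cod_of D g = cod_of D f\<rbrakk>
    \<Longrightarrow> r *\<^sub>L (f \<oplus> g) = r *\<^sub>L f \<oplus> r *\<^sub>L g"
  by (rule Scl_Add_right[of "dom_of D f" "cod_of D f"]) (auto simp: Hom_iff)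

text \<open>The axioms only assert that additive inverses exist. This cancellation is the source of
  all the laws for zero morphisms and zero scalars that follow.\<close>

lemma Add_self_Zer:
  assumes f: "f \<in> Arr D" "dom_of D f = a" "cod_of D f = b" and e: "f \<oplus> f = f"
  shows "f = Zer D a b"
proof -
  have ab: "a \<in> Obj D" "b \<in> Obj D" using f by auto
  obtain g where g: "g \<in> Hom D a b" "f \<oplus> g = Zer D a b"
    using Add_inverse[OF ab, of f] f ab by (auto simp: Hom_iff)
  have "f = f \<oplus> (f \<oplus> g)" using f g by simp
  also have "\<dots> = (f \<oplus> f) \<oplus> g" using f g ab by (subst Add_assoc') (auto simp: Hom_iff)
  finally show ?thesis using e g by simp
qed

lemma Scl_zero [simp]:
  assumes "f \<in> Arr D" "dom_of D f = a" "cod_of D f = b" shows "0 *\<^sub>L f = Zer D a b"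
  by (rule Add_self_Zer) (use assms in \<open>simp_all flip: Scl_add\<close>)

lemma Scl_Zer [simp]: assumes "a \<in> Obj D" "b \<in> Obj D" shows "r *\<^sub>L Zer D a b = Zer D a b"
  by (rule Add_self_Zer) (use assms in \<open>simp_all flip: Scl_Add\<close>)

lemma Zer_Cmp [simp]:
  assumes "f \<in> Arr D" "cod_of D f = b" "c \<in> Obj D" shows "Zer D b c \<cdot> f = Zer D (dom_of D f) c"
proof (rule Add_self_Zer)
  have b: "b \<in> Obj D" using assms by auto
  then show "Zer D b c \<cdot> f \<oplus> Zer D b c \<cdot> f = Zer D b c \<cdot> f"
    using assms by (subst Cmp_Add_left'[symmetric]) auto
qed (use assms in auto)

lemma Cmp_Zer [simp]:
  assumes "f \<in> Arr D" "dom_of D f = b" "a \<in> Obj D" shows "f \<cdot> Zer D a b = Zer D a (cod_of D f)"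
proof (rule Add_self_Zer)
  have b: "b \<in> Obj D" using assms by auto
  then show "f \<cdot> Zer D a b \<oplus> f \<cdot> Zer D a b = f \<cdot> Zer D a b"
    using assms by (subst Cmp_Add_right'[symmetric]) auto
qed (use assms in auto)

lemma Add_neg: "\<lbrakk>f \<in> Arr D; dom_of D f = a; cod_of D f = b\<rbrakk> \<Longrightarrow> f \<oplus> (-1) *\<^sub>L f = Zer D a b"
  using Scl_add[of f 1 "-1"] by simp

lemma eq_if_diff_Zer:
  assumes "f \<in> Arr D" "g \<in> Arr D" "dom_of D g = dom_of D f" "cod_of D g = cod_of D f"
    and "f \<oplus> (-1) *\<^sub>L g = Zer D (dom_of D f) (cod_of D f)"
  shows "f = g"
proof -
  have "f = f \<oplus> (g \<oplus> (-1) *\<^sub>L g)" using assms by (simp add: Add_neg)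
  also have "\<dots> = f \<oplus> ((-1) *\<^sub>L g \<oplus> g)"
    using assms by (subst Add_commute'[of g]) auto
  also have "\<dots> = (f \<oplus> (-1) *\<^sub>L g) \<oplus> g" using assms(1-4) by (subst Add_assoc') auto
  also have "\<dots> = g" using assms by simp
  finally show ?thesis .
qed

lemma Scl_eq_Zer:
  assumes "f \<in> Arr D" "dom_of D f = a" "cod_of D f = b" "r *\<^sub>L f = Zer D a b" "r \<noteq> 0"
  shows "f = Zer D a b"
proof -
  have "f = inverse r *\<^sub>L (r *\<^sub>L f)" using assms(1,5) by simp
  also have "\<dots> = Zer D a b" unfolding assms(4) using assms(1-3) by auto
  finally show ?thesis .
qed

lemma hom_sum_Arr [simp]:
  assumes "a \<in> Obj D" "b \<in> Obj D" "\<And>k. k < n \<Longrightarrow> u k \<in> Arr D \<and> dom_of D (u k) = a \<and> cod_of D (u k) = b"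
  shows "hom_sum D a b u n \<in> Arr D" "dom_of D (hom_sum D a b u n) = a" "cod_of D (hom_sum D a b u n) = b"
  using assms(3) by (induction n) (auto simp: assms(1,2))

lemma Cmp_hom_sum:
  assumes "a \<in> Obj D" "b \<in> Obj D" "\<And>k. k < n \<Longrightarrow> u k \<in> Arr D \<and> dom_of D (u k) = a \<and> cod_of D (u k) = b"
    and "g \<in> Arr D" "dom_of D g = b"
  shows "g \<cdot> hom_sum D a b u n = hom_sum D a (cod_of D g) (\<lambda>k. g \<cdot> u k) n"
  using assms(3) by (induction n) (auto simp: assms(1,2,4,5))

lemma hom_sum_Cmp:
  assumes "a \<in> Obj D" "b \<in> Obj D" "\<And>k. k < n \<Longrightarrow> u k \<in> Arr D \<and> dom_of D (u k) = a \<and> cod_of D (u k) = b"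
    and "f \<in> Arr D" "cod_of D f = a"
  shows "hom_sum D a b u n \<cdot> f = hom_sum D (dom_of D f) b (\<lambda>k. u k \<cdot> f) n"
  using assms(3) by (induction n) (auto simp: assms(1,2,4,5))

lemma hom_sum_cong: "(\<And>k. k < n \<Longrightarrow> u k = v k) \<Longrightarrow> hom_sum D a b u n = hom_sum D a b v n"
  by (induction n) auto

lemma hom_sum_Zer: "\<lbrakk>a \<in> Obj D; b \<in> Obj D\<rbrakk> \<Longrightarrow> hom_sum D a b (\<lambda>_. Zer D a b) n = Zer D a b"
  by (induction n) auto

lemma additive_hom_sum:
  fixes \<phi> :: "'m \<Rightarrow> 'k"
  assumes ab: "a \<in> Obj D" "b \<in> Obj D"
    and u: "\<And>k. k < n \<Longrightarrow> u k \<in> Arr D \<and> dom_of D (u k) = a \<and> cod_of D (u k) = b"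
    and add: "\<And>f g. \<lbrakk>f \<in> Arr D; g \<in> Arr D; dom_of D f = a; cod_of D f = b; dom_of D g = a; cod_of D g = b\<rbrakk>
      \<Longrightarrow> \<phi> (f \<oplus> g) = \<phi> f + \<phi> g"
  shows "\<phi> (hom_sum D a b u n) = (\<Sum>k<n. \<phi> (u k))"
  using u
proof (induction n)
  case 0
  \<comment> \<open>Additivity alone makes \<open>\<phi>\<close> vanish at zero, as the value there
    equals its own double.\<close>
  have "\<phi> (Zer D a b \<oplus> Zer D a b) = \<phi> (Zer D a b) + \<phi> (Zer D a b)"
    by (rule add) (use ab in auto)
  then have "\<phi> (Zer D a b) = \<phi> (Zer D a b) + \<phi> (Zer D a b)" using ab by simp
  then have "\<phi> (Zer D a b) = 0" by (metis add_cancel_right_right)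
  then show ?case by simp
next
  case (Suc n)
  then have "\<phi> (hom_sum D a b u n \<oplus> u n) = \<phi> (hom_sum D a b u n) + \<phi> (u n)"
    using ab by (intro add) auto
  then show ?case using Suc by simp
qed

lemma is_iso_iff: "\<lbrakk>a \<in> Obj D; b \<in> Obj D\<rbrakk>
    \<Longrightarrow> is_iso D a b f \<longleftrightarrow> isom D f \<and> dom_of D f = a \<and> cod_of D f = b"
  unfolding is_iso_def isom_def by (auto simp: Hom_iff)

lemma zero_object_if_Idt_Zer:
  assumes "a \<in> Obj D" "Idt D a = Zer D a a"
  shows "zero_object D a"
proof -
  have "f = Zer D b a" if "f \<in> Hom D b a" "b \<in> Obj D" for b f
  proof -
    have "f = Idt D a \<cdot> f" using that assms(1) by (simp add: Hom_iff)
    also have "\<dots> = Zer D b a" unfolding assms(2) using that assms(1) by (simp add: Hom_iff)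
    finally show ?thesis .
  qed
  moreover have "f = Zer D a b" if "f \<in> Hom D a b" "b \<in> Obj D" for b f
  proof -
    have "f = f \<cdot> Idt D a" using that assms(1) by (simp add: Hom_iff)
    also have "\<dots> = Zer D a b" unfolding assms(2) using that assms(1) by (simp add: Hom_iff)
    finally show ?thesis .
  qed
  ultimately show ?thesis
    unfolding zero_object_def using assms(1) Zer_closed by blast
qed

lemma lin_span_Arr:
  assumes "a \<in> Obj D" "b \<in> Obj D" "S \<subseteq> Hom D a b" "g \<in> lin_span D a b S"
  shows "g \<in> Arr D \<and> dom_of D g = a \<and> cod_of D g = b"
  using assms(4)
proof induction
  case (2 f g r)
  then have "f \<in> Hom D a b" using assms(3) by blast
  then show ?case using 2 assms(1,2) by (auto simp: Hom_iff)
qed (use assms in auto)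

lemma lin_span_Add:
  assumes ab: "a \<in> Obj D" "b \<in> Obj D" "S \<subseteq> Hom D a b" and g: "g \<in> lin_span D a b S" "h \<in> lin_span D a b S"
  shows "g \<oplus> h \<in> lin_span D a b S"
  using g(1)
proof induction
  case 1 then show ?case using lin_span_Arr[OF ab g(2)] g(2) by simp
next
  case (2 f g r)
  have "f \<in> Hom D a b" using 2 ab(3) by blast
  then have "((r *\<^sub>L f) \<oplus> g) \<oplus> h = (r *\<^sub>L f) \<oplus> (g \<oplus> h)"
    using lin_span_Arr[OF ab 2(2)] lin_span_Arr[OF ab g(2)] ab by (subst Add_assoc') (auto simp: Hom_iff)
  then show ?case using lin_span.intros(2)[OF 2(1,3)] by metis
qed

lemma lin_span_Scl:
  assumes ab: "a \<in> Obj D" "b \<in> Obj D" "S \<subseteq> Hom D a b" and g: "g \<in> lin_span D a b S"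
  shows "c *\<^sub>L g \<in> lin_span D a b S"
  using g
proof induction
  case 1 then show ?case using ab by (simp add: lin_span.intros)
next
  case (2 f g r)
  have "f \<in> Hom D a b" using 2 ab(3) by blast
  then have "c *\<^sub>L ((r *\<^sub>L f) \<oplus> g) = ((c * r) *\<^sub>L f) \<oplus> c *\<^sub>L g"
    using lin_span_Arr[OF ab 2(2)] ab by (auto simp: Hom_iff)
  then show ?case using lin_span.intros(2)[OF 2(1,3)] by metis
qed

text \<open>Splitting off one generator serves as the induction step of \<open>peval_kernel\<close>.
  The coefficient \<open>c\<close> need not be unique, since generators may be linearly
  dependent.\<close>

lemma lin_span_insert:
  assumes ab: "a \<in> Obj D" "b \<in> Obj D" "insert x S \<subseteq> Hom D a b" and g: "g \<in> lin_span D a b (insert x S)"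
  shows "\<exists>c. \<exists>h \<in> lin_span D a b S. g = (c *\<^sub>L x) \<oplus> h"
  using g
proof induction
  case 1
  have "Zer D a b = (0 *\<^sub>L x) \<oplus> Zer D a b" using ab by (simp add: Hom_iff)
  then show ?case by (intro exI bexI[OF _ lin_span.intros(1)])
next
  case (2 f g r)
  have x: "x \<in> Arr D" "dom_of D x = a" "cod_of D x = b" and f: "f \<in> Arr D" "dom_of D f = a" "cod_of D f = b"
    using 2 ab by (auto simp: Hom_iff)
  from 2 obtain c h where h: "h \<in> lin_span D a b S" "g = (c *\<^sub>L x) \<oplus> h" by blast
  have h': "h \<in> Arr D \<and> dom_of D h = a \<and> cod_of D h = b" using lin_span_Arr[OF ab(1,2) _ h(1)] ab by blast
  show ?case
  proof (cases "f = x")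
    case True
    have "(r *\<^sub>L f) \<oplus> g = ((r + c) *\<^sub>L x) \<oplus> h"
      unfolding h(2) True using x h' by (subst Add_assoc'[symmetric]) (auto simp: Scl_add)
    then show ?thesis using h(1) by blast
  next
    case False
    have "(r *\<^sub>L f) \<oplus> g = ((r *\<^sub>L f) \<oplus> (c *\<^sub>L x)) \<oplus> h"
      unfolding h(2) using x f h' by (subst Add_assoc') auto
    also have "\<dots> = ((c *\<^sub>L x) \<oplus> (r *\<^sub>L f)) \<oplus> h"
      using x f by (subst Add_commute') auto
    also have "\<dots> = (c *\<^sub>L x) \<oplus> ((r *\<^sub>L f) \<oplus> h)"
      using x f h' by (subst Add_assoc') auto
    finally have "(r *\<^sub>L f) \<oplus> g = (c *\<^sub>L x) \<oplus> ((r *\<^sub>L f) \<oplus> h)" .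
    moreover have "(r *\<^sub>L f) \<oplus> h \<in> lin_span D a b S"
      using False 2(1) h(1) by (blast intro: lin_span.intros)
    ultimately show ?thesis by blast
  qed
qed

section \<open>Polynomials in an endomorphism and Schur's lemma\<close>

definition peval :: "'o \<Rightarrow> 'm \<Rightarrow> 'k poly \<Rightarrow> 'm" where
  "peval s f p = fold_coeffs (\<lambda>c g. c *\<^sub>L Idt D s \<oplus> f \<cdot> g) p (Zer D s s)"

context
  fixes s f
  assumes s: "s \<in> Obj D" and f: "f \<in> Arr D" "dom_of D f = s" "cod_of D f = s"
begin

lemma peval_0 [simp]: "peval s f 0 = Zer D s s"
  by (simp add: peval_def)

lemma peval_pCons [simp]: "peval s f (pCons c p) = c *\<^sub>L Idt D s \<oplus> f \<cdot> peval s f p"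
proof (cases "p = 0 \<and> c = 0")
  case True then show ?thesis using s f by (simp add: peval_def)
qed (auto simp: peval_def)

lemma peval_Arr [simp]: "peval s f p \<in> Arr D" "dom_of D (peval s f p) = s" "cod_of D (peval s f p) = s"
  by (induction p) (use s f in auto)

lemma peval_add: "peval s f (p + q) = peval s f p \<oplus> peval s f q"
proof (induction p arbitrary: q)
  case 0 then show ?case by simp
next
  case (pCons c p)
  obtain d q' where q: "q = pCons d q'" by (cases q)
  let ?i = "Idt D s" and ?p = "f \<cdot> peval s f p" and ?q = "f \<cdot> peval s f q'"
  have "peval s f (pCons c p + q) = (c *\<^sub>L ?i \<oplus> d *\<^sub>L ?i) \<oplus> (?p \<oplus> ?q)"
    unfolding q using s f by (simp add: pCons.IH Scl_add)
  also have "\<dots> = c *\<^sub>L ?i \<oplus> ((d *\<^sub>L ?i \<oplus> ?p) \<oplus> ?q)"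
    using s f by (simp add: Add_assoc')
  also have "\<dots> = c *\<^sub>L ?i \<oplus> ((?p \<oplus> d *\<^sub>L ?i) \<oplus> ?q)"
    using s f by (subst (2) Add_commute') auto
  also have "\<dots> = (c *\<^sub>L ?i \<oplus> ?p) \<oplus> (d *\<^sub>L ?i \<oplus> ?q)"
    using s f by (simp add: Add_assoc')
  finally show ?case unfolding q by simp
qed

lemma peval_smult: "peval s f (smult c p) = c *\<^sub>L peval s f p"
  by (induction p) (use s f in auto)

text \<open>
  An infinite-dimensional space of polynomials cannot be evaluated injectively into a
  finite-dimensional one: intersecting it with a hyperplane keeps it infinite-dimensional.
\<close>

lemma peval_kernel:
  assumes "finite S" "S \<subseteq> Hom D s s"
    and "\<And>p q. \<lbrakk>p \<in> W; q \<in> W\<rbrakk> \<Longrightarrow> p + q \<in> W" "\<And>c p. p \<in> W \<Longrightarrow> smult c p \<in> W"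
    and "\<And>N. \<exists>p \<in> W. degree p > N"
    and "\<And>p. p \<in> W \<Longrightarrow> peval s f p \<in> lin_span D s s S"
  shows "\<exists>p \<in> W. p \<noteq> 0 \<and> peval s f p = Zer D s s"
  using assms
proof (induction S arbitrary: W)
  case empty
  obtain p where p: "p \<in> W" "degree p > 0" using empty by blast
  have "lin_span D s s {} = {Zer D s s}" by (auto elim: lin_span.cases intro: lin_span.intros)
  then have "peval s f p = Zer D s s" using p(1) empty.prems(5) by blast
  moreover have "p \<noteq> 0" using p(2) by auto
  ultimately show ?case using p(1) by blast
next
  case (insert x S)
  have S: "S \<subseteq> Hom D s s" and x: "x \<in> Arr D" "dom_of D x = s" "cod_of D x = s"
    using insert.prems(1) s by (auto simp: Hom_iff)
  \<comment> \<open>The smaller space is cut out by membership in the smaller span and not by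
    vanishing of the coefficient of \<open>x\<close>, which is not well defined if the generators
    are dependent.\<close>
  define W' where "W' = {p \<in> W. peval s f p \<in> lin_span D s s S}"
  have "\<exists>p \<in> W'. degree p > N" for N
  proof (cases "W \<subseteq> W'")
    case True then show ?thesis using insert.prems(4) by blast
  next
    case False
    then obtain p0 where p0: "p0 \<in> W" "peval s f p0 \<notin> lin_span D s s S" unfolding W'_def by blast
    obtain c0 h0 where h0: "h0 \<in> lin_span D s s S" "peval s f p0 = (c0 *\<^sub>L x) \<oplus> h0"
      using lin_span_insert[OF s s insert.prems(1) insert.prems(5)[OF p0(1)]] by blast
    have h0': "h0 \<in> Arr D \<and> dom_of D h0 = s \<and> cod_of D h0 = s" using lin_span_Arr[OF s s S h0(1)] .
    have c0: "c0 \<noteq> 0" using p0(2) h0 h0' x by auto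
    \<comment> \<open>A degree above that of \<open>p0\<close> ensures that adding a multiple of
      \<open>p0\<close> to \<open>p\<close> leaves the degree unchanged, so \<open>W'\<close> keeps
      polynomials of unbounded degree.\<close>
    obtain p where p: "p \<in> W" "degree p > max N (degree p0)" using insert.prems(4) by blast
    obtain c h where h: "h \<in> lin_span D s s S" "peval s f p = (c *\<^sub>L x) \<oplus> h"
      using lin_span_insert[OF s s insert.prems(1) insert.prems(5)[OF p(1)]] by blast
    have h': "h \<in> Arr D \<and> dom_of D h = s \<and> cod_of D h = s" using lin_span_Arr[OF s s S h(1)] .
    \<comment> \<open>Chosen so that the multiples of \<open>x\<close> in the values of
      \<open>p\<close> and \<open>smult e p0\<close> cancel; \<open>c0\<close> is nonzero because
      \<open>p0\<close> lies outside \<open>W'\<close>.\<close>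
    define e where "e = - c / c0"
    have ce: "c + e * c0 = 0" using c0 by (simp add: e_def)
    define q where "q = p + smult e p0"
    have "q \<in> W" using p p0 insert.prems by (simp add: q_def)
    moreover have "degree q = degree p"
      unfolding q_def by (rule degree_add_eq_left)
        (use p(2) degree_smult_le[of e p0] in linarith)
    moreover have "peval s f q = h \<oplus> e *\<^sub>L h0"
    proof -
      have "peval s f q = ((c *\<^sub>L x) \<oplus> h) \<oplus> (((e * c0) *\<^sub>L x) \<oplus> e *\<^sub>L h0)"
        unfolding q_def peval_add peval_smult h h0 using x h' h0' by simp
      also have "\<dots> = (c *\<^sub>L x \<oplus> (e * c0) *\<^sub>L x) \<oplus> (h \<oplus> e *\<^sub>L h0)"
      proof -
        have "(c *\<^sub>L x \<oplus> h) \<oplus> (((e * c0) *\<^sub>L x) \<oplus> e *\<^sub>L h0) = c *\<^sub>L x \<oplus> ((h \<oplus> (e * c0) *\<^sub>L x) \<oplus> e *\<^sub>L h0)"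
          using x h' h0' by (simp add: Add_assoc')
        also have "\<dots> = c *\<^sub>L x \<oplus> (((e * c0) *\<^sub>L x \<oplus> h) \<oplus> e *\<^sub>L h0)"
          using x h' by (subst Add_commute'[of h]) auto
        also have "\<dots> = (c *\<^sub>L x \<oplus> (e * c0) *\<^sub>L x) \<oplus> (h \<oplus> e *\<^sub>L h0)"
          using x h' h0' by (simp add: Add_assoc')
        finally show ?thesis .
      qed
      also have "\<dots> = h \<oplus> e *\<^sub>L h0"
        using x h' h0' by (simp add: ce flip: Scl_add)
      finally show ?thesis .
    qed
    moreover have "h \<oplus> e *\<^sub>L h0 \<in> lin_span D s s S"
      by (intro lin_span_Add lin_span_Scl s S h(1) h0(1))
    ultimately have "q \<in> W'" "degree q > N" using p by (auto simp: W'_def)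
    then show ?thesis by blast
  qed
  then have "\<exists>p \<in> W'. p \<noteq> 0 \<and> peval s f p = Zer D s s"
    using insert.prems S by (intro insert.IH) (auto simp: W'_def peval_add peval_smult intro!: lin_span_Add lin_span_Scl s)
  then show ?case by (auto simp: W'_def)
qed

end

end

text \<open>Schur's lemma. Simplicity of \<open>s\<close> leaves two options for the kernel
  inclusion of \<open>f\<close>. If it is invertible, then \<open>f\<close> is zero. If the kernel
  is a zero object, then \<open>f\<close> is monic, and simplicity of \<open>t\<close> makes it
  invertible, because \<open>s\<close> is not a zero object.\<close>

lemma (in abelian_category) simple_isom:
  assumes s: "simple_object D s" and t: "simple_object D t"
    and f: "f \<in> Arr D" "dom_of D f = s" "cod_of D f = t" and nz: "f \<noteq> Zer D s t"
  shows "isom D f"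
proof -
  have st: "s \<in> Obj D" "t \<in> Obj D" using s t by (auto simp: simple_object_def)
  obtain c i where k: "is_kernel D s t f c i" using has_kernels[OF st, of f] f st by (auto simp: Hom_iff)
  then have c: "c \<in> Obj D" and i: "i \<in> Arr D" "dom_of D i = c" "cod_of D i = s" and fi: "f \<cdot> i = Zer D c t"
    using st by (auto simp: is_kernel_def Hom_iff)
  have univ: "\<And>x u. x \<in> Obj D \<Longrightarrow> u \<in> Hom D x s \<Longrightarrow> f \<cdot> u = Zer D x t \<Longrightarrow> \<exists>!v. v \<in> Hom D x c \<and> i \<cdot> v = u"
    using k by (auto simp: is_kernel_def)
  have "monic D c s i"
    unfolding monic_def
  proof (intro conjI ballI impI)
    show "i \<in> Hom D c s" using i c st by (simp add: Hom_iff)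
    fix x u v assume x: "x \<in> Obj D" "u \<in> Hom D x c" "v \<in> Hom D x c" "i \<cdot> u = i \<cdot> v"
    have "f \<cdot> i \<cdot> u = (f \<cdot> i) \<cdot> u" using x i f c by (simp add: Hom_iff)
    also have "\<dots> = Zer D x t" unfolding fi using x c st by (simp add: Hom_iff)
    finally have "\<exists>!w. w \<in> Hom D x c \<and> i \<cdot> w = i \<cdot> u"
      using x i c st by (intro univ) (auto simp: Hom_iff)
    then show "u = v" using x by auto
  qed
  then consider "zero_object D c" | "is_iso D c s i" using s c unfolding simple_object_def by blast
  then show ?thesis
  proof cases
    case 2
    then have ii: "isom D i" using c st by (simp add: is_iso_iff)
    have "f = (f \<cdot> i) \<cdot> inv_of D i" using ii i f by simp
    also have "\<dots> = Zer D s t" unfolding fi using ii i st by simp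
    finally show ?thesis using nz by simp
  next
    case 1
    have "monic D s t f"
      unfolding monic_def
    proof (intro conjI ballI impI)
      show "f \<in> Hom D s t" using f st by (simp add: Hom_iff)
      fix x u v assume x: "x \<in> Obj D" "u \<in> Hom D x s" "v \<in> Hom D x s" "f \<cdot> u = f \<cdot> v"
      then have u: "u \<in> Arr D" "dom_of D u = x" "cod_of D u = s" and v: "v \<in> Arr D" "dom_of D v = x" "cod_of D v = s"
        using st by (auto simp: Hom_iff)
      \<comment> \<open>The difference of \<open>u\<close> and \<open>v\<close> is killed by
        \<open>f\<close>, so it factors through the zero object \<open>c\<close>.\<close>
      have "f \<cdot> (u \<oplus> (-1) *\<^sub>L v) = f \<cdot> u \<oplus> (-1) *\<^sub>L (f \<cdot> v)" using u v f by simp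
      also have "\<dots> = Zer D x t" unfolding x(4) using v f by (simp add: Add_neg)
      finally obtain w where w: "w \<in> Hom D x c" "i \<cdot> w = u \<oplus> (-1) *\<^sub>L v"
        using univ[of x "u \<oplus> (-1) *\<^sub>L v"] x u v st by (auto simp: Hom_iff)
      have "w = Zer D x c" using 1 w x c Zer_closed unfolding zero_object_def by blast
      then have "u \<oplus> (-1) *\<^sub>L v = Zer D (dom_of D u) (cod_of D u)" using w(2) i x u by auto
      then show "u = v" by (rule eq_if_diff_Zer[rotated 4]) (use u v in auto)
    qed
    moreover have "\<not> zero_object D s" using s by (simp add: simple_object_def)
    ultimately show ?thesis using t st unfolding simple_object_def by (auto simp: is_iso_iff)
  qed
qed

locale semisimple_category = finite_category D
  for D :: "('o, 'm, 'k :: alg_closed_field) lincat" (structure) +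
  assumes is_semisimple: "semisimple D"
begin

lemma simple_Obj [simp]: "simple_object D s \<Longrightarrow> s \<in> Obj D"
  by (simp add: simple_object_def)

lemma simple_Idt: "simple_object D s \<Longrightarrow> Idt D s \<noteq> Zer D s s"
  using zero_object_if_Idt_Zer unfolding simple_object_def by blast

text \<open>The Hom-space is finite-dimensional, so some nonzero polynomial kills \<open>f\<close>;
  take one of least degree. It is not constant, hence has a root \<open>r\<close>, and it factors as
  \<open>[:- r, 1:] * q\<close>. By minimality \<open>q\<close> does not kill \<open>f\<close>, so
  \<open>f\<close> minus \<open>r\<close> times the identity is not invertible, and by Schur's lemma
  it is zero.\<close>

lemma simple_scalar:
  assumes s: "simple_object D s" and f: "f \<in> Arr D" "dom_of D f = s" "cod_of D f = s"
  shows "\<exists>r. f = r *\<^sub>L Idt D s"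
proof -
  have so: "s \<in> Obj D" using s by simp
  note pe = peval_0[OF so f] peval_pCons[OF so f] peval_Arr[OF so f] peval_add[OF so f] peval_smult[OF so f]
  obtain S where S: "finite S" "S \<subseteq> Hom D s s" "Hom D s s = lin_span D s s S"
    using finite_dim_Hom[OF so so] by blast
  have "\<exists>p \<in> (UNIV :: 'k poly set). degree p > N" for N
    by (rule bexI[of _ "monom (1 :: 'k) (Suc N)"]) (auto simp: degree_monom_eq)
  moreover have "peval s f p \<in> lin_span D s s S" for p
    using pe so by (simp add: Hom_iff flip: S(3))
  ultimately have ex: "\<exists>p. p \<noteq> 0 \<and> peval s f p = Zer D s s"
    using peval_kernel[OF so f S(1,2), of UNIV] by auto
  define p where "p = (ARG_MIN degree p. p \<noteq> 0 \<and> peval s f p = Zer D s s)"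
  have p: "p \<noteq> 0" "peval s f p = Zer D s s"
    using arg_min_natI[of "\<lambda>p. p \<noteq> 0 \<and> peval s f p = Zer D s s"] ex unfolding p_def by blast+
  have min: "degree p \<le> degree q" if "q \<noteq> 0" "peval s f q = Zer D s s" for q
    unfolding p_def using that by (intro arg_min_nat_le) auto
  have "degree p > 0"
  proof (rule ccontr)
    assume "\<not> degree p > 0"
    then obtain c where c: "p = [:c:]" by (metis degree_eq_zeroE not_gr0)
    then have "c *\<^sub>L Idt D s = Zer D s s" using p(2) pe so f by simp
    then have "Idt D s = Zer D s s" by (rule Scl_eq_Zer[rotated 3]) (use so c p in auto)
    then show False using simple_Idt[OF s] by simp
  qed
  then obtain r where "poly p r = 0" using alg_closed_imp_poly_has_root by blast
  then obtain q where q: "p = [:- r, 1:] * q" using poly_eq_0_iff_dvd by blast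
  let ?g = "f \<oplus> (-1) *\<^sub>L (r *\<^sub>L Idt D s)"
  have g: "?g \<in> Arr D" "dom_of D ?g = s" "cod_of D ?g = s" using so f by auto
  have "q \<noteq> 0" using q p by auto
  moreover from this have "degree p = degree [:- r, 1:] + degree q"
    unfolding q by (intro degree_mult_eq) auto
  ultimately have nz: "peval s f q \<noteq> Zer D s s" using min[of q] by auto
  have e: "p = smult (- r) q + pCons 0 q" using q by simp
  have "peval s f p = (- r) *\<^sub>L peval s f q \<oplus> f \<cdot> peval s f q"
    unfolding e pe(6,7) using so f pe(1-5) by simp
  also have "\<dots> = ?g \<cdot> peval s f q"
    using so f pe by (subst Add_commute') auto
  finally have 0: "?g \<cdot> peval s f q = Zer D s s" using p(2) by simp
  have "?g = Zer D s s"
  proof (rule ccontr)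
    assume "?g \<noteq> Zer D s s"
    then have "isom D ?g" using simple_isom[OF s s g] by simp
    from isom_cancel_left[OF this, of "peval s f q" "Zer D s s"] have "peval s f q = Zer D s s"
      using 0 g so pe f by simp
    with nz show False by simp
  qed
  then have "f = r *\<^sub>L Idt D s"
    by (intro eq_if_diff_Zer[of f "r *\<^sub>L Idt D s"]) (use so f in simp_all)
  then show ?thesis by blast
qed

end

section \<open>Decompositions into simple objects and the canonical trace\<close>

definition decomposition ::
  "('o, 'm, 'k) lincat \<Rightarrow> 'o \<Rightarrow> nat \<Rightarrow> (nat \<Rightarrow> 'o) \<Rightarrow> (nat \<Rightarrow> 'm) \<Rightarrow> (nat \<Rightarrow> 'm) \<Rightarrow> bool" where
  "decomposition D x n s i p \<longleftrightarrow> x \<in> Obj D \<and> (\<forall>k < n. simple_object D (s k) \<and>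
     i k \<in> Arr D \<and> dom_of D (i k) = s k \<and> cod_of D (i k) = x \<and>
     p k \<in> Arr D \<and> dom_of D (p k) = x \<and> cod_of D (p k) = s k) \<and>
     (\<forall>j < n. \<forall>k < n. p j \<cdot>\<^bsub>D\<^esub> i k = (if j = k then Idt D (s k) else Zer D (s k) (s j))) \<and>
     hom_sum D x x (\<lambda>k. i k \<cdot>\<^bsub>D\<^esub> p k) n = Idt D x"

text \<open>The identification of the endomorphism ring of a simple object with the field. Existence
  of the scalar is \<open>simple_scalar\<close>; uniqueness holds as the identity of a simple object
  is nonzero.\<close>

definition scalar_of :: "('o, 'm, 'k) lincat \<Rightarrow> 'o \<Rightarrow> 'm \<Rightarrow> 'k" where
  "scalar_of D s f = (THE r. f = r *\<^sub>L\<^bsub>D\<^esub> Idt D s)"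

text \<open>The trace of the matrix of \<open>f\<close> in the given decomposition, every simple
  summand having weight 1.\<close>

definition decomposition_trace ::
  "('o, 'm, 'k :: field) lincat \<Rightarrow> nat \<Rightarrow> (nat \<Rightarrow> 'o) \<Rightarrow> (nat \<Rightarrow> 'm) \<Rightarrow> (nat \<Rightarrow> 'm) \<Rightarrow> 'm \<Rightarrow> 'k" where
  "decomposition_trace D n s i p f = (\<Sum>k<n. scalar_of D (s k) (p k \<cdot>\<^bsub>D\<^esub> f \<cdot>\<^bsub>D\<^esub> i k))"

text \<open>The choice of a decomposition is harmless for endomorphisms:
  \<open>canonical_trace_eq\<close> shows that all give the same value.\<close>

definition canonical_trace :: "('o, 'm, 'k :: field) lincat \<Rightarrow> 'o \<Rightarrow> 'm \<Rightarrow> 'k" where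
  "canonical_trace D x f = (SOME r. \<exists>n s i p. decomposition D x n s i p \<and> r = decomposition_trace D n s i p f)"

text \<open>What the canonical trace, its twists, arbitrary Calabi-Yau traces and pullbacks along
  functors have in common: linearity and cyclicity. \<open>trace_decomposition\<close> shows how
  rigid such traces are.\<close>

definition cyclic_trace :: "('o, 'm, 'k :: field) lincat \<Rightarrow> ('o \<Rightarrow> 'm \<Rightarrow> 'k) \<Rightarrow> bool" where
  "cyclic_trace D t \<longleftrightarrow>
     (\<forall>c \<in> Obj D. \<forall>f \<in> Arr D. \<forall>g \<in> Arr D. dom_of D f = c \<longrightarrow> cod_of D f = c \<longrightarrow>
        dom_of D g = c \<longrightarrow> cod_of D g = c \<longrightarrow> t c (f \<oplus>\<^bsub>D\<^esub> g) = t c f + t c g) \<and>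
     (\<forall>c \<in> Obj D. \<forall>f \<in> Arr D. \<forall>r. dom_of D f = c \<longrightarrow> cod_of D f = c \<longrightarrow> t c (r *\<^sub>L\<^bsub>D\<^esub> f) = r * t c f) \<and>
     (\<forall>f \<in> Arr D. \<forall>g \<in> Arr D. dom_of D g = cod_of D f \<longrightarrow> cod_of D g = dom_of D f \<longrightarrow>
        t (dom_of D f) (g \<cdot>\<^bsub>D\<^esub> f) = t (cod_of D f) (f \<cdot>\<^bsub>D\<^esub> g))"

context semisimple_category
begin

lemma decompositionE:
  assumes "decomposition D x n s i p"
  shows "x \<in> Obj D" "\<And>k. k < n \<Longrightarrow> simple_object D (s k)" "\<And>k. k < n \<Longrightarrow> s k \<in> Obj D"
    "\<And>k. k < n \<Longrightarrow> i k \<in> Arr D" "\<And>k. k < n \<Longrightarrow> dom_of D (i k) = s k" "\<And>k. k < n \<Longrightarrow> cod_of D (i k) = x"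
    "\<And>k. k < n \<Longrightarrow> p k \<in> Arr D" "\<And>k. k < n \<Longrightarrow> dom_of D (p k) = x" "\<And>k. k < n \<Longrightarrow> cod_of D (p k) = s k"
    "\<And>j k. \<lbrakk>j < n; k < n\<rbrakk> \<Longrightarrow> p j \<cdot> i k = (if j = k then Idt D (s k) else Zer D (s k) (s j))"
    "hom_sum D x x (\<lambda>k. i k \<cdot> p k) n = Idt D x"
  using assms by (simp_all add: decomposition_def)

lemma ex_decomposition:
  assumes "x \<in> Obj D" obtains n s i p where "decomposition D x n s i p"
proof -
  obtain n s where s: "\<forall>k < n. simple_object D (s k)" "finite_direct_sum D n s x"
    using is_semisimple assms unfolding semisimple_def by blast
  then obtain i p where "\<forall>k < n. s k \<in> Obj D \<and> i k \<in> Hom D (s k) x \<and> p k \<in> Hom D x (s k)"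
    "\<forall>j < n. \<forall>k < n. p j \<cdot> i k = (if j = k then Idt D (s k) else Zer D (s k) (s j))"
    "hom_sum D x x (\<lambda>k. i k \<cdot> p k) n = Idt D x"
    unfolding finite_direct_sum_def by blast
  then have "decomposition D x n s i p"
    using s(1) assms by (simp add: decomposition_def Hom_iff)
  then show thesis by (rule that)
qed

lemma decomposition_simple:
  assumes "simple_object D s" shows "decomposition D s 1 (\<lambda>_. s) (\<lambda>_. Idt D s) (\<lambda>_. Idt D s)"
  using assms by (simp add: decomposition_def)

text \<open>Inserts the resolution of the identity of \<open>x\<close> between \<open>f\<close> and
  \<open>g\<close>; this is matrix multiplication in coordinates of the middle object.\<close>

lemma decomposition_insert:
  assumes d: "decomposition D x n s i p"
    and f: "f \<in> Arr D" "cod_of D f = x" and g: "g \<in> Arr D" "dom_of D g = x"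
  shows "g \<cdot> f = hom_sum D (dom_of D f) (cod_of D g) (\<lambda>k. (g \<cdot> i k) \<cdot> p k \<cdot> f) n"
proof -
  note d' = decompositionE[OF d]
  have "g \<cdot> f = g \<cdot> Idt D x \<cdot> f" using f g by simp
  also have "\<dots> = g \<cdot> hom_sum D x x (\<lambda>k. i k \<cdot> p k) n \<cdot> f" unfolding d' ..
  also have "\<dots> = g \<cdot> hom_sum D (dom_of D f) x (\<lambda>k. (i k \<cdot> p k) \<cdot> f) n"
    using f d' by (subst hom_sum_Cmp) auto
  also have "\<dots> = hom_sum D (dom_of D f) (cod_of D g) (\<lambda>k. g \<cdot> (i k \<cdot> p k) \<cdot> f) n"
    using f g d' by (subst Cmp_hom_sum) auto
  also have "\<dots> = hom_sum D (dom_of D f) (cod_of D g) (\<lambda>k. (g \<cdot> i k) \<cdot> p k \<cdot> f) n"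
    using f g d' by (intro hom_sum_cong) simp
  finally show ?thesis .
qed

lemma scalar_of_Scl [simp]:
  assumes "simple_object D s" shows "scalar_of D s (r *\<^sub>L Idt D s) = r"
  unfolding scalar_of_def
proof (rule the_equality)
  fix q assume q: "r *\<^sub>L Idt D s = q *\<^sub>L Idt D s"
  show "q = r"
  proof (rule ccontr)
    assume "q \<noteq> r"
    have "(r + - q) *\<^sub>L Idt D s = r *\<^sub>L Idt D s \<oplus> (- q) *\<^sub>L Idt D s"
      using assms by (intro Scl_add) simp
    also have "\<dots> = (q + - q) *\<^sub>L Idt D s" unfolding q using assms by (intro Scl_add[symmetric]) simp
    finally have "(r + - q) *\<^sub>L Idt D s = Zer D s s" using assms by simp
    then have "Idt D s = Zer D s s" by (rule Scl_eq_Zer[rotated 3]) (use assms \<open>q \<noteq> r\<close> in auto)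
    then show False using simple_Idt assms by simp
  qed
qed simp

lemma scalar_of_Idt [simp]: "simple_object D s \<Longrightarrow> scalar_of D s (Idt D s) = 1"
  using scalar_of_Scl[of s 1] by simp

lemma scalar_of_eq:
  assumes "simple_object D s" "f \<in> Arr D" "dom_of D f = s" "cod_of D f = s"
  shows "scalar_of D s f *\<^sub>L Idt D s = f"
  using simple_scalar[OF assms] assms(1) by auto

lemma scalar_of_Add:
  assumes "simple_object D s" "f \<in> Arr D" "dom_of D f = s" "cod_of D f = s" "g \<in> Arr D" "dom_of D g = s" "cod_of D g = s"
  shows "scalar_of D s (f \<oplus> g) = scalar_of D s f + scalar_of D s g"
proof -
  have "f \<oplus> g = (scalar_of D s f *\<^sub>L Idt D s) \<oplus> (scalar_of D s g *\<^sub>L Idt D s)"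
    using assms by (simp add: scalar_of_eq)
  also have "\<dots> = (scalar_of D s f + scalar_of D s g) *\<^sub>L Idt D s" using assms by (simp add: Scl_add)
  finally show ?thesis using assms by simp
qed

lemma scalar_of_Scl':
  assumes "simple_object D s" "f \<in> Arr D" "dom_of D f = s" "cod_of D f = s"
  shows "scalar_of D s (r *\<^sub>L f) = r * scalar_of D s f"
proof -
  have "r *\<^sub>L f = r *\<^sub>L (scalar_of D s f *\<^sub>L Idt D s)" using assms by (simp add: scalar_of_eq)
  also have "\<dots> = (r * scalar_of D s f) *\<^sub>L Idt D s" using assms by simp
  finally show ?thesis using assms by simp
qed

text \<open>If \<open>v \<cdot> u\<close> and \<open>u \<cdot> v\<close> are the scalars
  \<open>c\<close> and \<open>d\<close>, then evaluating \<open>u \<cdot> v \<cdot> u\<close> in two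
  ways gives equality of the \<open>c\<close>-fold and the \<open>d\<close>-fold of
  \<open>u\<close>. So \<open>c = d\<close> unless \<open>u\<close> is zero, and then both scalars
  vanish.\<close>

lemma scalar_of_cyclic:
  assumes s: "simple_object D s" and t: "simple_object D t"
    and u: "u \<in> Arr D" "dom_of D u = s" "cod_of D u = t" and v: "v \<in> Arr D" "dom_of D v = t" "cod_of D v = s"
  shows "scalar_of D s (v \<cdot> u) = scalar_of D t (u \<cdot> v)"
proof -
  obtain c where c: "v \<cdot> u = c *\<^sub>L Idt D s" using simple_scalar[OF s, of "v \<cdot> u"] u v by auto
  obtain d where d: "u \<cdot> v = d *\<^sub>L Idt D t" using simple_scalar[OF t, of "u \<cdot> v"] u v by auto
  show ?thesis
  proof (cases "u = Zer D s t")
    case True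
    have "v \<cdot> u = 0 *\<^sub>L Idt D s" "u \<cdot> v = 0 *\<^sub>L Idt D t" unfolding True using s t u v by auto
    then show ?thesis using s t by (simp only: scalar_of_Scl)
  next
    case False
    have "c *\<^sub>L u = u \<cdot> (v \<cdot> u)" unfolding c using u s by simp
    also have "\<dots> = (u \<cdot> v) \<cdot> u" using u v by simp
    also have "\<dots> = d *\<^sub>L u" unfolding d using u t by simp
    finally have e: "c *\<^sub>L u = d *\<^sub>L u" .
    have "(c + - d) *\<^sub>L u = c *\<^sub>L u \<oplus> (- d) *\<^sub>L u" using u by (intro Scl_add)
    also have "\<dots> = (d + - d) *\<^sub>L u" unfolding e using u by (intro Scl_add[symmetric])
    finally have "(c + - d) *\<^sub>L u = Zer D s t" using u by simp
    then have "c + - d = 0" using Scl_eq_Zer[OF u] False by blast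
    then show ?thesis unfolding c d using s t by simp
  qed
qed

lemma scalar_of_hom_sum:
  assumes s: "simple_object D s" "\<And>k. k < n \<Longrightarrow> u k \<in> Arr D \<and> dom_of D (u k) = s \<and> cod_of D (u k) = s"
  shows "scalar_of D s (hom_sum D s s u n) = (\<Sum>k<n. scalar_of D s (u k))"
  by (rule additive_hom_sum) (use assms scalar_of_Add in auto)

text \<open>The usual proof of tr(AB) = tr(BA) for block matrices, with
  \<open>scalar_of_cyclic\<close> in place of commutativity of the entries. Allowing different
  decompositions on the two sides also yields independence of the decomposition.\<close>

lemma decomposition_trace_cyclic:
  assumes dx: "decomposition D x n s i p" and dy: "decomposition D y m t j q"
    and f: "f \<in> Arr D" "dom_of D f = x" "cod_of D f = y" and g: "g \<in> Arr D" "dom_of D g = y" "cod_of D g = x"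
  shows "decomposition_trace D n s i p (g \<cdot> f) = decomposition_trace D m t j q (f \<cdot> g)"
proof -
  note x = decompositionE[OF dx] and y = decompositionE[OF dy]
  \<comment> \<open>Stated for arbitrary data because it is applied twice, the second time with the
    two objects and the two arrows exchanged.\<close>
  have half: "scalar_of D (s k) (p k \<cdot> (g \<cdot> f) \<cdot> i k) =
      (\<Sum>l<m. scalar_of D (s k) ((p k \<cdot> g \<cdot> j l) \<cdot> (q l \<cdot> f \<cdot> i k)))"
    if k: "k < n" and dx: "decomposition D x n s i p" and dy: "decomposition D y m t j q"
      and f: "f \<in> Arr D" "dom_of D f = x" "cod_of D f = y" and g: "g \<in> Arr D" "dom_of D g = y" "cod_of D g = x"
    for k n s i p m t j q x y f g
  proof -
    note x = decompositionE[OF dx] and y = decompositionE[OF dy]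
    have "p k \<cdot> (g \<cdot> f) \<cdot> i k = (p k \<cdot> g) \<cdot> (f \<cdot> i k)" using x k f g by simp
    also have "\<dots> = hom_sum D (s k) (s k) (\<lambda>l. ((p k \<cdot> g) \<cdot> j l) \<cdot> q l \<cdot> f \<cdot> i k) m"
      using x k f g by (subst decomposition_insert[OF dy]) auto
    also have "scalar_of D (s k) \<dots> = (\<Sum>l<m. scalar_of D (s k) (((p k \<cdot> g) \<cdot> j l) \<cdot> q l \<cdot> f \<cdot> i k))"
      by (rule scalar_of_hom_sum) (use x k y f g in auto)
    also have "\<dots> = (\<Sum>l<m. scalar_of D (s k) ((p k \<cdot> g \<cdot> j l) \<cdot> (q l \<cdot> f \<cdot> i k)))"
      by (rule sum.cong) (use x k y f g in auto)
    finally show ?thesis .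
  qed
  have "decomposition_trace D n s i p (g \<cdot> f) =
      (\<Sum>k<n. \<Sum>l<m. scalar_of D (s k) ((p k \<cdot> g \<cdot> j l) \<cdot> (q l \<cdot> f \<cdot> i k)))"
    unfolding decomposition_trace_def by (rule sum.cong) (use half dx dy f g in auto)
  also have "\<dots> = (\<Sum>k<n. \<Sum>l<m. scalar_of D (t l) ((q l \<cdot> f \<cdot> i k) \<cdot> (p k \<cdot> g \<cdot> j l)))"
  proof (intro sum.cong refl)
    fix k l assume "k \<in> {..<n}" "l \<in> {..<m}"
    then show "scalar_of D (s k) ((p k \<cdot> g \<cdot> j l) \<cdot> (q l \<cdot> f \<cdot> i k)) =
        scalar_of D (t l) ((q l \<cdot> f \<cdot> i k) \<cdot> (p k \<cdot> g \<cdot> j l))"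
      by (intro scalar_of_cyclic) (use x y f g in auto)
  qed
  also have "\<dots> = (\<Sum>l<m. \<Sum>k<n. scalar_of D (t l) ((q l \<cdot> f \<cdot> i k) \<cdot> (p k \<cdot> g \<cdot> j l)))"
    by (rule sum.swap)
  also have "\<dots> = decomposition_trace D m t j q (f \<cdot> g)"
    unfolding decomposition_trace_def by (rule sum.cong[symmetric]) (use half dx dy f g in auto)
  finally show ?thesis .
qed

text \<open>Two decompositions of the same object are compared by cyclicity for \<open>f\<close> and
  the identity of \<open>x\<close>.\<close>

lemma canonical_trace_eq:
  assumes d: "decomposition D x n s i p" and f: "f \<in> Arr D" "dom_of D f = x" "cod_of D f = x"
  shows "canonical_trace D x f = decomposition_trace D n s i p f"
proof -
  have "\<exists>n s i p. decomposition D x n s i p \<and> canonical_trace D x f = decomposition_trace D n s i p f"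
    unfolding canonical_trace_def by (rule someI_ex) (use d in blast)
  then obtain m t j q where m: "decomposition D x m t j q" "canonical_trace D x f = decomposition_trace D m t j q f"
    by blast
  have "decomposition_trace D m t j q (Idt D x \<cdot> f) = decomposition_trace D n s i p (f \<cdot> Idt D x)"
    by (rule decomposition_trace_cyclic[OF m(1) d]) (use f in auto)
  then show ?thesis using m(2) f by simp
qed

lemma canonical_trace_simple:
  assumes "simple_object D s" "f \<in> Arr D" "dom_of D f = s" "cod_of D f = s"
  shows "canonical_trace D s f = scalar_of D s f"
  using canonical_trace_eq[OF decomposition_simple[OF assms(1)] assms(2-4)] assms
  by (simp add: decomposition_trace_def)

lemma cyclic_trace_canonical: "cyclic_trace D (canonical_trace D)"
  unfolding cyclic_trace_def
proof (intro conjI ballI allI impI)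
  fix x f g assume x: "x \<in> Obj D" and f: "f \<in> Arr D" "dom_of D f = x" "cod_of D f = x"
    and g: "g \<in> Arr D" "dom_of D g = x" "cod_of D g = x"
  obtain n s i p where d: "decomposition D x n s i p" using ex_decomposition[OF x] .
  note e = decompositionE[OF d]
  show "canonical_trace D x (f \<oplus> g) = canonical_trace D x f + canonical_trace D x g"
    using f g e by (simp add: canonical_trace_eq[OF d] decomposition_trace_def scalar_of_Add flip: sum.distrib)
next
  fix x f r assume x: "x \<in> Obj D" and f: "f \<in> Arr D" "dom_of D f = x" "cod_of D f = x"
  obtain n s i p where d: "decomposition D x n s i p" using ex_decomposition[OF x] .
  note e = decompositionE[OF d]
  show "canonical_trace D x (r *\<^sub>L f) = r * canonical_trace D x f"
    using f e by (simp add: canonical_trace_eq[OF d] decomposition_trace_def scalar_of_Scl' sum_distrib_left)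
next
  fix f g assume a: "f \<in> Arr D" "g \<in> Arr D" "dom_of D g = cod_of D f" "cod_of D g = dom_of D f"
  obtain n s i p where d: "decomposition D (dom_of D f) n s i p" using ex_decomposition a by (metis dom_of_Obj)
  obtain m t j q where d': "decomposition D (cod_of D f) m t j q" using ex_decomposition a by (metis cod_of_Obj)
  show "canonical_trace D (dom_of D f) (g \<cdot> f) = canonical_trace D (cod_of D f) (f \<cdot> g)"
    using a decomposition_trace_cyclic[OF d d'] by (simp add: canonical_trace_eq[OF d] canonical_trace_eq[OF d'])
qed

context
  fixes t assumes t: "cyclic_trace D t"
begin

lemma trace_Add: "\<lbrakk>f \<in> Arr D; g \<in> Arr D; dom_of D f = c; cod_of D f = c; dom_of D g = c; cod_of D g = c\<rbrakk>
    \<Longrightarrow> t c (f \<oplus> g) = t c f + t c g"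
  using t unfolding cyclic_trace_def by (metis cod_of_Obj)

lemma trace_Scl: "\<lbrakk>f \<in> Arr D; dom_of D f = c; cod_of D f = c\<rbrakk> \<Longrightarrow> t c (r *\<^sub>L f) = r * t c f"
  using t unfolding cyclic_trace_def by (metis cod_of_Obj)

lemma trace_cyclic: "\<lbrakk>f \<in> Arr D; g \<in> Arr D; dom_of D f = c; cod_of D f = d; dom_of D g = d; cod_of D g = c\<rbrakk>
    \<Longrightarrow> t c (g \<cdot> f) = t d (f \<cdot> g)"
  using t unfolding cyclic_trace_def by metis

lemma trace_hom_sum:
  assumes "c \<in> Obj D" "\<And>k. k < n \<Longrightarrow> u k \<in> Arr D \<and> dom_of D (u k) = c \<and> cod_of D (u k) = c"
  shows "t c (hom_sum D c c u n) = (\<Sum>k<n. t c (u k))"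
  by (rule additive_hom_sum) (use assms trace_Add in auto)

text \<open>Rigidity: a cyclic trace is determined by its values on identities of simple objects. It
  yields both the surjectivity of twisting and the invariance of the canonical trace under
  equivalences.\<close>

lemma trace_decomposition:
  assumes d: "decomposition D x n s i p" and f: "f \<in> Arr D" "dom_of D f = x" "cod_of D f = x"
  shows "t x f = (\<Sum>k<n. t (s k) (Idt D (s k)) * scalar_of D (s k) (p k \<cdot> f \<cdot> i k))"
proof -
  note e = decompositionE[OF d]
  have "f \<cdot> Idt D x = hom_sum D x x (\<lambda>k. (f \<cdot> i k) \<cdot> p k \<cdot> Idt D x) n"
    using f e(1) by (subst decomposition_insert[OF d]) auto
  also have "\<dots> = hom_sum D x x (\<lambda>k. (f \<cdot> i k) \<cdot> p k) n"
    by (rule hom_sum_cong) (use f e in auto)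
  finally have "f = hom_sum D x x (\<lambda>k. (f \<cdot> i k) \<cdot> p k) n" using f by simp
  then have "t x f = t x (hom_sum D x x (\<lambda>k. (f \<cdot> i k) \<cdot> p k) n)" by simp
  also have "\<dots> = (\<Sum>k<n. t x ((f \<cdot> i k) \<cdot> p k))"
    by (rule trace_hom_sum) (use f e in auto)
  also have "\<dots> = (\<Sum>k<n. t (s k) (Idt D (s k)) * scalar_of D (s k) (p k \<cdot> f \<cdot> i k))"
  proof (rule sum.cong[OF refl])
    fix k assume "k \<in> {..<n}"
    then have k: "k < n" by simp
    have "t x ((f \<cdot> i k) \<cdot> p k) = t (s k) (p k \<cdot> f \<cdot> i k)"
      by (rule trace_cyclic) (use f e k in auto)
    also have "\<dots> = t (s k) (scalar_of D (s k) (p k \<cdot> f \<cdot> i k) *\<^sub>L Idt D (s k))"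
      using f e k by (simp add: scalar_of_eq)
    also have "\<dots> = scalar_of D (s k) (p k \<cdot> f \<cdot> i k) * t (s k) (Idt D (s k))"
      by (rule trace_Scl) (use e k in auto)
    finally show "t x ((f \<cdot> i k) \<cdot> p k) = t (s k) (Idt D (s k)) * scalar_of D (s k) (p k \<cdot> f \<cdot> i k)"
      by simp
  qed
  finally show ?thesis .
qed

lemma trace_Zer: "c \<in> Obj D \<Longrightarrow> t c (Zer D c c) = 0"
  using trace_Scl[of "Zer D c c" c 0] by simp

text \<open>Cyclicity moves each inclusion to the other end, where it meets its projection and
  cancels.\<close>

lemma trace_biproduct:
  assumes b: "is_biproduct D c d s i j p q" and cd: "c \<in> Obj D" "d \<in> Obj D"
    and f: "f \<in> Hom D c c" "g \<in> Hom D d d"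
  shows "t s ((i \<cdot> f \<cdot> p) \<oplus> (j \<cdot> g \<cdot> q)) = t c f + t d g"
proof -
  have a: "s \<in> Obj D" "i \<in> Arr D" "dom_of D i = c" "cod_of D i = s" "j \<in> Arr D" "dom_of D j = d" "cod_of D j = s"
    "p \<in> Arr D" "dom_of D p = s" "cod_of D p = c" "q \<in> Arr D" "dom_of D q = s" "cod_of D q = d"
    "p \<cdot> i = Idt D c" "q \<cdot> j = Idt D d"
    using b cd by (auto simp: is_biproduct_def Hom_iff)
  have f': "f \<in> Arr D" "dom_of D f = c" "cod_of D f = c" "g \<in> Arr D" "dom_of D g = d" "cod_of D g = d"
    using f cd by (auto simp: Hom_iff)
  have "t s (i \<cdot> f \<cdot> p) = t c ((f \<cdot> p) \<cdot> i)" by (rule trace_cyclic) (use a f' in auto)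
  moreover have "t s (j \<cdot> g \<cdot> q) = t d ((g \<cdot> q) \<cdot> j)" by (rule trace_cyclic) (use a f' in auto)
  ultimately show ?thesis using a f' by (subst trace_Add) auto
qed

end

lemmas can_Add = trace_Add[OF cyclic_trace_canonical]
  and can_Scl = trace_Scl[OF cyclic_trace_canonical]
  and can_cyclic = trace_cyclic[OF cyclic_trace_canonical]
  and can_Zer = trace_Zer[OF cyclic_trace_canonical]

text \<open>A nonzero matrix entry of \<open>f\<close> would be invertible by Schur's lemma and
  could be detected by a suitable \<open>g\<close>. Hence all entries vanish, and the resolutions of
  the identities of \<open>c\<close> and \<open>d\<close> reassemble \<open>f\<close> from
  them.\<close>

lemma can_nondegenerate:
  assumes f: "f \<in> Arr D" "dom_of D f = c" "cod_of D f = d"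
    and z: "\<And>g. \<lbrakk>g \<in> Arr D; dom_of D g = d; cod_of D g = c\<rbrakk> \<Longrightarrow> canonical_trace D c (g \<cdot> f) = 0"
  shows "f = Zer D c d"
proof -
  have cd: "c \<in> Obj D" "d \<in> Obj D" using f by auto
  obtain n s i p where dx: "decomposition D c n s i p" using ex_decomposition[OF cd(1)] .
  obtain m t j q where dy: "decomposition D d m t j q" using ex_decomposition[OF cd(2)] .
  note x = decompositionE[OF dx] and y = decompositionE[OF dy]
  have entry: "q l \<cdot> f \<cdot> i k = Zer D (s k) (t l)" if k: "k < n" and l: "l < m" for k l
  proof (rule ccontr)
    let ?u = "q l \<cdot> f \<cdot> i k"
    assume "?u \<noteq> Zer D (s k) (t l)"
    then have u: "isom D ?u" by (intro simple_isom[OF x(2)[OF k] y(2)[OF l]]) (use x y k l f in auto)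
    let ?v = "inv_of D ?u"
    have du: "dom_of D ?u = s k" "cod_of D ?u = t l" using x y k l f by auto
    note v = inv_of[OF u, unfolded du]
    \<comment> \<open>The test morphism projects to the summand \<open>t l\<close>, inverts the
      entry and includes the summand \<open>s k\<close>. Cyclicity reduces its trace against
      \<open>f\<close> to the trace of the identity of \<open>s k\<close>, which is 1.\<close>
    have "canonical_trace D c ((i k \<cdot> ?v \<cdot> q l) \<cdot> f) = canonical_trace D c (i k \<cdot> (?v \<cdot> q l \<cdot> f))"
      using x y k l f v by simp
    also have "\<dots> = canonical_trace D (s k) ((?v \<cdot> q l \<cdot> f) \<cdot> i k)"
      by (rule can_cyclic) (use x y k l f v in auto)
    also have "(?v \<cdot> q l \<cdot> f) \<cdot> i k = ?v \<cdot> ?u" using x y k l f v(1-3) by simp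
    also have "\<dots> = 1 *\<^sub>L Idt D (s k)" using v(4) x k by simp
    also have "canonical_trace D (s k) (1 *\<^sub>L Idt D (s k)) = 1"
      using x k by (subst canonical_trace_simple) (auto simp del: Scl_one')
    finally have "canonical_trace D c ((i k \<cdot> ?v \<cdot> q l) \<cdot> f) = 1" .
    moreover have "canonical_trace D c ((i k \<cdot> ?v \<cdot> q l) \<cdot> f) = 0"
      by (rule z) (use x y k l v in auto)
    ultimately show False by simp
  qed
  have "q l \<cdot> f = Zer D c (t l)" if l: "l < m" for l
  proof -
    have "q l \<cdot> f = (q l \<cdot> f) \<cdot> Idt D c" using y l f by simp
    also have "\<dots> = hom_sum D c (t l) (\<lambda>k. ((q l \<cdot> f) \<cdot> i k) \<cdot> p k \<cdot> Idt D c) n"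
      using y l f cd by (subst decomposition_insert[OF dx]) auto
    also have "\<dots> = hom_sum D c (t l) (\<lambda>k. Zer D c (t l)) n"
      by (rule hom_sum_cong) (use entry l x y f cd in auto)
    finally show ?thesis using hom_sum_Zer cd y l by simp
  qed
  note col = this
  have "f = Idt D d \<cdot> f" using f by simp
  also have "\<dots> = hom_sum D c d (\<lambda>l. (Idt D d \<cdot> j l) \<cdot> q l \<cdot> f) m"
    using f cd by (subst decomposition_insert[OF dy]) auto
  also have "\<dots> = hom_sum D c d (\<lambda>l. Zer D c d) m"
    by (rule hom_sum_cong) (use col y f cd in auto)
  finally show ?thesis using hom_sum_Zer cd by simp
qed

lemma can_separates:
  assumes f: "f \<in> Arr D" "dom_of D f = c" "cod_of D f = d" and g: "g \<in> Arr D" "dom_of D g = c" "cod_of D g = d"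
    and e: "\<And>h. \<lbrakk>h \<in> Arr D; dom_of D h = d; cod_of D h = c\<rbrakk>
      \<Longrightarrow> canonical_trace D c (h \<cdot> f) = canonical_trace D c (h \<cdot> g)"
  shows "f = g"
proof -
  have "f \<oplus> (-1) *\<^sub>L g = Zer D c d"
    by (rule can_nondegenerate) (use f g e in \<open>auto simp: can_Add can_Scl\<close>)
  then show ?thesis using f g by (intro eq_if_diff_Zer[of f g]) auto
qed

end

text \<open>
  Every Calabi-Yau structure is the canonical trace twisted by a natural automorphism of the
  identity, which acts on a simple object \<open>s\<close> by the scalar \<open>tr (Idt s)\<close>.
\<close>

definition twisted_trace ::
  "('o, 'm, 'k :: field) lincat \<Rightarrow> ('o, 'm, 'k) nattr \<Rightarrow> 'o \<Rightarrow> 'm \<Rightarrow> 'k" where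
  "twisted_trace D \<nu> = (\<lambda>c \<in> Obj D. \<lambda>f \<in> Hom D c c. canonical_trace D c (cmpt \<nu> c \<cdot>\<^bsub>D\<^esub> f))"

context semisimple_category
begin

text \<open>Naturality moves the twist past an arrow, which preserves cyclicity; invertibility of
  the twist preserves nondegeneracy.\<close>

lemma CY_category_twisted:
  assumes "linear_nat_iso D D (fun_id D) (fun_id D) \<nu>"
  shows "CY_category D (twisted_trace D \<nu>)"
proof -
  interpret l: linear_nat_iso D D "fun_id D" "fun_id D" \<nu> by fact
  have tw: "twisted_trace D \<nu> c f = canonical_trace D c (cmpt \<nu> c \<cdot> f)"
    if "f \<in> Arr D" "dom_of D f = c" "cod_of D f = c" for c f
  proof -
    have "c \<in> Obj D" using that by auto
    with that show ?thesis by (simp add: twisted_trace_def Hom_iff)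
  qed
  have cyc: "twisted_trace D \<nu> c (g \<cdot> f) = twisted_trace D \<nu> d (f \<cdot> g)"
    if f: "f \<in> Arr D" "dom_of D f = c" "cod_of D f = d" and g: "g \<in> Arr D" "dom_of D g = d" "cod_of D g = c"
    for c d f g
  proof -
    have cd: "c \<in> Obj D" "d \<in> Obj D" using f by auto
    have "twisted_trace D \<nu> c (g \<cdot> f) = canonical_trace D c ((cmpt \<nu> c \<cdot> g) \<cdot> f)"
      using f g cd by (subst tw) auto
    also have "\<dots> = canonical_trace D d (f \<cdot> (cmpt \<nu> c \<cdot> g))"
      by (rule can_cyclic) (use f g cd in auto)
    also have "f \<cdot> (cmpt \<nu> c \<cdot> g) = (f \<cdot> cmpt \<nu> c) \<cdot> g" using f g cd by simp
    also have "f \<cdot> cmpt \<nu> c = cmpt \<nu> d \<cdot> f" using l.naturality[of f c d] f by simp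
    finally show ?thesis using f g cd by (subst tw) auto
  qed
  have ct: "cyclic_trace D (twisted_trace D \<nu>)"
    unfolding cyclic_trace_def by (intro conjI ballI allI impI cyc) (auto simp: tw can_Add can_Scl)
  have left: "f = Zer D c d"
    if f: "f \<in> Arr D" "dom_of D f = c" "cod_of D f = d"
      and z: "\<And>g. \<lbrakk>g \<in> Arr D; dom_of D g = d; cod_of D g = c\<rbrakk> \<Longrightarrow> twisted_trace D \<nu> c (g \<cdot> f) = 0" for c d f
  proof (rule can_nondegenerate[OF f])
    fix g assume g: "g \<in> Arr D" "dom_of D g = d" "cod_of D g = c"
    have cd: "c \<in> Obj D" "d \<in> Obj D" using f by auto
    \<comment> \<open>The hypothesis is applied to \<open>g\<close> composed with the inverse twist,
      so that the twist cancels.\<close>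
    have "canonical_trace D c (cmpt \<nu> c \<cdot> (inv_of D (cmpt \<nu> c) \<cdot> g) \<cdot> f) = 0"
      using z[of "inv_of D (cmpt \<nu> c) \<cdot> g"] f g cd by (simp add: tw)
    then show "canonical_trace D c (g \<cdot> f) = 0" using f g cd by simp
  qed
  \<comment> \<open>Cyclicity turns nondegeneracy in one argument into nondegeneracy in the
    other.\<close>
  have right: "g = Zer D d c"
    if g: "g \<in> Arr D" "dom_of D g = d" "cod_of D g = c"
      and z: "\<And>f. \<lbrakk>f \<in> Arr D; dom_of D f = c; cod_of D f = d\<rbrakk> \<Longrightarrow> twisted_trace D \<nu> c (g \<cdot> f) = 0" for c d g
    by (rule left[OF g]) (use cyc z g in metis)
  show ?thesis
  proof (unfold_locales)
    show "twisted_trace D \<nu> \<in> extensional (Obj D)" by (simp add: twisted_trace_def)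
    show "twisted_trace D \<nu> c \<in> extensional (Hom D c c)" if "c \<in> Obj D" for c
      using that by (simp add: twisted_trace_def)
    show "twisted_trace D \<nu> c (f \<oplus> g) = twisted_trace D \<nu> c f + twisted_trace D \<nu> c g"
      if "c \<in> Obj D" "f \<in> Hom D c c" "g \<in> Hom D c c" for c f g
      using that trace_Add[OF ct] by (simp add: Hom_iff)
    show "twisted_trace D \<nu> c (r *\<^sub>L f) = r * twisted_trace D \<nu> c f"
      if "c \<in> Obj D" "f \<in> Hom D c c" for c f r
      using that trace_Scl[OF ct] by (simp add: Hom_iff)
    show "twisted_trace D \<nu> c (g \<cdot> f) = twisted_trace D \<nu> d (f \<cdot> g)"
      if "c \<in> Obj D" "d \<in> Obj D" "f \<in> Hom D c d" "g \<in> Hom D d c" for c d f g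
      using that by (intro cyc) (auto simp: Hom_iff)
    show "twisted_trace D \<nu> s ((i \<cdot> f \<cdot> p) \<oplus> (j \<cdot> g \<cdot> q)) = twisted_trace D \<nu> c f + twisted_trace D \<nu> d g"
      if "c \<in> Obj D" "d \<in> Obj D" "is_biproduct D c d s i j p q" "f \<in> Hom D c c" "g \<in> Hom D d d"
      for c d s i j p q f g
      using trace_biproduct[OF ct] that by blast
    show "f = Zer D c d" if "c \<in> Obj D" "d \<in> Obj D" "f \<in> Hom D c d"
      "\<And>g. g \<in> Hom D d c \<Longrightarrow> twisted_trace D \<nu> c (g \<cdot> f) = 0" for c d f
      by (rule left) (use that in \<open>simp_all add: Hom_iff\<close>)
    show "g = Zer D d c" if "c \<in> Obj D" "d \<in> Obj D" "g \<in> Hom D d c"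
      "\<And>f. f \<in> Hom D c d \<Longrightarrow> twisted_trace D \<nu> c (g \<cdot> f) = 0" for c d g
      by (rule right) (use that in \<open>simp_all add: Hom_iff\<close>)
  qed (rule is_semisimple)
qed

text \<open>On each object \<open>t\<close> is represented, with respect to the canonical trace, by
  an endomorphism that acts on a simple summand \<open>s\<close> by the scalar
  \<open>t s (Idt D s)\<close>. Uniqueness of representing endomorphisms makes the family natural;
  nonvanishing of the scalars makes it invertible.\<close>

lemma twisted_trace_surj:
  assumes "CY_category D t"
  obtains \<nu> where "linear_nat_iso D D (fun_id D) (fun_id D) \<nu>" "t = twisted_trace D \<nu>"
proof -
  interpret CY: CY_category D t by fact
  have ct: "cyclic_trace D t"
    unfolding cyclic_trace_def
  proof (intro conjI ballI allI impI)
    fix f g assume a: "f \<in> Arr D" "g \<in> Arr D" "dom_of D g = cod_of D f" "cod_of D g = dom_of D f"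
    then show "t (dom_of D f) (g \<cdot> f) = t (cod_of D f) (f \<cdot> g)"
      by (intro CY.tr_cyclic) (auto simp: Hom_iff)
  qed (auto intro!: CY.tr_Add CY.tr_Scl simp: Hom_iff)
  define \<tau> where "\<tau> s = t s (Idt D s)" for s
  \<comment> \<open>All endomorphisms of \<open>s\<close> are multiples of the identity, so if
    \<open>\<tau> s\<close> were zero the pairing on \<open>s\<close> would vanish, and the identity
    with it.\<close>
  have \<tau>: "\<tau> s \<noteq> 0" if s: "simple_object D s" for s
  proof
    assume 0: "\<tau> s = 0"
    have "Idt D s = Zer D s s"
    proof (rule CY.tr_nondegenerate_left)
      fix g assume "g \<in> Hom D s s"
      then have g: "g \<in> Arr D" "dom_of D g = s" "cod_of D g = s" using s by (auto simp: Hom_iff)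
      obtain r where "g = r *\<^sub>L Idt D s" using simple_scalar[OF s g] by blast
      then show "t s (g \<cdot> Idt D s) = 0"
        using 0 s trace_Scl[OF ct, of "Idt D s" s r] g by (simp add: \<tau>_def)
    qed (use s in \<open>auto simp: Hom_iff\<close>)
    then show False using simple_Idt[OF s] by simp
  qed
  have "\<exists>l. l \<in> Arr D \<and> dom_of D l = x \<and> cod_of D l = x \<and>
     (\<forall>f \<in> Arr D. dom_of D f = x \<longrightarrow> cod_of D f = x \<longrightarrow> canonical_trace D x (l \<cdot> f) = t x f)"
    if x: "x \<in> Obj D" for x
  proof -
    obtain n s i p where d: "decomposition D x n s i p" using ex_decomposition[OF x] .
    note e = decompositionE[OF d]
    \<comment> \<open>Weighting the projector onto each simple summand by \<open>\<tau>\<close>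
      turns the weights 1 of the canonical trace into those of \<open>t\<close>.\<close>
    let ?u = "\<lambda>k. \<tau> (s k) *\<^sub>L (i k \<cdot> p k)"
    let ?l = "hom_sum D x x ?u n"
    have l: "?l \<in> Arr D" "dom_of D ?l = x" "cod_of D ?l = x" using e by auto
    have "canonical_trace D x (?l \<cdot> f) = t x f" if f: "f \<in> Arr D" "dom_of D f = x" "cod_of D f = x" for f
    proof -
      have "?l \<cdot> f = hom_sum D x x (\<lambda>k. ?u k \<cdot> f) n"
        using e f by (subst hom_sum_Cmp) auto
      then have "canonical_trace D x (?l \<cdot> f) = (\<Sum>k<n. canonical_trace D x (?u k \<cdot> f))"
        using e f by (simp add: trace_hom_sum[OF cyclic_trace_canonical])
      also have "\<dots> = (\<Sum>k<n. t (s k) (Idt D (s k)) * scalar_of D (s k) (p k \<cdot> f \<cdot> i k))"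
      proof (rule sum.cong[OF refl])
        fix k assume "k \<in> {..<n}"
        then have k: "k < n" by simp
        have "canonical_trace D x (?u k \<cdot> f) = \<tau> (s k) * canonical_trace D x (i k \<cdot> (p k \<cdot> f))"
          using e k f can_Scl[of "i k \<cdot> p k \<cdot> f" x] by simp
        also have "canonical_trace D x (i k \<cdot> (p k \<cdot> f)) = canonical_trace D (s k) ((p k \<cdot> f) \<cdot> i k)"
          by (rule can_cyclic) (use e k f in auto)
        also have "\<dots> = scalar_of D (s k) (p k \<cdot> f \<cdot> i k)"
          using e k f by (subst canonical_trace_simple) auto
        finally show "canonical_trace D x (?u k \<cdot> f) = t (s k) (Idt D (s k)) * scalar_of D (s k) (p k \<cdot> f \<cdot> i k)"
          by (simp add: \<tau>_def)
      qed
      also have "\<dots> = t x f" by (rule trace_decomposition[OF ct d f, symmetric])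
      finally show ?thesis .
    qed
    with l show ?thesis by blast
  qed
  then obtain L where L: "\<And>x. x \<in> Obj D \<Longrightarrow> L x \<in> Arr D \<and> dom_of D (L x) = x \<and> cod_of D (L x) = x \<and>
     (\<forall>f \<in> Arr D. dom_of D f = x \<longrightarrow> cod_of D f = x \<longrightarrow> canonical_trace D x (L x \<cdot> f) = t x f)" by metis
  have Lx: "L x \<in> Arr D" "dom_of D (L x) = x" "cod_of D (L x) = x" if "x \<in> Obj D" for x
    using L[OF that] by auto
  have Lt: "canonical_trace D x (L x \<cdot> f) = t x f" if "f \<in> Arr D" "dom_of D f = x" "cod_of D f = x" for x f
  proof -
    have "x \<in> Obj D" using that by auto
    with L that show ?thesis by blast
  qed
  \<comment> \<open>The family \<open>L\<close> is chosen object by object from decompositions. Both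
    sides pair equally with every \<open>h\<close> because \<open>t\<close> is cyclic, and the
    canonical trace separates arrows.\<close>
  have nat: "L y \<cdot> f = f \<cdot> L x" if f: "f \<in> Arr D" "dom_of D f = x" "cod_of D f = y" for f x y
  proof (rule can_separates[where c = x and d = y])
    have xy: "x \<in> Obj D" "y \<in> Obj D" using f by auto
    show "L y \<cdot> f \<in> Arr D" "dom_of D (L y \<cdot> f) = x" "cod_of D (L y \<cdot> f) = y"
      "f \<cdot> L x \<in> Arr D" "dom_of D (f \<cdot> L x) = x" "cod_of D (f \<cdot> L x) = y"
      using f xy Lx by auto
    fix h assume h: "h \<in> Arr D" "dom_of D h = y" "cod_of D h = x"
    have "canonical_trace D x (h \<cdot> L y \<cdot> f) = canonical_trace D y ((L y \<cdot> f) \<cdot> h)"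
      by (rule can_cyclic) (use f h xy Lx in auto)
    also have "\<dots> = t y (f \<cdot> h)" using f h xy Lx by (simp add: Lt)
    also have "\<dots> = t x (h \<cdot> f)" by (rule trace_cyclic[OF ct]) (use f h in auto)
    also have "\<dots> = canonical_trace D x (L x \<cdot> h \<cdot> f)" using f h by (subst Lt) auto
    also have "\<dots> = canonical_trace D x ((h \<cdot> f) \<cdot> L x)"
      by (rule can_cyclic) (use f h xy Lx in auto)
    also have "(h \<cdot> f) \<cdot> L x = h \<cdot> f \<cdot> L x" using f h xy Lx by simp
    finally show "canonical_trace D x (h \<cdot> L y \<cdot> f) = canonical_trace D x (h \<cdot> f \<cdot> L x)" .
  qed
  have Ls: "L s = \<tau> s *\<^sub>L Idt D s" if s: "simple_object D s" for s
  proof -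
    note l = Lx[OF simple_Obj[OF s]]
    have "\<tau> s = canonical_trace D s (L s)" using Lt[of "Idt D s" s] s l by (simp add: \<tau>_def)
    also have "\<dots> = scalar_of D s (L s)" by (rule canonical_trace_simple[OF s l])
    finally show ?thesis using scalar_of_eq[OF s l] by simp
  qed
  have iso: "isom D (L x)" if x: "x \<in> Obj D" for x
  proof -
    obtain n s i p where d: "decomposition D x n s i p" using ex_decomposition[OF x] .
    note e = decompositionE[OF d] and lx = Lx[OF x]
    \<comment> \<open>The inverse of \<open>L x\<close> acts by the reciprocal scalars. Naturality
      at the inclusions and projections shows that \<open>L x\<close> acts on the summands of any
      decomposition by \<open>\<tau>\<close>.\<close>
    let ?u = "\<lambda>k. inverse (\<tau> (s k)) *\<^sub>L (i k \<cdot> p k)"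
    let ?m = "hom_sum D x x ?u n"
    have m: "?m \<in> Arr D" "dom_of D ?m = x" "cod_of D ?m = x" using e by auto
    have Li: "L x \<cdot> i k = \<tau> (s k) *\<^sub>L i k" "p k \<cdot> L x = \<tau> (s k) *\<^sub>L p k" if k: "k < n" for k
      using nat[of "i k" "s k" x] nat[of "p k" x "s k"] e k by (simp_all add: Ls)
    have "L x \<cdot> ?m = hom_sum D x x (\<lambda>k. L x \<cdot> ?u k) n"
      using e lx by (subst Cmp_hom_sum) auto
    also have "\<dots> = hom_sum D x x (\<lambda>k. i k \<cdot> p k) n"
    proof (rule hom_sum_cong)
      fix k assume k: "k < n"
      have "L x \<cdot> ?u k = inverse (\<tau> (s k)) *\<^sub>L ((L x \<cdot> i k) \<cdot> p k)" using e k lx by simp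
      then show "L x \<cdot> ?u k = i k \<cdot> p k" unfolding Li[OF k] using e k \<tau> by simp
    qed
    finally have 1: "L x \<cdot> ?m = Idt D x" using e by simp
    have "?m \<cdot> L x = hom_sum D x x (\<lambda>k. ?u k \<cdot> L x) n"
      using e lx by (subst hom_sum_Cmp) auto
    also have "\<dots> = hom_sum D x x (\<lambda>k. i k \<cdot> p k) n"
      by (rule hom_sum_cong) (use e lx Li \<tau> in auto)
    finally have 2: "?m \<cdot> L x = Idt D x" using e by simp
    show ?thesis by (rule isomI[of _ ?m]) (use 1 2 m lx in auto)
  qed
  define \<nu> where "\<nu> = \<lparr>Src = fun_id D, Trg = fun_id D, cmpt = (\<lambda>x \<in> Obj D. L x)\<rparr>"
  note fi = fun_id_linear[OF linear_category_axioms]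
  have "linear_nat D D (fun_id D) (fun_id D) \<nu>"
    by (rule linear_natI[OF fi fi]) (use Lx nat in \<open>auto simp: nat_transformations_iff[OF fi fi] \<nu>_def\<close>)
  then have "linear_nat_iso D D (fun_id D) (fun_id D) \<nu>"
    by (rule linear_nat_isoI) (use iso in \<open>auto simp: \<nu>_def\<close>)
  moreover have "t = twisted_trace D \<nu>"
  proof (rule extensionalityI[OF CY.tr_extensional(1)])
    show "twisted_trace D \<nu> \<in> extensional (Obj D)" by (simp add: twisted_trace_def)
    fix x assume x: "x \<in> Obj D"
    show "t x = twisted_trace D \<nu> x"
    proof (rule extensionalityI[OF CY.tr_extensional(2)[OF x]])
      show "twisted_trace D \<nu> x \<in> extensional (Hom D x x)" using x by (simp add: twisted_trace_def)
      fix f assume "f \<in> Hom D x x"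
      then show "t x f = twisted_trace D \<nu> x f"
        using x Lt by (simp add: twisted_trace_def \<nu>_def Hom_iff)
    qed
  qed
  ultimately show thesis by (rule that)
qed

end

lemma (in linear_functor) mmap_Zer [simp]:
  "\<lbrakk>a \<in> Obj D; b \<in> Obj D\<rbrakk> \<Longrightarrow> mmap F (Zer D a b) = Zer E (omap F a) (omap F b)"
  using mmap_Scl[of "Zer D a b" 0] by simp

section \<open>Equivalences of semisimple categories and Calabi-Yau functors\<close>

locale semisimple_equivalence =
  linear_equivalence D E F G \<eta> \<epsilon> + D: semisimple_category D + E: semisimple_category E
  for D E :: "('o, 'm, 'k :: alg_closed_field) lincat" and F G \<eta> \<epsilon>

text \<open>The canonical trace of \<open>E\<close> pulled back along \<open>F\<close> is a cyclic
  trace on \<open>D\<close>. By rigidity it suffices that it takes the value 1 on the identity of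
  each simple \<open>s\<close>, which means that the image of \<open>s\<close> has exactly one
  simple summand.\<close>

lemma (in semisimple_equivalence) canonical_trace_mmap:
  assumes f: "f \<in> Arr D" "dom_of D f = x" "cod_of D f = x"
  shows "canonical_trace E (omap F x) (mmap F f) = canonical_trace D x f"
proof -
  define t where "t x f = canonical_trace E (omap F x) (mmap F f)" for x f
  have ct: "cyclic_trace D t"
    unfolding cyclic_trace_def t_def
  proof (intro conjI ballI allI impI)
    fix f g assume a: "f \<in> Arr D" "g \<in> Arr D" "dom_of D g = cod_of D f" "cod_of D g = dom_of D f"
    then have "canonical_trace E (omap F (dom_of D f)) (mmap F g \<cdot>\<^bsub>E\<^esub> mmap F f) =
        canonical_trace E (omap F (cod_of D f)) (mmap F f \<cdot>\<^bsub>E\<^esub> mmap F g)"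
      by (intro E.can_cyclic) auto
    then show "canonical_trace E (omap F (dom_of D f)) (mmap F (g \<cdot>\<^bsub>D\<^esub> f)) =
        canonical_trace E (omap F (cod_of D f)) (mmap F (f \<cdot>\<^bsub>D\<^esub> g))"
      using a by simp
  qed (auto simp: E.can_Add E.can_Scl)
  have one: "t s (Idt D s) = 1" if s: "simple_object D s" for s
  proof -
    have so: "s \<in> Obj D" using s by simp
    obtain n u i p where d: "decomposition E (omap F s) n u i p"
      using E.ex_decomposition[OF omap_Obj[OF so]] by blast
    note e = E.decompositionE[OF d]
    have nz: "Idt E (omap F s) \<noteq> Zer E (omap F s) (omap F s)"
    proof
      assume "Idt E (omap F s) = Zer E (omap F s) (omap F s)"
      then have "mmap F (Idt D s) = mmap F (Zer D s s)" using so by simp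
      then have "Idt D s = Zer D s s" by (rule faithful[rotated 4]) (use so in auto)
      then show False using D.simple_Idt[OF s] by simp
    qed
    \<comment> \<open>Faithfulness keeps the identity of the image of \<open>s\<close> different
      from zero, whereas an empty decomposition would make it zero.\<close>
    have "n \<noteq> 0" using e(11) nz by (intro notI) auto
    moreover have "\<not> 1 < n"
    proof
      assume n: "1 < n"
      \<comment> \<open>By fullness each projector is the image of an endomorphism of
        \<open>s\<close>, hence a scalar. It is nonzero because the projector restricts to the
        identity of a simple object.\<close>
      have idem: "\<exists>r. i k \<cdot>\<^bsub>E\<^esub> p k = r *\<^sub>L\<^bsub>E\<^esub> Idt E (omap F s) \<and> r \<noteq> 0" if k: "k < n" for k
      proof -
        obtain g where g: "g \<in> Arr D" "dom_of D g = s" "cod_of D g = s" "mmap F g = i k \<cdot>\<^bsub>E\<^esub> p k"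
          by (rule full[of s s "i k \<cdot>\<^bsub>E\<^esub> p k"]) (use so e k in auto)
        obtain r where r: "g = r *\<^sub>L\<^bsub>D\<^esub> Idt D s" using D.simple_scalar[OF s g(1-3)] by blast
        have ip: "i k \<cdot>\<^bsub>E\<^esub> p k = r *\<^sub>L\<^bsub>E\<^esub> Idt E (omap F s)" using g(4) so unfolding r by simp
        have "r \<noteq> 0"
        proof
          assume "r = 0"
          then have z: "i k \<cdot>\<^bsub>E\<^esub> p k = Zer E (omap F s) (omap F s)" using ip so by simp
          have "Idt E (u k) = p k \<cdot>\<^bsub>E\<^esub> (i k \<cdot>\<^bsub>E\<^esub> p k) \<cdot>\<^bsub>E\<^esub> i k"
            using e k by simp
          also have "\<dots> = Zer E (u k) (u k)" unfolding z using e k so by simp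
          finally show False using E.simple_Idt e(2)[OF k] by blast
        qed
        with ip show ?thesis by blast
      qed
      obtain q r where q: "i 0 \<cdot>\<^bsub>E\<^esub> p 0 = q *\<^sub>L\<^bsub>E\<^esub> Idt E (omap F s)" "q \<noteq> 0"
        and r: "i 1 \<cdot>\<^bsub>E\<^esub> p 1 = r *\<^sub>L\<^bsub>E\<^esub> Idt E (omap F s)" "r \<noteq> 0"
        using idem[of 0] idem[of 1] n by auto
      \<comment> \<open>Projectors onto different summands have product zero, but nonzero scalars do
        not.\<close>
      have "(i 0 \<cdot>\<^bsub>E\<^esub> p 0) \<cdot>\<^bsub>E\<^esub> (i 1 \<cdot>\<^bsub>E\<^esub> p 1) = i 0 \<cdot>\<^bsub>E\<^esub> (p 0 \<cdot>\<^bsub>E\<^esub> i 1) \<cdot>\<^bsub>E\<^esub> p 1"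
        using e(2-9)[of 0] e(2-9)[of 1] n by simp
      also have "\<dots> = Zer E (omap F s) (omap F s)"
        using e(10)[of 0 1] e(2-9)[of 0] e(2-9)[of 1] n so by simp
      finally have "(q * r) *\<^sub>L\<^bsub>E\<^esub> Idt E (omap F s) = Zer E (omap F s) (omap F s)"
        unfolding q r using so by (simp add: mult.commute)
      then have "Idt E (omap F s) = Zer E (omap F s) (omap F s)"
        by (rule Cd.Scl_eq_Zer[rotated 3]) (use so q r in auto)
      then show False using nz by simp
    qed
    ultimately have n: "n = 1" by simp
    have "canonical_trace E (omap F s) (Idt E (omap F s)) = scalar_of E (u 0) (Idt E (u 0))"
      using e(2-9)[of 0] e(10)[of 0 0] so n by (simp add: E.canonical_trace_eq[OF d] decomposition_trace_def)
    then show ?thesis using e(2)[of 0] so n by (simp add: t_def)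
  qed
  have "x \<in> Obj D" using f by auto
  then obtain n s i p where d: "decomposition D x n s i p" using D.ex_decomposition by blast
  show ?thesis
    using D.trace_decomposition[OF ct d f] one D.decompositionE(2)[OF d]
    by (simp add: D.canonical_trace_eq[OF d f] decomposition_trace_def t_def)
qed

text \<open>Invariance of the canonical trace moves both traces to \<open>E\<close>, where they
  differ only in the twist. Nondegeneracy there compares the twists themselves.\<close>

lemma (in semisimple_equivalence) CY_functor_iff:
  assumes \<nu>: "linear_nat_iso D D (fun_id D) (fun_id D) \<nu>" and \<mu>: "linear_nat_iso E E (fun_id E) (fun_id E) \<mu>"
  shows "F \<in> CY_functors (D, twisted_trace D \<nu>) (E, twisted_trace E \<mu>) \<longleftrightarrow>
    (\<forall>a \<in> Obj D. mmap F (cmpt \<nu> a) = cmpt \<mu> (omap F a))"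
proof -
  interpret l: linear_nat_iso D D "fun_id D" "fun_id D" \<nu> by fact
  interpret m: linear_nat_iso E E "fun_id E" "fun_id E" \<mu> by fact
  have tr: "twisted_trace D \<nu> c f = canonical_trace E (omap F c) (mmap F (cmpt \<nu> c) \<cdot>\<^bsub>E\<^esub> mmap F f)"
    "twisted_trace E \<mu> (omap F c) (mmap F f) = canonical_trace E (omap F c) (cmpt \<mu> (omap F c) \<cdot>\<^bsub>E\<^esub> mmap F f)"
    if c: "c \<in> Obj D" and f: "f \<in> Arr D" "dom_of D f = c" "cod_of D f = c" for c f
    using canonical_trace_mmap[of "cmpt \<nu> c \<cdot>\<^bsub>D\<^esub> f" c] f c
    by (simp_all add: twisted_trace_def Dm.Hom_iff Cd.Hom_iff)
  show ?thesis
  proof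
    assume a: "\<forall>a \<in> Obj D. mmap F (cmpt \<nu> a) = cmpt \<mu> (omap F a)"
    then show "F \<in> CY_functors (D, twisted_trace D \<nu>) (E, twisted_trace E \<mu>)"
      using linear by (simp add: CY_functors_def Dm.Hom_iff tr)
  next
    assume "F \<in> CY_functors (D, twisted_trace D \<nu>) (E, twisted_trace E \<mu>)"
    then have a: "twisted_trace D \<nu> c f = twisted_trace E \<mu> (omap F c) (mmap F f)"
      if "c \<in> Obj D" "f \<in> Arr D" "dom_of D f = c" "cod_of D f = c" for c f
      using that by (simp add: CY_functors_def Dm.Hom_iff)
    show "\<forall>a \<in> Obj D. mmap F (cmpt \<nu> a) = cmpt \<mu> (omap F a)"
    proof
      fix c assume c: "c \<in> Obj D"
      show "mmap F (cmpt \<nu> c) = cmpt \<mu> (omap F c)"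
      proof (rule E.can_separates[where c = "omap F c" and d = "omap F c"])
        fix h assume h: "h \<in> Arr E" "dom_of E h = omap F c" "cod_of E h = omap F c"
        \<comment> \<open>The hypothesis only speaks about images of endomorphisms of
          \<open>c\<close>; by fullness these are all endomorphisms of
          \<open>omap F c\<close>.\<close>
        obtain f where f: "f \<in> Arr D" "dom_of D f = c" "cod_of D f = c" "mmap F f = h"
          using full[OF c c h] .
        have "canonical_trace E (omap F c) (mmap F (cmpt \<nu> c) \<cdot>\<^bsub>E\<^esub> h) = canonical_trace E (omap F c) (cmpt \<mu> (omap F c) \<cdot>\<^bsub>E\<^esub> h)"
          using a[OF c f(1-3)] tr[OF c f(1-3)] f(4) by simp
        moreover have "canonical_trace E (omap F c) (mmap F (cmpt \<nu> c) \<cdot>\<^bsub>E\<^esub> h) = canonical_trace E (omap F c) (h \<cdot>\<^bsub>E\<^esub> mmap F (cmpt \<nu> c))"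
          by (rule E.can_cyclic) (use c h in auto)
        moreover have "canonical_trace E (omap F c) (cmpt \<mu> (omap F c) \<cdot>\<^bsub>E\<^esub> h) = canonical_trace E (omap F c) (h \<cdot>\<^bsub>E\<^esub> cmpt \<mu> (omap F c))"
          by (rule E.can_cyclic) (use c h in auto)
        ultimately show "canonical_trace E (omap F c) (h \<cdot>\<^bsub>E\<^esub> mmap F (cmpt \<nu> c)) = canonical_trace E (omap F c) (h \<cdot>\<^bsub>E\<^esub> cmpt \<mu> (omap F c))"
          by simp
      qed (use c in auto)
    qed
  qed
qed

text \<open>\<open>F\<close> preserves the trace of \<open>G f\<close>, conjugation by the counit
  turns \<open>F (G f)\<close> into \<open>f\<close>, and a cyclic trace is invariant under
  conjugation.\<close>

lemma (in linear_equivalence) CY_functor_inverse: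
  assumes "CY_category D s" "CY_category E t" "F \<in> CY_functors (D, s) (E, t)"
  shows "G \<in> CY_functors (E, t) (D, s)"
proof -
  interpret X: CY_category D s by fact
  interpret Y: CY_category E t by fact
  have "t c f = s (omap G c) (mmap G f)" if c: "c \<in> Obj E" and f: "f \<in> Arr E" "dom_of E f = c" "cod_of E f = c" for c f
  proof -
    let ?e = "cmpt \<epsilon> c"
    have e: "?e \<in> Arr E" "dom_of E ?e = omap F (omap G c)" "cod_of E ?e = c" using c by auto
    have ie: "isom E ?e" using c by auto
    have "s (omap G c) (mmap G f) = t (omap F (omap G c)) (mmap F (mmap G f))"
      using assms(3) c f by (simp add: CY_functors_def Dm.Hom_iff)
    also have "mmap F (mmap G f) = inv_of E ?e \<cdot>\<^bsub>E\<^esub> (?e \<cdot>\<^bsub>E\<^esub> mmap F (mmap G f))"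
      using e ie c f by simp
    also have "?e \<cdot>\<^bsub>E\<^esub> mmap F (mmap G f) = f \<cdot>\<^bsub>E\<^esub> ?e"
      using counit.naturality[of f c c] f by simp
    also have "t (omap F (omap G c)) (inv_of E ?e \<cdot>\<^bsub>E\<^esub> (f \<cdot>\<^bsub>E\<^esub> ?e)) = t c ((f \<cdot>\<^bsub>E\<^esub> ?e) \<cdot>\<^bsub>E\<^esub> inv_of E ?e)"
      by (rule Y.tr_cyclic) (use c e ie f in \<open>auto simp: Cd.Hom_iff\<close>)
    also have "(f \<cdot>\<^bsub>E\<^esub> ?e) \<cdot>\<^bsub>E\<^esub> inv_of E ?e = f" using e ie f by simp
    finally show ?thesis by simp
  qed
  then show ?thesis using G.linear by (simp add: CY_functors_def Cd.Hom_iff)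
qed

section \<open>Homotopy fixed points in linear categories\<close>

lemma Equiv1_linear_functor:
  "\<lbrakk>linear_category D; linear_category E; F \<in> Equiv1 Vect2 D E\<rbrakk> \<Longrightarrow> linear_functor D E F"
  using Equiv1_Hom1[of F Vect2 D E] by (simp add: linear_functorI)

lemma nat_vcomp_eqI:
  assumes "Src \<alpha> = Src \<alpha>'" "Trg \<beta> = Trg \<beta>'"
    "\<And>a. a \<in> Obj (Dom (Src \<alpha>)) \<Longrightarrow> cmpt \<beta> a \<cdot>\<^bsub>Cod (Src \<alpha>)\<^esub> cmpt \<alpha> a = cmpt \<beta>' a \<cdot>\<^bsub>Cod (Src \<alpha>)\<^esub> cmpt \<alpha>' a"
  shows "nat_vcomp \<beta> \<alpha> = nat_vcomp \<beta>' \<alpha>'"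
  using assms by (auto simp: nat_vcomp_def intro!: restrict_ext)

lemma cmpt_cong: "\<alpha> = \<beta> \<Longrightarrow> cmpt \<alpha> a = cmpt \<beta> a"
  by simp

lemma const_paths_in: "g \<in> carrier G \<Longrightarrow> (\<lambda>_. g) \<in> paths_in G"
  by (auto simp: paths_in_def path_def path_image_def)

lemma join_paths_in: "\<lbrakk>\<gamma> \<in> paths_in G; \<delta> \<in> paths_in G; pathfinish \<gamma> = pathstart \<delta>\<rbrakk> \<Longrightarrow> \<gamma> +++ \<delta> \<in> paths_in G"
  by (auto simp: paths_in_def path_join_imp path_image_join)

lemma paths_in_ends: "\<gamma> \<in> paths_in G \<Longrightarrow> pathstart \<gamma> \<in> carrier G" "\<gamma> \<in> paths_in G \<Longrightarrow> pathfinish \<gamma> \<in> carrier G"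
  using pathstart_in_path_image pathfinish_in_path_image by (auto simp: paths_in_def)

text \<open>\<open>mult_paths_in\<close> is what continuity of the multiplication provides.
  \<open>connected\<close> lets each \<open>g\<close> be reached from the unit, so that
  trivializations exist for all of them.\<close>

locale path_connected_group =
  fixes G :: "'g :: topological_space monoid" (structure)
  assumes monoid: "monoid G"
    and mult_paths_in: "\<lbrakk>\<gamma> \<in> paths_in G; \<delta> \<in> paths_in G\<rbrakk> \<Longrightarrow> (\<lambda>t. \<gamma> t \<otimes> \<delta> t) \<in> paths_in G"
    and connected: "g \<in> carrier G \<Longrightarrow> \<exists>\<gamma> \<in> paths_in G. pathstart \<gamma> = \<one> \<and> pathfinish \<gamma> = g"
begin

sublocale monoid G by (rule monoid)

end

text \<open>
  Along a path \<open>\<gamma>\<close> from the unit to \<open>g\<close>, the structure of a fixed point trivializes \<open>\<Theta> g\<close>.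
\<close>

definition triv ::
  "('g, ('o, 'm, 'k) lincat, ('o, 'm, 'k) linfun, ('o, 'm, 'k) nattr) hfp0 \<Rightarrow> (real \<Rightarrow> 'g) \<Rightarrow> ('o, 'm, 'k) nattr" where
  "triv X \<gamma> = nat_vcomp (h\<Theta>p X \<gamma>) (nat_inv (hM X))"

locale linear_fixed_point =
  path_connected_group G + hfp_object G "core Vect2_fd" X
  for G :: "'g :: topological_space monoid" (structure)
    and X :: "('g, ('o, 'm, 'k :: field) lincat, ('o, 'm, 'k) linfun, ('o, 'm, 'k) nattr) hfp0"
begin

abbreviation "D \<equiv> hbase X"
abbreviation "\<Theta> \<equiv> h\<Theta> X"

sublocale finite_category D using base by simp

lemma \<Theta>_linear: "g \<in> carrier G \<Longrightarrow> linear_functor D D (\<Theta> g)"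
  using \<Theta>_equiv[of g] by (simp add: Equiv1_linear_functor linear_category_axioms)

lemma \<Theta>p_linear: "\<gamma> \<in> paths_in G \<Longrightarrow> linear_nat_iso D D (\<Theta> (pathstart \<gamma>)) (\<Theta> (pathfinish \<gamma>)) (h\<Theta>p X \<gamma>)"
  using \<Theta>p_iso[of \<gamma>] by (simp add: Iso2_Vect2_iff[OF \<Theta>_linear \<Theta>_linear] paths_in_ends)

lemma \<Pi>_linear: "\<lbrakk>g \<in> carrier G; h \<in> carrier G\<rbrakk>
    \<Longrightarrow> linear_nat_iso D D (fun_comp (\<Theta> h) (\<Theta> g)) (\<Theta> (g \<otimes> h)) (h\<Pi> X g h)"
  using \<Pi>_iso[of g h] by (simp add: Iso2_Vect2_iff[OF fun_comp_linear[OF \<Theta>_linear \<Theta>_linear] \<Theta>_linear])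

lemma M_linear: "linear_nat_iso D D (\<Theta> \<one>) (fun_id D) (hM X)"
  using M_iso by (simp add: Iso2_Vect2_iff[OF \<Theta>_linear fun_id_linear] linear_category_axioms)

sublocale M: linear_nat_iso D D "\<Theta> \<one>" "fun_id D" "hM X" by (rule M_linear)

lemma triv_linear:
  assumes "\<gamma> \<in> paths_in G" "pathstart \<gamma> = \<one>"
  shows "linear_nat_iso D D (fun_id D) (\<Theta> (pathfinish \<gamma>)) (triv X \<gamma>)"
  unfolding triv_def using nat_iso_vcomp[OF nat_inv_linear[OF M_linear]] \<Theta>p_linear[OF assms(1)] assms(2) by simp

lemma cmpt_triv: "\<lbrakk>\<gamma> \<in> paths_in G; a \<in> Obj D\<rbrakk> \<Longrightarrow> cmpt (triv X \<gamma>) a = cmpt (h\<Theta>p X \<gamma>) a \<cdot>\<^bsub>D\<^esub> inv_of D (cmpt (hM X) a)"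
  by (simp add: triv_def)

lemma triv_const: assumes "a \<in> Obj D" shows "cmpt (triv X (\<lambda>_. \<one>)) a = inv_of D (cmpt (hM X) a)"
  using assms by (simp add: cmpt_triv const_paths_in \<Theta>p_const)

lemma triv_join:
  assumes "\<gamma> \<in> paths_in G" "\<delta> \<in> paths_in G" "pathstart \<gamma> = \<one>" "pathfinish \<gamma> = pathstart \<delta>" "a \<in> Obj D"
  shows "cmpt (triv X (\<gamma> +++ \<delta>)) a = cmpt (h\<Theta>p X \<delta>) a \<cdot>\<^bsub>D\<^esub> cmpt (triv X \<gamma>) a"
proof -
  interpret g: linear_nat_iso D D "\<Theta> (pathstart \<gamma>)" "\<Theta> (pathfinish \<gamma>)" "h\<Theta>p X \<gamma>" by (rule \<Theta>p_linear) fact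
  interpret d: linear_nat_iso D D "\<Theta> (pathstart \<delta>)" "\<Theta> (pathfinish \<delta>)" "h\<Theta>p X \<delta>" by (rule \<Theta>p_linear) fact
  show ?thesis
    using assms(3-5) g.isom_cmpt[of a]
    by (simp add: cmpt_triv[OF join_paths_in[OF assms(1,2,4)]] \<Theta>p_join[OF assms(1,2,4)] cmpt_triv[OF assms(1)])
qed

lemma triv_homotopic: "homotopic_paths (carrier G) \<gamma> \<delta> \<Longrightarrow> triv X \<gamma> = triv X \<delta>"
  using \<Theta>p_track by (simp add: triv_def)

text \<open>Naturality of \<open>h\<Pi>\<close> along the two paths carries it from their end points
  to their starting points, where both arguments are the unit and the unit axiom identifies it with
  \<open>hM\<close>.\<close>

lemma triv_mult:
  assumes g: "\<gamma> \<in> paths_in G" "pathstart \<gamma> = \<one>" and d: "\<delta> \<in> paths_in G" "pathstart \<delta> = \<one>" and a: "a \<in> Obj D"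
  shows "cmpt (h\<Pi> X (pathfinish \<gamma>) (pathfinish \<delta>)) a \<cdot>\<^bsub>D\<^esub>
      cmpt (triv X \<delta>) (omap (\<Theta> (pathfinish \<gamma>)) a) \<cdot>\<^bsub>D\<^esub> cmpt (triv X \<gamma>) a = cmpt (triv X (\<lambda>t. \<gamma> t \<otimes> \<delta> t)) a"
proof -
  let ?g = "pathfinish \<gamma>" and ?h = "pathfinish \<delta>"
  let ?M = "cmpt (hM X)" and ?U = "\<lambda>a. inv_of D (cmpt (hM X) a)"
  have gh: "?g \<in> carrier G" "?h \<in> carrier G" using g d paths_in_ends by auto
  interpret g: linear_nat_iso D D "\<Theta> \<one>" "\<Theta> ?g" "h\<Theta>p X \<gamma>" using \<Theta>p_linear g by metis
  interpret d: linear_nat_iso D D "\<Theta> \<one>" "\<Theta> ?h" "h\<Theta>p X \<delta>" using \<Theta>p_linear d by metis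
  interpret gd: linear_nat_iso D D "\<Theta> (\<one> \<otimes> \<one>)" "\<Theta> (?g \<otimes> ?h)" "h\<Theta>p X (\<lambda>t. \<gamma> t \<otimes> \<delta> t)"
    using \<Theta>p_linear[OF mult_paths_in[OF g(1) d(1)]] g d by (simp add: pathstart_def pathfinish_def)
  interpret P: linear_nat_iso D D "fun_comp (\<Theta> ?h) (\<Theta> ?g)" "\<Theta> (?g \<otimes> ?h)" "h\<Pi> X ?g ?h"
    by (rule \<Pi>_linear[OF gh])
  interpret P1: linear_nat_iso D D "fun_comp (\<Theta> \<one>) (\<Theta> \<one>)" "\<Theta> (\<one> \<otimes> \<one>)" "h\<Pi> X \<one> \<one>"
    by (rule \<Pi>_linear) auto
  interpret U: linear_nat_iso D D "fun_id D" "\<Theta> \<one>" "nat_inv (hM X)" by (rule nat_inv_linear[OF M_linear])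
  let ?b = "omap (\<Theta> \<one>) a"
  \<comment> \<open>Moves the inverse of \<open>hM\<close> past the cell of \<open>\<gamma>\<close>,
    so that the cells of \<open>\<delta>\<close> and \<open>\<gamma>\<close> become adjacent and
    form the horizontal composite in the naturality of \<open>h\<Pi>\<close>.\<close>
  have nU: "?U (omap (\<Theta> ?g) a) \<cdot>\<^bsub>D\<^esub> cmpt (h\<Theta>p X \<gamma>) a = mmap (\<Theta> \<one>) (cmpt (h\<Theta>p X \<gamma>) a) \<cdot>\<^bsub>D\<^esub> ?U ?b"
    using U.naturality[of "cmpt (h\<Theta>p X \<gamma>) a" ?b "omap (\<Theta> ?g) a"] a by simp
  have \<Pi>1: "cmpt (h\<Pi> X \<one> \<one>) a = ?M ?b"
    using \<Pi>_unit_right[of \<one>] a by simp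
  have nat: "cmpt (h\<Pi> X ?g ?h) a \<cdot>\<^bsub>D\<^esub> cmpt (h\<Theta>p X \<delta>) (omap (\<Theta> ?g) a) \<cdot>\<^bsub>D\<^esub> mmap (\<Theta> \<one>) (cmpt (h\<Theta>p X \<gamma>) a) =
      cmpt (h\<Theta>p X (\<lambda>t. \<gamma> t \<otimes> \<delta> t)) a \<cdot>\<^bsub>D\<^esub> cmpt (h\<Pi> X \<one> \<one>) a"
    using cmpt_cong[OF \<Pi>_natural[OF g(1) d(1)], of a] a g(2) d(2) by simp
  have "cmpt (h\<Pi> X ?g ?h) a \<cdot>\<^bsub>D\<^esub> cmpt (triv X \<delta>) (omap (\<Theta> ?g) a) \<cdot>\<^bsub>D\<^esub> cmpt (triv X \<gamma>) a =
      (cmpt (h\<Pi> X ?g ?h) a \<cdot>\<^bsub>D\<^esub> cmpt (h\<Theta>p X \<delta>) (omap (\<Theta> ?g) a)) \<cdot>\<^bsub>D\<^esub>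
      (?U (omap (\<Theta> ?g) a) \<cdot>\<^bsub>D\<^esub> cmpt (h\<Theta>p X \<gamma>) a) \<cdot>\<^bsub>D\<^esub> ?U a"
    using a by (simp add: cmpt_triv g(1) d(1))
  also have "\<dots> = (cmpt (h\<Pi> X ?g ?h) a \<cdot>\<^bsub>D\<^esub> cmpt (h\<Theta>p X \<delta>) (omap (\<Theta> ?g) a) \<cdot>\<^bsub>D\<^esub> mmap (\<Theta> \<one>) (cmpt (h\<Theta>p X \<gamma>) a)) \<cdot>\<^bsub>D\<^esub> ?U ?b \<cdot>\<^bsub>D\<^esub> ?U a"
    unfolding nU using a by simp
  also have "\<dots> = cmpt (h\<Theta>p X (\<lambda>t. \<gamma> t \<otimes> \<delta> t)) a \<cdot>\<^bsub>D\<^esub> ?U a"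
    unfolding nat \<Pi>1 using a by simp
  finally show ?thesis using a by (simp add: cmpt_triv mult_paths_in g(1) d(1))
qed

end

text \<open>
  A 1-morphism of fixed points is the same as an equivalence together with 2-cells that are
  compatible with all trivializations; all other axioms follow.
\<close>

definition compatible ::
  "'g :: topological_space monoid \<Rightarrow>
    ('g, ('o, 'm, 'k :: field) lincat, ('o, 'm, 'k) linfun, ('o, 'm, 'k) nattr) hfp0 \<Rightarrow>
    ('g, ('o, 'm, 'k) lincat, ('o, 'm, 'k) linfun, ('o, 'm, 'k) nattr) hfp0 \<Rightarrow>
    ('o, 'm, 'k) linfun \<Rightarrow> ('g \<Rightarrow> ('o, 'm, 'k) nattr) \<Rightarrow> bool" where
  "compatible G X Y f m \<longleftrightarrow> m \<in> extensional (carrier G) \<and>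
     (\<forall>g \<in> carrier G. linear_nat_iso (hbase X) (hbase Y) (fun_comp f (h\<Theta> X g)) (fun_comp (h\<Theta> Y g) f) (m g)) \<and>
     (\<forall>\<gamma> \<in> paths_in G. pathstart \<gamma> = \<one>\<^bsub>G\<^esub> \<longrightarrow> (\<forall>a \<in> Obj (hbase X).
        cmpt (m (pathfinish \<gamma>)) a \<cdot>\<^bsub>hbase Y\<^esub> mmap f (cmpt (triv X \<gamma>) a) = cmpt (triv Y \<gamma>) (omap f a)))"

section \<open>Morphisms of fixed points in terms of trivializations\<close>

locale fixed_point_pair =
  X: linear_fixed_point G X + Y: linear_fixed_point G Y + f: linear_functor "hbase X" "hbase Y" f
  for G :: "'g :: topological_space monoid" (structure)
    and X Y :: "('g, ('o, 'm, 'k :: field) lincat, ('o, 'm, 'k) linfun, ('o, 'm, 'k) nattr) hfp0" and f +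
  assumes f_equiv: "f \<in> Equiv1 Vect2 (hbase X) (hbase Y)"
begin

lemma fX: "g \<in> carrier G \<Longrightarrow> linear_functor (hbase X) (hbase Y) (fun_comp f (h\<Theta> X g))"
  and fY: "g \<in> carrier G \<Longrightarrow> linear_functor (hbase X) (hbase Y) (fun_comp (h\<Theta> Y g) f)"
  by (blast intro: fun_comp_linear X.\<Theta>_linear Y.\<Theta>_linear f.linear_functor_axioms)+

text \<open>Naturality along the path reduces the condition at its end to the one at the unit, where
  the axiom for \<open>hM\<close> determines \<open>m \<one>\<close>.\<close>

lemma compatible_if_morphism:
  assumes "hfp_morphism G (core Vect2_fd) X Y f m"
  shows "compatible G X Y f m"
  unfolding compatible_def
proof (intro conjI ballI impI)
  interpret m: hfp_morphism G "core Vect2_fd" X Y f m by fact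
  show "m \<in> extensional (carrier G)" by (rule m.m_extensional)
  show ml: "linear_nat_iso (hbase X) (hbase Y) (fun_comp f (h\<Theta> X g)) (fun_comp (h\<Theta> Y g) f) (m g)"
    if "g \<in> carrier G" for g
    using m.m_iso[OF that] by (simp add: Iso2_Vect2_iff[OF fX fY] that)
  fix \<gamma> a assume g: "\<gamma> \<in> paths_in G" "pathstart \<gamma> = \<one>" and a: "a \<in> Obj (hbase X)"
  interpret gX: linear_nat_iso "hbase X" "hbase X" "h\<Theta> X \<one>" "h\<Theta> X (pathfinish \<gamma>)" "h\<Theta>p X \<gamma>" using X.\<Theta>p_linear g by metis
  interpret gY: linear_nat_iso "hbase Y" "hbase Y" "h\<Theta> Y \<one>" "h\<Theta> Y (pathfinish \<gamma>)" "h\<Theta>p Y \<gamma>" using Y.\<Theta>p_linear g by metis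
  interpret m1: linear_nat_iso "hbase X" "hbase Y" "fun_comp f (h\<Theta> X \<one>)" "fun_comp (h\<Theta> Y \<one>) f" "m \<one>"
    by (rule ml) simp
  interpret mg: linear_nat_iso "hbase X" "hbase Y" "fun_comp f (h\<Theta> X (pathfinish \<gamma>))" "fun_comp (h\<Theta> Y (pathfinish \<gamma>)) f" "m (pathfinish \<gamma>)"
    by (rule ml) (rule paths_in_ends[OF g(1)])
  let ?E = "hbase Y"
  have nat: "cmpt (h\<Theta>p Y \<gamma>) (omap f a) \<cdot>\<^bsub>?E\<^esub> cmpt (m \<one>) a = cmpt (m (pathfinish \<gamma>)) a \<cdot>\<^bsub>?E\<^esub> mmap f (cmpt (h\<Theta>p X \<gamma>) a)"
    using cmpt_cong[OF m.m_natural[OF g(1)], of a] a g(2) by simp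
  have M: "cmpt (hM Y) (omap f a) \<cdot>\<^bsub>?E\<^esub> cmpt (m \<one>) a = mmap f (cmpt (hM X) a)"
    using cmpt_cong[OF m.m_M, of a] a by simp
  have "cmpt (m \<one>) a \<cdot>\<^bsub>?E\<^esub> inv_of ?E (mmap f (cmpt (hM X) a)) = inv_of ?E (cmpt (hM Y) (omap f a))"
    by (rule Y.isom_cancel_left[of "cmpt (hM Y) (omap f a)"])
      (use a in \<open>simp_all flip: Y.Cmp_assoc' add: M\<close>)
  then have m1: "cmpt (m \<one>) a \<cdot>\<^bsub>?E\<^esub> mmap f (inv_of (hbase X) (cmpt (hM X) a)) = inv_of ?E (cmpt (hM Y) (omap f a))"
    using a by simp
  have "cmpt (m (pathfinish \<gamma>)) a \<cdot>\<^bsub>?E\<^esub> mmap f (cmpt (triv X \<gamma>) a) =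
      (cmpt (m (pathfinish \<gamma>)) a \<cdot>\<^bsub>?E\<^esub> mmap f (cmpt (h\<Theta>p X \<gamma>) a)) \<cdot>\<^bsub>?E\<^esub> mmap f (inv_of (hbase X) (cmpt (hM X) a))"
    using a by (simp add: X.cmpt_triv g)
  also have "\<dots> = cmpt (h\<Theta>p Y \<gamma>) (omap f a) \<cdot>\<^bsub>?E\<^esub> cmpt (m \<one>) a \<cdot>\<^bsub>?E\<^esub> mmap f (inv_of (hbase X) (cmpt (hM X) a))"
    unfolding nat[symmetric] using a by simp
  also have "\<dots> = cmpt (triv Y \<gamma>) (omap f a)"
    unfolding m1 using a by (simp add: Y.cmpt_triv g)
  finally show "cmpt (m (pathfinish \<gamma>)) a \<cdot>\<^bsub>?E\<^esub> mmap f (cmpt (triv X \<gamma>) a) = cmpt (triv Y \<gamma>) (omap f a)" .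
qed

text \<open>Both sides of each axiom are composed with an invertible trivialization or its image.
  The axiom then becomes a law for trivializations: concatenation for naturality,
  \<open>triv_mult\<close> for the axiom on \<open>h\<Pi>\<close>, the constant path for the axiom
  on \<open>hM\<close>.\<close>

lemma morphism_if_compatible:
  assumes "compatible G X Y f m"
  shows "hfp_morphism G (core Vect2_fd) X Y f m"
proof -
  let ?E = "hbase Y"
  have ml: "linear_nat_iso (hbase X) ?E (fun_comp f (h\<Theta> X g)) (fun_comp (h\<Theta> Y g) f) (m g)"
    if "g \<in> carrier G" for g
    using assms that by (simp add: compatible_def)
  have ct: "cmpt (m (pathfinish \<gamma>)) a \<cdot>\<^bsub>?E\<^esub> mmap f (cmpt (triv X \<gamma>) a) = cmpt (triv Y \<gamma>) (omap f a)"
    if "\<gamma> \<in> paths_in G" "pathstart \<gamma> = \<one>" "a \<in> Obj (hbase X)" for \<gamma> a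
    using assms that by (simp add: compatible_def)
  show ?thesis
  proof
    show "f \<in> Hom1 (core Vect2_fd) (hbase X) (hbase Y)" using f_equiv by simp
    show "m \<in> extensional (carrier G)" using assms by (simp add: compatible_def)
    show "m g \<in> Iso2 (core Vect2_fd) (f \<diamondop>\<^bsub>core Vect2_fd\<^esub> h\<Theta> X g) (h\<Theta> Y g \<diamondop>\<^bsub>core Vect2_fd\<^esub> f)"
      if "g \<in> carrier G" for g
      using ml[OF that] by (simp add: Iso2_Vect2_iff[OF fX fY] that)
  next
    fix \<gamma> assume g: "\<gamma> \<in> paths_in G"
    let ?g = "pathstart \<gamma>" and ?h = "pathfinish \<gamma>"
    note gh = paths_in_ends[OF g]
    \<comment> \<open>Along a path from the unit to the start of \<open>\<gamma>\<close>, both sides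
      of naturality become the trivialization of \<open>Y\<close> along
      \<open>\<delta> +++ \<gamma>\<close>.\<close>
    obtain \<delta> where d: "\<delta> \<in> paths_in G" "pathstart \<delta> = \<one>" "pathfinish \<delta> = ?g" using X.connected[OF gh(1)] by blast
    interpret gX: linear_nat_iso "hbase X" "hbase X" "h\<Theta> X ?g" "h\<Theta> X ?h" "h\<Theta>p X \<gamma>" by (rule X.\<Theta>p_linear[OF g])
    interpret gY: linear_nat_iso "hbase Y" "hbase Y" "h\<Theta> Y ?g" "h\<Theta> Y ?h" "h\<Theta>p Y \<gamma>" by (rule Y.\<Theta>p_linear[OF g])
    interpret mg: linear_nat_iso "hbase X" "hbase Y" "fun_comp f (h\<Theta> X ?g)" "fun_comp (h\<Theta> Y ?g) f" "m ?g" by (rule ml[OF gh(1)])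
    interpret mh: linear_nat_iso "hbase X" "hbase Y" "fun_comp f (h\<Theta> X ?h)" "fun_comp (h\<Theta> Y ?h) f" "m ?h" by (rule ml[OF gh(2)])
    interpret dX: linear_nat_iso "hbase X" "hbase X" "fun_id (hbase X)" "h\<Theta> X ?g" "triv X \<delta>" using X.triv_linear d by metis
    interpret dY: linear_nat_iso "hbase Y" "hbase Y" "fun_id (hbase Y)" "h\<Theta> Y ?g" "triv Y \<delta>" using Y.triv_linear d by metis
    have "cmpt (h\<Theta>p Y \<gamma>) (omap f a) \<cdot>\<^bsub>?E\<^esub> cmpt (m ?g) a = cmpt (m ?h) a \<cdot>\<^bsub>?E\<^esub> mmap f (cmpt (h\<Theta>p X \<gamma>) a)"
      if a: "a \<in> Obj (hbase X)" for a
    proof (rule Y.isom_cancel_right[of "mmap f (cmpt (triv X \<delta>) a)"])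
      have "(cmpt (h\<Theta>p Y \<gamma>) (omap f a) \<cdot>\<^bsub>?E\<^esub> cmpt (m ?g) a) \<cdot>\<^bsub>?E\<^esub> mmap f (cmpt (triv X \<delta>) a) =
          cmpt (triv Y (\<delta> +++ \<gamma>)) (omap f a)"
        using a ct[OF d(1,2) a] by (simp add: Y.triv_join[OF d(1) g d(2,3)] d(3))
      also have "\<dots> = (cmpt (m ?h) a \<cdot>\<^bsub>?E\<^esub> mmap f (cmpt (h\<Theta>p X \<gamma>) a)) \<cdot>\<^bsub>?E\<^esub> mmap f (cmpt (triv X \<delta>) a)"
        using a ct[OF join_paths_in[OF d(1) g d(3)], of a] d(2) by (simp add: X.triv_join[OF d(1) g d(2,3)])
      finally show "(cmpt (h\<Theta>p Y \<gamma>) (omap f a) \<cdot>\<^bsub>?E\<^esub> cmpt (m ?g) a) \<cdot>\<^bsub>?E\<^esub> mmap f (cmpt (triv X \<delta>) a) =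
        (cmpt (m ?h) a \<cdot>\<^bsub>?E\<^esub> mmap f (cmpt (h\<Theta>p X \<gamma>) a)) \<cdot>\<^bsub>?E\<^esub> mmap f (cmpt (triv X \<delta>) a)" .
    qed (use a in simp_all)
    then show "(h\<Theta>p Y \<gamma> \<star>\<^bsub>core Vect2_fd\<^esub> id2 (core Vect2_fd) f) \<odot>\<^bsub>core Vect2_fd\<^esub> m (pathstart \<gamma>) =
        m (pathfinish \<gamma>) \<odot>\<^bsub>core Vect2_fd\<^esub> (id2 (core Vect2_fd) f \<star>\<^bsub>core Vect2_fd\<^esub> h\<Theta>p X \<gamma>)"
      by (simp, intro nat_vcomp_eqI) simp_all
  next
    fix g h assume g: "g \<in> carrier G" and h: "h \<in> carrier G"
    obtain \<gamma> where \<gamma>: "\<gamma> \<in> paths_in G" "pathstart \<gamma> = \<one>" "pathfinish \<gamma> = g" using X.connected[OF g] by blast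
    obtain \<delta> where \<delta>: "\<delta> \<in> paths_in G" "pathstart \<delta> = \<one>" "pathfinish \<delta> = h" using X.connected[OF h] by blast
    \<comment> \<open>The pointwise product is a path from the unit to \<open>g \<otimes> h\<close>,
      so compatibility at \<open>g \<otimes> h\<close> can be tested along it.\<close>
    let ?\<gamma>\<delta> = "\<lambda>t. \<gamma> t \<otimes> \<delta> t"
    have \<gamma>\<delta>: "?\<gamma>\<delta> \<in> paths_in G" "pathstart ?\<gamma>\<delta> = \<one>" "pathfinish ?\<gamma>\<delta> = g \<otimes> h"
      using X.mult_paths_in[OF \<gamma>(1) \<delta>(1)] \<gamma> \<delta> by (auto simp: pathstart_def pathfinish_def)
    interpret Xg: linear_functor "hbase X" "hbase X" "h\<Theta> X g" by (rule X.\<Theta>_linear[OF g])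
    interpret Xh: linear_functor "hbase X" "hbase X" "h\<Theta> X h" by (rule X.\<Theta>_linear[OF h])
    interpret Yg: linear_functor "hbase Y" "hbase Y" "h\<Theta> Y g" by (rule Y.\<Theta>_linear[OF g])
    interpret Yh: linear_functor "hbase Y" "hbase Y" "h\<Theta> Y h" by (rule Y.\<Theta>_linear[OF h])
    interpret PX: linear_nat_iso "hbase X" "hbase X" "fun_comp (h\<Theta> X h) (h\<Theta> X g)" "h\<Theta> X (g \<otimes> h)" "h\<Pi> X g h" by (rule X.\<Pi>_linear[OF g h])
    interpret PY: linear_nat_iso "hbase Y" "hbase Y" "fun_comp (h\<Theta> Y h) (h\<Theta> Y g)" "h\<Theta> Y (g \<otimes> h)" "h\<Pi> Y g h" by (rule Y.\<Pi>_linear[OF g h])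
    interpret mg: linear_nat_iso "hbase X" "hbase Y" "fun_comp f (h\<Theta> X g)" "fun_comp (h\<Theta> Y g) f" "m g" by (rule ml[OF g])
    interpret mh: linear_nat_iso "hbase X" "hbase Y" "fun_comp f (h\<Theta> X h)" "fun_comp (h\<Theta> Y h) f" "m h" by (rule ml[OF h])
    interpret mgh: linear_nat_iso "hbase X" "hbase Y" "fun_comp f (h\<Theta> X (g \<otimes> h))" "fun_comp (h\<Theta> Y (g \<otimes> h)) f" "m (g \<otimes> h)"
      by (rule ml) (use g h in simp)
    interpret gX: linear_nat_iso "hbase X" "hbase X" "fun_id (hbase X)" "h\<Theta> X g" "triv X \<gamma>" using X.triv_linear \<gamma> by metis
    interpret gY: linear_nat_iso "hbase Y" "hbase Y" "fun_id (hbase Y)" "h\<Theta> Y g" "triv Y \<gamma>" using Y.triv_linear \<gamma> by metis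
    interpret dX: linear_nat_iso "hbase X" "hbase X" "fun_id (hbase X)" "h\<Theta> X h" "triv X \<delta>" using X.triv_linear \<delta> by metis
    interpret dY: linear_nat_iso "hbase Y" "hbase Y" "fun_id (hbase Y)" "h\<Theta> Y h" "triv Y \<delta>" using Y.triv_linear \<delta> by metis
    have eq: "cmpt (m (g \<otimes> h)) a \<cdot>\<^bsub>?E\<^esub> mmap f (cmpt (h\<Pi> X g h) a) =
        cmpt (h\<Pi> Y g h) (omap f a) \<cdot>\<^bsub>?E\<^esub> mmap (h\<Theta> Y h) (cmpt (m g) a) \<cdot>\<^bsub>?E\<^esub> cmpt (m h) (omap (h\<Theta> X g) a)"
      if a: "a \<in> Obj (hbase X)" for a
    proof -
      let ?ga = "omap (h\<Theta> X g) a"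
      let ?t = "mmap f (cmpt (triv X \<delta>) ?ga) \<cdot>\<^bsub>?E\<^esub> mmap f (cmpt (triv X \<gamma>) a)"
      note XP = X.triv_mult[OF \<gamma>(1,2) \<delta>(1,2) a, unfolded \<gamma>(3) \<delta>(3)]
      note YP = Y.triv_mult[OF \<gamma>(1,2) \<delta>(1,2) f.omap_Obj[OF a], unfolded \<gamma>(3) \<delta>(3)]
      note cg = ct[OF \<gamma>(1,2) a, unfolded \<gamma>(3)]
      note ch = ct[OF \<delta>(1,2) Xg.omap_Obj[OF a], unfolded \<delta>(3)]
      note cgh = ct[OF \<gamma>\<delta>(1,2) a, unfolded \<gamma>\<delta>(3)]
      have nY: "cmpt (triv Y \<delta>) (omap (h\<Theta> Y g) (omap f a)) \<cdot>\<^bsub>?E\<^esub> cmpt (m g) a =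
          mmap (h\<Theta> Y h) (cmpt (m g) a) \<cdot>\<^bsub>?E\<^esub> cmpt (triv Y \<delta>) (omap f ?ga)"
        using dY.naturality[of "cmpt (m g) a" "omap f ?ga" "omap (h\<Theta> Y g) (omap f a)"] a by simp
      have "(cmpt (m (g \<otimes> h)) a \<cdot>\<^bsub>?E\<^esub> mmap f (cmpt (h\<Pi> X g h) a)) \<cdot>\<^bsub>?E\<^esub> ?t =
          cmpt (m (g \<otimes> h)) a \<cdot>\<^bsub>?E\<^esub> mmap f (cmpt (h\<Pi> X g h) a \<cdot>\<^bsub>hbase X\<^esub> cmpt (triv X \<delta>) ?ga \<cdot>\<^bsub>hbase X\<^esub> cmpt (triv X \<gamma>) a)"
        using a by simp
      also have "\<dots> = cmpt (triv Y ?\<gamma>\<delta>) (omap f a)" unfolding XP cgh ..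
      also have "\<dots> = cmpt (h\<Pi> Y g h) (omap f a) \<cdot>\<^bsub>?E\<^esub> cmpt (triv Y \<delta>) (omap (h\<Theta> Y g) (omap f a)) \<cdot>\<^bsub>?E\<^esub>
          (cmpt (m g) a \<cdot>\<^bsub>?E\<^esub> mmap f (cmpt (triv X \<gamma>) a))"
        unfolding YP[symmetric] cg ..
      also have "\<dots> = cmpt (h\<Pi> Y g h) (omap f a) \<cdot>\<^bsub>?E\<^esub>
          (cmpt (triv Y \<delta>) (omap (h\<Theta> Y g) (omap f a)) \<cdot>\<^bsub>?E\<^esub> cmpt (m g) a) \<cdot>\<^bsub>?E\<^esub> mmap f (cmpt (triv X \<gamma>) a)"
        using a by simp
      also have "\<dots> = (cmpt (h\<Pi> Y g h) (omap f a) \<cdot>\<^bsub>?E\<^esub> mmap (h\<Theta> Y h) (cmpt (m g) a) \<cdot>\<^bsub>?E\<^esub> cmpt (m h) ?ga) \<cdot>\<^bsub>?E\<^esub> ?t"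
        unfolding nY ch[symmetric] using a by simp
      finally show ?thesis
        by (rule Y.isom_cancel_right[rotated 5]) (use a in simp_all)
    qed
    show "m (g \<otimes> h) \<odot>\<^bsub>core Vect2_fd\<^esub> (id2 (core Vect2_fd) f \<star>\<^bsub>core Vect2_fd\<^esub> h\<Pi> X g h) \<odot>\<^bsub>core Vect2_fd\<^esub>
        assoc (core Vect2_fd) f (h\<Theta> X h) (h\<Theta> X g) =
      (h\<Pi> Y g h \<star>\<^bsub>core Vect2_fd\<^esub> id2 (core Vect2_fd) f) \<odot>\<^bsub>core Vect2_fd\<^esub>
      assoc_inv (core Vect2_fd) (h\<Theta> Y h) (h\<Theta> Y g) f \<odot>\<^bsub>core Vect2_fd\<^esub>
      (id2 (core Vect2_fd) (h\<Theta> Y h) \<star>\<^bsub>core Vect2_fd\<^esub> m g) \<odot>\<^bsub>core Vect2_fd\<^esub>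
      assoc (core Vect2_fd) (h\<Theta> Y h) f (h\<Theta> X g) \<odot>\<^bsub>core Vect2_fd\<^esub>
      (m h \<star>\<^bsub>core Vect2_fd\<^esub> id2 (core Vect2_fd) (h\<Theta> X g))"
      by (simp, intro nat_vcomp_eqI)
        (simp_all add: eq fun_comp_assoc[OF Xg.linear_functor_axioms Xh.linear_functor_axioms f.linear_functor_axioms])
  next
    interpret m1: linear_nat_iso "hbase X" "hbase Y" "fun_comp f (h\<Theta> X \<one>)" "fun_comp (h\<Theta> Y \<one>) f" "m \<one>"
      by (rule ml) simp
    have eq: "cmpt (hM Y) (omap f a) \<cdot>\<^bsub>?E\<^esub> cmpt (m \<one>) a = mmap f (cmpt (hM X) a)" if a: "a \<in> Obj (hbase X)" for a
    proof (rule Y.isom_cancel_right[of "mmap f (inv_of (hbase X) (cmpt (hM X) a))"])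
      \<comment> \<open>Compatibility along the constant path at the unit, where the trivializations
        are the inverses of \<open>hM\<close>.\<close>
      have "cmpt (m \<one>) a \<cdot>\<^bsub>?E\<^esub> mmap f (inv_of (hbase X) (cmpt (hM X) a)) = inv_of ?E (cmpt (hM Y) (omap f a))"
        using ct[OF const_paths_in[of \<one>], of a] a by (simp add: X.triv_const Y.triv_const pathstart_def pathfinish_def)
      then show "(cmpt (hM Y) (omap f a) \<cdot>\<^bsub>?E\<^esub> cmpt (m \<one>) a) \<cdot>\<^bsub>?E\<^esub> mmap f (inv_of (hbase X) (cmpt (hM X) a)) =
          mmap f (cmpt (hM X) a) \<cdot>\<^bsub>?E\<^esub> mmap f (inv_of (hbase X) (cmpt (hM X) a))"
        using a by simp
    qed (use a in simp_all)
    show "lunit (core Vect2_fd) f \<odot>\<^bsub>core Vect2_fd\<^esub> (hM Y \<star>\<^bsub>core Vect2_fd\<^esub> id2 (core Vect2_fd) f) \<odot>\<^bsub>core Vect2_fd\<^esub> m \<one> =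
        runit (core Vect2_fd) f \<odot>\<^bsub>core Vect2_fd\<^esub> (id2 (core Vect2_fd) f \<star>\<^bsub>core Vect2_fd\<^esub> hM X)"
      by (simp, intro nat_vcomp_eqI) (simp_all add: eq)
  qed
qed

lemma morphism_iff_compatible: "hfp_morphism G (core Vect2_fd) X Y f m \<longleftrightarrow> compatible G X Y f m"
  using compatible_if_morphism morphism_if_compatible by blast

end

lemma hfp_simps [simp]:
  "Ob (homotopy_fixed_points G B) = {X. hfp_object G B X}"
  "Hom1 (homotopy_fixed_points G B) = hfp_Hom1 G B"
  "Hom2 (homotopy_fixed_points G B) = hfp_Hom2 G B"
  "id1 (homotopy_fixed_points G B) = hfp_id1 G B"
  "comp1 (homotopy_fixed_points G B) = hfp_comp1 G B"
  by (simp_all add: homotopy_fixed_points_def Let_def)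

text \<open>After composition with the image of a trivialization of \<open>X\<close>, compatibility
  removes \<open>m\<close> and \<open>n\<close>. What remains is naturality of the trivialization of
  \<open>Y\<close> and of \<open>\<alpha>\<close>.\<close>

lemma (in fixed_point_pair) Hom2_automatic:
  assumes "fixed_point_pair G X Y f'"
    and m: "compatible G X Y f m" and n: "compatible G X Y f' n"
    and \<alpha>: "linear_nat_iso (hbase X) (hbase Y) f f' \<alpha>" and g: "g \<in> carrier G"
  shows "nat_vcomp (nat_hcomp (nat_id (h\<Theta> Y g)) \<alpha>) (m g) = nat_vcomp (n g) (nat_hcomp \<alpha> (nat_id (h\<Theta> X g)))"
proof -
  interpret f': fixed_point_pair G X Y f' by fact
  interpret a: linear_nat_iso "hbase X" "hbase Y" f f' \<alpha> by fact
  obtain \<gamma> where \<gamma>: "\<gamma> \<in> paths_in G" "pathstart \<gamma> = \<one>" "pathfinish \<gamma> = g" using X.connected[OF g] by blast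
  interpret Xg: linear_functor "hbase X" "hbase X" "h\<Theta> X g" by (rule X.\<Theta>_linear[OF g])
  interpret Yg: linear_functor "hbase Y" "hbase Y" "h\<Theta> Y g" by (rule Y.\<Theta>_linear[OF g])
  interpret mg: linear_nat_iso "hbase X" "hbase Y" "fun_comp f (h\<Theta> X g)" "fun_comp (h\<Theta> Y g) f" "m g"
    using m g by (simp add: compatible_def)
  interpret ng: linear_nat_iso "hbase X" "hbase Y" "fun_comp f' (h\<Theta> X g)" "fun_comp (h\<Theta> Y g) f'" "n g"
    using n g by (simp add: compatible_def)
  interpret gX: linear_nat_iso "hbase X" "hbase X" "fun_id (hbase X)" "h\<Theta> X g" "triv X \<gamma>" using X.triv_linear \<gamma> by metis
  interpret gY: linear_nat_iso "hbase Y" "hbase Y" "fun_id (hbase Y)" "h\<Theta> Y g" "triv Y \<gamma>" using Y.triv_linear \<gamma> by metis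
  let ?E = "hbase Y"
  have "mmap (h\<Theta> Y g) (cmpt \<alpha> x) \<cdot>\<^bsub>?E\<^esub> cmpt (m g) x = cmpt (n g) x \<cdot>\<^bsub>?E\<^esub> cmpt \<alpha> (omap (h\<Theta> X g) x)"
    if x: "x \<in> Obj (hbase X)" for x
  proof -
    let ?t = "mmap f (cmpt (triv X \<gamma>) x)"
    have cm: "cmpt (m g) x \<cdot>\<^bsub>?E\<^esub> ?t = cmpt (triv Y \<gamma>) (omap f x)"
      using m \<gamma> x by (auto simp: compatible_def)
    have cn: "cmpt (n g) x \<cdot>\<^bsub>?E\<^esub> mmap f' (cmpt (triv X \<gamma>) x) = cmpt (triv Y \<gamma>) (omap f' x)"
      using n \<gamma> x by (auto simp: compatible_def)
    have "(mmap (h\<Theta> Y g) (cmpt \<alpha> x) \<cdot>\<^bsub>?E\<^esub> cmpt (m g) x) \<cdot>\<^bsub>?E\<^esub> ?t =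
        mmap (h\<Theta> Y g) (cmpt \<alpha> x) \<cdot>\<^bsub>?E\<^esub> cmpt (triv Y \<gamma>) (omap f x)"
      unfolding cm[symmetric] using x by simp
    also have "\<dots> = cmpt (triv Y \<gamma>) (omap f' x) \<cdot>\<^bsub>?E\<^esub> cmpt \<alpha> x"
      using gY.naturality[of "cmpt \<alpha> x" "omap f x" "omap f' x"] x by simp
    also have "\<dots> = cmpt (n g) x \<cdot>\<^bsub>?E\<^esub> mmap f' (cmpt (triv X \<gamma>) x) \<cdot>\<^bsub>?E\<^esub> cmpt \<alpha> x"
      unfolding cn[symmetric] using x by simp
    also have "mmap f' (cmpt (triv X \<gamma>) x) \<cdot>\<^bsub>?E\<^esub> cmpt \<alpha> x = cmpt \<alpha> (omap (h\<Theta> X g) x) \<cdot>\<^bsub>?E\<^esub> ?t"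
      using a.naturality[of "cmpt (triv X \<gamma>) x" x "omap (h\<Theta> X g) x"] x by simp
    also have "cmpt (n g) x \<cdot>\<^bsub>?E\<^esub> \<dots> = (cmpt (n g) x \<cdot>\<^bsub>?E\<^esub> cmpt \<alpha> (omap (h\<Theta> X g) x)) \<cdot>\<^bsub>?E\<^esub> ?t"
      using x by simp
    finally show ?thesis
      by (rule Y.isom_cancel_right[rotated 5]) (use x in simp_all)
  qed
  then show ?thesis
    by (intro nat_vcomp_eqI) simp_all
qed

lemma (in linear_fixed_point) fixed_point_pair_id: "fixed_point_pair G X X (fun_id D)"
proof -
  interpret i: linear_functor D D "fun_id D" by (rule fun_id_linear[OF linear_category_axioms])
  show ?thesis
    by unfold_locales
      (use bicategory.id1_Equiv1[OF bicategory_Vect2, of D] abelian_category_axioms in simp)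
qed

lemma (in linear_fixed_point) compatible_id:
  "compatible G X X (fun_id D) (hm (hfp_id1 G (core Vect2_fd) X))"
  unfolding compatible_def
proof (intro conjI ballI impI)
  fix g assume g: "g \<in> carrier G"
  show "linear_nat_iso D D (fun_comp (fun_id D) (\<Theta> g)) (fun_comp (\<Theta> g) (fun_id D)) (hm (hfp_id1 G (core Vect2_fd) X) g)"
    using g nat_iso_id[OF \<Theta>_linear[OF g]]
    by (simp add: hfp_id1_def fun_comp_id[OF \<Theta>_linear[OF g]] nat_vcomp_id[OF nat_id_linear[OF \<Theta>_linear[OF g]]])
next
  fix \<gamma> a assume g: "\<gamma> \<in> paths_in G" "pathstart \<gamma> = \<one>" and a: "a \<in> Obj D"
  interpret g: linear_nat_iso D D "fun_id D" "\<Theta> (pathfinish \<gamma>)" "triv X \<gamma>" by (rule triv_linear[OF g])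
  show "cmpt (hm (hfp_id1 G (core Vect2_fd) X) (pathfinish \<gamma>)) a \<cdot>\<^bsub>D\<^esub> mmap (fun_id D) (cmpt (triv X \<gamma>) a) =
      cmpt (triv X \<gamma>) (omap (fun_id D) a)"
    using a g paths_in_ends(2)[OF g(1)] by (simp add: hfp_id1_def)
qed (simp add: hfp_id1_def)

text \<open>The associators are identities, so the cells of the composite are plain pastings.
  Applying \<open>hcell Q\<close> to the condition for \<open>P\<close> produces the input of the
  condition for \<open>Q\<close>.\<close>

lemma compatible_comp:
  assumes "fixed_point_pair G X Y (hcell P)" "fixed_point_pair G Y Z (hcell Q)"
    and m: "compatible G X Y (hcell P) (hm P)" and n: "compatible G Y Z (hcell Q) (hm Q)"
    and PQ: "hsrc P = X" "htrg P = Y" "htrg Q = Z"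
  shows "compatible G X Z (fun_comp (hcell Q) (hcell P)) (hm (hfp_comp1 G (core Vect2_fd) Q P))"
proof -
  interpret P: fixed_point_pair G X Y "hcell P" by fact
  interpret Q: fixed_point_pair G Y Z "hcell Q" by fact
  let ?p = "hcell P" and ?q = "hcell Q"
  let ?k = "hm (hfp_comp1 G (core Vect2_fd) Q P)"
  note lin = P.f.linear_functor_axioms Q.f.linear_functor_axioms
  have ml: "linear_nat_iso (hbase X) (hbase Y) (fun_comp ?p (h\<Theta> X g)) (fun_comp (h\<Theta> Y g) ?p) (hm P g)" if "g \<in> carrier G" for g
    using m that by (simp add: compatible_def)
  have nl: "linear_nat_iso (hbase Y) (hbase Z) (fun_comp ?q (h\<Theta> Y g)) (fun_comp (h\<Theta> Z g) ?q) (hm Q g)" if "g \<in> carrier G" for g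
    using n that by (simp add: compatible_def)
  have k: "?k g = nat_vcomp (nat_hcomp (hm Q g) (nat_id ?p)) (nat_hcomp (nat_id ?q) (hm P g))"
    and kl: "linear_nat_iso (hbase X) (hbase Z) (fun_comp (fun_comp ?q ?p) (h\<Theta> X g)) (fun_comp (h\<Theta> Z g) (fun_comp ?q ?p)) (?k g)"
    if g: "g \<in> carrier G" for g
  proof -
    note t = P.X.\<Theta>_linear[OF g] P.Y.\<Theta>_linear[OF g] Q.Y.\<Theta>_linear[OF g]
    have 1: "linear_nat_iso (hbase X) (hbase Z) (fun_comp ?q (fun_comp ?p (h\<Theta> X g))) (fun_comp ?q (fun_comp (h\<Theta> Y g) ?p))
        (nat_hcomp (nat_id ?q) (hm P g))"
      by (rule nat_iso_hcomp[OF ml[OF g] nat_iso_id[OF lin(2)]])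
    have 2: "linear_nat_iso (hbase X) (hbase Z) (fun_comp ?q (fun_comp (h\<Theta> Y g) ?p)) (fun_comp (h\<Theta> Z g) (fun_comp ?q ?p))
        (nat_hcomp (hm Q g) (nat_id ?p))"
      using nat_iso_hcomp[OF nat_iso_id[OF lin(1)] nl[OF g]]
      by (simp add: fun_comp_assoc[OF lin(1) t(2) lin(2)] fun_comp_assoc[OF lin t(3)])
    note v = nat_iso_vcomp[OF 1 2]
    note l = 1[THEN linear_nat_iso.axioms(1)] 2[THEN linear_nat_iso.axioms(1)] v[THEN linear_nat_iso.axioms(1)]
    show e: "?k g = nat_vcomp (nat_hcomp (hm Q g) (nat_id ?p)) (nat_hcomp (nat_id ?q) (hm P g))"
      using g by (simp add: hfp_comp1_def PQ nat_vcomp_id[OF l(1)] nat_vcomp_id[OF l(3)])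
    show "linear_nat_iso (hbase X) (hbase Z) (fun_comp (fun_comp ?q ?p) (h\<Theta> X g)) (fun_comp (h\<Theta> Z g) (fun_comp ?q ?p)) (?k g)"
      unfolding e using v by (simp add: fun_comp_assoc[OF t(1) lin])
  qed
  show ?thesis
    unfolding compatible_def
  proof (intro conjI ballI impI kl)
    show "?k \<in> extensional (carrier G)" by (simp add: hfp_comp1_def)
    fix \<gamma> a assume g: "\<gamma> \<in> paths_in G" "pathstart \<gamma> = \<one>\<^bsub>G\<^esub>" and a: "a \<in> Obj (hbase X)"
    let ?g = "pathfinish \<gamma>" and ?E = "hbase Z"
    note c = paths_in_ends(2)[OF g(1)]
    interpret mg: linear_nat_iso "hbase X" "hbase Y" "fun_comp ?p (h\<Theta> X ?g)" "fun_comp (h\<Theta> Y ?g) ?p" "hm P ?g" by (rule ml[OF c])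
    interpret ng: linear_nat_iso "hbase Y" "hbase Z" "fun_comp ?q (h\<Theta> Y ?g)" "fun_comp (h\<Theta> Z ?g) ?q" "hm Q ?g" by (rule nl[OF c])
    interpret gX: linear_nat_iso "hbase X" "hbase X" "fun_id (hbase X)" "h\<Theta> X ?g" "triv X \<gamma>" by (rule P.X.triv_linear[OF g])
    interpret Yg: linear_functor "hbase Y" "hbase Y" "h\<Theta> Y ?g" by (rule P.Y.\<Theta>_linear[OF c])
    have cm: "cmpt (hm P ?g) a \<cdot>\<^bsub>hbase Y\<^esub> mmap ?p (cmpt (triv X \<gamma>) a) = cmpt (triv Y \<gamma>) (omap ?p a)"
      using m g a by (simp add: compatible_def)
    have cn: "cmpt (hm Q ?g) (omap ?p a) \<cdot>\<^bsub>?E\<^esub> mmap ?q (cmpt (triv Y \<gamma>) (omap ?p a)) = cmpt (triv Z \<gamma>) (omap ?q (omap ?p a))"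
      using n g a by (simp add: compatible_def)
    have "cmpt (?k ?g) a \<cdot>\<^bsub>?E\<^esub> mmap (fun_comp ?q ?p) (cmpt (triv X \<gamma>) a) =
        cmpt (hm Q ?g) (omap ?p a) \<cdot>\<^bsub>?E\<^esub> mmap ?q (cmpt (hm P ?g) a \<cdot>\<^bsub>hbase Y\<^esub> mmap ?p (cmpt (triv X \<gamma>) a))"
      using a by (simp add: k[OF c])
    then show "cmpt (?k ?g) a \<cdot>\<^bsub>?E\<^esub> mmap (fun_comp ?q ?p) (cmpt (triv X \<gamma>) a) = cmpt (triv Z \<gamma>) (omap (fun_comp ?q ?p) a)"
      unfolding cm cn using a by simp
  qed
qed

lemma (in path_connected_group) linear_fixed_pointI:
  "hfp_object G (core Vect2_fd) X \<Longrightarrow> linear_fixed_point G X"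
  by (simp add: linear_fixed_point_def path_connected_group_axioms)

lemma (in path_connected_group) hfp_Hom1_iff:
  assumes "hfp_object G (core Vect2_fd) X" "hfp_object G (core Vect2_fd) Y"
  shows "P \<in> hfp_Hom1 G (core Vect2_fd) X Y \<longleftrightarrow> hsrc P = X \<and> htrg P = Y \<and>
    fixed_point_pair G X Y (hcell P) \<and> compatible G X Y (hcell P) (hm P)"
proof -
  interpret X: linear_fixed_point G X by (rule linear_fixed_pointI) fact
  interpret Y: linear_fixed_point G Y by (rule linear_fixed_pointI) fact
  have pair: "fixed_point_pair G X Y f" if "f \<in> Equiv1 Vect2 (hbase X) (hbase Y)" for f
    using that Equiv1_linear_functor[OF X.linear_category_axioms Y.linear_category_axioms that]
    by (simp add: fixed_point_pair_def fixed_point_pair_axioms_def X.linear_fixed_point_axioms Y.linear_fixed_point_axioms)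
  show ?thesis
  proof
    assume "P \<in> hfp_Hom1 G (core Vect2_fd) X Y"
    then have h: "hsrc P = X" "htrg P = Y" "hfp_morphism G (core Vect2_fd) X Y (hcell P) (hm P)"
      by (auto simp: hfp_Hom1_def)
    then have p: "fixed_point_pair G X Y (hcell P)"
      using pair hfp_morphism.cell[OF h(3)] by simp
    with h show "hsrc P = X \<and> htrg P = Y \<and> fixed_point_pair G X Y (hcell P) \<and> compatible G X Y (hcell P) (hm P)"
      using fixed_point_pair.morphism_iff_compatible[OF p] by simp
  next
    assume "hsrc P = X \<and> htrg P = Y \<and> fixed_point_pair G X Y (hcell P) \<and> compatible G X Y (hcell P) (hm P)"
    then show "P \<in> hfp_Hom1 G (core Vect2_fd) X Y"
      by (auto simp: hfp_Hom1_def intro: fixed_point_pair.morphism_if_compatible)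
  qed
qed

text \<open>Local fullness over the base is \<open>Hom2_automatic\<close>; closure under identities
  and composition is checked through \<open>compatible\<close>.\<close>

lemma (in path_connected_group) lifted_homotopy_fixed_points:
  "lifted_bicategory (core Vect2_fd)
    (homotopy_fixed_points G (core (Vect2_fd :: (('o, 'm, 'k :: field) lincat, ('o, 'm, 'k) linfun, ('o, 'm, 'k) nattr) bicat)))
    hbase hcell"
proof -
  let ?V = "core (Vect2_fd :: (('o, 'm, 'k) lincat, ('o, 'm, 'k) linfun, ('o, 'm, 'k) nattr) bicat)"
  interpret V: bicategory ?V by (rule bicategory_core_Vect2_fd)
  show ?thesis
  proof (unfold_locales, unfold hfp_simps mem_Collect_eq)
    fix X assume X: "hfp_object G ?V X"
    interpret X: linear_fixed_point G X by (rule linear_fixed_pointI[OF X])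
    show "hbase X \<in> Ob ?V" by (rule X.base)
    show "hfp_id1 G ?V X \<in> hfp_Hom1 G ?V X X"
      using X.fixed_point_pair_id X.compatible_id by (simp add: hfp_Hom1_iff[OF X X]) (simp add: hfp_id1_def)
    show "hcell (hfp_id1 G ?V X) = id1 ?V (hbase X)" by (simp add: hfp_id1_def)
  next
    fix X Y P assume a: "hfp_object G ?V X" "hfp_object G ?V Y" "P \<in> hfp_Hom1 G ?V X Y"
    then have h: "hsrc P = X" "htrg P = Y" "fixed_point_pair G X Y (hcell P)"
      by (simp_all add: hfp_Hom1_iff)
    show "hcell P \<in> Hom1 ?V (hbase X) (hbase Y)"
      using fixed_point_pair.f_equiv[OF h(3)] by simp
    show "id2 (homotopy_fixed_points G ?V) P = (P, P, id2 ?V (hcell P))"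
      "lunit (homotopy_fixed_points G ?V) P = (hfp_comp1 G ?V (hfp_id1 G ?V Y) P, P, lunit ?V (hcell P))"
      "lunit_inv (homotopy_fixed_points G ?V) P = (P, hfp_comp1 G ?V (hfp_id1 G ?V Y) P, lunit_inv ?V (hcell P))"
      "runit (homotopy_fixed_points G ?V) P = (hfp_comp1 G ?V P (hfp_id1 G ?V X), P, runit ?V (hcell P))"
      "runit_inv (homotopy_fixed_points G ?V) P = (P, hfp_comp1 G ?V P (hfp_id1 G ?V X), runit_inv ?V (hcell P))"
      using h by (simp_all add: homotopy_fixed_points_def Let_def)
  next
    fix X Y X' Y' P assume "P \<in> hfp_Hom1 G ?V X Y" "P \<in> hfp_Hom1 G ?V X' Y'"
    then show "X = X' \<and> Y = Y'" by (simp add: hfp_Hom1_def)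
  next
    fix X Y Z P Q
    assume a: "hfp_object G ?V X" "hfp_object G ?V Y" "hfp_object G ?V Z"
      "P \<in> hfp_Hom1 G ?V X Y" "Q \<in> hfp_Hom1 G ?V Y Z"
    show "hcell (hfp_comp1 G ?V Q P) = hcell Q \<diamondop>\<^bsub>?V\<^esub> hcell P" by (simp add: hfp_comp1_def)
    have p: "hsrc P = X" "htrg P = Y" "fixed_point_pair G X Y (hcell P)" "compatible G X Y (hcell P) (hm P)"
      and q: "hsrc Q = Y" "htrg Q = Z" "fixed_point_pair G Y Z (hcell Q)" "compatible G Y Z (hcell Q) (hm Q)"
      using a by (simp_all add: hfp_Hom1_iff)
    interpret P: fixed_point_pair G X Y "hcell P" by (rule p)
    interpret Q: fixed_point_pair G Y Z "hcell Q" by (rule q)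
    interpret QP: linear_functor "hbase X" "hbase Z" "fun_comp (hcell Q) (hcell P)"
      by (rule fun_comp_linear[OF P.f.linear_functor_axioms Q.f.linear_functor_axioms])
    have "fixed_point_pair G X Z (fun_comp (hcell Q) (hcell P))"
      by unfold_locales
        (use V.comp1_closed[of "hbase X" "hbase Y" "hbase Z" "hcell P" "hcell Q"] P.X.base P.Y.base Q.Y.base
          P.f_equiv Q.f_equiv in simp)
    then show "hfp_comp1 G ?V Q P \<in> hfp_Hom1 G ?V X Z"
      using compatible_comp[OF p(3) q(3) p(4) q(4) p(1,2) q(2)] p q
      by (simp add: hfp_Hom1_iff[OF a(1,3)]) (simp add: hfp_comp1_def)
  next
    fix X Y P Q
    assume a: "hfp_object G ?V X" "hfp_object G ?V Y" "P \<in> hfp_Hom1 G ?V X Y" "Q \<in> hfp_Hom1 G ?V X Y"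
    have p: "hsrc P = X" "htrg P = Y" "fixed_point_pair G X Y (hcell P)" "compatible G X Y (hcell P) (hm P)"
      and q: "fixed_point_pair G X Y (hcell Q)" "compatible G X Y (hcell Q) (hm Q)"
      using a by (simp_all add: hfp_Hom1_iff)
    interpret P: fixed_point_pair G X Y "hcell P" by (rule p)
    interpret Q: fixed_point_pair G X Y "hcell Q" by (rule q)
    have "nat_vcomp (nat_hcomp (nat_id (h\<Theta> Y g)) \<alpha>) (hm P g) = nat_vcomp (hm Q g) (nat_hcomp \<alpha> (nat_id (h\<Theta> X g)))"
      if "\<alpha> \<in> Iso2 Vect2 (hcell P) (hcell Q)" "g \<in> carrier G" for \<alpha> g
      using P.Hom2_automatic[OF q(1) p(4) q(2)] that
      by (simp add: Iso2_Vect2_iff[OF P.f.linear_functor_axioms Q.f.linear_functor_axioms])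
    then show "hfp_Hom2 G ?V P Q = {(P, Q, \<alpha>) |\<alpha>. \<alpha> \<in> Hom2 ?V (hcell P) (hcell Q)}"
      using p by (auto simp: hfp_Hom2_def)
  qed (simp_all add: homotopy_fixed_points_def Let_def)
qed

section \<open>Paths in \<open>SO(2)\<close>\<close>

definition mat_of :: "complex \<Rightarrow> real ^ 2 ^ 2" where
  "mat_of z = vector [vector [Re z, - Im z], vector [Im z, Re z]]"

text \<open>Angles are measured in full turns, so that the kernel of \<open>rot\<close> is the
  integers and floors count turns.\<close>

definition rot :: "real \<Rightarrow> real ^ 2 ^ 2" where
  "rot x = mat_of (cis (2 * pi * x))"

lemma mat_of_nth [simp]:
  "mat_of z $ 1 $ 1 = Re z" "mat_of z $ 1 $ 2 = - Im z" "mat_of z $ 2 $ 1 = Im z" "mat_of z $ 2 $ 2 = Re z"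
  by (simp_all add: mat_of_def)

lemma mat_of_mult: "mat_of z ** mat_of w = mat_of (z * w)"
  by (simp add: vec_eq_iff forall_2 matrix_matrix_mult_def sum_2)

lemma rot_add: "rot x ** rot y = rot (x + y)"
  by (simp add: rot_def mat_of_mult cis_mult ring_distribs)

lemma rot_0 [simp]: "rot 0 = mat 1"
  by (simp add: rot_def vec_eq_iff forall_2 mat_def)

lemma SO_simps [simp]:
  "carrier SO = {A. orthogonal_matrix A \<and> det A = 1}" "mult SO = (**)" "one SO = mat 1"
  by (simp_all add: SO_def)

lemma rot_SO: "rot x \<in> carrier SO"
proof -
  have "cos t * cos t + sin t * sin t = 1" "sin t * sin t + cos t * cos t = 1" for t :: real
    using sin_cos_squared_add[of t] by (simp_all add: power2_eq_square add.commute)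
  then show ?thesis
    by (simp add: rot_def orthogonal_matrix_def vec_eq_iff forall_2 matrix_matrix_mult_def sum_2
        transpose_def mat_def det_2)
qed

lemma SO_rot: assumes "A \<in> carrier SO" obtains x where "A = rot x"
proof -
  have t: "(transpose A ** A) $ i $ j = mat 1 $ i $ j" for i j
    using assms by (simp add: orthogonal_matrix_def)
  have 1: "A $ 1 $ 1 * A $ 1 $ 1 + A $ 2 $ 1 * A $ 2 $ 1 = 1" "A $ 1 $ 1 * A $ 1 $ 2 + A $ 2 $ 1 * A $ 2 $ 2 = 0"
    "A $ 1 $ 1 * A $ 2 $ 2 - A $ 1 $ 2 * A $ 2 $ 1 = 1"
    using t[of 1 1] t[of 1 2] assms by (simp_all add: matrix_matrix_mult_def sum_2 transpose_def mat_def det_2)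
  \<comment> \<open>Orthogonality and determinant 1 force the second column to be the first one
    turned by a right angle.\<close>
  have 2: "A $ 2 $ 2 = A $ 1 $ 1" "A $ 1 $ 2 = - A $ 2 $ 1"
    using 1 by algebra+
  define z where "z = Complex (A $ 1 $ 1) (A $ 2 $ 1)"
  have "cmod z = 1" using 1(1) by (simp add: z_def cmod_def power2_eq_square)
  then have "z = cis (Arg z)" using rcis_cmod_Arg[of z] by (simp add: rcis_def)
  then have "A = rot (Arg z / (2 * pi))"
    using 2 by (simp add: rot_def vec_eq_iff forall_2) (simp add: z_def complex_eq_iff)
  then show thesis by (rule that)
qed

lemma rot_eq_iff: "rot x = rot y \<longleftrightarrow> (\<exists>n :: int. x = y + of_int n)"
proof -
  have "rot x = rot y \<longleftrightarrow> sin (2 * pi * x) = sin (2 * pi * y) \<and> cos (2 * pi * x) = cos (2 * pi * y)"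
    by (auto simp: rot_def vec_eq_iff forall_2)
  also have "\<dots> \<longleftrightarrow> (\<exists>n :: int. 2 * pi * x = 2 * pi * y + 2 * pi * n)"
    by (rule sin_cos_eq_iff)
  also have "\<dots> \<longleftrightarrow> (\<exists>n :: int. x = y + of_int n)"
    by (simp flip: distrib_left)
  finally show ?thesis .
qed

lemma continuous_on_rot [continuous_intros]:
  fixes S :: "'a :: t2_space set"
  assumes "continuous_on S f" shows "continuous_on S (\<lambda>x. rot (f x))"
proof -
  have "rot y = cos (2 * pi * y) *\<^sub>R mat 1 + sin (2 * pi * y) *\<^sub>R mat_of \<i>" for y
    by (simp add: rot_def vec_eq_iff forall_2 mat_def)
  then show ?thesis using assms by (simp only:) (intro continuous_intros)
qed

text \<open>A lift along the universal covering \<open>rot\<close> of the circle group by the real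
  line.\<close>

definition angle_lift :: "(real \<Rightarrow> real ^ 2 ^ 2) \<Rightarrow> (real \<Rightarrow> real) \<Rightarrow> bool" where
  "angle_lift \<gamma> l \<longleftrightarrow> path l \<and> (\<forall>t \<in> {0..1}. rot (l t) = \<gamma> t)"

lemma angle_lift_paths_in:
  assumes "angle_lift \<gamma> l" shows "\<gamma> \<in> paths_in SO"
proof -
  have "continuous_on {0..1} (\<lambda>t. rot (l t))"
    using assms by (intro continuous_on_rot) (simp add: angle_lift_def path_def)
  then have "continuous_on {0..1} \<gamma>"
    by (rule continuous_on_eq) (use assms in \<open>simp add: angle_lift_def\<close>)
  moreover have "\<gamma> t \<in> carrier SO" if "t \<in> {0..1}" for t
    using assms that rot_SO by (metis angle_lift_def)
  ultimately show ?thesis by (auto simp: paths_in_def path_def path_image_def)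
qed

lemma angle_lift_self: "path l \<Longrightarrow> angle_lift (\<lambda>t. rot (l t)) l"
  by (simp add: angle_lift_def)

text \<open>Identifies SO(2) with the unit circle, so that path and homotopy lifting can be taken
  from the covering of the punctured plane by \<open>exp\<close>.\<close>

abbreviation column :: "real ^ 2 ^ 2 \<Rightarrow> complex" where
  "column A \<equiv> Complex (A $ 1 $ 1) (A $ 2 $ 1)"

lemma column_rot: "column (rot x) = exp (\<i> * of_real (2 * pi * x))"
  by (simp only: cis_conv_exp[symmetric]) (simp add: rot_def complex_eq_iff)

lemma continuous_column: "continuous_on S column"
  by (auto simp: Complex_eq intro!: continuous_intros)

lemma column_nonzero: "column ` carrier SO \<subseteq> - {0}"
proof -
  have "column A \<noteq> 0" if A: "A \<in> carrier SO" for A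
  proof -
    obtain x where x: "A = rot x" using A by (rule SO_rot)
    show ?thesis unfolding x column_rot by (rule exp_not_eq_zero)
  qed
  then show ?thesis by auto
qed

lemma angle_lift_exists:
  assumes g: "\<gamma> \<in> paths_in SO" and x: "rot x = pathstart \<gamma>"
  obtains l where "angle_lift \<gamma> l" "pathstart l = x"
proof -
  have gp: "path \<gamma>" "path_image \<gamma> \<subseteq> carrier SO" using g by (auto simp: paths_in_def)
  obtain h where h: "path h" "pathstart h = \<i> * of_real (2 * pi * x)"
    "\<And>t. t \<in> {0..1} \<Longrightarrow> exp (h t) = (column \<circ> \<gamma>) t"
  proof (rule covering_space_lift_path_strong[OF covering_space_exp_punctured_plane])
    show "path (column \<circ> \<gamma>)" using gp(1) continuous_column by (intro path_continuous_image) 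
    show "path_image (column \<circ> \<gamma>) \<subseteq> - {0}" using column_nonzero gp(2) by (auto simp: path_image_compose)
    show "pathstart (column \<circ> \<gamma>) = exp (\<i> * of_real (2 * pi * x))"
      by (simp only: pathstart_compose x[symmetric] column_rot)
  qed auto
  \<comment> \<open>The imaginary part in units of full turns. The equation for
    \<open>exp (h t)\<close> fixes it up to an integer, which \<open>rot\<close> does not
    see.\<close>
  define l where "l t = Im (h t) / (2 * pi)" for t
  have "rot (l t) = \<gamma> t" if t: "t \<in> {0..1}" for t
  proof -
    have "\<gamma> t \<in> carrier SO" using gp(2) t unfolding path_image_def by blast
    then obtain y where y: "\<gamma> t = rot y" by (rule SO_rot)
    have "exp (h t) = exp (\<i> * of_real (2 * pi * y))" using h(3)[OF t] y column_rot by simp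
    then obtain n :: int where "h t = \<i> * of_real (2 * pi * y) + of_int (2 * n) * pi * \<i>"
      unfolding exp_eq by blast
    then have "Im (h t) = 2 * pi * y + 2 * n * pi" by simp
    then have "l t = y + n" by (simp add: l_def field_simps)
    then show ?thesis unfolding y rot_eq_iff by blast
  qed
  moreover have "path l" using h(1) unfolding path_def l_def by (intro continuous_intros) auto
  moreover have "pathstart l = x" using h(2) by (simp add: l_def pathstart_def)
  ultimately show thesis by (intro that[of l]) (simp_all add: angle_lift_def)
qed

text \<open>The straight-line homotopy between the lifts on the real line is pushed forward by
  \<open>rot\<close>.\<close>

lemma angle_lift_homotopic:
  assumes l: "angle_lift \<gamma> l" and k: "angle_lift \<delta> k" and ends: "pathstart l = pathstart k" "pathfinish l = pathfinish k"
  shows "homotopic_paths (carrier SO) \<gamma> \<delta>"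
proof -
  have p: "path l" "path k" using l k by (auto simp: angle_lift_def)
  have "homotopic_paths UNIV l k"
    using p ends by (intro homotopic_paths_linear) auto
  then have "homotopic_paths (carrier SO) (rot \<circ> l) (rot \<circ> k)"
    by (rule homotopic_paths_continuous_image) (use rot_SO in \<open>auto intro!: continuous_intros\<close>)
  moreover have "homotopic_paths (carrier SO) \<gamma> (rot \<circ> l)" "homotopic_paths (carrier SO) \<delta> (rot \<circ> k)"
    using l k angle_lift_paths_in[OF l] angle_lift_paths_in[OF k]
    by (auto intro!: homotopic_paths_eq simp: angle_lift_def paths_in_def)
  ultimately show ?thesis by (meson homotopic_paths_sym homotopic_paths_trans)
qed

text \<open>Homotopy lifting along \<open>exp\<close>, applied to the lifts multiplied by 2 pi times
  the imaginary unit. Together with \<open>angle_lift_homotopic\<close>, homotopy of paths with a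
  common start becomes equality of the end points of their lifts.\<close>

lemma angle_lift_monodromy:
  assumes h: "homotopic_paths (carrier SO) \<gamma> \<delta>" and l: "angle_lift \<gamma> l" and k: "angle_lift \<delta> k"
    and start: "pathstart l = pathstart k"
  shows "pathfinish l = pathfinish k"
proof -
  define e where "e r t = \<i> * of_real (2 * pi * r t)" for r :: "real \<Rightarrow> real" and t :: real
  have hc: "homotopic_paths (- {0}) (column \<circ> \<gamma>) (column \<circ> \<delta>)"
    by (rule homotopic_paths_continuous_image[OF h continuous_column]) (use column_nonzero in blast)
  have "homotopic_paths UNIV (e l) (e k)"
  proof (rule covering_space_lift_homotopic_paths[OF covering_space_exp_punctured_plane _ _ _ _ hc])
    show "path (e l)" "path (e k)"
      using l k by (auto simp: angle_lift_def path_def e_def intro!: continuous_intros)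
    show "exp (e l t) = (column \<circ> \<gamma>) t" "exp (e k t) = (column \<circ> \<delta>) t" if "t \<in> {0..1}" for t
      using l k that unfolding e_def column_rot[symmetric] by (simp_all add: angle_lift_def)
    show "pathstart (e l) = pathstart (e k)" using start by (simp add: e_def pathstart_def)
  qed (use homotopic_paths_imp_path[OF hc] homotopic_paths_imp_subset[OF hc] in auto)
  from homotopic_paths_imp_pathfinish[OF this] show ?thesis by (simp add: e_def pathfinish_def)
qed

text \<open>For a loop this is the winding number. With floors it extends to open paths: changing
  the lift by an integer changes both floors equally, and concatenation makes the floors
  telescope.\<close>

definition turns :: "(real \<Rightarrow> real ^ 2 ^ 2) \<Rightarrow> int" where
  "turns \<gamma> = (let l = SOME l. angle_lift \<gamma> l in \<lfloor>pathfinish l\<rfloor> - \<lfloor>pathstart l\<rfloor>)"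

text \<open>Serves two purposes: with the trivial homotopy it computes \<open>turns\<close> from any
  lift, and with a general one it gives homotopy invariance.\<close>

lemma turns_homotopic_lift:
  assumes h: "homotopic_paths (carrier SO) \<gamma> \<delta>" and l: "angle_lift \<gamma> l"
  shows "turns \<delta> = \<lfloor>pathfinish l\<rfloor> - \<lfloor>pathstart l\<rfloor>"
proof -
  have d: "\<delta> \<in> paths_in SO" using homotopic_paths_imp_path[OF h] homotopic_paths_imp_subset[OF h] by (auto simp: paths_in_def)
  define k where "k = (SOME l. angle_lift \<delta> l)"
  obtain x where "rot x = pathstart \<delta>" using SO_rot paths_in_ends(1)[OF d] by metis
  then have k: "angle_lift \<delta> k" unfolding k_def using angle_lift_exists[OF d] by (metis someI_ex)
  have "rot (pathstart l) = rot (pathstart k)"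
    using l k homotopic_paths_imp_pathstart[OF h] by (auto simp: angle_lift_def pathstart_def)
  then obtain n :: int where n: "pathstart l = pathstart k + n" unfolding rot_eq_iff by blast
  have "rot (y + n) = rot y" for y :: real unfolding rot_eq_iff by auto
  \<comment> \<open>The lift selected in \<open>turns\<close> may start at another angle; an integer
    shift gives both lifts the same start.\<close>
  then have "angle_lift \<delta> (\<lambda>t. k t + n)"
    using k by (auto simp: angle_lift_def path_def intro!: continuous_intros)
  then have "pathfinish l = pathfinish (\<lambda>t. k t + n)"
    by (rule angle_lift_monodromy[OF h l]) (use n in \<open>simp add: pathstart_def\<close>)
  then have "\<lfloor>pathfinish l\<rfloor> - \<lfloor>pathstart l\<rfloor> = \<lfloor>pathfinish k\<rfloor> - \<lfloor>pathstart k\<rfloor>"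
    by (simp add: n) (simp add: pathfinish_def)
  then show ?thesis by (simp add: turns_def Let_def k_def)
qed

lemma turns_eq:
  assumes "angle_lift \<gamma> l" shows "turns \<gamma> = \<lfloor>pathfinish l\<rfloor> - \<lfloor>pathstart l\<rfloor>"
  by (rule turns_homotopic_lift[OF _ assms])
    (use angle_lift_paths_in[OF assms] in \<open>simp add: paths_in_def homotopic_paths_refl\<close>)

lemma paths_in_SO_lift:
  assumes "\<gamma> \<in> paths_in SO" obtains l where "angle_lift \<gamma> l"
  using angle_lift_exists[OF assms] SO_rot[OF paths_in_ends(1)[OF assms]] by metis

lemma turns_homotopic: "homotopic_paths (carrier SO) \<gamma> \<delta> \<Longrightarrow> turns \<gamma> = turns \<delta>"
proof -
  assume h: "homotopic_paths (carrier SO) \<gamma> \<delta>"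
  then have "\<gamma> \<in> paths_in SO"
    using homotopic_paths_imp_path[OF h] homotopic_paths_imp_subset[OF h] by (auto simp: paths_in_def)
  then obtain l where "angle_lift \<gamma> l" by (rule paths_in_SO_lift)
  then show ?thesis using turns_homotopic_lift[OF h] turns_eq by simp
qed

text \<open>Lifting \<open>\<delta>\<close> from the end point of the lift of
  \<open>\<gamma>\<close> lets the floor at the junction cancel.\<close>

lemma turns_join:
  assumes "\<gamma> \<in> paths_in SO" "\<delta> \<in> paths_in SO" "pathfinish \<gamma> = pathstart \<delta>"
  shows "turns (\<gamma> +++ \<delta>) = turns \<delta> + turns \<gamma>"
proof -
  obtain l where l: "angle_lift \<gamma> l" using paths_in_SO_lift[OF assms(1)] .
  have "rot (pathfinish l) = pathstart \<delta>" using l assms(3) by (simp add: angle_lift_def pathfinish_def)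
  then obtain k where k: "angle_lift \<delta> k" "pathstart k = pathfinish l" using angle_lift_exists[OF assms(2)] by metis
  have "path (l +++ k)" using l k by (simp add: angle_lift_def)
  then have "angle_lift (\<gamma> +++ \<delta>) (l +++ k)"
    using l k by (simp add: angle_lift_def) (simp add: joinpaths_def)
  from turns_eq[OF this] show ?thesis using turns_eq[OF l] turns_eq[OF k(1)] k(2) by simp
qed

lemma turns_const: "g \<in> carrier SO \<Longrightarrow> turns (\<lambda>_. g) = 0"
proof -
  assume "g \<in> carrier SO"
  then obtain x where "g = rot x" by (rule SO_rot)
  then have "angle_lift (\<lambda>_. g) (\<lambda>_. x)" by (simp add: angle_lift_def path_const)
  from turns_eq[OF this] show ?thesis by (simp add: pathstart_def pathfinish_def)
qed

text \<open>The cocycle describing the failure of the angle in \<open>[0, 1)\<close> to be additive.\<close>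

definition carry :: "real ^ 2 ^ 2 \<Rightarrow> real ^ 2 ^ 2 \<Rightarrow> int" where
  "carry g h = \<lfloor>frac (SOME x. rot x = g) + frac (SOME x. rot x = h)\<rfloor>"

text \<open>For arbitrary representatives the cocycle is, up to sign, the coboundary of the floor
  function; the identities it has to satisfy then hold by telescoping.\<close>

lemma carry_rot: "carry (rot x) (rot y) = \<lfloor>x + y\<rfloor> - \<lfloor>x\<rfloor> - \<lfloor>y\<rfloor>"
proof -
  have "frac (SOME u. rot u = rot x) = frac x" for x
  proof -
    have "rot (SOME u. rot u = rot x) = rot x" by (rule someI) simp
    then obtain n :: int where "(SOME u. rot u = rot x) = x + n" unfolding rot_eq_iff by blast
    then show ?thesis by (simp add: frac_def)
  qed
  moreover have "\<lfloor>frac x + frac y\<rfloor> = \<lfloor>x + y\<rfloor> - \<lfloor>x\<rfloor> - \<lfloor>y\<rfloor>"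
  proof -
    have "frac x + frac y = x + y - of_int (\<lfloor>x\<rfloor> + \<lfloor>y\<rfloor>)" by (simp add: frac_def)
    then show ?thesis by (simp only: floor_diff_of_int)
  qed
  ultimately show ?thesis by (simp add: carry_def)
qed

text \<open>This is \<open>\<Pi>_natural\<close> for exponents. If \<open>l\<close> and
  \<open>k\<close> are lifts of the two paths, their sum lifts the product, and both sides equal the
  floor of the sum at the end minus the floors of \<open>l\<close> and \<open>k\<close> at the
  start.\<close>

lemma turns_mult:
  assumes "\<gamma> \<in> paths_in SO" "\<delta> \<in> paths_in SO"
  shows "carry (pathfinish \<gamma>) (pathfinish \<delta>) + (turns \<delta> + turns \<gamma>) =
    turns (\<lambda>t. \<gamma> t ** \<delta> t) + carry (pathstart \<gamma>) (pathstart \<delta>)"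
proof -
  obtain l where l: "angle_lift \<gamma> l" using paths_in_SO_lift[OF assms(1)] .
  obtain k where k: "angle_lift \<delta> k" using paths_in_SO_lift[OF assms(2)] .
  have lk: "angle_lift (\<lambda>t. \<gamma> t ** \<delta> t) (\<lambda>t. l t + k t)"
    using l k by (auto simp: angle_lift_def path_def simp flip: rot_add intro!: continuous_intros)
  have "pathfinish \<gamma> = rot (pathfinish l)" "pathstart \<gamma> = rot (pathstart l)"
    "pathfinish \<delta> = rot (pathfinish k)" "pathstart \<delta> = rot (pathstart k)"
    using l k by (auto simp: angle_lift_def pathstart_def pathfinish_def)
  then show ?thesis
    by (simp add: carry_rot turns_eq[OF l] turns_eq[OF k] turns_eq[OF lk]) (simp add: pathstart_def pathfinish_def)
qed

lemma path_connected_group_SO: "path_connected_group (SO :: (real ^ 2 ^ 2) monoid)"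
proof (rule path_connected_group.intro)
  show "monoid (SO :: (real ^ 2 ^ 2) monoid)"
  proof
    fix x y :: "real ^ 2 ^ 2" assume "x \<in> carrier SO" "y \<in> carrier SO"
    then show "x \<otimes>\<^bsub>SO\<^esub> y \<in> carrier SO" by (simp add: orthogonal_matrix_mul det_mul)
  qed (auto simp: orthogonal_matrix_id matrix_mul_assoc)
next
  fix \<gamma> \<delta> :: "real \<Rightarrow> real ^ 2 ^ 2" assume g: "\<gamma> \<in> paths_in SO" "\<delta> \<in> paths_in SO"
  obtain l where l: "angle_lift \<gamma> l" using paths_in_SO_lift[OF g(1)] .
  obtain k where k: "angle_lift \<delta> k" using paths_in_SO_lift[OF g(2)] .
  have "angle_lift (\<lambda>t. \<gamma> t ** \<delta> t) (\<lambda>t. l t + k t)"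
    using l k by (auto simp: angle_lift_def path_def simp flip: rot_add intro!: continuous_intros)
  from angle_lift_paths_in[OF this] show "(\<lambda>t. \<gamma> t \<otimes>\<^bsub>SO\<^esub> \<delta> t) \<in> paths_in SO" by simp
next
  fix g :: "real ^ 2 ^ 2" assume "g \<in> carrier SO"
  then obtain x where x: "g = rot x" by (rule SO_rot)
  have "angle_lift (\<lambda>t. rot (x * t)) (\<lambda>t. x * t)"
    by (rule angle_lift_self) (auto simp: path_def intro!: continuous_intros)
  from angle_lift_paths_in[OF this]
  show "\<exists>\<gamma> \<in> paths_in SO. pathstart \<gamma> = \<one>\<^bsub>SO\<^esub> \<and> pathfinish \<gamma> = g"
    by (rule bexI[rotated]) (simp add: x pathstart_def pathfinish_def)
qed

text \<open>A normal form: by \<open>homotopic_ray\<close> each path from the unit is homotopic to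
  the ray whose length is the end point of its lift from 0.\<close>

definition ray :: "real \<Rightarrow> real \<Rightarrow> real ^ 2 ^ 2" where
  "ray x = (\<lambda>t. rot (x * t))"

lemma ray_lift: "angle_lift (ray x) (\<lambda>t. x * t)"
  unfolding ray_def by (rule angle_lift_self) (auto simp: path_def intro!: continuous_intros)

lemma ray_paths_in: "ray x \<in> paths_in SO"
  by (rule angle_lift_paths_in[OF ray_lift])

lemma ray_ends [simp]: "pathstart (ray x) = mat 1" "pathfinish (ray x) = rot x"
  by (simp_all add: ray_def pathstart_def pathfinish_def)

lemma homotopic_ray:
  assumes "\<gamma> \<in> paths_in SO" "pathstart \<gamma> = mat 1"
  obtains x where "homotopic_paths (carrier SO) \<gamma> (ray x)" "pathfinish \<gamma> = rot x"
proof -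
  obtain l where l: "angle_lift \<gamma> l" "pathstart l = 0" using angle_lift_exists[OF assms(1), of 0] assms(2) by auto
  show thesis
    by (rule that[of "pathfinish l"], rule angle_lift_homotopic[OF l(1) ray_lift])
      (use l in \<open>auto simp: angle_lift_def pathstart_def pathfinish_def\<close>)
qed

lemma rot_1: "rot 1 = mat 1"
  using rot_eq_iff[of 1 0] by (simp add: exI[of _ "1 :: int"])

text \<open>The extra full turn is split off at the beginning, which puts the holonomy on the right
  in \<open>triv_ray_Suc\<close>.\<close>

lemma ray_Suc: "homotopic_paths (carrier SO) (ray (x + 1)) (ray 1 +++ ray x)"
proof (rule angle_lift_homotopic[OF ray_lift])
  \<comment> \<open>The lift of \<open>ray x\<close> is started at 1, where that of
    \<open>ray 1\<close> ends; the integer shift is invisible to \<open>rot\<close>.\<close>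
  show "angle_lift (ray 1 +++ ray x) ((\<lambda>t. 1 * t) +++ (\<lambda>t. 1 + x * t))"
  proof -
    have "path ((\<lambda>t. 1 * t) +++ (\<lambda>t. 1 + x * t))"
      by (rule path_join_imp) (auto simp: path_def pathstart_def pathfinish_def intro!: continuous_intros)
    moreover have "rot (1 + y) = rot y" for y using rot_eq_iff[of "1 + y" y] by (auto intro: exI[of _ "1 :: int"])
    ultimately show ?thesis by (simp add: angle_lift_def) (simp add: joinpaths_def ray_def)
  qed
qed (auto simp: pathstart_def pathfinish_def joinpaths_def)

section \<open>The holonomy of a fixed point\<close>

text \<open>
  A fixed point of the trivial action is determined by the natural automorphism of the identity
  induced by the generator of the fundamental group.
\<close>

definition holonomy ::
  "(real ^ 2 ^ 2, ('o, 'm, 'k) lincat, ('o, 'm, 'k) linfun, ('o, 'm, 'k) nattr) hfp0 \<Rightarrow> ('o, 'm, 'k) nattr" where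
  "holonomy X = nat_vcomp (hM X) (triv X (ray 1))"

context
  fixes X :: "(real ^ 2 ^ 2, ('o, 'm, 'k :: field) lincat, ('o, 'm, 'k) linfun, ('o, 'm, 'k) nattr) hfp0"
  assumes X: "linear_fixed_point SO X"
begin

interpretation linear_fixed_point SO X by (rule X)

lemma triv_ray: "linear_nat_iso (hbase X) (hbase X) (fun_id (hbase X)) (h\<Theta> X (rot x)) (triv X (ray x))"
  using triv_linear[OF ray_paths_in, of x] by simp

lemma holonomy_linear: "linear_nat_iso (hbase X) (hbase X) (fun_id (hbase X)) (fun_id (hbase X)) (holonomy X)"
  unfolding holonomy_def using nat_iso_vcomp[OF triv_ray[of 1]] M_linear by (simp add: rot_1)

text \<open>Inserting \<open>hM\<close> with its inverse after the full turn splits the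
  trivialization along the concatenation into that of \<open>ray x\<close> and the holonomy.\<close>

lemma triv_ray_Suc:
  assumes a: "a \<in> Obj (hbase X)"
  shows "cmpt (triv X (ray (x + 1))) a = cmpt (triv X (ray x)) a \<cdot>\<^bsub>hbase X\<^esub> cmpt (holonomy X) a"
proof -
  interpret t: linear_nat_iso D D "fun_id D" "\<Theta> (mat 1)" "triv X (ray 1)"
    using triv_ray[of 1] by (simp add: rot_1)
  interpret p: linear_nat_iso D D "\<Theta> (mat 1)" "\<Theta> (rot x)" "h\<Theta>p X (ray x)"
    using \<Theta>p_linear[OF ray_paths_in, of x] by simp
  have "isom D (cmpt (hM X) a)" using a by (rule M.isom_cmpt)
  moreover have "dom_of D (cmpt (hM X) a) = omap (\<Theta> (mat 1)) a" "cod_of D (cmpt (hM X) a) = a"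
    using M.cmpt_Arr a by simp_all
  moreover have "cmpt (triv X (ray (x + 1))) a = cmpt (h\<Theta>p X (ray x)) a \<cdot>\<^bsub>D\<^esub> cmpt (triv X (ray 1)) a"
    unfolding triv_homotopic[OF ray_Suc]
    by (rule triv_join) (simp_all add: ray_paths_in rot_1 a)
  ultimately show ?thesis
    using a by (simp add: cmpt_triv[OF ray_paths_in[of x]] holonomy_def)
qed

end

context
  fixes X Y :: "(real ^ 2 ^ 2, ('o, 'm, 'k :: field) lincat, ('o, 'm, 'k) linfun, ('o, 'm, 'k) nattr) hfp0" and f
  assumes XYf: "fixed_point_pair SO X Y f"
begin

interpretation fixed_point_pair SO X Y f by (rule XYf)

interpretation hX: linear_nat_iso "hbase X" "hbase X" "fun_id (hbase X)" "fun_id (hbase X)" "holonomy X"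
  by (rule holonomy_linear[OF X.linear_fixed_point_axioms])

interpretation hY: linear_nat_iso "hbase Y" "hbase Y" "fun_id (hbase Y)" "fun_id (hbase Y)" "holonomy Y"
  by (rule holonomy_linear[OF Y.linear_fixed_point_axioms])

text \<open>The rays of length 0 and 1 both end at the unit, so compatibility along them involves
  the same cell \<open>m (mat 1)\<close>. Expressing the second ray by the first and cancelling the
  common invertible factor leaves the claim.\<close>

lemma holonomy_commutes:
  assumes m: "compatible SO X Y f m" and a: "a \<in> Obj (hbase X)"
  shows "mmap f (cmpt (holonomy X) a) = cmpt (holonomy Y) (omap f a)"
proof -
  let ?E = "hbase Y" and ?t = "cmpt (triv X (ray 0)) a"
  interpret m1: linear_nat_iso "hbase X" "hbase Y" "fun_comp f (h\<Theta> X (mat 1))" "fun_comp (h\<Theta> Y (mat 1)) f" "m (mat 1)"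
    using m X.one_closed by (simp add: compatible_def del: SO_simps(1))
  interpret tX: linear_nat_iso "hbase X" "hbase X" "fun_id (hbase X)" "h\<Theta> X (mat 1)" "triv X (ray 0)"
    using triv_ray[OF X.linear_fixed_point_axioms, of 0] by simp
  interpret tY: linear_nat_iso "hbase Y" "hbase Y" "fun_id (hbase Y)" "h\<Theta> Y (mat 1)" "triv Y (ray 0)"
    using triv_ray[OF Y.linear_fixed_point_axioms, of 0] by simp
  have c: "cmpt (m (rot x)) a \<cdot>\<^bsub>?E\<^esub> mmap f (cmpt (triv X (ray x)) a) = cmpt (triv Y (ray x)) (omap f a)" for x
  proof -
    have "\<forall>\<gamma> \<in> paths_in SO. pathstart \<gamma> = \<one>\<^bsub>SO\<^esub> \<longrightarrow> (\<forall>a \<in> Obj (hbase X).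
        cmpt (m (pathfinish \<gamma>)) a \<cdot>\<^bsub>?E\<^esub> mmap f (cmpt (triv X \<gamma>) a) = cmpt (triv Y \<gamma>) (omap f a))"
      using m unfolding compatible_def by blast
    from bspec[OF this ray_paths_in[of x]] show ?thesis using a by simp
  qed
  note s = triv_ray_Suc[OF X.linear_fixed_point_axioms a, of 0] triv_ray_Suc[OF Y.linear_fixed_point_axioms f.omap_Obj[OF a], of 0]
  have "(cmpt (m (mat 1)) a \<cdot>\<^bsub>?E\<^esub> mmap f ?t) \<cdot>\<^bsub>?E\<^esub> mmap f (cmpt (holonomy X) a) =
      cmpt (m (rot 1)) a \<cdot>\<^bsub>?E\<^esub> mmap f (cmpt (triv X (ray (0 + 1))) a)"
    unfolding s using a by (simp add: rot_1)
  also have "\<dots> = cmpt (triv Y (ray 0)) (omap f a) \<cdot>\<^bsub>?E\<^esub> cmpt (holonomy Y) (omap f a)"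
    unfolding s(2)[symmetric] using c[of 1] by simp
  also have "cmpt (triv Y (ray 0)) (omap f a) = cmpt (m (mat 1)) a \<cdot>\<^bsub>?E\<^esub> mmap f ?t"
    using c[of 0] by simp
  finally show ?thesis
    by (rule Y.isom_cancel_left[rotated 5]) (use a in simp_all)
qed

text \<open>The value of \<open>m g\<close> is prescribed by one ray ending at \<open>g\<close>. The
  other rays ending there have lengths that differ by integers, and commuting with the holonomies
  transfers compatibility between neighbours. Every path from the unit is homotopic to a
  ray.\<close>

lemma ex_compatible:
  assumes h: "\<And>a. a \<in> Obj (hbase X) \<Longrightarrow> mmap f (cmpt (holonomy X) a) = cmpt (holonomy Y) (omap f a)"
  obtains m where "compatible SO X Y f m"
proof -
  let ?E = "hbase Y"
  \<comment> \<open>An arbitrary representative angle, without normalization or continuity; no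
    continuity of \<open>m\<close> in \<open>g\<close> is asked for beyond its naturality along
    paths.\<close>
  define ang where "ang g = (SOME x. rot x = g)" for g
  have ang: "rot (ang g) = g" if "g \<in> carrier SO" for g
    unfolding ang_def using SO_rot[OF that] by (metis (mono_tags) someI_ex)
  define m where "m = (\<lambda>g \<in> carrier SO. nat_vcomp (nat_hcomp (triv Y (ray (ang g))) (nat_id f))
    (nat_inv (nat_hcomp (nat_id f) (triv X (ray (ang g))))))"
  note fl = f.linear_functor_axioms
  have tX: "linear_nat_iso (hbase X) (hbase X) (fun_id (hbase X)) (h\<Theta> X (rot x)) (triv X (ray x))" for x
    by (rule triv_ray[OF X.linear_fixed_point_axioms])
  have tY: "linear_nat_iso (hbase Y) (hbase Y) (fun_id (hbase Y)) (h\<Theta> Y (rot x)) (triv Y (ray x))" for x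
    by (rule triv_ray[OF Y.linear_fixed_point_axioms])
  have ml: "linear_nat_iso (hbase X) (hbase Y) (fun_comp f (h\<Theta> X g)) (fun_comp (h\<Theta> Y g) f) (m g)"
    if g: "g \<in> carrier SO" for g
  proof -
    have "linear_nat_iso (hbase X) (hbase Y) f (fun_comp f (h\<Theta> X g)) (nat_hcomp (nat_id f) (triv X (ray (ang g))))"
      using nat_iso_hcomp[OF tX[of "ang g"] nat_iso_id[OF fl]] by (simp add: ang[OF g] fun_comp_id[OF fl])
    moreover have "linear_nat_iso (hbase X) (hbase Y) f (fun_comp (h\<Theta> Y g) f) (nat_hcomp (triv Y (ray (ang g))) (nat_id f))"
      using nat_iso_hcomp[OF nat_iso_id[OF fl] tY[of "ang g"]] by (simp add: ang[OF g] fun_comp_id[OF fl])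
    ultimately show ?thesis
      using g nat_iso_vcomp[OF nat_inv_linear] by (simp add: m_def del: SO_simps(1))
  qed
  have ct: "cmpt (m (rot x)) a \<cdot>\<^bsub>?E\<^esub> mmap f (cmpt (triv X (ray x)) a) = cmpt (triv Y (ray x)) (omap f a)"
    if a: "a \<in> Obj (hbase X)" for x a
  proof -
    let ?g = "rot x" and ?P = "\<lambda>y. cmpt (m (rot x)) a \<cdot>\<^bsub>?E\<^esub> mmap f (cmpt (triv X (ray y)) a) = cmpt (triv Y (ray y)) (omap f a)"
    obtain n :: int where n: "x = ang ?g + n" using ang[OF rot_SO, of x] rot_eq_iff[of x] by metis
    interpret mg: linear_nat_iso "hbase X" "hbase Y" "fun_comp f (h\<Theta> X ?g)" "fun_comp (h\<Theta> Y ?g) f" "m ?g" by (rule ml[OF rot_SO])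
    interpret x0: linear_nat_iso "hbase X" "hbase X" "fun_id (hbase X)" "h\<Theta> X ?g" "triv X (ray (ang ?g))"
      using tX[of "ang ?g"] ang[OF rot_SO, of x] by simp
    interpret y0: linear_nat_iso "hbase Y" "hbase Y" "fun_id (hbase Y)" "h\<Theta> Y ?g" "triv Y (ray (ang ?g))"
      using tY[of "ang ?g"] ang[OF rot_SO, of x] by simp
    have start: "?P (ang ?g)"
      using a rot_SO[of x] by (simp add: m_def del: SO_simps(1))
    \<comment> \<open>An equivalence, since the holonomy is invertible; this permits induction over
      the integers in both directions.\<close>
    have step: "?P (ang ?g + k) \<longleftrightarrow> ?P (ang ?g + k + 1)" for k :: int
    proof -
      let ?y = "ang ?g + k"
      have r: "rot ?y = ?g" using rot_eq_iff[of ?y "ang ?g"] ang[OF rot_SO, of x] by auto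
      interpret xk: linear_nat_iso "hbase X" "hbase X" "fun_id (hbase X)" "h\<Theta> X ?g" "triv X (ray ?y)" using tX[of ?y] r by simp
      interpret yk: linear_nat_iso "hbase Y" "hbase Y" "fun_id (hbase Y)" "h\<Theta> Y ?g" "triv Y (ray ?y)" using tY[of ?y] r by simp
      have "?P (?y + 1) \<longleftrightarrow> (cmpt (m ?g) a \<cdot>\<^bsub>?E\<^esub> mmap f (cmpt (triv X (ray ?y)) a)) \<cdot>\<^bsub>?E\<^esub> cmpt (holonomy Y) (omap f a) =
          cmpt (triv Y (ray ?y)) (omap f a) \<cdot>\<^bsub>?E\<^esub> cmpt (holonomy Y) (omap f a)"
        unfolding triv_ray_Suc[OF X.linear_fixed_point_axioms a] triv_ray_Suc[OF Y.linear_fixed_point_axioms f.omap_Obj[OF a]]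
          h[OF a, symmetric] using a by simp
      also have "\<dots> \<longleftrightarrow> ?P ?y"
      proof
        assume "(cmpt (m ?g) a \<cdot>\<^bsub>?E\<^esub> mmap f (cmpt (triv X (ray ?y)) a)) \<cdot>\<^bsub>?E\<^esub> cmpt (holonomy Y) (omap f a) =
          cmpt (triv Y (ray ?y)) (omap f a) \<cdot>\<^bsub>?E\<^esub> cmpt (holonomy Y) (omap f a)"
        then show "?P ?y" by (rule Y.isom_cancel_right[rotated 5]) (use a in simp_all)
      qed simp
      finally show ?thesis by blast
    qed
    have "?P (ang ?g + k)" for k :: int
    proof (induction k rule: int_induct[where k = 0])
      case base then show ?case using start by simp
    next
      case (step1 i) then show ?case using step[of i] by (simp add: add.assoc)
    next
      case (step2 i) then show ?case using step[of "i - 1"] by simp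
    qed
    from this[of n] show ?thesis using n by simp
  qed
  have "compatible SO X Y f m"
    unfolding compatible_def
  proof (intro conjI ballI impI ml)
    show "m \<in> extensional (carrier SO)" by (simp add: m_def del: SO_simps(1))
    fix \<gamma> :: "real \<Rightarrow> real ^ 2 ^ 2" and a
    assume g: "\<gamma> \<in> paths_in SO" "pathstart \<gamma> = \<one>\<^bsub>SO\<^esub>" and a: "a \<in> Obj (hbase X)"
    obtain x where x: "homotopic_paths (carrier SO) \<gamma> (ray x)" "pathfinish \<gamma> = rot x"
      using homotopic_ray[OF g(1)] g(2) by auto
    show "cmpt (m (pathfinish \<gamma>)) a \<cdot>\<^bsub>?E\<^esub> mmap f (cmpt (triv X \<gamma>) a) = cmpt (triv Y \<gamma>) (omap f a)"
      unfolding X.triv_homotopic[OF x(1)] Y.triv_homotopic[OF x(1)] x(2) by (rule ct[OF a])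
  qed
  then show thesis by (rule that)
qed

end

text \<open>Conversely, every automorphism is a holonomy, of a fixed point with \<open>\<Theta> g = id\<close>.\<close>

definition automorphism_group :: "('o, 'm, 'k :: field) lincat \<Rightarrow> ('o, 'm, 'k) nattr monoid" where
  "automorphism_group D = \<lparr>carrier = {\<alpha>. linear_nat_iso D D (fun_id D) (fun_id D) \<alpha>},
     mult = nat_vcomp, one = nat_id (fun_id D)\<rparr>"

lemma automorphism_group_simps [simp]:
  "carrier (automorphism_group D) = {\<alpha>. linear_nat_iso D D (fun_id D) (fun_id D) \<alpha>}"
  "mult (automorphism_group D) = nat_vcomp" "one (automorphism_group D) = nat_id (fun_id D)"
  by (simp_all add: automorphism_group_def)

lemma group_automorphism_group: assumes "linear_category D" shows "group (automorphism_group D)"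
proof -
  note ax = linear_nat_iso.axioms(1)
  note fi = fun_id_linear[OF assms]
  show ?thesis
  proof (rule groupI)
    fix x assume x: "x \<in> carrier (automorphism_group D)"
    then show "\<one>\<^bsub>automorphism_group D\<^esub> \<otimes>\<^bsub>automorphism_group D\<^esub> x = x"
      using nat_vcomp_id(2)[OF ax, of D D "fun_id D" "fun_id D" x] by simp
    show "\<exists>y \<in> carrier (automorphism_group D). y \<otimes>\<^bsub>automorphism_group D\<^esub> x = \<one>\<^bsub>automorphism_group D\<^esub>"
      using x nat_inv_linear[of D D "fun_id D" "fun_id D" x] nat_inv_vcomp(1)[of D D "fun_id D" "fun_id D" x]
      by (intro bexI[of _ "nat_inv x"]) simp_all
  qed (auto intro: nat_iso_vcomp nat_iso_id fi nat_vcomp_assoc ax)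
qed

text \<open>Whiskering with the identity functor changes nothing, so on its automorphisms both
  compositions agree. For powers of one automorphism, every composite thus becomes a sum of
  exponents.\<close>

lemma nat_hcomp_automorphisms:
  assumes "linear_nat_iso D D (fun_id D) (fun_id D) \<alpha>" "linear_nat_iso D D (fun_id D) (fun_id D) \<beta>"
  shows "nat_hcomp \<beta> \<alpha> = nat_vcomp \<beta> \<alpha>"
proof -
  interpret a: linear_nat_iso D D "fun_id D" "fun_id D" \<alpha> by fact
  interpret b: linear_nat_iso D D "fun_id D" "fun_id D" \<beta> by fact
  note ii = fun_comp_id[OF a.Sc.linear_functor_axioms]
  show ?thesis
    by (rule linear_nat_eqI[of D D "fun_id D" "fun_id D"])
      (use nat_hcomp_linear[OF a.linear_nat_axioms b.linear_nat_axioms]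
        nat_vcomp_linear[OF a.linear_nat_axioms b.linear_nat_axioms] ii in simp_all)
qed

text \<open>All 2-cells are powers of \<open>\<nu>\<close>, so the axioms are equations between
  integers: \<open>turns_join\<close>, \<open>turns_homotopic\<close> and \<open>turns_mult\<close>
  for paths, the cocycle identity of \<open>carry\<close> for associativity, and its vanishing on
  the unit for the unit axioms.\<close>

lemma ex_holonomy:
  fixes D :: "('o, 'm, 'k :: field) lincat"
  assumes D: "finite_category D" "semisimple D" and \<nu>: "linear_nat_iso D D (fun_id D) (fun_id D) \<nu>"
  obtains X :: "(real ^ 2 ^ 2, ('o, 'm, 'k) lincat, ('o, 'm, 'k) linfun, ('o, 'm, 'k) nattr) hfp0"
  where "hfp_object SO (core Vect2_fd) X" "hbase X = D" "holonomy X = \<nu>"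
proof -
  interpret D: finite_category D by fact
  interpret SO: path_connected_group "SO :: (real ^ 2 ^ 2) monoid" by (rule path_connected_group_SO)
  interpret A: group "automorphism_group D" by (rule group_automorphism_group[OF D.linear_category_axioms])
  note fi = fun_id_linear[OF D.linear_category_axioms]
  define pw :: "int \<Rightarrow> _" where "pw n = \<nu> [^]\<^bsub>automorphism_group D\<^esub> n" for n
  have pw: "linear_nat_iso D D (fun_id D) (fun_id D) (pw n)" for n
    using A.int_pow_closed[of \<nu> n] \<nu> by (simp add: pw_def)
  have pw0: "pw 0 = nat_id (fun_id D)" and pw1: "pw 1 = \<nu>"
    using A.int_pow_1[of \<nu>] \<nu> by (simp_all add: pw_def)
  have vc: "nat_vcomp (pw m) (pw n) = pw (m + n)" for m n
    using A.int_pow_mult[of \<nu> m n] \<nu> by (simp add: pw_def)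
  have hc: "nat_hcomp (pw m) (pw n) = pw (m + n)" for m n
    using nat_hcomp_automorphisms[OF pw pw] vc by simp
  have iso: "pw n \<in> Iso2 Vect2 (fun_id D) (fun_id D)" for n
    using pw by (simp add: Iso2_Vect2_iff[OF fi fi])
  \<comment> \<open>\<open>hM\<close> is the identity, written as \<open>pw 0\<close> so that
    \<open>vc\<close> and \<open>hc\<close> evaluate every composite.\<close>
  define X where "X = \<lparr>hbase = D, h\<Theta> = (\<lambda>g \<in> carrier SO. fun_id D), h\<Theta>p = (\<lambda>\<gamma> \<in> paths_in SO. pw (turns \<gamma>)),
    h\<Pi> = (\<lambda>g \<in> carrier SO. \<lambda>h \<in> carrier SO. pw (carry g h)), hM = pw 0\<rparr>"
  have ii: "fun_comp (fun_id D) (fun_id D) = fun_id D" by (rule fun_comp_id[OF fi])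
  have Xs: "hbase X = D" "\<And>g. g \<in> carrier SO \<Longrightarrow> h\<Theta> X g = fun_id D"
    "\<And>\<gamma>. \<gamma> \<in> paths_in SO \<Longrightarrow> h\<Theta>p X \<gamma> = pw (turns \<gamma>)"
    "\<And>g h. \<lbrakk>g \<in> carrier SO; h \<in> carrier SO\<rbrakk> \<Longrightarrow> h\<Pi> X g h = pw (carry g h)" "hM X = pw 0"
    by (simp_all add: X_def del: SO_simps(1))
  note cl = SO.one_closed SO.m_closed paths_in_ends
  have "hfp_object SO (core Vect2_fd) X"
  proof
    show "hbase X \<in> Ob (core Vect2_fd)" using D by (simp add: Xs)
    show "h\<Theta> X \<in> extensional (carrier SO)" "h\<Theta>p X \<in> extensional (paths_in SO)" "h\<Pi> X \<in> extensional (carrier SO)"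
      by (simp_all add: X_def del: SO_simps(1))
    show "h\<Pi> X g \<in> extensional (carrier SO)" if "g \<in> carrier SO" for g
      using that by (simp add: X_def del: SO_simps(1))
    show "h\<Theta> X g \<in> Equiv1 (core Vect2_fd) (hbase X) (hbase X)" if "g \<in> carrier SO" for g
      using bicategory.id1_Equiv1[OF bicategory_Vect2, of D] D.abelian_category_axioms that
      by (simp add: Xs del: SO_simps(1))
  next
    fix \<gamma> :: "real \<Rightarrow> real ^ 2 ^ 2" assume g: "\<gamma> \<in> paths_in SO"
    then show "h\<Theta>p X \<gamma> \<in> Iso2 (core Vect2_fd) (h\<Theta> X (pathstart \<gamma>)) (h\<Theta> X (pathfinish \<gamma>))"
      using iso by (simp add: Xs cl del: SO_simps(1))
    fix \<delta> :: "real \<Rightarrow> real ^ 2 ^ 2" assume d: "\<delta> \<in> paths_in SO"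
    show "h\<Theta>p X (\<gamma> +++ \<delta>) = h\<Theta>p X \<delta> \<odot>\<^bsub>core Vect2_fd\<^esub> h\<Theta>p X \<gamma>" if "pathfinish \<gamma> = pathstart \<delta>"
      using g d that by (simp add: Xs join_paths_in turns_join vc)
    show "h\<Pi> X (pathfinish \<gamma>) (pathfinish \<delta>) \<odot>\<^bsub>core Vect2_fd\<^esub> (h\<Theta>p X \<delta> \<star>\<^bsub>core Vect2_fd\<^esub> h\<Theta>p X \<gamma>) =
        h\<Theta>p X (\<lambda>t. \<gamma> t \<otimes>\<^bsub>SO\<^esub> \<delta> t) \<odot>\<^bsub>core Vect2_fd\<^esub> h\<Pi> X (pathstart \<gamma>) (pathstart \<delta>)"
      using g d SO.mult_paths_in[OF g d] turns_mult[OF g d]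
      by (simp add: Xs cl vc hc del: SO_simps(1))
  next
    fix g :: "real ^ 2 ^ 2" assume g: "g \<in> carrier SO"
    show "h\<Theta>p X (\<lambda>_. g) = id2 (core Vect2_fd) (h\<Theta> X g)"
      using g turns_const[OF g] pw0 by (simp add: Xs const_paths_in del: SO_simps(1))
    obtain x where x: "g = rot x" using SO_rot[OF g] .
    have "carry \<one>\<^bsub>SO\<^esub> g = 0" "carry g \<one>\<^bsub>SO\<^esub> = 0"
      using carry_rot[of 0 x] carry_rot[of x 0] by (simp_all add: x)
    then show "h\<Pi> X \<one>\<^bsub>SO\<^esub> g = runit (core Vect2_fd) (h\<Theta> X g) \<odot>\<^bsub>core Vect2_fd\<^esub> (id2 (core Vect2_fd) (h\<Theta> X g) \<star>\<^bsub>core Vect2_fd\<^esub> hM X)"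
      "h\<Pi> X g \<one>\<^bsub>SO\<^esub> = lunit (core Vect2_fd) (h\<Theta> X g) \<odot>\<^bsub>core Vect2_fd\<^esub> (hM X \<star>\<^bsub>core Vect2_fd\<^esub> id2 (core Vect2_fd) (h\<Theta> X g))"
      using g by (simp_all add: Xs cl vc hc flip: pw0 del: SO_simps)
    fix h :: "real ^ 2 ^ 2" assume h: "h \<in> carrier SO"
    show "h\<Pi> X g h \<in> Iso2 (core Vect2_fd) (h\<Theta> X h \<diamondop>\<^bsub>core Vect2_fd\<^esub> h\<Theta> X g) (h\<Theta> X (g \<otimes>\<^bsub>SO\<^esub> h))"
      using g h iso by (simp add: Xs cl ii del: SO_simps)
    fix k :: "real ^ 2 ^ 2" assume k: "k \<in> carrier SO"
    obtain y where y: "h = rot y" using SO_rot[OF h] .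
    obtain z where z: "k = rot z" using SO_rot[OF k] .
    \<comment> \<open>By \<open>carry_rot\<close> both sides are the floor of the total angle minus
      the floors of the three angles.\<close>
    have "carry (g \<otimes>\<^bsub>SO\<^esub> h) k + carry g h = carry g (h \<otimes>\<^bsub>SO\<^esub> k) + carry h k"
      by (simp add: x y z rot_add carry_rot add.assoc)
    then show "h\<Pi> X (g \<otimes>\<^bsub>SO\<^esub> h) k \<odot>\<^bsub>core Vect2_fd\<^esub> (id2 (core Vect2_fd) (h\<Theta> X k) \<star>\<^bsub>core Vect2_fd\<^esub> h\<Pi> X g h) \<odot>\<^bsub>core Vect2_fd\<^esub>
          assoc (core Vect2_fd) (h\<Theta> X k) (h\<Theta> X h) (h\<Theta> X g) =
        h\<Pi> X g (h \<otimes>\<^bsub>SO\<^esub> k) \<odot>\<^bsub>core Vect2_fd\<^esub> (h\<Pi> X h k \<star>\<^bsub>core Vect2_fd\<^esub> id2 (core Vect2_fd) (h\<Theta> X g))"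
      using g h k by (simp add: Xs cl ii vc hc flip: pw0 del: SO_simps)
  next
    show "h\<Theta>p X \<gamma> = h\<Theta>p X \<delta>" if "homotopic_paths (carrier SO) \<gamma> \<delta>" for \<gamma> \<delta>
    proof -
      have "\<gamma> \<in> paths_in SO" "\<delta> \<in> paths_in SO"
        using homotopic_paths_imp_path[OF that] homotopic_paths_imp_subset[OF that]
        by (simp_all add: paths_in_def del: SO_simps)
      then show ?thesis using turns_homotopic[OF that] by (simp add: Xs)
    qed
    show "hM X \<in> Iso2 (core Vect2_fd) (h\<Theta> X \<one>\<^bsub>SO\<^esub>) (id1 (core Vect2_fd) (hbase X))"
      using iso by (simp add: Xs cl del: SO_simps)
  qed
  moreover have "holonomy X = \<nu>"
  proof -
    have "nat_inv (pw 0) = pw 0"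
      using nat_inv_vcomp(1)[OF pw[of 0]] nat_vcomp_id(1)[OF linear_nat_iso.axioms(1)[OF nat_inv_linear[OF pw[of 0]]]]
      by (simp add: pw0)
    \<comment> \<open>The generating loop lifts to the identity path from 0 to 1, so its exponent is
      1 and its cell is \<open>\<nu>\<close> itself.\<close>
    moreover have "turns (ray 1) = 1" using turns_eq[OF ray_lift, of 1] by (simp add: pathstart_def pathfinish_def)
    ultimately have "holonomy X = pw 1" by (simp add: holonomy_def triv_def Xs ray_paths_in vc)
    then show ?thesis by (simp only: pw1)
  qed
  ultimately show thesis using Xs(1) by (intro that) auto
qed

section \<open>The core of the bicategory of Calabi-Yau categories\<close>

lemma CY_simps [simp]:
  "Ob CY = {(D, t). CY_category D t}" "Hom1 CY X Y = {(X, Y, F) | F. F \<in> CY_functors X Y}"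
  "Hom2 CY (X, Y, F) (X', Y', G) = {((X, Y, F), (X', Y', G), \<alpha>) | \<alpha>. \<alpha> \<in> nat_transformations F G}"
  "id1 CY X = (X, X, fun_id (fst X))" "id2 CY = CY_nat_id" "comp1 CY = CY_comp"
  "vcomp CY (Q, R, \<beta>) (P, Q', \<alpha>) = (P, R, nat_vcomp \<beta> \<alpha>)"
  "hcomp CY (Q, Q', \<beta>) (P, P', \<alpha>) = (CY_comp Q P, CY_comp Q' P', nat_hcomp \<beta> \<alpha>)"
  "assoc CY R' Q' P = CY_nat_id (CY_comp R' (CY_comp Q' P))"
  "assoc_inv CY R' Q' P = CY_nat_id (CY_comp R' (CY_comp Q' P))"
  "lunit CY = CY_nat_id" "lunit_inv CY = CY_nat_id" "runit CY = CY_nat_id" "runit_inv CY = CY_nat_id"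
  by (simp_all add: CY_def)

lemma CY_tagged_simps [simp]:
  "CY_comp (Y', Z, G) (X, Y, F) = (X, Z, fun_comp G F)" "CY_nat_id (X, Y, F) = ((X, Y, F), (X, Y, F), nat_id F)"
  by (simp_all add: CY_comp_def CY_nat_id_def)

lemma Iso2_CY: "Iso2 CY (X, Y, F) (X', Y', G) = {((X, Y, F), (X', Y', G), \<alpha>) | \<alpha>. \<alpha> \<in> Iso2 Vect2 F G}"
  by (auto simp: Iso2_def inverse2_def)

lemma CY_functors_linear: "F \<in> CY_functors X Y \<Longrightarrow> F \<in> linear_functors (fst X) (fst Y)"
  by (simp add: CY_functors_def)

text \<open>The inclusion from right to left has content: a linear quasi-inverse of a Calabi-Yau
  functor preserves traces by \<open>CY_functor_inverse\<close>, and its unit and counit are 2-cells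
  of \<open>CY\<close> because these are arbitrary natural transformations.\<close>

lemma Equiv1_CY:
  assumes "X \<in> Ob CY" "Y \<in> Ob CY"
  shows "Equiv1 CY X Y = {(X, Y, F) | F. F \<in> CY_functors X Y \<and> F \<in> Equiv1 Vect2 (fst X) (fst Y)}"
proof -
  obtain D s E t where XY: "X = (D, s)" "Y = (E, t)" by (cases X, cases Y)
  interpret X: CY_category D s using assms XY by simp
  interpret Y: CY_category E t using assms XY by simp
  show ?thesis
  proof (intro equalityI subsetI)
    fix P assume P: "P \<in> Equiv1 CY X Y"
    obtain F where F: "P = (X, Y, F)" "F \<in> CY_functors X Y" using Equiv1_Hom1[OF P] by auto
    from P obtain Q where Q: "Q \<in> Equiv1 CY Y X" "Iso2 CY (id1 CY X) (Q \<diamondop>\<^bsub>CY\<^esub> P) \<noteq> {}" "Iso2 CY (P \<diamondop>\<^bsub>CY\<^esub> Q) (id1 CY Y) \<noteq> {}"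
      by (rule Equiv1_inverse)
    obtain G where G: "Q = (Y, X, G)" "G \<in> CY_functors Y X" using Equiv1_Hom1[OF Q(1)] by auto
    have "F \<in> Equiv1 Vect2 (fst X) (fst Y)"
      by (rule Equiv1I[of _ _ _ _ G])
        (use Q(2,3) F(1) G(1) CY_functors_linear[OF F(2)] CY_functors_linear[OF G(2)] in \<open>auto simp: Iso2_CY\<close>)
    with F show "P \<in> {(X, Y, F) | F. F \<in> CY_functors X Y \<and> F \<in> Equiv1 Vect2 (fst X) (fst Y)}" by blast
  next
    fix P assume "P \<in> {(X, Y, F) | F. F \<in> CY_functors X Y \<and> F \<in> Equiv1 Vect2 (fst X) (fst Y)}"
    then obtain F where F: "P = (X, Y, F)" "F \<in> CY_functors X Y" "F \<in> Equiv1 Vect2 D E" using XY by auto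
    obtain G \<eta> \<epsilon> where e: "linear_equivalence D E F G \<eta> \<epsilon>"
      using Equiv1_Vect2E[OF X.linear_category_axioms Y.linear_category_axioms F(3)] by blast
    interpret linear_equivalence D E F G \<eta> \<epsilon> by (rule e)
    have G: "G \<in> CY_functors Y X"
      using CY_functor_inverse X.CY_category_axioms Y.CY_category_axioms F(2) XY by blast
    have "\<eta> \<in> Iso2 Vect2 (fun_id D) (fun_comp G F)"
      using unit fun_id_linear[OF X.linear_category_axioms] fun_comp_linear[OF linear_functor_axioms inverse_linear]
      by (simp add: Iso2_Vect2_iff[of D D])
    moreover have "\<epsilon> \<in> Iso2 Vect2 (fun_comp F G) (fun_id E)"
      using counit fun_id_linear[OF Y.linear_category_axioms] fun_comp_linear[OF inverse_linear linear_functor_axioms]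
      by (simp add: Iso2_Vect2_iff[of E E])
    ultimately show "P \<in> Equiv1 CY X Y"
      by (intro Equiv1I[of _ _ _ _ "(Y, X, G)"]) (use F(1,2) G XY in \<open>auto simp: Iso2_CY\<close>)
  qed
qed

lemma CY_functors_id: "linear_category (fst X) \<Longrightarrow> fun_id (fst X) \<in> CY_functors X X"
proof -
  assume X: "linear_category (fst X)"
  interpret linear_category "fst X" by (rule X)
  interpret linear_functor "fst X" "fst X" "fun_id (fst X)" by (rule fun_id_linear[OF X])
  show ?thesis using linear by (auto simp: CY_functors_def Hom_iff)
qed

lemma CY_functors_comp:
  assumes "linear_category (fst X)" "linear_category (fst Y)" "linear_category (fst Z)"
    and F: "F \<in> CY_functors X Y" and G: "G \<in> CY_functors Y Z"
  shows "fun_comp G F \<in> CY_functors X Z"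
proof -
  interpret F: linear_functor "fst X" "fst Y" F using assms CY_functors_linear by (blast intro: linear_functorI)
  interpret G: linear_functor "fst Y" "fst Z" G using assms CY_functors_linear by (blast intro: linear_functorI)
  interpret GF: linear_functor "fst X" "fst Z" "fun_comp G F"
    by (rule fun_comp_linear[OF F.linear_functor_axioms G.linear_functor_axioms])
  show ?thesis
    using F G GF.linear by (simp add: CY_functors_def F.Dm.Hom_iff F.Cd.Hom_iff)
qed

text \<open>Local fullness is \<open>Iso2_CY\<close>. By \<open>Equiv1_CY\<close> the 1-cells are
  the equivalences of the base that preserve traces, a condition closed under identities and
  composition.\<close>

lemma lifted_CY:
  "lifted_bicategory (core Vect2_fd)
    (core (CY :: (('o, 'm, 'k :: field) cy0, ('o, 'm, 'k) cy1, ('o, 'm, 'k) cy2) bicat)) fst (\<lambda>(X, Y, F). F)"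
proof -
  interpret V: bicategory "core Vect2_fd" by (rule bicategory_core_Vect2_fd)
  have cy: "linear_category (fst X) \<and> finite_category (fst X) \<and> semisimple (fst X)"
    if X: "X \<in> Ob CY" for X :: "('o, 'm, 'k) cy0"
  proof -
    obtain D t where Dt: "X = (D, t)" "CY_category D t" using X by auto
    interpret CY_category D t by (rule Dt(2))
    show ?thesis using Dt(1) linear_category_axioms finite_category_axioms all_semisimple by simp
  qed
  then have lin: "linear_category (fst X)" and ob: "fst X \<in> Ob (core Vect2_fd)"
    if "X \<in> Ob CY" for X :: "('o, 'm, 'k) cy0"
    using that by simp_all
  show ?thesis
  proof (unfold_locales, unfold core_simps)
    fix X :: "('o, 'm, 'k) cy0" assume X: "X \<in> Ob CY"
    show "fst X \<in> Ob Vect2_fd" using ob[OF X] by simp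
    show "id1 CY X \<in> Equiv1 CY X X" "(\<lambda>(X, Y, F). F) (id1 CY X) = id1 Vect2_fd (fst X)"
      using CY_functors_id[OF lin[OF X]] V.id1_closed[OF ob[OF X]] by (simp_all add: Equiv1_CY[OF X X])
  next
    fix X Y :: "('o, 'm, 'k) cy0" and P assume a: "X \<in> Ob CY" "Y \<in> Ob CY" "P \<in> Equiv1 CY X Y"
    then obtain F where F: "P = (X, Y, F)" "F \<in> CY_functors X Y" "F \<in> Equiv1 Vect2 (fst X) (fst Y)"
      by (auto simp: Equiv1_CY)
    have l: "linear_functor (fst X) (fst Y) F"
      using F(2) CY_functors_linear lin[OF a(1)] lin[OF a(2)] by (blast intro: linear_functorI)
    show "(\<lambda>(X, Y, F). F) P \<in> Equiv1 Vect2_fd (fst X) (fst Y)" using F by simp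
    show "id2 CY P = (P, P, id2 Vect2_fd ((\<lambda>(X, Y, F). F) P))"
      "lunit CY P = (id1 CY Y \<diamondop>\<^bsub>CY\<^esub> P, P, lunit Vect2_fd ((\<lambda>(X, Y, F). F) P))"
      "lunit_inv CY P = (P, id1 CY Y \<diamondop>\<^bsub>CY\<^esub> P, lunit_inv Vect2_fd ((\<lambda>(X, Y, F). F) P))"
      "runit CY P = (P \<diamondop>\<^bsub>CY\<^esub> id1 CY X, P, runit Vect2_fd ((\<lambda>(X, Y, F). F) P))"
      "runit_inv CY P = (P, P \<diamondop>\<^bsub>CY\<^esub> id1 CY X, runit_inv Vect2_fd ((\<lambda>(X, Y, F). F) P))"
      using F(1) fun_comp_id[OF l] by simp_all
    fix Q assume "Q \<in> Equiv1 CY X Y"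
    then obtain G where "Q = (X, Y, G)" using a by (auto simp: Equiv1_CY)
    then show "Iso2 CY P Q = {(P, Q, \<alpha>) |\<alpha>. \<alpha> \<in> Iso2 Vect2_fd ((\<lambda>(X, Y, F). F) P) ((\<lambda>(X, Y, F). F) Q)}"
      using F(1) by (simp add: Iso2_CY)
  next
    fix X Y X' Y' :: "('o, 'm, 'k) cy0" and P
    assume "X \<in> Ob CY" "Y \<in> Ob CY" "X' \<in> Ob CY" "Y' \<in> Ob CY" "P \<in> Equiv1 CY X Y" "P \<in> Equiv1 CY X' Y'"
    then show "X = X' \<and> Y = Y'" by (auto simp: Equiv1_CY)
  next
    fix X Y Z :: "('o, 'm, 'k) cy0" and P Q
    assume a: "X \<in> Ob CY" "Y \<in> Ob CY" "Z \<in> Ob CY" "P \<in> Equiv1 CY X Y" "Q \<in> Equiv1 CY Y Z"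
    then obtain F G where F: "P = (X, Y, F)" "F \<in> CY_functors X Y" "F \<in> Equiv1 Vect2 (fst X) (fst Y)"
      and G: "Q = (Y, Z, G)" "G \<in> CY_functors Y Z" "G \<in> Equiv1 Vect2 (fst Y) (fst Z)"
      by (auto simp: Equiv1_CY)
    show "Q \<diamondop>\<^bsub>CY\<^esub> P \<in> Equiv1 CY X Z"
      "(\<lambda>(X, Y, F). F) (Q \<diamondop>\<^bsub>CY\<^esub> P) = (\<lambda>(X, Y, F). F) Q \<diamondop>\<^bsub>Vect2_fd\<^esub> (\<lambda>(X, Y, F). F) P"
      using F G CY_functors_comp[OF a(1-3)[THEN lin] F(2) G(2)] V.comp1_closed[OF a(1-3)[THEN ob], of F G]
      by (simp_all add: Equiv1_CY[OF a(1,3)])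
  next
    fix Q R :: "('o, 'm, 'k) cy1" and P Q' :: "('o, 'm, 'k) cy1" and \<alpha> \<beta> :: "('o, 'm, 'k) nattr"
    show "vcomp CY (Q, R, \<beta>) (P, Q', \<alpha>) = (P, R, vcomp Vect2_fd \<beta> \<alpha>)" by simp
  next
    fix Q Q' P P' :: "('o, 'm, 'k) cy1" and \<alpha> \<beta> :: "('o, 'm, 'k) nattr"
    show "hcomp CY (Q, Q', \<beta>) (P, P', \<alpha>) = (Q \<diamondop>\<^bsub>CY\<^esub> P, Q' \<diamondop>\<^bsub>CY\<^esub> P', hcomp Vect2_fd \<beta> \<alpha>)" by simp
  next
    fix W X Y Z :: "('o, 'm, 'k) cy0" and P Q R
    assume a: "W \<in> Ob CY" "X \<in> Ob CY" "Y \<in> Ob CY" "Z \<in> Ob CY"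
      "P \<in> Equiv1 CY W X" "Q \<in> Equiv1 CY X Y" "R \<in> Equiv1 CY Y Z"
    then obtain F G H where F: "P = (W, X, F)" "F \<in> CY_functors W X" and G: "Q = (X, Y, G)" "G \<in> CY_functors X Y"
      and H: "R = (Y, Z, H)" "H \<in> CY_functors Y Z"
      by (auto simp: Equiv1_CY)
    note l = linear_functorI[OF lin lin CY_functors_linear]
    note e = fun_comp_assoc[OF l[OF a(1,2) F(2)] l[OF a(2,3) G(2)] l[OF a(3,4) H(2)]]
    show "assoc CY R Q P = ((R \<diamondop>\<^bsub>CY\<^esub> Q) \<diamondop>\<^bsub>CY\<^esub> P, R \<diamondop>\<^bsub>CY\<^esub> Q \<diamondop>\<^bsub>CY\<^esub> P,
        assoc Vect2_fd ((\<lambda>(X, Y, F). F) R) ((\<lambda>(X, Y, F). F) Q) ((\<lambda>(X, Y, F). F) P))"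
      "assoc_inv CY R Q P = (R \<diamondop>\<^bsub>CY\<^esub> Q \<diamondop>\<^bsub>CY\<^esub> P, (R \<diamondop>\<^bsub>CY\<^esub> Q) \<diamondop>\<^bsub>CY\<^esub> P,
        assoc_inv Vect2_fd ((\<lambda>(X, Y, F). F) R) ((\<lambda>(X, Y, F). F) Q) ((\<lambda>(X, Y, F). F) P))"
      using F(1) G(1) H(1) e by simp_all
  qed
qed

theorem corollary4p6:
  shows "biequivalent
    (homotopy_fixed_points (SO :: (real ^ 2 ^ 2) monoid)
      (core (Vect2_fd ::
        (('o, 'm, 'k :: alg_closed_field) lincat, ('o, 'm, 'k) linfun, ('o, 'm, 'k) nattr) bicat)))
    (core (CY :: (('o, 'm, 'k) cy0, ('o, 'm, 'k) cy1, ('o, 'm, 'k) cy2) bicat))"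
proof -
  let ?V = "core (Vect2_fd :: (('o, 'm, 'k) lincat, ('o, 'm, 'k) linfun, ('o, 'm, 'k) nattr) bicat)"
  let ?S = "SO :: (real ^ 2 ^ 2) monoid"
  interpret SO: path_connected_group ?S by (rule path_connected_group_SO)
  let ?t = "\<lambda>X :: (real ^ 2 ^ 2, ('o, 'm, 'k) lincat, ('o, 'm, 'k) linfun, ('o, 'm, 'k) nattr) hfp0.
    (hbase X, twisted_trace (hbase X) (holonomy X))"
  have ss: "semisimple_category (hbase X)" "linear_nat_iso (hbase X) (hbase X) (fun_id (hbase X)) (fun_id (hbase X)) (holonomy X)"
    if "hfp_object ?S ?V X" for X
    using hfp_object.base[OF that] holonomy_linear[OF SO.linear_fixed_pointI[OF that]]
    by (simp_all add: semisimple_category_def semisimple_category_axioms_def)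
  \<comment> \<open>The meeting point of the two sides: trace preservation becomes commutation with
    the holonomies, which also decides whether the equivalence underlies a morphism of fixed
    points.\<close>
  have CY_iff: "f \<in> CY_functors (?t X) (?t Y) \<longleftrightarrow>
      (\<forall>a \<in> Obj (hbase X). mmap f (cmpt (holonomy X) a) = cmpt (holonomy Y) (omap f a))"
    if XY: "hfp_object ?S ?V X" "hfp_object ?S ?V Y" and f: "f \<in> Equiv1 Vect2 (hbase X) (hbase Y)" for X Y f
  proof -
    interpret X: semisimple_category "hbase X" by (rule ss[OF XY(1)])
    interpret Y: semisimple_category "hbase Y" by (rule ss[OF XY(2)])
    obtain G \<eta> \<epsilon> where "linear_equivalence (hbase X) (hbase Y) f G \<eta> \<epsilon>"
      using Equiv1_Vect2E[OF X.linear_category_axioms Y.linear_category_axioms f] by blast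
    then interpret semisimple_equivalence "hbase X" "hbase Y" f G \<eta> \<epsilon>
      by (simp add: semisimple_equivalence_def X.semisimple_category_axioms Y.semisimple_category_axioms)
    show ?thesis by (rule CY_functor_iff[OF ss(2)[OF XY(1)] ss(2)[OF XY(2)]])
  qed
  have ob: "?t X \<in> Ob CY" if "hfp_object ?S ?V X" for X
    using semisimple_category.CY_category_twisted[OF ss[OF that]] by simp
  show ?thesis
  \<comment> \<open>A fixed point is sent to its category with the canonical trace twisted by the
    holonomy, a morphism to its underlying functor; the cells \<open>m g\<close> are
    forgotten.\<close>
  proof (rule biequivalent_lifted[OF SO.lifted_homotopy_fixed_points lifted_CY,
        where \<phi> = ?t and \<psi> = "\<lambda>P. (?t (hsrc P), ?t (htrg P), hcell P)"])
    fix X assume "X \<in> Ob (homotopy_fixed_points ?S ?V)"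
    then show "?t X \<in> Ob (core CY)" "fst (?t X) = hbase X" using ob by simp_all
  next
    fix y :: "('o, 'm, 'k) cy0" assume "y \<in> Ob (core CY)"
    then obtain D t where y: "y = (D, t)" "CY_category D t" by auto
    interpret CY: CY_category D t by (rule y(2))
    interpret semisimple_category D by unfold_locales (rule CY.all_semisimple)
    obtain \<nu> where \<nu>: "linear_nat_iso D D (fun_id D) (fun_id D) \<nu>" "t = twisted_trace D \<nu>"
      using twisted_trace_surj[OF y(2)] .
    obtain X :: "(real ^ 2 ^ 2, ('o, 'm, 'k) lincat, ('o, 'm, 'k) linfun, ('o, 'm, 'k) nattr) hfp0"
      where "hfp_object ?S ?V X" "hbase X = D" "holonomy X = \<nu>"
      using ex_holonomy[OF CY.finite_category_axioms is_semisimple \<nu>(1)] .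
    then show "\<exists>X \<in> Ob (homotopy_fixed_points ?S ?V). ?t X = y" using y(1) \<nu>(2) by auto
  next
    fix X Y P assume "X \<in> Ob (homotopy_fixed_points ?S ?V)" "Y \<in> Ob (homotopy_fixed_points ?S ?V)"
      "P \<in> Hom1 (homotopy_fixed_points ?S ?V) X Y"
    then have a: "hfp_object ?S ?V X" "hfp_object ?S ?V Y" "P \<in> hfp_Hom1 ?S ?V X Y" by simp_all
    then have p: "hsrc P = X" "htrg P = Y" "fixed_point_pair ?S X Y (hcell P)" "compatible ?S X Y (hcell P) (hm P)"
      by (simp_all add: SO.hfp_Hom1_iff)
    have e: "hcell P \<in> Equiv1 Vect2 (hbase X) (hbase Y)" by (rule fixed_point_pair.f_equiv[OF p(3)])
    have "hcell P \<in> CY_functors (?t X) (?t Y)"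
      using CY_iff[OF a(1,2) e] holonomy_commutes[OF p(3,4)] by blast
    then show "(?t (hsrc P), ?t (htrg P), hcell P) \<in> Hom1 (core CY) (?t X) (?t Y)"
      using e p by (simp add: Equiv1_CY[OF ob[OF a(1)] ob[OF a(2)]])
    show "(\<lambda>(X, Y, F). F) (?t (hsrc P), ?t (htrg P), hcell P) = hcell P" by simp
  next
    fix X Y k assume "X \<in> Ob (homotopy_fixed_points ?S ?V)" "Y \<in> Ob (homotopy_fixed_points ?S ?V)"
      "k \<in> Hom1 (core CY) (?t X) (?t Y)"
    then have a: "hfp_object ?S ?V X" "hfp_object ?S ?V Y" "k \<in> Equiv1 CY (?t X) (?t Y)" by simp_all
    then obtain f where f: "k = (?t X, ?t Y, f)" "f \<in> CY_functors (?t X) (?t Y)" "f \<in> Equiv1 Vect2 (hbase X) (hbase Y)"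
      by (auto simp: Equiv1_CY[OF ob[OF a(1)] ob[OF a(2)]])
    interpret X: linear_fixed_point ?S X by (rule SO.linear_fixed_pointI[OF a(1)])
    interpret Y: linear_fixed_point ?S Y by (rule SO.linear_fixed_pointI[OF a(2)])
    interpret f: linear_functor "hbase X" "hbase Y" f
      by (rule Equiv1_linear_functor[OF X.linear_category_axioms Y.linear_category_axioms f(3)])
    have pair: "fixed_point_pair ?S X Y f" by unfold_locales (rule f(3))
    \<comment> \<open>The forgotten cells are restored from commutation with the holonomies; the
      functor itself is kept, as the underlying 1-cell has to be matched exactly.\<close>
    obtain m where "compatible ?S X Y f m"
      using ex_compatible[OF pair] f(2) CY_iff[OF a(1,2) f(3)] by blast
    then have "\<lparr>hsrc = X, htrg = Y, hcell = f, hm = m\<rparr> \<in> hfp_Hom1 ?S ?V X Y"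
      using pair by (simp add: SO.hfp_Hom1_iff[OF a(1,2)])
    then show "\<exists>P \<in> Hom1 (homotopy_fixed_points ?S ?V) X Y. hcell P = (\<lambda>(X, Y, F). F) k"
      using f(1) by (intro bexI[of _ "\<lparr>hsrc = X, htrg = Y, hcell = f, hm = m\<rparr>"]) simp_all
  qed
qed

end
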